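(* Let $I_0\subset\Omega$ be a $(d-1)$-dimensional submanifold. For any vector field $$\mathbf u^{in}\in W^{1,2}(\Omega;\mathbb S^2)\quad\text{with}\quad\mathbf u^{in}|_{I_0}\cdot\mathbf n_{I_0}=0\ \text{ a.e. on } I_0,$$ there exists (for each $\varepsilon$) $\mathbf u_\varepsilon^{in}\in W^{1,2}_0(\Omega)\cap L^\infty(\Omega)$ such that $$\mathbf u_\varepsilon^{in}=\mathbf u^{in}\ \text{ in }\Omega_0^+\setminus B_{2\delta_0}(I_0),\qquad\mathbf u_\varepsilon^{in}=0\ \text{ in }\Omega_0^-\setminus B_{2\delta_0}(I_0),$$ and $$A_\varepsilon(\mathbf u_\varepsilon^{in})\le c_1,\qquad E_\varepsilon[\mathbf u_\varepsilon^{in}|I_0]+B[\mathbf u_\varepsilon^{in}|I_0]\le c_1\varepsilon$$ for a constant $c_1>0$ which only depends on $I_0$ and $\|\mathbf u^{in}\|_{W^{1,2}(\Omega)}$ (in particular not on $\varepsilon$).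
   Context: $d\in\{2,3\}$; $\Omega\subset\mathbb R^d$ is a bounded domain with $C^3$ boundary, $\mu>0$ a constant, $0<\varepsilon<1$; $\Omega$, $\mu$, $F$ and the cut-off functions below are fixed throughout. Vector fields take values in $\mathbb R^3$; $\operatorname{div}\mathbf u=\sum_{i=1}^3\partial_iu_i$; when $d=2$, points are $(x_1,x_2,0)$, $\partial_3=0$, and planar vector fields are regarded as fields in $\mathbb R^3$ with zero third component. A $(d-1)$-dimensional submanifold means an embedded closed smooth surface ($d=3$) or curve ($d=2$). $\Omega_0^+$ is the domain enclosed by $I_0$, $\Omega_0^-=\Omega\setminus\overline{\Omega_0^+}$; $d_{I_0}$ is the signed distance to $I_0$, positive in $\Omega_0^+$, negative in $\Omega_0^-$; $\mathbf n_{I_0}=\nabla d_{I_0}$ on $I_0$; $B_\delta(I_0)=\{x\in\Omega:|d_{I_0}(x)|<\delta\}$; $\delta_0\in(0,1)$ is so small that the nearest-point projection $B_{4\delta_0}(I_0)\to I_0$ is smooth and $I_0$ has distance at least $4\delta_0$ from $\partial\Omega$. $F(\mathbf u)=f(|\mathbf u|)=\frac12g(|\mathbf u|)^2$, where $f\in C^\infty(\mathbb R_{\ge0})$, $f>0$ on $\mathbb R_{\ge0}\setminus\{0,1\}$; $g\ge0$ is locally Lipschitz, $g(0)=g(1)=0$; there is $s_0\in(0,1)$ with $f'>0$ on $(0,s_0)$, $f'<0$ on $(s_0,1)$; $f'(0)=f'(1)=0$, $f''(0),f''(1)>0$; there is $c_0\in(0,1)$ with $2c_0^2s^2\le f(s)\le2c_0^{-2}s^2$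 for $s\ge100$. $\sigma=\int_0^1g(s)\,ds$. $\boldsymbol\xi(x)=\phi(d_{I_0}(x)/\delta_0)\nabla d_{I_0}(x)$, with $\phi:\mathbb R\to\mathbb R_+$ even, smooth, decreasing on $[0,1]$, $\phi>0$ on $|z|<1$, $\phi=0$ for $|z|\ge1$, $1-4z^2\le\phi(z)\le1-\frac12z^2$ for $|z|\le\frac12$. For $\mathbf v:\Omega\to\mathbb R^3$ put $\psi(x)=\int_0^{|\mathbf v(x)|}g(s)\,ds$ and $$A_\varepsilon(\mathbf v)=\int_\Omega\Big(\frac\varepsilon2\mu|\operatorname{div}\mathbf v|^2+\frac\varepsilon2|\nabla\mathbf v|^2+\frac1\varepsilon F(\mathbf v)\Big)dx,$$ $$E_\varepsilon[\mathbf v|I_0]=\int_\Omega\frac\varepsilon2\mu|\operatorname{div}\mathbf v|^2dx+\int_\Omega\Big(\frac\varepsilon2|\nabla\mathbf v|^2+\frac1\varepsilon F(\mathbf v)-\boldsymbol\xi\cdot\nabla\psi\Big)dx,$$ $$B[\mathbf v|I_0]=\int_\Omega\big(\sigma\chi-\sigma+2(\psi-\sigma)^-\big)\eta\circ d_{I_0}\,dx+\int_\Omega(\psi-\sigma)^+|\eta\circ d_{I_0}|\,dx,$$ where $\chi=\mathbf 1_{\Omega_0^+}-\mathbf 1_{\Omega_0^-}$, $h=h^+-h^-$ with $h^\pm\ge0$ the positive/negative parts, and $\eta(z)=\max(-\delta_0,\min(z,\delta_0))$. *)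

theory Defs
  imports "HOL-Analysis.Analysis"
begin

section \<open>Smoothness and hypersurfaces\<close>

text \<open>For open \<open>U\<close>; the values of \<open>f\<close> off \<open>U\<close> are irrelevant.\<close>

primrec C_on :: "nat \<Rightarrow> 'a::euclidean_space set \<Rightarrow> ('a \<Rightarrow> 'b::real_normed_vector) \<Rightarrow> bool" where
  "C_on 0 U f \<longleftrightarrow> continuous_on U f"
| "C_on (Suc k) U f \<longleftrightarrow> (\<forall>x\<in>U. f differentiable (at x)) \<and>
     (\<forall>b\<in>Basis. C_on k U (\<lambda>x. frechet_derivative f (at x) b))"

definition smooth_on :: "'a::euclidean_space set \<Rightarrow> ('a \<Rightarrow> 'b::real_normed_vector) \<Rightarrow> bool" where
  "smooth_on U f \<longleftrightarrow> (\<forall>k. C_on k U f)"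

definition grad :: "(real^'d \<Rightarrow> real) \<Rightarrow> real^'d \<Rightarrow> real^'d" where
  "grad h x = (\<chi> i. frechet_derivative h (at x) (axis i 1))"

definition closed_hypersurface :: "(real^'d) set \<Rightarrow> bool" where
  "closed_hypersurface S \<longleftrightarrow> compact S \<and> S \<noteq> {} \<and>
     (\<forall>p\<in>S. \<exists>U h. open U \<and> p \<in> U \<and> smooth_on U h \<and> (\<forall>x\<in>U. grad h x \<noteq> 0) \<and>
        S \<inter> U = {x \<in> U. h x = 0})"

definition C3_boundary :: "(real^'d) set \<Rightarrow> bool" where
  "C3_boundary S \<longleftrightarrow>
     (\<forall>p\<in>frontier S. \<exists>U h. open U \<and> p \<in> U \<and> C_on 3 U h \<and> (\<forall>x\<in>U. grad h x \<noteq> 0) \<and>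
        S \<inter> U = {x \<in> U. h x < 0})"

text \<open>The domain enclosed by a closed hypersurface: the bounded domain whose boundary it is and
  which lies on one side of it.  If \<open>S\<close> is connected, this is \<^term>\<open>inside S\<close>.\<close>

definition encloses :: "(real^'d) set \<Rightarrow> (real^'d) set \<Rightarrow> bool" where
  "encloses S P \<longleftrightarrow> open P \<and> connected P \<and> bounded P \<and> frontier P = S \<and> interior (closure P) = P"

definition smooth_nearest_point_on :: "(real^'d) set \<Rightarrow> (real^'d) set \<Rightarrow> bool" where
  "smooth_nearest_point_on U S \<longleftrightarrow> (\<exists>P. smooth_on U P \<and>
     (\<forall>x\<in>U. P x \<in> S \<and> dist x (P x) = infdist x S \<and>
        (\<forall>y\<in>S. dist x y = infdist x S \<longrightarrow> y = P x)))"

text \<open>In \<open>sdist\<close>, \<open>tube\<close> and everything built on them, \<open>P\<close> is the domain enclosed by \<open>S\<close>.\<close>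

definition sdist :: "(real^'d) set \<Rightarrow> (real^'d) set \<Rightarrow> real^'d \<Rightarrow> real" where
  "sdist S P x = (if x \<in> P then infdist x S else - infdist x S)"

definition tube :: "(real^'d) set \<Rightarrow> (real^'d) set \<Rightarrow> (real^'d) set \<Rightarrow> real \<Rightarrow> (real^'d) set" where
  "tube \<Omega> S P \<delta> = {x \<in> \<Omega>. \<bar>sdist S P x\<bar> < \<delta>}"


section \<open>Hausdorff measure\<close>

text \<open>Only used for \<open>n \<ge> 1\<close> (for \<open>n = 0\<close> the empty set would be charged, as \<open>0 ^ 0 = 1\<close>).\<close>

definition hausdorff_pre :: "nat \<Rightarrow> real \<Rightarrow> 'a::metric_space set \<Rightarrow> ennreal" where
  "hausdorff_pre n \<delta> A =
     (INF C\<in>{C :: nat \<Rightarrow> 'a set. A \<subseteq> (\<Union>i. C i) \<and> (\<forall>i. bounded (C i) \<and> diameter (C i) \<le> \<delta>)}.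
        \<Sum>i. ennreal (unit_ball_vol (real n) * (diameter (C i) / 2) ^ n))"

definition hausdorff_measure :: "nat \<Rightarrow> 'a::metric_space measure" where
  "hausdorff_measure n = measure_of UNIV (sets borel) (\<lambda>A. SUP \<delta>\<in>{0<..}. hausdorff_pre n \<delta> A)"


section \<open>Sobolev spaces\<close>

definition test_function :: "'a::euclidean_space set \<Rightarrow> ('a \<Rightarrow> 'b::real_normed_vector) \<Rightarrow> bool" where
  "test_function \<Omega> \<theta> \<longleftrightarrow> smooth_on UNIV \<theta> \<and> compact (closure {x. \<theta> x \<noteq> 0}) \<and>
     closure {x. \<theta> x \<noteq> 0} \<subseteq> \<Omega>"

definition locally_integrable ::
  "'a::euclidean_space set \<Rightarrow> ('a \<Rightarrow> 'b::euclidean_space) \<Rightarrow> bool" where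
  "locally_integrable \<Omega> w \<longleftrightarrow> (\<forall>K. compact K \<and> K \<subseteq> \<Omega> \<longrightarrow> set_integrable lebesgue K w)"

definition weak_grad :: "(real^'d) set \<Rightarrow> (real^'d \<Rightarrow> real) \<Rightarrow> (real^'d \<Rightarrow> real^'d) \<Rightarrow> bool" where
  "weak_grad \<Omega> w G \<longleftrightarrow> locally_integrable \<Omega> w \<and> locally_integrable \<Omega> G \<and>
     (\<forall>\<theta>. test_function \<Omega> \<theta> \<longrightarrow>
        (LINT x:\<Omega>|lebesgue. w x *\<^sub>R grad \<theta> x) = - (LINT x:\<Omega>|lebesgue. \<theta> x *\<^sub>R G x))"

text \<open>Determined up to null subsets of \<open>\<Omega>\<close> when a weak gradient exists.\<close>

definition wgrad :: "(real^'d) set \<Rightarrow> (real^'d \<Rightarrow> real) \<Rightarrow> real^'d \<Rightarrow> real^'d" where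
  "wgrad \<Omega> w = (SOME G. weak_grad \<Omega> w G)"

definition wjac :: "(real^'d) set \<Rightarrow> (real^'d \<Rightarrow> real^3) \<Rightarrow> real^'d \<Rightarrow> real^'d^3" where
  "wjac \<Omega> u x = (\<chi> j. wgrad \<Omega> (\<lambda>y. u y $ j) x)"

definition square_integrable ::
  "'a::euclidean_space set \<Rightarrow> ('a \<Rightarrow> 'b::euclidean_space) \<Rightarrow> bool" where
  "square_integrable \<Omega> u \<longleftrightarrow> set_borel_measurable lebesgue \<Omega> u \<and>
     set_integrable lebesgue \<Omega> (\<lambda>x. (norm (u x))\<^sup>2)"

definition W12 :: "(real^'d) set \<Rightarrow> (real^'d \<Rightarrow> real^3) set" where
  "W12 \<Omega> = {u. square_integrable \<Omega> u \<and> (\<forall>j. \<exists>G. weak_grad \<Omega> (\<lambda>x. u x $ j) G) \<and>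
     square_integrable \<Omega> (wjac \<Omega> u)}"

definition W12_norm :: "(real^'d) set \<Rightarrow> (real^'d \<Rightarrow> real^3) \<Rightarrow> real" where
  "W12_norm \<Omega> u =
     sqrt ((LINT x:\<Omega>|lebesgue. (norm (u x))\<^sup>2) + (LINT x:\<Omega>|lebesgue. (norm (wjac \<Omega> u x))\<^sup>2))"

definition W12_0 :: "(real^'d) set \<Rightarrow> (real^'d \<Rightarrow> real^3) set" where
  "W12_0 \<Omega> = {u \<in> W12 \<Omega>. \<forall>e>0. \<exists>\<theta>. test_function \<Omega> \<theta> \<and> W12_norm \<Omega> (\<lambda>x. u x - \<theta> x) < e}"

definition L_infty :: "(real^'d) set \<Rightarrow> (real^'d \<Rightarrow> real^3) set" where
  "L_infty \<Omega> = {u. set_borel_measurable lebesgue \<Omega> u \<and>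
     (\<exists>M. AE x in lebesgue. x \<in> \<Omega> \<longrightarrow> norm (u x) \<le> M)}"

text \<open>\<open>T\<close> is the trace of \<open>u\<close> on a compact hypersurface \<open>S \<subseteq> \<Omega>\<close>: the value at \<open>u\<close> of the continuous
  extension to \<open>W12 \<Omega>\<close>, with values in \<open>L\<^sup>2(S)\<close>, of the restriction map on its dense subspace of smooth
  fields.\<close>

definition has_trace ::
  "(real^'d) set \<Rightarrow> (real^'d) set \<Rightarrow> (real^'d \<Rightarrow> real^3) \<Rightarrow> (real^'d \<Rightarrow> real^3) \<Rightarrow> bool" where
  "has_trace \<Omega> S u T \<longleftrightarrow>
     set_borel_measurable (hausdorff_measure (CARD('d) - 1)) S T \<and>
     (\<exists>v :: nat \<Rightarrow> real^'d \<Rightarrow> real^3.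
        (\<forall>k. smooth_on \<Omega> (v k) \<and> v k \<in> W12 \<Omega>) \<and>
        (\<lambda>k. W12_norm \<Omega> (\<lambda>x. v k x - u x)) \<longlonglongrightarrow> 0 \<and>
        (\<lambda>k. set_nn_integral (hausdorff_measure (CARD('d) - 1)) S
               (\<lambda>y. ennreal ((norm (v k y - T y))\<^sup>2))) \<longlonglongrightarrow> 0)"


section \<open>Planar and spatial fields\<close>

text \<open>Points live in \<open>real^'d\<close>, fields take values in \<open>real^3\<close>.  An injection \<open>\<iota> :: 'd \<Rightarrow> 3\<close> names
  the coordinates of the former in the latter.  Its range is \<open>{1, 2}\<close> if \<open>d = 2\<close> and everything if
  \<open>d = 3\<close>; derivatives in a direction outside the range are zero and hence absent from
  the divergence.\<close>

definition emb :: "('d::finite \<Rightarrow> 3) \<Rightarrow> real^'d \<Rightarrow> real^3" where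
  "emb \<iota> a = (\<Sum>i\<in>UNIV. a $ i *\<^sub>R axis (\<iota> i) 1)"

definition wdiv ::
  "('d::finite \<Rightarrow> 3) \<Rightarrow> (real^'d) set \<Rightarrow> (real^'d \<Rightarrow> real^3) \<Rightarrow> real^'d \<Rightarrow> real" where
  "wdiv \<iota> \<Omega> u x = (\<Sum>i\<in>UNIV. wjac \<Omega> u x $ \<iota> i $ i)"

definition tangential_on ::
  "('d::finite \<Rightarrow> 3) \<Rightarrow> (real^'d) set \<Rightarrow> (real^'d) set \<Rightarrow> (real^'d) set \<Rightarrow> (real^'d \<Rightarrow> real^3) \<Rightarrow> bool"
  where
  "tangential_on \<iota> \<Omega> S P u \<longleftrightarrow> (\<exists>T. has_trace \<Omega> S u T \<and>
     (AE y in hausdorff_measure (CARD('d) - 1). y \<in> S \<longrightarrow> T y \<bullet> emb \<iota> (grad (sdist S P) y) = 0))"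


section \<open>Potential, cut-off and energies\<close>

text \<open>One-sided at the end point \<open>0\<close>.\<close>

definition hderiv :: "(real \<Rightarrow> real) \<Rightarrow> real \<Rightarrow> real" where
  "hderiv f s = vector_derivative f (at s within {0..})"

definition double_well :: "(real \<Rightarrow> real) \<Rightarrow> (real \<Rightarrow> real) \<Rightarrow> bool" where
  "double_well f g \<longleftrightarrow>
     (\<forall>s\<ge>0. f s = (g s)\<^sup>2 / 2) \<and>
     (\<forall>k. \<forall>s\<ge>0. (hderiv ^^ k) f differentiable (at s within {0..})) \<and>
     (\<forall>s\<ge>0. s \<noteq> 0 \<and> s \<noteq> 1 \<longrightarrow> f s > 0) \<and>
     (\<forall>s\<ge>0. g s \<ge> 0) \<and>
     (\<forall>s\<ge>0. \<exists>r>0. \<exists>L. L-lipschitz_on (cball s r \<inter> {0..}) g) \<and>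
     g 0 = 0 \<and> g 1 = 0 \<and>
     (\<exists>s0. 0 < s0 \<and> s0 < 1 \<and>
        (\<forall>s\<in>{0<..<s0}. hderiv f s > 0) \<and> (\<forall>s\<in>{s0<..<1}. hderiv f s < 0)) \<and>
     hderiv f 0 = 0 \<and> hderiv f 1 = 0 \<and>
     hderiv (hderiv f) 0 > 0 \<and> hderiv (hderiv f) 1 > 0 \<and>
     (\<exists>c0. 0 < c0 \<and> c0 < 1 \<and>
        (\<forall>s\<ge>100. 2 * c0\<^sup>2 * s\<^sup>2 \<le> f s \<and> f s \<le> 2 / c0\<^sup>2 * s\<^sup>2))"

definition cutoff :: "(real \<Rightarrow> real) \<Rightarrow> bool" where
  "cutoff \<phi> \<longleftrightarrow> smooth_on UNIV \<phi> \<and> (\<forall>z. \<phi> z \<ge> 0) \<and> (\<forall>z. \<phi> (- z) = \<phi> z) \<and> antimono_on {0..1} \<phi> \<and>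
     (\<forall>z. \<bar>z\<bar> < 1 \<longrightarrow> \<phi> z > 0) \<and> (\<forall>z. \<bar>z\<bar> \<ge> 1 \<longrightarrow> \<phi> z = 0) \<and>
     (\<forall>z. \<bar>z\<bar> \<le> 1/2 \<longrightarrow> 1 - 4 * z\<^sup>2 \<le> \<phi> z \<and> \<phi> z \<le> 1 - z\<^sup>2 / 2)"

definition sigma :: "(real \<Rightarrow> real) \<Rightarrow> real" where
  "sigma g = integral {0..1} g"

definition psi :: "(real \<Rightarrow> real) \<Rightarrow> (real^'d \<Rightarrow> real^3) \<Rightarrow> real^'d \<Rightarrow> real" where
  "psi g v x = integral {0..norm (v x)} g"

definition xi :: "(real \<Rightarrow> real) \<Rightarrow> real \<Rightarrow> (real^'d) set \<Rightarrow> (real^'d) set \<Rightarrow> real^'d \<Rightarrow> real^'d" where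
  "xi \<phi> \<delta>0 S P x = \<phi> (sdist S P x / \<delta>0) *\<^sub>R grad (sdist S P) x"

definition eta :: "real \<Rightarrow> real \<Rightarrow> real" where
  "eta \<delta>0 z = max (- \<delta>0) (min z \<delta>0)"

definition chi :: "(real^'d) set \<Rightarrow> (real^'d) set \<Rightarrow> real^'d \<Rightarrow> real" where
  "chi \<Omega> P x = indicator P x - indicator (\<Omega> - closure P) x"

definition A_energy ::
  "('d::finite \<Rightarrow> 3) \<Rightarrow> (real^'d) set \<Rightarrow> real \<Rightarrow> (real \<Rightarrow> real) \<Rightarrow> real \<Rightarrow> (real^'d \<Rightarrow> real^3) \<Rightarrow> real"
  where
  "A_energy \<iota> \<Omega> \<mu> f \<epsilon> v = (LINT x:\<Omega>|lebesgue.
     \<epsilon> / 2 * \<mu> * (wdiv \<iota> \<Omega> v x)\<^sup>2 + \<epsilon> / 2 * (norm (wjac \<Omega> v x))\<^sup>2 + 1 / \<epsilon> * f (norm (v x)))"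

definition E_energy ::
  "('d::finite \<Rightarrow> 3) \<Rightarrow> (real^'d) set \<Rightarrow> real \<Rightarrow> (real \<Rightarrow> real) \<Rightarrow> (real \<Rightarrow> real) \<Rightarrow> (real \<Rightarrow> real) \<Rightarrow> real \<Rightarrow>
   (real^'d) set \<Rightarrow> (real^'d) set \<Rightarrow> real \<Rightarrow> (real^'d \<Rightarrow> real^3) \<Rightarrow> real"
  where
  "E_energy \<iota> \<Omega> \<mu> f g \<phi> \<delta>0 S P \<epsilon> v =
     (LINT x:\<Omega>|lebesgue. \<epsilon> / 2 * \<mu> * (wdiv \<iota> \<Omega> v x)\<^sup>2) +
     (LINT x:\<Omega>|lebesgue. \<epsilon> / 2 * (norm (wjac \<Omega> v x))\<^sup>2 + 1 / \<epsilon> * f (norm (v x))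
        - xi \<phi> \<delta>0 S P x \<bullet> wgrad \<Omega> (psi g v) x)"

definition B_energy ::
  "(real^'d) set \<Rightarrow> (real \<Rightarrow> real) \<Rightarrow> real \<Rightarrow> (real^'d) set \<Rightarrow> (real^'d) set \<Rightarrow>
   (real^'d \<Rightarrow> real^3) \<Rightarrow> real"
  where
  "B_energy \<Omega> g \<delta>0 S P v =
     (LINT x:\<Omega>|lebesgue.
        (sigma g * chi \<Omega> P x - sigma g + 2 * max (- (psi g v x - sigma g)) 0) * eta \<delta>0 (sdist S P x)) +
     (LINT x:\<Omega>|lebesgue. max (psi g v x - sigma g) 0 * \<bar>eta \<delta>0 (sdist S P x)\<bar>)"

end

theory Submission
  imports Defs
begin

notation scaleR (infixr "*R" 75) and divideR (infixl "'/R" 70) and inner (infix "<.>" 70)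

abbreviation leb :: "'a::euclidean_space set => 'a measure" where "leb A == lebesgue_on A"

section \<open>Functions of class C^k\<close>

lemma frechet_derivative_eqI:
 "(f has_derivative f') (at x) ==> frechet_derivative f (at x) = f'"
 by (metis frechet_derivative_at)

lemma C_on_cong:
 assumes "open U" "!!x. x : U ==> f x = g x" "C_on k U f"
 shows "C_on k U g"
 using assms(2,3)
proof (induction k arbitrary: f g)
 case 0 thus ?case by (simp cong: continuous_on_cong)
next
 case (Suc k)
 have d: "(g has_derivative frechet_derivative f (at x)) (at x)" if "x : U" for x
 proof -
  have "(f has_derivative frechet_derivative f (at x)) (at x)"
   using Suc.prems(2) that by (simp add: frechet_derivative_works)
  thus ?thesis
   using has_derivative_transform_within_open[OF _ assms(1) that] Suc.prems(1) by blast
 qed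
 have e: "frechet_derivative g (at x) = frechet_derivative f (at x)" if "x : U" for x
  by (rule frechet_derivative_eqI[OF d[OF that]])
 show ?case
 proof (simp, intro conjI ballI)
  fix x assume "x : U" thus "g differentiable at x" using d differentiable_def by blast
 next
  fix b :: 'a assume b: "b : Basis"
  show "C_on k U (%x. frechet_derivative g (at x) b)"
   by (rule Suc.IH[of "%x. frechet_derivative f (at x) b"]) (use Suc.prems b e in auto)
 qed
qed

lemma C_on_SucI:
 assumes "open U" "!!x. x : U ==> (f has_derivative f' x) (at x)"
  and "!!b. b : Basis ==> C_on k U (%x. f' x b)"
 shows "C_on (Suc k) U f"
proof -
 have e: "frechet_derivative f (at x) = f' x" if "x : U" for x
  by (rule frechet_derivative_eqI[OF assms(2)[OF that]])
 show ?thesis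
 proof (simp, intro conjI ballI)
  fix x assume "x : U" thus "f differentiable at x" using assms(2) differentiable_def by blast
 next
  fix b :: 'a assume b: "b : Basis"
  show "C_on k U (%x. frechet_derivative f (at x) b)"
   by (rule C_on_cong[OF assms(1) _ assms(3)[OF b]]) (simp add: e)
 qed
qed

lemma C_on_Suc_has_derivative:
 assumes "C_on (Suc k) U f" "x : U"
 shows "(f has_derivative frechet_derivative f (at x)) (at x)"
 using assms by (simp add: frechet_derivative_works)

lemma C_on_SucD: "C_on (Suc k) U f ==> C_on k U f"
proof (induction k arbitrary: f)
 case 0
 thus ?case
  by (auto intro!: continuous_at_imp_continuous_on differentiable_imp_continuous_within)
next
 case (Suc k)
 have "C_on (Suc k) U (%x. frechet_derivative f (at x) b)" if "b : Basis" for b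
  using Suc.prems that by simp
 hence "C_on k U (%x. frechet_derivative f (at x) b)" if "b : Basis" for b
  using Suc.IH that by blast
 thus ?case using Suc.prems by simp
qed

lemma C_on_const: "open U ==> C_on k U (%x. c)"
proof (induction k arbitrary: c)
 case (Suc k) show ?case
  by (rule C_on_SucI[where f'="%x h. 0"]) (use Suc in auto)
qed simp

lemma C_on_linear_image:
 fixes f :: "'a::euclidean_space => 'b::real_normed_vector"
 assumes "bounded_linear L" "open U" "C_on k U f"
 shows "C_on k U (%x. L (f x))"
 using assms(3)
proof (induction k arbitrary: f)
 case 0
 thus ?case using assms(1)
  by (auto intro: continuous_on_compose2[OF linear_continuous_on[OF assms(1), of UNIV]])
next
 case (Suc k)
 show ?case
 proof (rule C_on_SucI[OF assms(2), where f'="%x h. L (frechet_derivative f (at x) h)"])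
  fix x assume "x : U"
  thus "((%x. L (f x)) has_derivative (%h. L (frechet_derivative f (at x) h))) (at x)"
   by (intro bounded_linear.has_derivative[OF assms(1)] C_on_Suc_has_derivative[OF Suc.prems])
 next
  fix b :: 'a assume "b : Basis"
  thus "C_on k U (%x. L (frechet_derivative f (at x) b))"
   using Suc by simp
 qed
qed

lemma C_on_add:
 assumes "open U" "C_on k U f" "C_on k U g"
 shows "C_on k U (%x. f x + g x)"
 using assms(2,3)
proof (induction k arbitrary: f g)
 case 0 thus ?case by (auto intro: continuous_intros)
next
 case (Suc k)
 show ?case
  by (rule C_on_SucI[OF assms(1), where f'="%x h. frechet_derivative f (at x) h + frechet_derivative g (at x) h"])
    (use Suc in \<open>auto intro!: has_derivative_add C_on_Suc_has_derivative[OF Suc.prems(1)] C_on_Suc_has_derivative[OF Suc.prems(2)]\<close>)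
qed

lemma C_on_mult:
 fixes f g :: "'a::euclidean_space => real"
 assumes "open U" "C_on k U f" "C_on k U g"
 shows "C_on k U (%x. f x * g x)"
 using assms(2,3)
proof (induction k arbitrary: f g)
 case 0 thus ?case by (auto intro: continuous_intros)
next
 case (Suc k)
 show ?case
 proof (rule C_on_SucI[OF assms(1), where f'="%x h. f x * frechet_derivative g (at x) h + frechet_derivative f (at x) h * g x"])
  fix x assume "x : U"
  thus "((%x. f x * g x) has_derivative (%h. f x * frechet_derivative g (at x) h + frechet_derivative f (at x) h * g x)) (at x)"
   by (intro has_derivative_mult C_on_Suc_has_derivative[OF Suc.prems(1)] C_on_Suc_has_derivative[OF Suc.prems(2)])
 next
  fix b :: 'a assume "b : Basis"
  thus "C_on k U (%x. f x * frechet_derivative g (at x) b + frechet_derivative f (at x) b * g x)"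
   using Suc.prems C_on_SucD[OF Suc.prems(1)] C_on_SucD[OF Suc.prems(2)]
   by (intro C_on_add[OF assms(1)] Suc.IH) simp_all
 qed
qed

lemma C_on_prod:
 fixes f :: "'i => 'a::euclidean_space => real"
 assumes "open U" "!!i. i : I ==> C_on k U (f i)"
 shows "C_on k U (%x. \<Prod>i\<in>I. f i x)"
 using assms(2)
 by (induction I rule: infinite_finite_induct) (auto intro!: C_on_const C_on_mult assms(1))

lemma C_on_affine_compose:
 fixes f :: "real => real" and l :: "'a::euclidean_space"
 assumes "C_on k UNIV f"
 shows "C_on k UNIV (%x. f (l <.> x + c))"
 using assms
proof (induction k arbitrary: f)
 case 0
 thus ?case by (auto intro!: continuous_intros intro: continuous_on_compose2[of UNIV f])
next
 case (Suc k)
 have d: "(f has_derivative (%h. h * frechet_derivative f (at y) 1)) (at y)" for y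
 proof -
  have "(f has_derivative frechet_derivative f (at y)) (at y)"
   using C_on_Suc_has_derivative[OF Suc.prems] by simp
  moreover from this have "frechet_derivative f (at y) = (%h. h * frechet_derivative f (at y) 1)"
   using linear_scale[OF has_derivative_linear, of f _ "at y" _ "1::real"] by (metis ext mult.right_neutral real_scaleR_def)
  ultimately show ?thesis by simp
 qed
 show ?case
 proof (rule C_on_SucI[where f'="%x h. (l <.> h) * frechet_derivative f (at (l <.> x + c)) 1"])
  fix x
  have "((%x. l <.> x + c) has_derivative (%h. l <.> h)) (at x)"
   by (auto intro!: derivative_eq_intros)
  from has_derivative_compose[OF this d]
  show "((%x. f (l <.> x + c)) has_derivative (%h. (l <.> h) * frechet_derivative f (at (l <.> x + c)) 1)) (at x)"
   by simp
 next
  fix b :: 'a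
  have "C_on k UNIV (%x. frechet_derivative f (at (l <.> x + c)) 1)"
   using Suc.IH[of "%x. frechet_derivative f (at x) 1"] Suc.prems by simp
  thus "C_on k UNIV (%x. (l <.> b) * frechet_derivative f (at (l <.> x + c)) 1)"
   by (intro C_on_mult C_on_const) auto
 qed auto
qed

lemma has_derivative_C1_any_direction:
 assumes "C_on (Suc k) U f" "open U"
 shows "C_on k U (%x. frechet_derivative f (at x) v)"
proof -
 have "C_on k U (%x. \<Sum>b\<in>B. (v <.> b) *R frechet_derivative f (at x) b)" if "B <= Basis" for B
 proof -
  have "finite B" using that finite_subset finite_Basis by blast
  thus ?thesis using that
  proof (induction B)
   case empty show ?case by (simp add: C_on_const assms(2))
  next
   case (insert b B)
   have "C_on k U (%x. (v <.> b) *R frechet_derivative f (at x) b)"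
    by (rule C_on_linear_image[OF bounded_linear_scaleR_right assms(2)]) (use assms insert in auto)
   thus ?case using insert C_on_add[OF assms(2)] by auto
  qed
 qed
 from this[OF subset_refl]
 show ?thesis
 proof (rule C_on_cong[OF assms(2), rotated])
  fix x assume "x : U"
  hence "linear (frechet_derivative f (at x))"
   using C_on_Suc_has_derivative[OF assms(1)] has_derivative_linear by blast
  thus "(\<Sum>b\<in>Basis. (v <.> b) *R frechet_derivative f (at x) b) = frechet_derivative f (at x) v"
   by (subst (2) euclidean_representation[of v, symmetric], subst linear_sum)
     (simp_all add: linear_scale)
 qed
qed

text \<open>Differentiating under the integral sign moves the derivative to the kernel, which can be repeated.\<close>

lemma has_derivative_convolution:
 fixes h :: "'a::euclidean_space => real" and \<rho> :: "'a => real"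
 assumes h: "continuous_on (cbox a b') h" and C: "C_on (Suc 0) UNIV \<rho>"
 shows "((%x. integral (cbox a b') (%y. h y * \<rho> (x - y))) has_derivative
   (%e. integral (cbox a b') (%y. h y * frechet_derivative \<rho> (at (x - y)) e))) (at x)"
proof -
 let ?D = "%x. frechet_derivative \<rho> (at x)"
 have d: "(\<rho> has_derivative ?D x) (at x)" for x
  using C_on_Suc_has_derivative[OF C] by simp
 have bl: "bounded_linear (%e. h y * ?D (x - y) e)" for x y
  by (intro bounded_linear_const_mult has_derivative_bounded_linear[OF d])
 have cD: "continuous_on UNIV (%x. ?D x v)" for v
  using has_derivative_C1_any_direction[OF C, of v] by simp
 have c\<rho>: "continuous_on UNIV \<rho>"
  using d by (meson continuous_at_imp_continuous_on has_derivative_continuous)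
 let ?B = "%x y. Blinfun (%e. h y * ?D (x - y) e)"
 have B: "blinfun_apply (?B x y) = (%e. h y * ?D (x - y) e)" for x y
  by (rule bounded_linear_Blinfun_apply[OF bl])
 have contB: "continuous_on (UNIV \<times> cbox a b') (%(x, y). ?B x y)"
 proof (rule continuous_on_blinfun_componentwise)
  fix i :: 'a
  have "continuous_on (UNIV \<times> cbox a b') (%z. h (snd z) * ?D (fst z - snd z) i)"
   by (intro continuous_intros continuous_on_compose2[OF h] continuous_on_compose2[OF cD]) auto
  thus "continuous_on (UNIV \<times> cbox a b') (%x. blinfun_apply (case x of (x, y) => ?B x y) i)"
   by (simp add: split_beta B)
 qed
 have contB1: "continuous_on (cbox a b') (?B x)" for x
  using continuous_on_compose2[OF contB, of "cbox a b'" "%y. (x, y)"] continuous_on_Pair[OF continuous_on_const continuous_on_id]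
  by fastforce
 have int: "?B x integrable_on cbox a b'" for x
  by (intro integrable_continuous contB1)
 have der: "((%x. integral (cbox a b') (%y. h y * \<rho> (x - y))) has_derivative
   (%e. integral (cbox a b') (%y. h y * ?D (x - y) e))) (at x)" for x
 proof -
  have "((%x. integral (cbox a b') (%y. h y * \<rho> (x - y))) has_derivative
   integral (cbox a b') (?B x)) (at x within UNIV)"
  proof (rule leibniz_rule[where fx="?B"])
   fix x t
   have "((%x. \<rho> (x - t)) has_derivative (%e. ?D (x - t) (e - 0))) (at x)"
    by (rule has_derivative_compose[where f="%x. x - t" and g=\<rho>, OF _ d])
      (auto intro!: derivative_eq_intros)
   thus "((%x. h t * \<rho> (x - t)) has_derivative blinfun_apply (?B x t)) (at x within UNIV)"
    unfolding B by (intro has_derivative_mult_right) simp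
  next
   fix x show "(%y. h y * \<rho> (x - y)) integrable_on cbox a b'"
    by (intro integrable_continuous continuous_intros h continuous_on_compose2[OF c\<rho>]) auto
  qed (use contB in auto)
  moreover have "blinfun_apply (integral (cbox a b') (?B x)) = (%e. integral (cbox a b') (%y. h y * ?D (x - y) e))"
   using blinfun_apply_integral[OF int[of x]] by (simp add: B fun_eq_iff)
  ultimately show ?thesis by simp
 qed
 show ?thesis by (rule der)
qed

lemma C_on_convolution:
 fixes h :: "'a::euclidean_space => real" and \<rho> :: "'a => real"
 assumes h: "continuous_on (cbox a b') h" and "C_on k UNIV \<rho>"
 shows "C_on k UNIV (%x. integral (cbox a b') (%y. h y * \<rho> (x - y)))"
 using assms(2)
proof (induction k arbitrary: \<rho>)
 case 0
 hence c: "continuous_on UNIV \<rho>" by simp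
 have "continuous_on (UNIV \<times> cbox a b') (%(x, y). h y * \<rho> (x - y))"
  unfolding split_beta
  by (intro continuous_intros continuous_on_compose2[OF h] continuous_on_compose2[OF c]) auto
 hence "continuous_on UNIV (%x. integral (cbox a b') (%y. h y * \<rho> (x - y)))"
  by (intro integral_continuous_on_param)
 thus ?case by simp
next
 case (Suc k)
 have "C_on (Suc 0) UNIV \<rho>" using Suc.prems
 proof (induction k)
  case (Suc k) thus ?case using C_on_SucD by blast
 qed
 note der = has_derivative_convolution[OF h this]
 show ?case
 proof (rule C_on_SucI[OF open_UNIV der])
  fix b :: 'a assume "b : Basis"
  hence "C_on k UNIV (%x. frechet_derivative \<rho> (at x) b)" using Suc.prems by simp
  thus "C_on k UNIV (%x. integral (cbox a b') (%y. h y * frechet_derivative \<rho> (at (x - y)) b))" by (rule Suc.IH)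
 qed
qed

section \<open>Lipschitz functions\<close>

definition locally_lipschitz_on :: "'a::metric_space set => ('a => 'b::metric_space) => bool" where
 "locally_lipschitz_on U f \<longleftrightarrow> (ALL x:U. EX r>0. EX L. L-lipschitz_on (ball x r) f)"

lemma locally_lipschitz_on_imp_continuous:
 assumes "locally_lipschitz_on U f"
 shows "continuous_on U f"
proof (intro continuous_at_imp_continuous_on ballI)
 fix x assume "x : U"
 then obtain r L where r: "r > 0" "L-lipschitz_on (ball x r) f"
  using assms unfolding locally_lipschitz_on_def by blast
 hence "continuous_on (ball x r) f" by (simp add: lipschitz_on_continuous_on)
 thus "isCont f x" using r(1) by (simp add: continuous_on_eq_continuous_at)
qed

lemma lipschitz_imp_locally_lipschitz:
 "L-lipschitz_on UNIV f ==> locally_lipschitz_on U f"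
 unfolding locally_lipschitz_on_def by (meson lipschitz_on_subset subset_UNIV zero_less_one)

lemma locally_lipschitz_on_subset:
 "locally_lipschitz_on U f ==> V <= U ==> locally_lipschitz_on V f"
 unfolding locally_lipschitz_on_def by blast

lemma locally_lipschitz_on_imp_lipschitz_on_compact:
 fixes f :: "'a::metric_space => 'b::metric_space"
 assumes "locally_lipschitz_on UNIV f" "compact K"
 obtains L where "L-lipschitz_on K f"
proof -
 have "local_lipschitz {0::real} K (%_. f)"
  unfolding local_lipschitz_def
 proof (intro ballI)
  fix x and t :: real assume "x : K" "t : {0}"
  obtain r L where r: "r > 0" "L-lipschitz_on (ball x r) f"
   using assms(1) unfolding locally_lipschitz_on_def by blast
  show "EX u>0. EX L. ALL t:cball t u \<inter> {0}. L-lipschitz_on (cball x u \<inter> K) f"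
   by (rule exI[of _ "r/2"]) (use r in \<open>auto intro!: exI[of _ L] elim!: lipschitz_on_subset simp: subset_iff\<close>)
 qed
 from local_lipschitz_compact_implies_lipschitz[OF this assms(2), of thesis]
 show ?thesis using that by auto
qed

lemma locally_lipschitz_on_mult:
 fixes f g :: "'a::metric_space => real"
 assumes "locally_lipschitz_on U f" "locally_lipschitz_on U g"
 shows "locally_lipschitz_on U (%x. f x * g x)"
 unfolding locally_lipschitz_on_def
proof
 fix x assume "x : U"
 then obtain r1 L r2 M where r: "r1 > 0" "L-lipschitz_on (ball x r1) f" "r2 > 0" "M-lipschitz_on (ball x r2) g"
  using assms unfolding locally_lipschitz_on_def by meson
 define r where "r = min r1 r2"
 have f: "L-lipschitz_on (ball x r) f" and g: "M-lipschitz_on (ball x r) g" and r0: "r > 0"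
  using r by (auto simp: r_def elim: lipschitz_on_subset)
 have L0: "0 <= L" "0 <= M" using f g lipschitz_on_nonneg by auto
 have bf: "\<bar>f y\<bar> <= \<bar>f x\<bar> + L * r" if "y : ball x r" for y
 proof -
  have "\<bar>f y - f x\<bar> <= L * dist y x" using lipschitz_onD[OF f that, of x] r0 by (simp add: dist_real_def)
  also have "... <= L * r" using that L0 by (intro mult_left_mono) (auto simp: dist_commute)
  finally show ?thesis by linarith
 qed
 have bg: "\<bar>g y\<bar> <= \<bar>g x\<bar> + M * r" if "y : ball x r" for y
 proof -
  have "\<bar>g y - g x\<bar> <= M * dist y x" using lipschitz_onD[OF g that, of x] r0 by (simp add: dist_real_def)
  also have "... <= M * r" using that L0 by (intro mult_left_mono) (auto simp: dist_commute)
  finally show ?thesis by linarith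
 qed
 have "((\<bar>f x\<bar> + L * r) * M + (\<bar>g x\<bar> + M * r) * L)-lipschitz_on (ball x r) (%x. f x * g x)"
 proof (rule lipschitz_onI)
  fix y z assume y: "y : ball x r" and z: "z : ball x r"
  have "f y * g y - f z * g z = f y * (g y - g z) + g z * (f y - f z)" by algebra
  hence "\<bar>f y * g y - f z * g z\<bar> <= \<bar>f y\<bar> * \<bar>g y - g z\<bar> + \<bar>g z\<bar> * \<bar>f y - f z\<bar>"
   by (metis abs_mult abs_triangle_ineq)
  also have "... <= (\<bar>f x\<bar> + L * r) * (M * dist y z) + (\<bar>g x\<bar> + M * r) * (L * dist y z)"
   using bf[OF y] bg[OF z] lipschitz_onD[OF f y z] lipschitz_onD[OF g y z]
   by (intro add_mono mult_mono) (auto simp: dist_real_def)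
  finally show "dist (f y * g y) (f z * g z) <= ((\<bar>f x\<bar> + L * r) * M + (\<bar>g x\<bar> + M * r) * L) * dist y z"
   by (simp add: dist_real_def algebra_simps)
 next
  show "0 <= (\<bar>f x\<bar> + L * r) * M + (\<bar>g x\<bar> + M * r) * L"
   using L0 r0 by (intro add_nonneg_nonneg mult_nonneg_nonneg) auto
 qed
 thus "EX r>0. EX L. L-lipschitz_on (ball x r) (%x. f x * g x)" using r0 by blast
qed

lemma locally_lipschitz_on_mult_zero_extension:
 fixes f g :: "'a::metric_space => real"
 assumes "locally_lipschitz_on U f" "locally_lipschitz_on UNIV g" "closure {x. g x ~= 0} <= U"
 shows "locally_lipschitz_on UNIV (%x. f x * g x)"
 unfolding locally_lipschitz_on_def
proof
 fix x :: 'a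
 show "EX r>0. EX L. L-lipschitz_on (ball x r) (%x. f x * g x)"
 proof (cases "x : U")
  case True
  have "locally_lipschitz_on U (%x. f x * g x)"
   by (rule locally_lipschitz_on_mult[OF assms(1) locally_lipschitz_on_subset[OF assms(2)]]) simp
  with True show ?thesis
   unfolding locally_lipschitz_on_def by simp
 next
  case False
  hence "x : - closure {x. g x ~= 0}" using assms(3) by blast
  then obtain r where r: "r > 0" "ball x r <= - closure {x. g x ~= 0}"
   using open_contains_ball[of "- closure {x. g x ~= 0}"] by auto
  have "g y = 0" if "y : ball x r" for y
  proof (rule ccontr)
   assume "g y ~= 0" hence "y : closure {x. g x ~= 0}" using closure_subset[of "{x. g x ~= 0}"] by auto
   thus False using r(2) that by auto
  qed
  hence "0-lipschitz_on (ball x r) (%x. f x * g x)"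
   by (auto intro!: lipschitz_onI)
  thus ?thesis using r(1) by blast
 qed
qed

lemma C1_imp_locally_lipschitz:
 fixes f :: "'a::euclidean_space => 'b::real_normed_vector"
 assumes "C_on (Suc 0) U f" "open U"
 shows "locally_lipschitz_on U f"
 unfolding locally_lipschitz_on_def
proof
 fix x assume "x : U"
 then obtain r where r: "r > 0" "cball x r <= U" using assms(2) open_contains_cball by blast
 let ?D = "%x. frechet_derivative f (at x)"
 have d: "(f has_derivative ?D y) (at y)" if "y : U" for y
  using C_on_Suc_has_derivative[OF assms(1) that] .
 have "EX B. ALL y:cball x r. norm (?D y b) <= B" if "b : Basis" for b
 proof -
  have "continuous_on (cball x r) (%y. ?D y b)"
   using assms(1) that by (intro continuous_on_subset[OF _ r(2)]) auto
  hence "bounded ((%y. ?D y b) ` cball x r)"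
   by (intro compact_imp_bounded compact_continuous_image) auto
  thus ?thesis unfolding bounded_iff by blast
 qed
 then obtain B where B: "!!b y. b : Basis ==> y : cball x r ==> norm (?D y b) <= B b" by metis
 have "onorm (?D y) <= (\<Sum>b\<in>Basis. B b)" if "y : cball x r" for y
 proof (rule onorm_bound)
  have "0 <= B b" if "b : Basis" for b using B[OF that \<open>y : cball x r\<close>] norm_ge_zero order_trans by blast
  thus "0 <= (\<Sum>b\<in>Basis. B b)" by (rule sum_nonneg)
  fix v
  have lin: "linear (?D y)" using d r(2) that has_derivative_linear by blast
  have "norm (?D y v) = norm (\<Sum>b\<in>Basis. (v <.> b) *R ?D y b)"
   by (subst euclidean_representation[of v, symmetric], subst linear_sum[OF lin]) (simp add: linear_scale[OF lin])
  also have "... <= (\<Sum>b\<in>Basis. norm ((v <.> b) *R ?D y b))" by (rule norm_sum)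
  also have "... <= (\<Sum>b\<in>Basis. norm v * B b)"
   using B[OF _ that] Basis_le_norm by (intro sum_mono) (auto intro!: mult_mono)
  finally show "norm (?D y v) <= (\<Sum>b\<in>Basis. B b) * norm v" by (simp add: sum_distrib_left mult.commute)
 qed
 moreover have "0 <= (\<Sum>b\<in>Basis. B b)"
 proof (rule sum_nonneg)
  fix b :: 'a assume "b : Basis"
  thus "0 <= B b" using B[of b x] r(1) norm_ge_zero order_trans by (metis centre_in_cball less_imp_le)
 qed
 ultimately have "(\<Sum>b\<in>Basis. B b)-lipschitz_on (cball x r) f"
  using d r(2) by (intro bounded_derivative_imp_lipschitz[where f'="?D"])
   (auto intro!: has_derivative_at_withinI d simp: subset_iff)
 hence "(\<Sum>b\<in>Basis. B b)-lipschitz_on (ball x r) f"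
  by (rule lipschitz_on_subset) auto
 thus "EX r>0. EX L. L-lipschitz_on (ball x r) f" using r(1) by blast
qed

lemma has_derivative_difference_quotient_LIMSEQ:
 fixes h :: "'a::euclidean_space => real"
 assumes "(h has_derivative h') (at x)"
 shows "(%n. real (Suc n) * (h (x + b /R real (Suc n)) - h x)) \<longlonglongrightarrow> h' b"
proof -
 have l: "((%t::real. x + t *R b) has_derivative (%t. t *R b)) (at 0)"
  by (auto intro!: derivative_eq_intros)
 have "((%t. h (x + t *R b)) has_derivative (%t. h' (t *R b))) (at 0)"
  using has_derivative_compose[OF l, of h h'] assms by simp
 moreover have "h' (t *R b) = h' b * t" for t
  using linear_scale[OF has_derivative_linear[OF assms]] by simp
 ultimately have "((%t. h (x + t *R b)) has_real_derivative h' b) (at 0)"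
  by (simp add: has_field_derivative_def mult.commute[of _ "h' b"])
 hence "((%t. (h (x + t *R b) - h x) / t) \<longlongrightarrow> h' b) (at 0)"
  by (simp add: has_field_derivative_iff)
 moreover have "filterlim (%n. inverse (real (Suc n))) (at 0) sequentially"
  using LIMSEQ_inverse_real_of_nat by (auto simp: filterlim_at intro!: always_eventually)
 ultimately show ?thesis
  by (auto dest: filterlim_compose simp: divide_inverse mult.commute)
qed

lemma continuous_compact_support_integrable:
 fixes h :: "'a::euclidean_space => 'b::{banach,second_countable_topology}"
 assumes "continuous_on UNIV h" "!!x. norm x > R ==> h x = 0"
 shows "integrable lborel h"
proof -
 have "integrable lborel (%x. indicator (cball 0 R) x *R h x)"
  by (rule borel_integrable_compact) (auto intro: continuous_on_subset[OF assms(1)])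
 moreover have "(%x. indicator (cball 0 R) x *R h x) = h"
  using assms(2) by (auto simp: fun_eq_iff indicator_def)
 ultimately show ?thesis by simp
qed

text \<open>The difference quotients of a compactly supported Lipschitz function integrate to zero, because
  Lebesgue measure is translation invariant, and they are bounded.\<close>

lemma compactly_supported_lipschitz_gradient:
 fixes h :: "'a::euclidean_space => real"
 assumes ll: "locally_lipschitz_on UNIV h" and sup: "!!x. norm x > R ==> h x = 0"
  and A: "A : sets lebesgue"
  and d: "AE x in lebesgue. x : A --> (h has_derivative (%e. G x <.> e)) (at x)"
 shows "integrable lebesgue (%x. indicator A x *R G x)"
  and "A = UNIV ==> integral\<^sup>L lebesgue G = 0"
proof -
 obtain L where L: "L-lipschitz_on (cball 0 (R+2)) h"
  using locally_lipschitz_on_imp_lipschitz_on_compact[OF ll compact_cball] by blast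
 have cont: "continuous_on UNIV h" using locally_lipschitz_on_imp_continuous[OF ll] .
 have hint: "integrable lborel h" using continuous_compact_support_integrable[OF cont sup] .
 have main: "integrable lebesgue (%x. indicator A x * (G x <.> b)) &
   (A = UNIV --> integral\<^sup>L lebesgue (%x. indicator A x * (G x <.> b)) = 0)" if b: "b : Basis" for b
 proof -
  define s where "s n x = real (Suc n) * (h (x + b /R real (Suc n)) - h x)" for n x
  have "continuous_on UNIV (s n)" for n
   unfolding s_def by (intro continuous_intros continuous_on_compose2[OF cont]) auto
  hence sb: "s n : borel_measurable borel" for n by (rule borel_measurable_continuous_onI)
  have s[measurable]: "s n : borel_measurable lebesgue" for n
   using sb[of n] by (simp add: measurable_completion)
  have bound: "\<bar>s n x\<bar> <= \<bar>L\<bar> * indicator (cball 0 (R+2)) x" for n x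
  proof -
   have nb: "norm (b /R real (Suc n)) <= 1" using b by (simp add: divide_simps)
   show ?thesis
   proof (cases "norm x <= R + 1")
    case True
    hence x: "x : cball 0 (R+2)" by simp
    have y: "x + b /R real (Suc n) : cball 0 (R+2)"
     using True nb norm_triangle_ineq[of x "b /R real (Suc n)"] by simp
    have "\<bar>h (x + b /R real (Suc n)) - h x\<bar> <= L * norm (b /R real (Suc n))"
     using lipschitz_onD[OF L y x] by (simp add: dist_norm)
    also have "... = L / real (Suc n)" using b by (simp add: divide_inverse)
    finally have "\<bar>s n x\<bar> <= real (Suc n) * (L / real (Suc n))"
     unfolding s_def abs_mult by (intro mult_mono) auto
    hence "\<bar>s n x\<bar> <= L" by simp
    thus ?thesis using x by simp
   next
    case False
    have "norm x <= norm (x + b /R real (Suc n)) + norm (b /R real (Suc n))"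
     by (metis add_diff_cancel norm_triangle_ineq4)
    hence "norm (x + b /R real (Suc n)) > R" using False nb by linarith
    hence "s n x = 0" using sup[of x] sup[of "x + b /R real (Suc n)"] False unfolding s_def by simp
    thus ?thesis by simp
   qed
  qed
  have conv: "AE x in lebesgue. (%n. indicator A x * s n x) \<longlonglongrightarrow> indicator A x * (G x <.> b)"
   using d
  proof eventually_elim
   case (elim x)
   show ?case
   proof (cases "x : A")
    case True
    thus ?thesis using has_derivative_difference_quotient_LIMSEQ elim unfolding s_def by auto
   qed simp
  qed
  have As[measurable]: "(%x. indicator A x * s n x) : borel_measurable lebesgue" for n
   using A by measurable
  have gm: "(%x. indicator A x * (G x <.> b)) : borel_measurable lebesgue"
  proof (rule borel_measurable_AE)
   show "(%x. lim (%n. indicator A x * s n x)) : borel_measurable lebesgue"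
    by (rule borel_measurable_lim_metric) simp
   show "AE x in lebesgue. lim (%n. indicator A x * s n x) = indicator A x * (G x <.> b)"
    using conv by eventually_elim (rule limI)
  qed
  have wint: "integrable lebesgue (%x::'a. \<bar>L\<bar> * indicator (cball 0 (R+2)) x :: real)"
   using emeasure_bounded_finite[OF bounded_cball, of "0::'a" "R+2"]
   by (intro integrable_mult_right integrable_real_indicator) (auto simp: emeasure_completion)
  have bnd: "AE x in lebesgue. norm (indicator A x * s n x) <= \<bar>L\<bar> * indicator (cball 0 (R+2)) x" for n
  proof (rule AE_I2)
   fix x
   have "norm (indicator A x * s n x) <= \<bar>s n x\<bar>" by (auto simp: indicator_def)
   also note bound
   finally show "norm (indicator A x * s n x) <= \<bar>L\<bar> * indicator (cball 0 (R+2)) x" .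
  qed
  note dc = integrable_dominated_convergence[OF gm As wint conv bnd]
   integral_dominated_convergence[OF gm As wint conv bnd]
  have "integral\<^sup>L lebesgue (%x. indicator A x * (G x <.> b)) = 0" if "A = UNIV"
  proof -
   have "integral\<^sup>L lebesgue (s n) = 0" for n
   proof -
    let ?c = "b /R real (Suc n)"
    have hb: "h : borel_measurable borel" using cont by (rule borel_measurable_continuous_onI)
    have i1: "integrable lborel (%x. h (?c + x))"
     using hint hb integrable_distr_eq[of "(+) ?c" lborel borel h] by (simp add: lborel_distr_plus)
    have e: "integral\<^sup>L lborel (%x. h (?c + x)) = integral\<^sup>L lborel h"
     using hb integral_distr[of "(+) ?c" lborel borel h] by (simp add: lborel_distr_plus)
    have "integral\<^sup>L lebesgue (s n) = integral\<^sup>L lborel (s n)"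
     using sb[of n] by (intro integral_completion) simp
    also have "... = real (Suc n) * (integral\<^sup>L lborel (%x. h (?c + x)) - integral\<^sup>L lborel h)"
     unfolding s_def using i1 hint by (simp add: add.commute)
    finally show ?thesis using e by simp
   qed
   hence "(%n. 0) \<longlonglongrightarrow> integral\<^sup>L lebesgue (%x. indicator A x * (G x <.> b))"
    using dc(2) that by simp
   thus ?thesis by (simp add: LIMSEQ_const_iff)
  qed
  thus ?thesis using dc(1) by blast
 qed
 have rep: "(%x. indicator A x *R G x) = (%x. \<Sum>b\<in>Basis. (indicator A x * (G x <.> b)) *R b)"
  by (auto simp: fun_eq_iff euclidean_representation indicator_def)
 show i: "integrable lebesgue (%x. indicator A x *R G x)"
  unfolding rep using main by (intro Bochner_Integration.integrable_sum integrable_scaleR_left) auto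
 show "integral\<^sup>L lebesgue G = 0" if "A = UNIV"
 proof -
  have "integral\<^sup>L lebesgue (%x. indicator A x *R G x) = (\<Sum>b\<in>Basis. integral\<^sup>L lebesgue (%x. (indicator A x * (G x <.> b)) *R b))"
   unfolding rep using main by (intro Bochner_Integration.integral_sum integrable_scaleR_left) auto
  also have "... = 0" using main that by (intro sum.neutral) auto
  finally show ?thesis using that by simp
 qed
qed

section \<open>Weak gradients of Lipschitz functions\<close>

lemma grad_eqI: "(h has_derivative (%e. G <.> e)) (at x) ==> grad h x = G"
 by (simp add: grad_def frechet_derivative_eqI[of h "%e. G <.> e"] vec_eq_iff inner_axis)

lemma linear_functional_eq_inner:
 fixes f :: "real^'d => real"
 assumes "linear f"
 shows "f e = (\<chi> i. f (axis i 1)) <.> e"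
proof -
 have "f e = f (\<Sum>i\<in>UNIV. (e $ i) *R axis i 1)"
  using basis_expansion[of e] by (simp add: scalar_mult_eq_scaleR)
 also have "... = (\<Sum>i\<in>UNIV. e $ i * f (axis i 1))"
  by (simp add: linear_sum[OF assms] linear_scale[OF assms])
 finally show ?thesis by (simp add: inner_vec_def mult.commute)
qed

lemma has_derivative_grad:
 fixes h :: "real^'d => real"
 assumes "h differentiable (at x)"
 shows "(h has_derivative (%e. grad h x <.> e)) (at x)"
proof -
 have "(h has_derivative frechet_derivative h (at x)) (at x)"
  using assms by (simp add: frechet_derivative_works)
 moreover have "frechet_derivative h (at x) = (%e. grad h x <.> e)"
  unfolding grad_def by (rule ext) (rule linear_functional_eq_inner[OF has_derivative_linear[OF calculation]])
 ultimately show ?thesis by simp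
qed

lemma continuous_on_vec_lambda':
 fixes f :: "'a::topological_space => real^'d"
 assumes "!!i. continuous_on S (%x. f x $ i)"
 shows "continuous_on S f"
 using continuous_on_vec_lambda[of S "%i x. f x $ i"] assms by simp

lemma C1_continuous_grad:
 fixes h :: "real^'d => real"
 assumes "C_on (Suc 0) U h"
 shows "continuous_on U (grad h)"
 by (rule continuous_on_vec_lambda') (use assms in \<open>auto simp: grad_def Basis_vec_def\<close>)

lemma test_function_facts:
 fixes tt :: "real^'d => real"
 assumes "test_function Om tt"
 shows "locally_lipschitz_on UNIV tt" "(tt has_derivative (%e. grad tt x <.> e)) (at x)"
  "continuous_on UNIV tt" "continuous_on UNIV (grad tt)"
  "EX R. ALL x. norm x > R --> tt x = 0 & grad tt x = 0"
  "closure {x. tt x ~= 0} <= Om" "EX K. compact K & K <= Om & (ALL x. x ~: K --> tt x = 0 & grad tt x = 0)"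
  "EX M>0. ALL x. \<bar>tt x\<bar> <= M & norm (grad tt x) <= M"
proof -
 have C: "C_on (Suc 0) UNIV tt" using assms unfolding test_function_def smooth_on_def by blast
 show ll: "locally_lipschitz_on UNIV tt" using C1_imp_locally_lipschitz[OF C] by simp
 have d: "(tt has_derivative (%e. grad tt x <.> e)) (at x)" for x
  using C by (intro has_derivative_grad) simp
 show "(tt has_derivative (%e. grad tt x <.> e)) (at x)" by (rule d)
 show cont: "continuous_on UNIV tt" using locally_lipschitz_on_imp_continuous[OF ll] .
 show contg: "continuous_on UNIV (grad tt)" using C1_continuous_grad[OF C] .
 show "closure {x. tt x ~= 0} <= Om" using assms by (simp add: test_function_def)
 obtain K where K: "K = closure {x. tt x ~= 0}" by simp
 have z0: "tt x = 0" if "x : - K" for x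
  using that closure_subset[of "{x. tt x ~= 0}"] unfolding K by blast
 have z: "tt x = 0 & grad tt x = 0" if "x ~: K" for x
 proof
  show "tt x = 0" using that z0 by simp
  have "((%x. 0) has_derivative (%e. 0)) (at x)" by simp
  hence "(tt has_derivative (%e. 0 <.> e)) (at x)"
   using has_derivative_transform_within_open[of "%x. 0::real" "%e. 0" x UNIV "- K" tt] that z0
   by (simp add: open_Compl K[THEN arg_cong[where f=closed]])
  thus "grad tt x = 0" by (rule grad_eqI)
 qed
 have cK: "compact K" "K <= Om" using assms by (simp_all add: test_function_def K)
 thus "EX K. compact K & K <= Om & (ALL x. x ~: K --> tt x = 0 & grad tt x = 0)"
  using z by (intro exI[of _ K]) simp
 obtain R where R: "!!x. x : K ==> norm x <= R" using cK(1) compact_imp_bounded bounded_iff by metis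
 show "EX R. ALL x. norm x > R --> tt x = 0 & grad tt x = 0"
 proof (intro exI allI impI)
  fix x :: "real^'d" assume "norm x > R"
  hence "x ~: K" using R[of x] by fastforce
  thus "tt x = 0 & grad tt x = 0" by (rule z)
 qed
 have "bounded (tt ` K)" "bounded (grad tt ` K)"
  using cK cont contg by (auto intro!: compact_imp_bounded compact_continuous_image intro: continuous_on_subset)
 then obtain M1 M2 where M: "!!x. x : K ==> \<bar>tt x\<bar> <= M1" "!!x. x : K ==> norm (grad tt x) <= M2"
  unfolding bounded_iff by (metis imageI real_norm_def)
 have "\<bar>tt x\<bar> <= 1 + \<bar>M1\<bar> + \<bar>M2\<bar> & norm (grad tt x) <= 1 + \<bar>M1\<bar> + \<bar>M2\<bar>" for x
  using M[of x] z[of x] by (cases "x : K") auto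
 moreover have "1 + \<bar>M1\<bar> + \<bar>M2\<bar> > 0" by linarith
 ultimately show "EX M>0. ALL x. \<bar>tt x\<bar> <= M & norm (grad tt x) <= M" by blast
qed

lemma set_lebesgue_on:
 fixes f :: "'a::euclidean_space => 'b::euclidean_space"
 assumes "Om : sets lebesgue"
 shows "set_integrable lebesgue Om f \<longleftrightarrow> integrable (leb Om) f"
  "set_lebesgue_integral lebesgue Om f = integral\<^sup>L (leb Om) f"
 unfolding set_integrable_def set_lebesgue_integral_def using assms
 by (subst integrable_restrict_space integral_restrict_space; simp)+

lemma set_borel_measurable_lebesgue_on:
 fixes f :: "'a::euclidean_space => 'b::euclidean_space"
 assumes "Om : sets lebesgue"
 shows "set_borel_measurable lebesgue Om f \<longleftrightarrow> f : borel_measurable (leb Om)"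
 using assms by (simp add: set_borel_measurable_def borel_measurable_restrict_space_iff)

lemma AE_lebesgue_on:
 assumes "Om : sets lebesgue"
 shows "(AE x in leb Om. P x) \<longleftrightarrow> (AE x\<in>Om in lebesgue. P x)"
 using assms by (simp add: AE_restrict_space_iff)

lemma open_in_sets_lebesgue: "open Om ==> Om : sets lebesgue"
 by (simp add: borel_open sets_completionI_sets)

lemma compact_nonempty_subset_open_collar:
 fixes K Om :: "'a::euclidean_space set"
 assumes "compact K" "open Om" "K <= Om" and False: "K ~= {}"
 shows "EX r>0. ALL x. infdist x K <= r --> x : Om"
proof -
 show ?thesis
 proof (cases "Om = UNIV")
  case True thus ?thesis by (intro exI[of _ 1]) auto
 next
  case F: False
  have pos: "setdist K (- Om) > 0"
  proof -
   have "setdist K (- Om) ~= 0"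
    using setdist_eq_0_compact_closed[of K "- Om"] assms False F by (auto simp: closed_Compl)
   thus ?thesis using setdist_pos_le[of K "- Om"] by linarith
  qed
  have "x : Om" if "infdist x K <= setdist K (- Om) / 2" for x
  proof (rule ccontr)
   assume "x ~: Om"
   obtain y where y: "y : K" "infdist x K = dist x y"
    using infdist_attains_inf[of K x] False assms(1) compact_imp_closed by blast
   have "setdist K (- Om) <= dist y x" using setdist_le_dist[of y K x "-Om"] y \<open>x ~: Om\<close> by auto
   thus False using y that pos by (simp add: dist_commute)
  qed
  thus ?thesis using pos by (intro exI[of _ "setdist K (- Om) / 2"]) auto
 qed
qed

lemma compact_subset_open_cutoff:
 fixes K Om :: "'a::euclidean_space set"
 assumes "compact K" "open Om" "K <= Om"
 obtains \<kappa> :: "'a => real" and V where "locally_lipschitz_on UNIV \<kappa>" "open V" "K <= V" "!!x. x : V ==> \<kappa> x = 1"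
  "compact (closure {x. \<kappa> x ~= 0})" "closure {x. \<kappa> x ~= 0} <= Om"
proof (cases "K = {}")
 case True
 show ?thesis
  by (rule that[of "%x. 0" "{}"]) (use True in \<open>auto intro!: lipschitz_imp_locally_lipschitz[of 0] lipschitz_onI\<close>)
next
 case False
 obtain r where r: "r > 0" "!!x. infdist x K <= r ==> x : Om"
  using compact_nonempty_subset_open_collar[OF assms False] by blast
 define \<kappa> where "\<kappa> x = min 1 (max 0 (2 - (2/r) * infdist x K))" for x
 have lip: "(2/r)-lipschitz_on UNIV \<kappa>"
 proof (rule lipschitz_onI)
  fix x y
  have "\<bar>\<kappa> x - \<kappa> y\<bar> <= \<bar>(2/r) * infdist x K - (2/r) * infdist y K\<bar>" unfolding \<kappa>_def by linarith
  also have "... = (2/r) * \<bar>infdist x K - infdist y K\<bar>" using r(1) by (simp add: abs_mult right_diff_distrib[symmetric] del: times_divide_eq_left)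
  also have "... <= (2/r) * dist x y"
   using r(1) infdist_triangle_abs[of x K y] by (intro mult_left_mono) auto
  finally show "dist (\<kappa> x) (\<kappa> y) <= 2 / r * dist x y" by (simp add: dist_real_def)
 qed (use r in auto)
 let ?V = "{x. infdist x K < r/2}"
 have z: "closure {x. \<kappa> x ~= 0} <= {x. infdist x K <= r}"
 proof (rule closure_minimal)
  have "\<kappa> x = 0" if "r < infdist x K" for x
  proof -
   have "2 < (2/r) * infdist x K" using r(1) that by (simp add: field_simps)
   thus ?thesis unfolding \<kappa>_def by simp
  qed
  thus "{x. \<kappa> x ~= 0} <= {x. infdist x K <= r}" by force
  show "closed {x. infdist x K <= r}" by (intro closed_Collect_le continuous_intros)
 qed
 have bdd: "bounded {x. infdist x K <= r}"
 proof -
  obtain B where B: "!!y. y : K ==> norm y <= B" using assms(1) compact_imp_bounded bounded_iff by metis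
  have "norm x <= B + r" if x: "infdist x K <= r" for x
  proof -
   obtain y where y: "y : K" "infdist x K = dist x y"
    using infdist_attains_inf[of K x] False assms(1) compact_imp_closed by blast
   thus ?thesis using B[of y] x norm_triangle_ineq2[of x y] by (simp add: dist_norm)
  qed
  thus ?thesis unfolding bounded_iff by blast
 qed
 show ?thesis
 proof (rule that[of \<kappa> ?V])
  show "locally_lipschitz_on UNIV \<kappa>" by (rule lipschitz_imp_locally_lipschitz[OF lip])
  show "open ?V" by (intro open_Collect_less continuous_intros)
  show "K <= ?V" using r(1) by auto
  show "\<kappa> x = 1" if "x : ?V" for x
  proof -
   have "(2/r) * infdist x K <= 1" using r(1) that by (simp add: field_simps)
   thus ?thesis unfolding \<kappa>_def by simp
  qed
  show "compact (closure {x. \<kappa> x ~= 0})"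
   using bounded_subset[OF bdd z] by (simp add: compact_eq_bounded_closed)
  show "closure {x. \<kappa> x ~= 0} <= Om" using z r(2) by auto
 qed
qed

lemma locally_integrable_continuous:
 fixes w :: "'a::euclidean_space => 'b::euclidean_space"
 assumes "continuous_on Om w"
 shows "locally_integrable Om w"
 unfolding locally_integrable_def set_integrable_def
proof (intro allI impI)
 fix K :: "'a set" assume K: "compact K & K <= Om"
 hence "integrable lborel (%x. indicator K x *R w x)"
  using borel_integrable_compact[of K w] assms continuous_on_subset by blast
 thus "integrable lebesgue (%x. indicator K x *R w x)"
  by (simp add: integrable_completion borel_measurable_integrable)
qed

text \<open>For a locally Lipschitz function that is differentiable almost everywhere, the weak gradient is
  the pointwise one: the product with a test function is compactly supported and Lipschitz.\<close>

lemma weak_grad_of_locally_lipschitz: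
 fixes w :: "real^'d => real"
 assumes Om: "open Om" and ll: "locally_lipschitz_on Om w"
  and d: "AE x\<in>Om in lebesgue. (w has_derivative (%e. G x <.> e)) (at x)"
 shows "weak_grad Om w G"
 unfolding weak_grad_def
proof (intro conjI allI impI)
 have cont: "continuous_on Om w" using ll by (rule locally_lipschitz_on_imp_continuous)
 thus "locally_integrable Om w" by (rule locally_integrable_continuous)
 show "locally_integrable Om G"
  unfolding locally_integrable_def
 proof (intro allI impI)
  fix K :: "(real^'d) set" assume K: "compact K & K <= Om"
  then obtain \<kappa> :: "real^'d => real" and V where \<kappa>: "locally_lipschitz_on UNIV \<kappa>" "open V" "K <= V" "!!x. x : V ==> \<kappa> x = 1"
   "compact (closure {x. \<kappa> x ~= 0})" "closure {x. \<kappa> x ~= 0} <= Om"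
   using compact_subset_open_cutoff[of K Om] Om by metis
  obtain R where R: "!!x. x : closure {x. \<kappa> x ~= 0} ==> norm x <= R"
   using \<kappa>(5) compact_imp_bounded bounded_iff by metis
  have "integrable lebesgue (%x. indicator K x *R G x)"
  proof (rule compactly_supported_lipschitz_gradient(1))
   show "locally_lipschitz_on UNIV (%x. w x * \<kappa> x)"
    by (rule locally_lipschitz_on_mult_zero_extension[OF ll \<kappa>(1,6)])
   show "w x * \<kappa> x = 0" if "norm x > R" for x
    using R[of x] that closure_subset[of "{x. \<kappa> x ~= 0}"] by fastforce
   show "K : sets lebesgue" using K by (simp add: borel_compact sets_completionI_sets)
   show "AE x in lebesgue. x : K --> ((%x. w x * \<kappa> x) has_derivative (%e. G x <.> e)) (at x)"
    using d
   proof eventually_elim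
    case (elim x)
    show ?case
    proof
     assume "x : K"
     hence "x : V" "(w has_derivative (%e. G x <.> e)) (at x)" using elim \<kappa>(3) K by auto
     thus "((%x. w x * \<kappa> x) has_derivative (%e. G x <.> e)) (at x)"
      using has_derivative_transform_within_open[of w "%e. G x <.> e" x UNIV V "%x. w x * \<kappa> x"] \<kappa>(2,4) by simp
    qed
   qed
  qed
  thus "set_integrable lebesgue K G" by (simp add: set_integrable_def)
 qed
 fix tt :: "real^'d => real" assume t: "test_function Om tt"
 note tf = test_function_facts[OF t]
 obtain R where R: "!!x. norm x > R ==> tt x = 0 & grad tt x = 0" using tf(5) by blast
 obtain K where K: "compact K" "K <= Om" "!!x. x ~: K ==> tt x = 0 & grad tt x = 0" using tf(7) by blast
 have oK: "open (- K)" using K(1) by (simp add: compact_imp_closed open_Compl)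
 define H where "H x = indicator Om x *R (w x *R grad tt x + tt x *R G x)" for x
 have dH: "AE x in lebesgue. x : UNIV --> ((%x. w x * tt x) has_derivative (%e. H x <.> e)) (at x)"
  using d
 proof eventually_elim
  case (elim x)
  show ?case
  proof (cases "x : Om")
   case True
   hence "((%x. w x * tt x) has_derivative (%e. w x * (grad tt x <.> e) + (G x <.> e) * tt x)) (at x)"
    using elim tf(2) by (intro has_derivative_mult) auto
   also have "(%e. w x * (grad tt x <.> e) + (G x <.> e) * tt x) = (%e. H x <.> e)"
    using True by (simp add: H_def inner_add_left algebra_simps)
   finally show ?thesis by simp
  next
   case False
   hence "x : - K" using K(2) by blast
   moreover have "((%x. 0::real) has_derivative (%e. 0)) (at x)" by simp
   ultimately have "((%x. w x * tt x) has_derivative (%e. 0)) (at x)"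
    using has_derivative_transform_within_open[of "%x. 0::real" "%e. 0" x UNIV "- K" "%x. w x * tt x"] K(3) oK
    by simp
   thus ?thesis using False by (simp add: H_def)
  qed
 qed
 have llp: "locally_lipschitz_on UNIV (%x. w x * tt x)"
  by (rule locally_lipschitz_on_mult_zero_extension[OF ll tf(1,6)])
 have sup: "w x * tt x = 0" if "norm x > R" for x using R that by simp
 have iH: "integrable lebesgue H" and H0: "integral\<^sup>L lebesgue H = 0"
  using compactly_supported_lipschitz_gradient[OF llp sup _ dH] by simp_all
 have c1: "continuous_on UNIV (%x. w x *R grad tt x)"
 proof (rule continuous_at_imp_continuous_on, rule ballI)
  fix x
  show "isCont (%x. w x *R grad tt x) x"
  proof (cases "x : Om")
   case True
   hence "isCont w x" using cont Om by (simp add: continuous_on_eq_continuous_at)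
   moreover have "isCont (grad tt) x" using tf(4) by (simp add: continuous_on_eq_continuous_at)
   ultimately show ?thesis by (rule continuous_scaleR)
  next
   case False
   have "continuous_on (- K) (%x. w x *R grad tt x)"
    by (rule continuous_on_eq[OF continuous_on_const[of _ 0]]) (simp add: K(3))
   moreover have "x : - K" using K(2) False by blast
   ultimately show ?thesis using oK by (simp only: continuous_on_eq_continuous_at)
  qed
 qed
 have i1: "integrable lebesgue (%x. w x *R grad tt x)"
  using continuous_compact_support_integrable[OF c1, of R] R
  by (simp add: integrable_completion borel_measurable_integrable)
 have e1: "indicator Om x *R (w x *R grad tt x) = w x *R grad tt x" for x
  using K(2,3) by (cases "x : Om") auto
 have e2: "indicator Om x *R (tt x *R G x) = H x - w x *R grad tt x" for x
  using e1[of x] by (simp add: H_def algebra_simps)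
 show "(LINT x:Om|lebesgue. w x *R grad tt x) = - (LINT x:Om|lebesgue. tt x *R G x)"
  unfolding set_lebesgue_integral_def e1 e2 using iH i1 H0 by simp
qed

section \<open>Closedness of the weak gradient\<close>

lemma smooth_step_exists:
 assumes "cutoff \<phi>"
 shows "EX H :: real => real. (ALL k. C_on k UNIV H) & (ALL t<=0. H t = 0) & (ALL t>=1. H t = 1) & (ALL t. 0 <= H t) & (ALL t. H t <= 1) & mono H"
proof -
 have C\<phi>: "C_on k UNIV \<phi>" for k using assms by (simp add: cutoff_def smooth_on_def)
 have cont: "continuous_on UNIV \<phi>" using C\<phi>[of 0] by simp
 have pos: "\<phi> z > 0" if "\<bar>z\<bar> < 1" for z using assms that by (simp add: cutoff_def)
 have nn: "\<phi> z >= 0" for z using assms by (simp add: cutoff_def)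
 have zero: "\<phi> z = 0" if "\<bar>z\<bar> >= 1" for z using assms that by (simp add: cutoff_def)
 define F where "F t = integral {-2..t} \<phi>" for t
 have Fz: "F t = 0" if "t <= -1" for t
 proof -
  have "integral {-2..t} \<phi> = integral {-2..t} (%x. 0)"
   by (rule integral_cong) (use that zero in auto)
  thus ?thesis by (simp add: F_def)
 qed
 have dF: "(F has_real_derivative \<phi> t) (at t)" for t
 proof (cases "t < -1")
  case True
  have "((%x. 0) has_real_derivative 0) (at t)" by simp
  hence "(F has_real_derivative 0) (at t)"
   by (rule has_field_derivative_transform_within_open[where S="{..<-1}"]) (use True Fz in auto)
  thus ?thesis using zero[of t] True by simp
 next
  case False
  have "(F has_real_derivative \<phi> t) (at t within {-2..t+1})"
   unfolding F_def by (rule integral_has_real_derivative) (use False cont continuous_on_subset in auto)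
  moreover have "at t within {-2..t+1} = at t"
   by (rule at_within_interior) (use False in auto)
  ultimately show ?thesis by simp
 qed
 have mono: "F s <= F t" if "s <= t" for s t
  by (rule DERIV_nonneg_imp_nondecreasing[OF that]) (use dF nn in blast)
 have const: "F t = F 1" if "t >= 1" for t
 proof (rule antisym)
  show "F 1 <= F t" using mono that .
  have "F t <= F 1"
   by (rule DERIV_nonpos_imp_nonincreasing[OF that]) (use dF zero in force)
  thus "F t <= F 1" .
 qed
 have p: "F 1 > 0"
 proof -
  have "F (-1/2) < F (1/2)"
   by (rule DERIV_pos_imp_increasing) (use dF pos in force)+
  thus ?thesis using mono[of "1/2" 1] mono[of "-1" "-1/2"] Fz[of "-1"] by simp
 qed
 have CF: "C_on k UNIV F" for k
 proof (cases k)
  case 0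
  have "continuous_on UNIV F"
   using dF by (meson DERIV_isCont continuous_at_imp_continuous_on)
  thus ?thesis using 0 by simp
 next
  case (Suc m)
  show ?thesis unfolding Suc
   by (rule C_on_SucI[where f'="%x h. \<phi> x * h"])
     (use dF C\<phi> in \<open>auto simp: has_field_derivative_def\<close>)
 qed
 define H where "H t = F (2 * t - 1) / F 1" for t
 show ?thesis
 proof (intro exI[of _ H] conjI allI impI)
  show "C_on k UNIV H" for k
  proof -
   have "C_on k UNIV (%t. (1 / F 1) * F ((2::real) <.> t + (-1)))"
    by (intro C_on_mult C_on_const C_on_affine_compose CF) auto
   thus ?thesis unfolding H_def by simp
  qed
  show "H t = 0" if "t <= 0" for t using that Fz by (simp add: H_def)
  show "H t = 1" if "t >= 1" for t using that const[of "2*t-1"] p by (simp add: H_def)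
  show "mono H" using p mono by (intro monoI) (simp add: H_def divide_right_mono)
  show "0 <= H t" for t
   using p mono[of "min (2*t-1) (-1)" "2*t-1"] Fz[of "min (2*t-1) (-1)"] by (simp add: H_def)
  show "H t <= 1" for t
   using p mono[of "2*t-1" "max (2*t-1) 1"] const[of "max (2*t-1) 1"] by (simp add: H_def)
 qed
qed

lemma integrable_bounded_mult:
 fixes f :: "'a => 'b::euclidean_space" and h :: "'a => real"
 assumes "integrable M f" "h : borel_measurable M" "!!x. x : space M ==> \<bar>h x\<bar> <= B"
 shows "integrable M (%x. h x *R f x)" "norm (\<integral>x. h x *R f x \<partial>M) <= B * (\<integral>x. norm (f x) \<partial>M)"
proof -
 have m: "(%x. h x *R f x) : borel_measurable M"
  using assms borel_measurable_scaleR[of h M f] borel_measurable_integrable by blast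
 have b: "norm (h x *R f x) <= B * norm (f x)" if "x : space M" for x
  using assms(3)[OF that] by (simp add: mult_right_mono)
 have iB: "integrable M (%x. B * norm (f x))" using assms(1) by (intro integrable_mult_right integrable_norm)
 show i: "integrable M (%x. h x *R f x)"
  by (rule Bochner_Integration.integrable_bound[OF iB m]) (use b in \<open>fastforce intro: AE_I2\<close>)
 have "norm (\<integral>x. h x *R f x \<partial>M) <= (\<integral>x. norm (h x *R f x) \<partial>M)" by (rule integral_norm_bound)
 also have "... <= (\<integral>x. B * norm (f x) \<partial>M)"
  by (rule integral_mono[OF integrable_norm[OF i] iB b])
 finally show "norm (\<integral>x. h x *R f x \<partial>M) <= B * (\<integral>x. norm (f x) \<partial>M)" by simp
qed

lemma continuous_measurable_lebesgue_on:
 fixes f :: "'a::euclidean_space => 'b::euclidean_space"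
 assumes "continuous_on UNIV f"
 shows "f : borel_measurable (leb Om)"
 by (intro measurable_restrict_space1 measurable_completion) (simp add: borel_measurable_continuous_onI assms)

lemma integrable_lebesgue_on_imp_locally_integrable:
 fixes f :: "'a::euclidean_space => 'b::euclidean_space"
 assumes so: "Om : sets lebesgue" and "integrable (leb Om) f"
 shows "locally_integrable Om f"
 unfolding locally_integrable_def
proof (intro allI impI)
 fix K :: "'a set" assume K: "compact K & K <= Om"
 hence "K : sets lebesgue" by (simp add: borel_compact sets_completionI_sets)
 thus "set_integrable lebesgue K f"
  using assms K by (intro set_integrable_subset[of lebesgue Om f K]) (auto simp: set_lebesgue_on(1)[OF so])
qed

text \<open>Weak gradients are closed under convergence in mean.\<close>

lemma weak_grad_closed:
 fixes w :: "real^'d => real"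
 assumes Om: "open Om"
  and i: "integrable (leb Om) w" "integrable (leb Om) G"
  and approx: "!!e. e > 0 ==> EX w' G'. weak_grad Om w' G' & integrable (leb Om) w' & integrable (leb Om) G' &
    (LINT x|leb Om. norm (w x - w' x)) < e & (LINT x|leb Om. norm (G x - G' x)) < e"
 shows "weak_grad Om w G"
 unfolding weak_grad_def
proof (intro conjI allI impI)
 note so = open_in_sets_lebesgue[OF Om]
 show "locally_integrable Om w" "locally_integrable Om G"
  using integrable_lebesgue_on_imp_locally_integrable[OF so] i by blast+
 fix tt :: "real^'d => real" assume t: "test_function Om tt"
 note tf = test_function_facts[OF t]
 obtain B where B: "B > 0" "!!x. \<bar>tt x\<bar> <= B" "!!x. norm (grad tt x) <= B" using tf(8) by blast
 let ?M = "leb Om"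
 have mtt: "tt : borel_measurable ?M" by (rule continuous_measurable_lebesgue_on[OF tf(3)])
 have mg: "(%x. grad tt x $ j) : borel_measurable ?M" for j
  by (rule continuous_measurable_lebesgue_on) (intro continuous_intros tf(4))
 have comp: "\<bar>grad tt x $ j\<bar> <= B" for x j
  using B(3)[of x] component_le_norm_cart[of "grad tt x" j] by linarith
 have ig: "integrable ?M (%x. v x *R grad tt x)" and bg: "norm ((LINT x|?M. v x *R grad tt x) $ j) <= B * (LINT x|?M. norm (v x))"
  if v: "integrable ?M v" for v :: "real^'d => real" and j
 proof -
  have mm: "grad tt : borel_measurable ?M" by (rule continuous_measurable_lebesgue_on[OF tf(4)])
  show ii: "integrable ?M (%x. v x *R grad tt x)"
  proof (rule Bochner_Integration.integrable_bound)
   show "integrable ?M (%x. B * norm (v x))" using v by (intro integrable_mult_right integrable_norm)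
   show "(%x. v x *R grad tt x) : borel_measurable ?M"
    using mm borel_measurable_integrable[OF v] by (intro borel_measurable_scaleR)
   show "AE x in ?M. norm (v x *R grad tt x) <= norm (B * norm (v x))"
    using B(1,3) mult_left_mono[OF B(3) abs_ge_zero] by (intro AE_I2) (simp add: mult.commute[of B])
  qed
  have "(LINT x|?M. v x *R grad tt x) $ j = (LINT x|?M. (v x *R grad tt x) $ j)"
   using integral_bounded_linear[OF bounded_linear_vec_nth ii] by simp
  also have "... = (LINT x|?M. (grad tt x $ j) *R v x)" by (simp add: mult.commute)
  finally show "norm ((LINT x|?M. v x *R grad tt x) $ j) <= B * (LINT x|?M. norm (v x))"
   using integrable_bounded_mult(2)[OF v mg comp, of j] by simp
 qed
 have "(LINT x|?M. w x *R grad tt x) + (LINT x|?M. tt x *R G x) = 0" (is "?S = 0")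
 proof -
  have "?S $ j = 0" for j
  proof (rule ccontr)
   assume ne: "?S $ j ~= 0"
   define e where "e = \<bar>?S $ j\<bar> / (2 * B)"
   have "e > 0" using ne B(1) by (simp add: e_def)
   then obtain w' G' where a: "weak_grad Om w' G'" "integrable ?M w'" "integrable ?M G'"
    "(LINT x|?M. norm (w x - w' x)) < e" "(LINT x|?M. norm (G x - G' x)) < e" using approx by blast
   have z: "(LINT x|?M. w' x *R grad tt x) + (LINT x|?M. tt x *R G' x) = 0"
    using a(1) t unfolding weak_grad_def set_lebesgue_on(2)[OF so] by simp
   have itt: "integrable ?M (%x. tt x *R V x)" if "integrable ?M V" for V :: "real^'d => real^'d"
    by (rule integrable_bounded_mult(1)[OF that mtt B(2)])
   have "?S = (LINT x|?M. (w x - w' x) *R grad tt x) + (LINT x|?M. tt x *R (G x - G' x))"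
    using z ig[OF i(1)] ig[OF a(2)] itt[OF i(2)] itt[OF a(3)]
    by (simp add: scaleR_diff_left scaleR_diff_right algebra_simps)
   hence "\<bar>?S $ j\<bar> <= norm ((LINT x|?M. (w x - w' x) *R grad tt x) $ j) + norm (LINT x|?M. tt x *R (G x - G' x))"
    using component_le_norm_cart[of "\<integral>x. tt x *R (G x - G' x) \<partial>?M" j] by simp
   also have "... <= B * (LINT x|?M. norm (w x - w' x)) + B * (LINT x|?M. norm (G x - G' x))"
    using bg[of "%x. w x - w' x" j] integrable_bounded_mult(2)[OF _ mtt B(2), of "%x. G x - G' x"] i a(2,3)
    by (intro add_mono) auto
   also have "... < B * e + B * e" using a(4,5) B(1) by (intro add_strict_mono mult_strict_left_mono) auto
   also have "... = \<bar>?S $ j\<bar>" using B(1) by (simp add: e_def)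
   finally show False by simp
  qed
  thus ?thesis by (simp add: vec_eq_iff)
 qed
 thus "(LINT x:Om|lebesgue. w x *R grad tt x) = - (LINT x:Om|lebesgue. tt x *R G x)"
  unfolding set_lebesgue_on(2)[OF so] by (simp add: eq_neg_iff_add_eq_0)
qed

lemma AE_eq_lebesgue_on_imp:
 fixes f g :: "'a::euclidean_space => 'b::euclidean_space"
 assumes so: "Om : sets lebesgue" and ae: "AE x\<in>Om in lebesgue. f x = g x"
 shows "integrable (leb Om) f ==> integrable (leb Om) g"
  "f : borel_measurable (leb Om) ==> g : borel_measurable (leb Om)"
proof -
 have ae': "AE x in lebesgue. indicator Om x *R f x = indicator Om x *R g x"
  using ae by eventually_elim (auto simp: indicator_def)
 show m: "g : borel_measurable (leb Om)" if "f : borel_measurable (leb Om)"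
 proof -
  have "(%x. indicator Om x *R f x) : borel_measurable lebesgue"
   using that so by (simp add: borel_measurable_restrict_space_iff)
  from borel_measurable_AE[OF this ae'] show ?thesis
   using so by (simp add: borel_measurable_restrict_space_iff)
 qed
 show "integrable (leb Om) g" if "integrable (leb Om) f"
 proof (rule integrable_cong_AE_imp[OF that])
  show "g : borel_measurable (leb Om)" using m that borel_measurable_integrable by blast
  show "AE x in leb Om. f x = g x" using ae so by (simp add: AE_lebesgue_on)
 qed
qed

lemma integral_lebesgue_on_cong_AE:
 fixes f g :: "'a::euclidean_space => 'b::euclidean_space"
 assumes so: "Om : sets lebesgue" and ae: "AE x\<in>Om in lebesgue. f x = g x"
 shows "integral\<^sup>L (leb Om) f = integral\<^sup>L (leb Om) g"
proof (cases "f : borel_measurable (leb Om)")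
 case True
 thus ?thesis using AE_eq_lebesgue_on_imp(2)[OF so ae] ae so
  by (intro integral_cong_AE) (auto simp: AE_lebesgue_on)
next
 case False
 hence "g ~: borel_measurable (leb Om)"
  using AE_eq_lebesgue_on_imp(2)[OF so, of g f] ae by (auto simp: eq_commute)
 thus ?thesis using False borel_measurable_integrable not_integrable_integral_eq by metis
qed

lemma weak_grad_cong_AE:
 assumes Om: "open Om" and "weak_grad Om w G" and ae: "AE x\<in>Om in lebesgue. w x = w' x" "AE x\<in>Om in lebesgue. G x = G' x"
 shows "weak_grad Om w' G'"
 unfolding weak_grad_def
proof (intro conjI allI impI)
 note so = open_in_sets_lebesgue[OF Om]
 have li: "locally_integrable Om g" if "locally_integrable Om f" "AE x\<in>Om in lebesgue. f x = g x"
  for f g :: "real^'a => 'b::euclidean_space"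
  unfolding locally_integrable_def
 proof (intro allI impI)
  fix K :: "(real^'a) set" assume K: "compact K & K <= Om"
  have sK: "K : sets lebesgue" using K by (simp add: borel_compact sets_completionI_sets)
  have "AE x in lebesgue. x : K --> f x = g x" using that(2) by eventually_elim (use K in blast)
  moreover have "set_integrable lebesgue K f" using that(1) K unfolding locally_integrable_def by blast
  ultimately show "set_integrable lebesgue K g"
   using AE_eq_lebesgue_on_imp(1)[OF sK, of f g] set_lebesgue_on(1)[OF sK, of f] set_lebesgue_on(1)[OF sK, of g] by simp
 qed
 show "locally_integrable Om w'" "locally_integrable Om G'"
  using assms li unfolding weak_grad_def by blast+
 fix tt :: "real^'a => real" assume t: "test_function Om tt"
 have "(LINT x:Om|lebesgue. w x *R grad tt x) = (LINT x:Om|lebesgue. w' x *R grad tt x)"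
  "(LINT x:Om|lebesgue. tt x *R G x) = (LINT x:Om|lebesgue. tt x *R G' x)"
  unfolding set_lebesgue_on(2)[OF so]
 proof (safe intro!: integral_lebesgue_on_cong_AE[OF so])
  show "AE x\<in>Om in lebesgue. w x *R grad tt x = w' x *R grad tt x"
   using ae(1) by eventually_elim simp
  show "AE x\<in>Om in lebesgue. tt x *R G x = tt x *R G' x"
   using ae(2) by eventually_elim simp
 qed
 thus "(LINT x:Om|lebesgue. w' x *R grad tt x) = - (LINT x:Om|lebesgue. tt x *R G' x)"
  using assms(2) t unfolding weak_grad_def by simp
qed

lemma locally_integrable_times_test:
 fixes f :: "real^'d => 'b::euclidean_space" and tt :: "real^'d => real"
 assumes Om: "open Om" and f: "locally_integrable Om f" and K: "compact K" "K <= Om" "!!x. x ~: K ==> tt x = 0"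
  and tt: "continuous_on UNIV tt"
 shows "integrable (leb Om) (%x. tt x *R f x)"
proof -
 have so: "Om : sets lebesgue" and sK: "K : sets lebesgue"
  using open_in_sets_lebesgue[OF Om] K by (auto simp: borel_compact sets_completionI_sets)
 obtain B where B: "!!x. x : K ==> \<bar>tt x\<bar> <= B"
  using compact_imp_bounded[OF compact_continuous_image[OF continuous_on_subset[OF tt] K(1)]]
  unfolding bounded_iff by (metis imageI real_norm_def subset_UNIV)
 have "set_integrable lebesgue K f" using f K unfolding locally_integrable_def by blast
 hence "integrable (leb K) f" using set_lebesgue_on(1)[OF sK, of f] by simp
 from integrable_bounded_mult(1)[OF this continuous_measurable_lebesgue_on[OF tt], of B]
 have "integrable (leb K) (%x. tt x *R f x)" using B by simp
 hence "set_integrable lebesgue K (%x. tt x *R f x)" by (simp add: set_lebesgue_on(1)[OF sK])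
 moreover have "(%x. indicator K x *R (tt x *R f x)) = (%x. indicator Om x *R (tt x *R f x))"
 proof
  fix x show "indicator K x *R (tt x *R f x) = indicator Om x *R (tt x *R f x)"
   using K by (cases "x : K") auto
 qed
 ultimately show ?thesis unfolding set_lebesgue_on(1)[OF so, symmetric] set_integrable_def by metis
qed

lemma locally_integrable_lincomb:
 fixes f g :: "'a::euclidean_space => 'b::euclidean_space"
 assumes "locally_integrable Om f" "locally_integrable Om g"
 shows "locally_integrable Om (%x. c *R f x + d *R g x)"
 using assms unfolding locally_integrable_def
 by (auto intro!: set_integral_add set_integrable_scaleR_right)

lemma weak_grad_lincomb:
 fixes w :: "real^'d => real"
 assumes Om: "open Om" and 1: "weak_grad Om w G" and 2: "weak_grad Om w' G'"
 shows "weak_grad Om (%x. c * w x + d * w' x) (%x. c *R G x + d *R G' x)"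
 unfolding weak_grad_def
proof (intro conjI allI impI)
 show "locally_integrable Om (%x. c * w x + d * w' x)" "locally_integrable Om (%x. c *R G x + d *R G' x)"
  using 1 2 locally_integrable_lincomb[of Om w w' c d] locally_integrable_lincomb[of Om G G' c d]
  unfolding weak_grad_def by auto
 note so = open_in_sets_lebesgue[OF Om]
 fix tt :: "real^'d => real" assume t: "test_function Om tt"
 note tf = test_function_facts[OF t]
 obtain K where K: "compact K" "K <= Om" "!!x. x ~: K ==> tt x = 0 & grad tt x = 0" using tf(7) by blast
 let ?M = "leb Om"
 have iG: "integrable ?M (%x. tt x *R V x)" if "locally_integrable Om V" for V :: "real^'d => real^'d"
  by (rule locally_integrable_times_test[OF Om that K(1,2) _ tf(3)]) (use K(3) in blast)
 have iw: "integrable ?M (%x. v x *R grad tt x)" if "locally_integrable Om v" for v :: "real^'d => real"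
 proof -
  have "integrable ?M (%x. (grad tt x $ j) *R v x)" for j
   by (rule locally_integrable_times_test[OF Om that K(1,2)])
     (use K(3) in \<open>auto intro!: continuous_intros tf(4)\<close>)
  hence "integrable ?M (%x. \<Sum>j\<in>UNIV. ((grad tt x $ j) *R v x) *R axis j 1 :: real^'d)"
   by (intro Bochner_Integration.integrable_sum integrable_scaleR_left) auto
  moreover have "(\<Sum>j\<in>UNIV. ((grad tt x $ j) *R v x) *R axis j 1) = v x *R grad tt x" for x
   by (simp add: vec_eq_iff axis_def if_distrib cong: if_cong)
  ultimately show ?thesis by simp
 qed
 have e: "(LINT x|?M. w x *R grad tt x) = - (LINT x|?M. tt x *R G x)" "(LINT x|?M. w' x *R grad tt x) = - (LINT x|?M. tt x *R G' x)"
  using 1 2 t unfolding weak_grad_def set_lebesgue_on(2)[OF so] by auto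
 have l: "locally_integrable Om w" "locally_integrable Om G" "locally_integrable Om w'" "locally_integrable Om G'"
  using 1 2 unfolding weak_grad_def by auto
 have "(LINT x|?M. (c * w x + d * w' x) *R grad tt x) = c *R (LINT x|?M. w x *R grad tt x) + d *R (LINT x|?M. w' x *R grad tt x)"
  using iw[OF l(1)] iw[OF l(3)] by (simp add: scaleR_add_left flip: scaleR_scaleR)
 moreover have "(LINT x|?M. tt x *R (c *R G x + d *R G' x)) = c *R (LINT x|?M. tt x *R G x) + d *R (LINT x|?M. tt x *R G' x)"
 proof -
  have "(%x. tt x *R (c *R G x + d *R G' x)) = (%x. c *R (tt x *R G x) + d *R (tt x *R G' x))"
   by (simp add: fun_eq_iff scaleR_add_right mult.commute)
  thus ?thesis
   using Bochner_Integration.integral_add[OF integrable_scaleR_right[OF iG[OF l(2)]] integrable_scaleR_right[OF iG[OF l(4)]], of c d]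
   by (simp del: scaleR_scaleR)
 qed
 ultimately show "(LINT x:Om|lebesgue. (c * w x + d * w' x) *R grad tt x) = - (LINT x:Om|lebesgue. tt x *R (c *R G x + d *R G' x))"
  unfolding set_lebesgue_on(2)[OF so] using e by simp
qed

section \<open>Uniqueness of weak gradients\<close>

lemma box_step_test_function:
 fixes a b :: "real^'d" and H :: "real => real"
 assumes H: "!!k. C_on k UNIV H" "!!t. t <= 0 ==> H t = 0"
  and sub: "cbox a b <= Om" and n: "n > 0"
 defines "tt == (%x::real^'d. \<Prod>i\<in>UNIV. H (n * (x $ i - a $ i)) * H (n * (b $ i - x $ i)))"
 shows "test_function Om tt" "!!x. x ~: box a b ==> tt x = 0"
proof -
 show z: "tt x = 0" if "x ~: box a b" for x
 proof -
  have "EX i. \<not> (a $ i < x $ i & x $ i < b $ i)" using that by (simp add: mem_box_cart)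
  then obtain i where "\<not> (a $ i < x $ i & x $ i < b $ i)" by blast
  hence "n * (x $ i - a $ i) <= 0 | n * (b $ i - x $ i) <= 0"
   using n by (auto simp: mult_le_0_iff)
  hence "H (n * (x $ i - a $ i)) * H (n * (b $ i - x $ i)) = 0" using H(2) by auto
  thus ?thesis unfolding tt_def by (intro prod_zero) auto
 qed
 hence "{x. tt x ~= 0} <= cbox a b" using box_subset_cbox by blast
 hence c: "closure {x. tt x ~= 0} <= cbox a b" by (simp add: closure_minimal closed_cbox)
 have "C_on k UNIV tt" for k
 proof -
  have "C_on k UNIV (%x::real^'d. \<Prod>i\<in>UNIV. H ((n *R axis i 1) <.> x + (- n * a $ i)) * H (((- n) *R axis i 1) <.> x + n * b $ i))"
   by (intro C_on_prod C_on_mult C_on_affine_compose H(1)) auto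
  thus ?thesis unfolding tt_def by (simp add: inner_axis' algebra_simps)
 qed
 thus "test_function Om tt"
  unfolding test_function_def smooth_on_def using c sub bounded_subset[OF bounded_cbox c]
  by (auto simp: compact_eq_bounded_closed)
qed

text \<open>Smooth steps approximate the indicator of a box from below, so the mean of \<open>g\<close> over every box
  vanishes; then \<open>g\<close> vanishes at its Lebesgue points.\<close>

lemma fundamental_lemma_calculus_of_variations:
 fixes g :: "real^'d => real"
 assumes \<phi>: "cutoff \<phi>" and Om: "open Om" and g: "locally_integrable Om g"
  and z: "!!tt. test_function Om tt ==> (LINT x:Om|lebesgue. tt x * g x) = 0"
 shows "AE x\<in>Om in lebesgue. g x = 0"
proof -
 obtain H :: "real => real" where H: "!!k. C_on k UNIV H" "!!t. t <= 0 ==> H t = 0" "!!t. t >= 1 ==> H t = 1"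
  "!!t. 0 <= H t" "!!t. H t <= 1" using smooth_step_exists[OF \<phi>] by blast
 have box0: "integral (cbox a b) g = 0" and absg: "g absolutely_integrable_on cbox a b" if sub: "cbox a b <= Om" for a b :: "real^'d"
 proof -
  have sQ: "cbox a b : sets lebesgue" by simp
  show ig: "g absolutely_integrable_on cbox a b" using g sub compact_cbox unfolding locally_integrable_def by blast
  let ?M = "leb (cbox a b)"
  have igM: "integrable ?M g" using ig set_lebesgue_on(1)[OF sQ, of g] by simp
  define tt where "tt n x = (\<Prod>i\<in>UNIV. H (real (Suc n) * (x $ i - a $ i)) * H (real (Suc n) * (b $ i - x $ i)))" for n and x :: "real^'d"
  have t: "test_function Om (tt n)" and tz: "x ~: box a b ==> tt n x = 0" for n x
   using box_step_test_function[OF H(1,2) sub, of "real (Suc n)"] unfolding tt_def by auto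
  have t1: "\<bar>tt n x\<bar> <= 1" for n x
   unfolding tt_def abs_prod using H(4,5) by (intro prod_le_1) (auto simp: abs_mult mult_le_one)
  have lim: "(%n. tt n x) \<longlonglongrightarrow> indicator (box a b) x" for x
  proof (cases "x : box a b")
   case True
   have "(%n. H (real (Suc n) * (x $ i - a $ i)) * H (real (Suc n) * (b $ i - x $ i))) \<longlonglongrightarrow> 1" for i
   proof -
    have p: "x $ i - a $ i > 0" "b $ i - x $ i > 0" using True by (auto simp: mem_box_cart)
    have ev: "eventually (%n. real (Suc n) * c >= 1) sequentially" if "c > 0" for c :: real
    proof -
     obtain N where N: "inverse (real (Suc N)) < c" using reals_Archimedean[of c] \<open>c > 0\<close> by blast
     have "real (Suc n) * c >= 1" if "n >= N" for n
     proof -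
      have "1 = real (Suc N) * inverse (real (Suc N))" by simp
      also have "... <= real (Suc n) * c" using N that by (intro mult_mono) auto
      finally show ?thesis .
     qed
     thus ?thesis unfolding eventually_sequentially by blast
    qed
    have "eventually (%n. H (real (Suc n) * (x $ i - a $ i)) * H (real (Suc n) * (b $ i - x $ i)) = 1) sequentially"
     using ev[OF p(1)] ev[OF p(2)] by eventually_elim (simp add: H(3))
    thus ?thesis by (rule tendsto_eventually)
   qed
   hence "(%n. tt n x) \<longlonglongrightarrow> (\<Prod>i\<in>(UNIV::'d set). 1)" unfolding tt_def by (intro tendsto_prod)
   thus ?thesis using True by simp
  next
   case False thus ?thesis using tz by simp
  qed
  have gm: "g : borel_measurable ?M" using igM by simp
  have tm: "tt n : borel_measurable ?M" for n by (rule continuous_measurable_lebesgue_on[OF test_function_facts(3)[OF t]])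
  have "(%n. \<integral>x. tt n x * g x \<partial>?M) \<longlonglongrightarrow> (LINT x|?M. indicator (box a b) x * g x)"
  proof (rule integral_dominated_convergence[where w="%x. norm (g x)"])
   show "(%x. indicator (box a b) x * g x) : borel_measurable ?M"
   proof (rule borel_measurable_times[OF _ gm])
    have "(indicator (box a b) :: real^'d => real) : borel_measurable lebesgue" by (rule borel_measurable_indicator) simp
    thus "(indicator (box a b) :: real^'d => real) : borel_measurable ?M" by (rule measurable_restrict_space1)
   qed
   show "(%x. tt n x * g x) : borel_measurable ?M" for n using gm tm by simp
   show "integrable ?M (%x. norm (g x))" using igM by simp
   show "AE x in ?M. (%n. tt n x * g x) \<longlonglongrightarrow> indicator (box a b) x * g x"
    by (intro AE_I2 tendsto_mult lim tendsto_const)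
   show "AE x in ?M. norm (tt n x * g x) <= norm (g x)" for n
    using t1[of n] by (intro AE_I2) (simp add: abs_mult mult_left_le_one_le)
  qed
  moreover have "(LINT x|?M. tt n x * g x) = 0" for n
  proof -
   have "(LINT x|?M. tt n x * g x) = (LINT x:cbox a b|lebesgue. tt n x * g x)"
    using set_lebesgue_on(2)[OF sQ, of "%x. tt n x * g x"] by simp
   also have "... = (LINT x:Om|lebesgue. tt n x * g x)"
   proof -
    have "indicator (cbox a b) x *R (tt n x * g x) = indicator Om x *R (tt n x * g x)" for x
     using sub tz[of x n] box_subset_cbox[of a b] by (cases "x : box a b") (auto simp: indicator_def)
    thus ?thesis unfolding set_lebesgue_integral_def by (intro Bochner_Integration.integral_cong refl)
   qed
   finally show ?thesis using z[OF t] by simp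
  qed
  ultimately have "(LINT x|?M. indicator (box a b) x * g x) = 0" by (simp add: LIMSEQ_const_iff)
  moreover have "(LINT x|?M. indicator (box a b) x * g x) = (LINT x:box a b|lebesgue. g x)"
  proof -
   have "indicator (cbox a b) x *R (indicator (box a b) x * g x) = indicator (box a b) x *R g x" for x
    using box_subset_cbox[of a b] by (auto simp: indicator_def)
   thus ?thesis
    unfolding set_lebesgue_on(2)[OF sQ, of "%x. indicator (box a b) x * g x", symmetric] set_lebesgue_integral_def
    by (intro Bochner_Integration.integral_cong refl)
  qed
  moreover have "(LINT x:box a b|lebesgue. g x) = integral (box a b) g"
   by (intro set_lebesgue_integral_eq_integral set_integrable_subset[OF ig]) (auto simp: box_subset_cbox)
  ultimately show "integral (cbox a b) g = 0" by (simp add: integral_open_interval)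
 qed
 have zero_on_box: "AE x in lebesgue. x : cbox p q --> g x = 0" if sub: "cbox p q <= Om" for p q :: "real^'d"
 proof -
  let ?f = "%x. if x : cbox p q then g x else 0"
  have cap: "EX u v. cbox p q \<inter> cbox a b = cbox u v & cbox u v <= Om" for a b
   using sub Int_interval[of p q a b] by blast
  have int: "?f integrable_on cbox a b" for a b
  proof -
   obtain u v where "cbox p q \<inter> cbox a b = cbox u v" "cbox u v <= Om" using cap by blast
   thus ?thesis using absg[of u v] by (simp add: integrable_restrict_Int set_lebesgue_integral_eq_integral(1))
  qed
  have i0: "integral (cbox a b) ?f = 0" for a b
  proof -
   obtain u v where "cbox p q \<inter> cbox a b = cbox u v" "cbox u v <= Om" using cap by blast
   thus ?thesis using box0[of u v] by (simp add: integral_restrict_Int)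
  qed
  obtain N where N: "negligible N"
    "!!x e. [|x ~: N; 0 < e|] ==> EX d>0. ALL h. 0 < h & h < d -->
             norm(integral (cbox x (x + h *R One)) ?f /R h ^ DIM(real^'d) - ?f x) < e"
   using integrable_ccontinuous_explicit[OF int] by blast
  have "?f x = 0" if "x ~: N" for x
  proof (rule ccontr)
   assume "?f x ~= 0"
   hence "norm (?f x) > 0" by simp
   from N(2)[OF \<open>x ~: N\<close> this] obtain d where d: "d > 0"
    "ALL h. 0 < h & h < d --> norm(integral (cbox x (x + h *R One)) ?f /R h ^ DIM(real^'d) - ?f x) < norm (?f x)" by blast
   have "0 < d / 2 & d / 2 < d" using d(1) by simp
   with d(2) have "norm(integral (cbox x (x + (d/2) *R One)) ?f /R (d/2) ^ DIM(real^'d) - ?f x) < norm (?f x)" by blast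
   thus False unfolding i0 by simp
  qed
  moreover have "AE x in lebesgue. x ~: N"
   using N(1) by (simp add: negligible_iff_null_sets AE_not_in)
  ultimately show ?thesis by (elim eventually_mono) meson
 qed
 obtain \<D> where D: "countable \<D>" "\<D> <= Pow Om" "!!X. X : \<D> ==> EX a b. X = cbox a b" "\<Union> \<D> = Om"
  using open_countable_Union_open_cbox[OF Om] by blast
 have "AE x in lebesgue. ALL X:\<D>. x : X --> g x = 0"
  unfolding AE_ball_countable[OF D(1)]
 proof
  fix X assume "X : \<D>"
  then obtain a b where "X = cbox a b" "cbox a b <= Om" using D(2,3) by blast
  thus "AE x in lebesgue. x : X --> g x = 0" using zero_on_box by simp
 qed
 thus ?thesis by eventually_elim (use D(4) in blast)
qed

lemma weak_grad_unique:
 fixes w :: "real^'d => real"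
 assumes \<phi>: "cutoff \<phi>" and Om: "open Om" and w: "weak_grad Om w G" "weak_grad Om w G'"
 shows "AE x\<in>Om in lebesgue. G x = G' x"
proof -
 note so = open_in_sets_lebesgue[OF Om]
 have d: "weak_grad Om (%x. 1 * w x + (-1) * w x) (%x. 1 *R G x + (-1) *R G' x)"
  by (rule weak_grad_lincomb[OF Om w])
 have li: "locally_integrable Om (%x. 1 *R G x + (-1) *R G' x)" using d unfolding weak_grad_def by blast
 have "AE x\<in>Om in lebesgue. (1 *R G x + (-1) *R G' x) $ j = 0" for j
 proof (rule fundamental_lemma_calculus_of_variations[OF \<phi> Om])
  show "locally_integrable Om (%x. (1 *R G x + (-1) *R G' x) $ j)"
   unfolding locally_integrable_def set_integrable_def
  proof (intro allI impI)
   fix K :: "(real^'d) set" assume "compact K & K <= Om"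
   hence "integrable lebesgue (%x. indicator K x *R (1 *R G x + (-1) *R G' x))"
    using li unfolding locally_integrable_def set_integrable_def by blast
   from integrable_bounded_linear[OF bounded_linear_vec_nth this, of j]
   show "integrable lebesgue (%x. indicator K x *R (1 *R G x + (-1) *R G' x) $ j)" by simp
  qed
  fix tt :: "real^'d => real" assume t: "test_function Om tt"
  note tf = test_function_facts[OF t]
  obtain K where K: "compact K" "K <= Om" "!!x. x ~: K ==> tt x = 0 & grad tt x = 0" using tf(7) by blast
  have i: "integrable (leb Om) (%x. tt x *R (1 *R G x + (-1) *R G' x))"
   by (rule locally_integrable_times_test[OF Om li K(1,2) _ tf(3)]) (use K(3) in blast)
  have "integral\<^sup>L (leb Om) (%x. tt x *R (1 *R G x + (-1) *R G' x)) = 0"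
   using d t unfolding weak_grad_def set_lebesgue_on(2)[OF so] by simp
  hence "integral\<^sup>L (leb Om) (%x. (tt x *R (1 *R G x + (-1) *R G' x)) $ j) = 0"
   using integral_bounded_linear[OF bounded_linear_vec_nth i, of j] by simp
  thus "(LINT x:Om|lebesgue. tt x * (1 *R G x + (-1) *R G' x) $ j) = 0"
   unfolding set_lebesgue_on(2)[OF so] by simp
 qed
 hence "AE x in lebesgue. ALL j:UNIV. x : Om --> (1 *R G x + (-1) *R G' x) $ j = 0"
  by (subst AE_ball_countable) (auto intro: countable_finite)
 thus ?thesis by eventually_elim (simp add: vec_eq_iff)
qed

lemma wgrad_works: "weak_grad Om w G ==> weak_grad Om w (wgrad Om w)"
 unfolding wgrad_def by (rule someI[of "weak_grad Om w"])

lemma wgrad_eq_AE: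
 fixes w :: "real^'d => real"
 assumes "cutoff \<phi>" "open Om" "weak_grad Om w G"
 shows "AE x\<in>Om in lebesgue. wgrad Om w x = G x"
 by (rule weak_grad_unique[OF assms(1,2) wgrad_works[OF assms(3)] assms(3)])

section \<open>Mollification of Lipschitz functions\<close>

definition mollifiers :: "(nat => real^'d => real) => bool" where
 "mollifiers \<rho> \<longleftrightarrow> (ALL n. (ALL k. C_on k UNIV (\<rho> n)) & (ALL z. 0 <= \<rho> n z) & (ALL z. \<rho> n (- z) = \<rho> n z) &
   (ALL z. norm z > real CARD('d) / real (Suc n) --> \<rho> n z = 0) & integral\<^sup>L lborel (\<rho> n) = 1)"

lemma mollifiers_exist:
 assumes "cutoff \<phi>"
 shows "EX \<rho> :: nat => real^'d => real. mollifiers \<rho>"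
proof -
 have C\<phi>: "C_on k UNIV \<phi>" for k using assms by (simp add: cutoff_def smooth_on_def)
 have nn: "\<phi> z >= 0" and even: "\<phi> (- z) = \<phi> z" and zero: "\<bar>z\<bar> >= 1 ==> \<phi> z = 0"
  and low: "\<bar>z\<bar> <= 1/2 ==> 1 - 4 * z^2 <= \<phi> z" for z
  using assms by (simp_all add: cutoff_def)
 define b where "b n z = (\<Prod>i\<in>UNIV. \<phi> (real (Suc n) * z $ i))" for n and z :: "real^'d"
 have Cb: "C_on k UNIV (b n)" for k n
 proof -
  have "C_on k UNIV (%z::real^'d. \<Prod>i\<in>UNIV. \<phi> ((real (Suc n) *R axis i 1) <.> z + 0))"
   by (intro C_on_prod C_on_affine_compose C\<phi>) auto
  thus ?thesis unfolding b_def by (simp add: inner_axis' algebra_simps)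
 qed
 have bnn: "0 <= b n z" for n z unfolding b_def by (intro prod_nonneg) (simp add: nn)
 have bev: "b n (- z) = b n z" for n z unfolding b_def using even[of "real (Suc n) * z $ i" for i] by simp
 have bz: "b n z = 0" if "norm z > real CARD('d) / real (Suc n)" for n z
 proof -
  have "EX i. \<bar>z $ i\<bar> >= 1 / real (Suc n)"
  proof (rule ccontr)
   assume "\<not> ?thesis"
   hence "(\<Sum>i\<in>UNIV. \<bar>z $ i\<bar>) <= (\<Sum>i\<in>(UNIV::'d set). 1 / real (Suc n))"
    by (intro sum_mono) (meson linear)
   thus False using norm_le_l1_cart[of z] that by simp
  qed
  then obtain i where "\<bar>z $ i\<bar> >= 1 / real (Suc n)" by blast
  hence "\<bar>real (Suc n) * z $ i\<bar> >= 1" by (simp add: abs_mult field_simps)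
  thus ?thesis unfolding b_def using zero by (intro prod_zero) auto
 qed
 have bc: "continuous_on UNIV (b n)" for n using Cb[of 0] by simp
 have bi: "integrable lborel (b n)" for n
  by (rule continuous_compact_support_integrable[OF bc bz])
 have I: "integral\<^sup>L lborel (b n) > 0" for n
 proof -
  define r where "r = 1 / (4 * real (Suc n))"
  have r: "r > 0" by (simp add: r_def)
  have le: "(3/4) ^ CARD('d) * indicator (cball 0 r) z <= b n z" for z
  proof (cases "z : cball 0 r")
   case True
   have "3/4 <= \<phi> (real (Suc n) * z $ i)" for i
   proof -
    have "\<bar>z $ i\<bar> <= r" using component_le_norm_cart[of z i] True by simp
    hence "real (Suc n) * \<bar>z $ i\<bar> <= real (Suc n) * r" by (intro mult_left_mono) auto
    hence q: "\<bar>real (Suc n) * z $ i\<bar> <= 1/4" by (simp add: r_def abs_mult field_simps del: of_nat_Suc)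
    hence "(real (Suc n) * z $ i)^2 <= (1/4)^2" using abs_le_square_iff[of "real (Suc n) * z $ i" "1/4"] by simp
    hence "1 - 4 * (real (Suc n) * z $ i)^2 >= 3/4" by (simp add: power2_eq_square)
    thus ?thesis using low[of "real (Suc n) * z $ i"] q by linarith
   qed
   hence "(\<Prod>i\<in>(UNIV::'d set). 3/4) <= b n z" unfolding b_def by (intro prod_mono) auto
   thus ?thesis using True by simp
  qed (simp add: bnn)
  have fin: "emeasure lborel (cball (0::real^'d) r) < \<infinity>" by (rule emeasure_lborel_cball_finite)
  have "0 < (3/4) ^ CARD('d) * measure lborel (cball (0::real^'d) r)"
   using content_cball_pos[OF r, of "0::real^'d"] by simp
  also have "... = (\<integral>z. (3/4) ^ CARD('d) * indicator (cball (0::real^'d) r) z \<partial>lborel)" by simp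
  also have "... <= integral\<^sup>L lborel (b n)"
   using fin by (intro integral_mono bi le integrable_mult_right integrable_real_indicator) auto
  finally show ?thesis .
 qed
 have "mollifiers (%n z. (1 / integral\<^sup>L lborel (b n)) * b n z)"
  unfolding mollifiers_def
 proof (intro allI conjI impI)
  fix n
  show "C_on k UNIV (%z. (1 / integral\<^sup>L lborel (b n)) * b n z)" for k by (intro C_on_mult C_on_const Cb) auto
  show "(\<integral>z. (1 / integral\<^sup>L lborel (b n)) * b n z \<partial>lborel) = 1" using I[of n] by simp
  show "0 <= (1 / integral\<^sup>L lborel (b n)) * b n z" for z using I[of n] bnn by simp
 qed (simp_all add: bev bz)
 thus ?thesis by blast
qed

context
 fixes \<rho> :: "nat => real^'d => real"
 assumes \<rho>: "mollifiers \<rho>"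
begin

lemma mollifier_facts:
 "C_on k UNIV (\<rho> n)" "0 <= \<rho> n z" "\<rho> n (- z) = \<rho> n z" "norm z > real CARD('d) / real (Suc n) ==> \<rho> n z = 0"
 "continuous_on UNIV (\<rho> n)" "integrable lborel (\<rho> n)"
proof -
 show "C_on k UNIV (\<rho> n)" "0 <= \<rho> n z" "\<rho> n (- z) = \<rho> n z" "norm z > real CARD('d) / real (Suc n) ==> \<rho> n z = 0" for k z
  using \<rho> unfolding mollifiers_def by blast+
 have "C_on 0 UNIV (\<rho> n)" using \<rho> unfolding mollifiers_def by blast
 thus c: "continuous_on UNIV (\<rho> n)" by simp
 show "integrable lborel (\<rho> n)"
  by (rule continuous_compact_support_integrable[OF c]) (use \<rho> in \<open>unfold mollifiers_def, blast\<close>)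
qed

lemma mollifier_translate:
 "integrable lebesgue (%y. \<rho> n (x - y))" "integral\<^sup>L lebesgue (%y. \<rho> n (x - y)) = 1"
proof -
 have b: "\<rho> n : borel_measurable borel" by (intro borel_measurable_continuous_onI mollifier_facts)
 have e: "(%y. \<rho> n (x - y)) = (%y. \<rho> n (- x + y))"
  using mollifier_facts(3)[of n "- x + y" for y] by (simp add: fun_eq_iff)
 have i: "integrable lborel (%y. \<rho> n (- x + y))"
  using mollifier_facts(6)[of n] b integrable_distr_eq[of "(+) (- x)" lborel borel "\<rho> n"] by (simp add: lborel_distr_plus)
 have "integral\<^sup>L lborel (%y. \<rho> n (- x + y)) = integral\<^sup>L lborel (\<rho> n)"
  using b integral_distr[of "(+) (- x)" lborel borel "\<rho> n"] by (simp add: lborel_distr_plus)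
 also have "... = 1" using \<rho> unfolding mollifiers_def by blast
 finally have v: "integral\<^sup>L lborel (%y. \<rho> n (- x + y)) = 1" .
 have m: "(%y. \<rho> n (- x + y)) : borel_measurable lborel" using i by (rule borel_measurable_integrable)
 show "integrable lebesgue (%y. \<rho> n (x - y))" "integral\<^sup>L lebesgue (%y. \<rho> n (x - y)) = 1"
  unfolding e using i v m by (simp_all add: integrable_completion integral_completion)
qed

lemma mollified_integrable:
 fixes f :: "real^'d => 'b::euclidean_space"
 assumes "integrable lebesgue f"
 shows "integrable lebesgue (%y. \<rho> n (x - y) *R f y)"
proof -
 have "bounded (\<rho> n ` cball 0 (real CARD('d) / real (Suc n)))"
  by (intro compact_imp_bounded compact_continuous_image continuous_on_subset[OF mollifier_facts(5)]) auto
 then obtain B where "ALL z:cball 0 (real CARD('d) / real (Suc n)). \<bar>\<rho> n z\<bar> <= B"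
  by (auto simp: bounded_iff simp del: of_nat_Suc)
 hence B: "\<bar>\<rho> n z\<bar> <= B" if "norm z <= real CARD('d) / real (Suc n)" for z using that by simp
 have "\<bar>\<rho> n z\<bar> <= \<bar>B\<bar>" for z
  using B[of z] mollifier_facts(4)[of n z] by (cases "norm z <= real CARD('d) / real (Suc n)") auto
 moreover have "(%y. \<rho> n (x - y)) : borel_measurable lebesgue"
  using mollifier_translate(1) by (rule borel_measurable_integrable)
 ultimately show ?thesis by (intro integrable_bounded_mult(1)[OF assms, of _ "\<bar>B\<bar>"]) auto
qed

lemma mollified_norm_le:
 fixes f :: "real^'d => 'b::euclidean_space"
 assumes f: "integrable lebesgue f" and e: "AE y in lebesgue. \<rho> n (x - y) ~= 0 --> norm (f y - c) <= e"
 shows "norm (integral\<^sup>L lebesgue (%y. \<rho> n (x - y) *R f y) - c) <= e"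
proof -
 have i2: "integrable lebesgue (%y. \<rho> n (x - y) *R c)" using mollifier_translate(1) by (rule integrable_scaleR_left)
 have eq: "integral\<^sup>L lebesgue (%y. \<rho> n (x - y) *R f y) - c = integral\<^sup>L lebesgue (%y. \<rho> n (x - y) *R (f y - c))"
  using mollified_integrable[OF f] i2 mollifier_translate[of n x]
  by (simp add: scaleR_diff_right)
 have i3: "integrable lebesgue (%y. \<rho> n (x - y) *R (f y - c))"
  using mollified_integrable[OF f] i2 by (simp add: scaleR_diff_right)
 have "norm (integral\<^sup>L lebesgue (%y. \<rho> n (x - y) *R (f y - c))) <= (LINT y|lebesgue. norm (\<rho> n (x - y) *R (f y - c)))"
  by (rule integral_norm_bound)
 also have "... <= (LINT y|lebesgue. \<rho> n (x - y) * e)"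
 proof (rule integral_mono_AE)
  show "integrable lebesgue (%y. norm (\<rho> n (x - y) *R (f y - c)))" using i3 by (rule integrable_norm)
  show "integrable lebesgue (%y. \<rho> n (x - y) * e)" using mollifier_translate(1) by simp
  show "AE y in lebesgue. norm (\<rho> n (x - y) *R (f y - c)) <= \<rho> n (x - y) * e"
   using e
  proof eventually_elim
   case (elim y)
   thus ?case using mollifier_facts(2)[of n "x - y"] by (cases "\<rho> n (x - y) = 0") (auto intro: mult_left_mono)
  qed
 qed
 also have "... = e" using mollifier_translate[of n x] by simp
 finally show ?thesis unfolding eq .
qed

lemma mollified_tendsto:
 fixes f :: "real^'d => 'b::euclidean_space"
 assumes f: "integrable lebesgue f" and c: "isCont f x"
 shows "(%n. integral\<^sup>L lebesgue (%y. \<rho> n (x - y) *R f y)) \<longlonglongrightarrow> f x"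
proof (rule LIMSEQ_I)
 fix r :: real assume "r > 0"
 hence "r/2 > 0" by simp
 then obtain d where d: "d > 0" "!!y. norm (y - x) < d ==> norm (f y - f x) < r/2"
  using c unfolding continuous_at_eps_delta dist_norm by blast
 obtain N where N: "real CARD('d) / d < real N" using reals_Archimedean2 by blast
 have "norm (integral\<^sup>L lebesgue (%y. \<rho> n (x - y) *R f y) - f x) < r" if "n >= N" for n
 proof -
  have "real CARD('d) / d < real (Suc n)" using N that by linarith
  hence n: "real CARD('d) / real (Suc n) < d" using d(1) by (simp add: field_simps)
  have "norm (integral\<^sup>L lebesgue (%y. \<rho> n (x - y) *R f y) - f x) <= r/2"
  proof (rule mollified_norm_le[OF f], rule AE_I2, rule impI)
   fix y assume "\<rho> n (x - y) ~= 0"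
   hence "norm (x - y) < d" using mollifier_facts(4)[of n "x - y"] n by linarith
   thus "norm (f y - f x) <= r/2" using d(2)[of y] by (simp add: norm_minus_commute)
  qed
  thus ?thesis using \<open>r > 0\<close> by simp
 qed
 thus "EX no. ALL n>=no. norm (integral\<^sup>L lebesgue (%y. \<rho> n (x - y) *R f y) - f x) < r" by blast
qed

end

lemma lipschitz_derivative_norm_le:
 fixes h :: "'a::euclidean_space => real"
 assumes d: "(h has_derivative (%e. G <.> e)) (at x)" and L: "L-lipschitz_on (ball x r) h" and r: "r > 0"
 shows "norm G <= L"
proof (cases "G = 0")
 case True thus ?thesis using lipschitz_on_nonneg[OF L] by simp
next
 case False
 have "(%n. real (Suc n) * (h (x + G /R real (Suc n)) - h x)) \<longlonglongrightarrow> G <.> G"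
  by (rule has_derivative_difference_quotient_LIMSEQ[OF d])
 moreover have "eventually (%n. real (Suc n) * (h (x + G /R real (Suc n)) - h x) <= L * norm G) sequentially"
 proof -
  obtain N where N: "norm G / r < real N" using reals_Archimedean2 by blast
  have "real (Suc n) * (h (x + G /R real (Suc n)) - h x) <= L * norm G" if "n >= N" for n
  proof -
   have "norm G / r < real (Suc n)" using N that by linarith
   hence "norm (G /R real (Suc n)) < r" using r by (simp add: field_simps)
   hence "x + G /R real (Suc n) : ball x r" by (simp add: dist_norm del: of_nat_Suc)
   hence "dist (h (x + G /R real (Suc n))) (h x) <= L * norm (G /R real (Suc n))"
    using lipschitz_onD[OF L, of "x + G /R real (Suc n)" x] r by (simp add: dist_norm del: of_nat_Suc)
   also have "... = L * norm G / real (Suc n)" by (simp add: divide_inverse mult_ac del: of_nat_Suc)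
   finally have "h (x + G /R real (Suc n)) - h x <= L * norm G / real (Suc n)" by (simp add: dist_real_def)
   hence "real (Suc n) * (h (x + G /R real (Suc n)) - h x) <= real (Suc n) * (L * norm G / real (Suc n))"
    by (rule mult_left_mono) simp
   thus ?thesis by simp
  qed
  thus ?thesis unfolding eventually_sequentially by blast
 qed
 ultimately have "G <.> G <= L * norm G" by (intro tendsto_upperbound) auto
 hence "norm G * norm G <= L * norm G" by (simp add: dot_square_norm power2_eq_square)
 thus ?thesis using False by simp
qed

lemma locally_lipschitz_reflect_translate:
 fixes f :: "'a::real_normed_vector => real"
 assumes "locally_lipschitz_on UNIV f"
 shows "locally_lipschitz_on UNIV (%y. f (x - y))"
 unfolding locally_lipschitz_on_def
proof
 fix y
 obtain r L where r: "r > 0" "L-lipschitz_on (ball (x - y) r) f"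
  using assms unfolding locally_lipschitz_on_def by blast
 have "L-lipschitz_on (ball y r) (%y. f (x - y))"
 proof (rule lipschitz_onI)
  fix a b assume "a : ball y r" "b : ball y r"
  hence "x - a : ball (x - y) r" "x - b : ball (x - y) r" by (auto simp: dist_norm norm_minus_commute)
  from lipschitz_onD[OF r(2) this] show "dist (f (x - a)) (f (x - b)) <= L * dist a b"
   by (simp add: dist_norm norm_minus_commute)
 qed (use r lipschitz_on_nonneg in blast)
 thus "EX r>0. EX L. L-lipschitz_on (ball y r) (%y. f (x - y))" using r(1) by blast
qed

lemma integrable_AE_bound:
 fixes f :: "'a => 'b::{banach,second_countable_topology}" and g :: "'a => real"
 assumes "f : borel_measurable M" "integrable M g" "AE x in M. norm (f x) <= g x"
 shows "integrable M f"
proof (rule Bochner_Integration.integrable_bound[OF assms(2,1)])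
 show "AE x in M. norm (f x) <= norm (g x)" using assms(3) by eventually_elim simp
qed

text \<open>Mollification commutes with the gradient, and mollified functions converge at every point of
  continuity; so a gradient that is continuous almost everywhere is enough for convergence.\<close>

lemma lipschitz_approx_by_test_functions:
 fixes h :: "real^'d => real"
 assumes \<phi>: "cutoff \<phi>" and Om: "open Om" and ll: "locally_lipschitz_on UNIV h"
  and K: "compact K" "K <= Om" "!!x. x ~: K ==> h x = 0"
  and d: "AE x in lebesgue. (h has_derivative (%e. G x <.> e)) (at x) & isCont G x" and e: "e > 0"
 shows "EX tt. test_function Om tt & integrable lebesgue (%x. (h x - tt x)^2) & integrable lebesgue (%x. (norm (G x - grad tt x))^2) &
   (LINT x|lebesgue. (h x - tt x)^2) < e & (LINT x|lebesgue. (norm (G x - grad tt x))^2) < e"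
proof -
 obtain \<rho> :: "nat => real^'d => real" where \<rho>: "mollifiers \<rho>" using mollifiers_exist[OF \<phi>] by blast
 note mf = mollifier_facts[OF \<rho>]
 obtain R where R: "R > 0" "!!x. x : K ==> norm x <= R"
  using compact_imp_bounded[OF K(1)] bounded_pos by metis
 have hz: "h x = 0" if "norm x > R" for x using K(3)[of x] R(2)[of x] that by fastforce
 obtain a :: "real^'d" where a: "cball 0 R <= cbox (- a) a" using bounded_subset_cbox_symmetric[OF bounded_cball] by blast
 have cont: "continuous_on UNIV h" using locally_lipschitz_on_imp_continuous[OF ll] .
 have hi: "integrable lebesgue h"
  using continuous_compact_support_integrable[OF cont hz] by (simp add: integrable_completion borel_measurable_integrable)
 have d1: "AE x in lebesgue. x : UNIV --> (h has_derivative (%e. G x <.> e)) (at x)"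
  using d by eventually_elim simp
 have Gi: "integrable lebesgue G"
  using compactly_supported_lipschitz_gradient(1)[OF ll hz _ d1] by simp
 obtain L where L: "L-lipschitz_on (cball 0 (R+2)) h"
  using locally_lipschitz_on_imp_lipschitz_on_compact[OF ll compact_cball] by blast
 have L0: "L >= 0" using lipschitz_on_nonneg[OF L] .
 have Gb: "AE y in lebesgue. norm (G y) <= L & (norm y > R --> G y = 0)"
  using d
 proof eventually_elim
  case (elim y)
  have out: "norm (G y) <= 0" if "norm y > R"
  proof -
   have z: "h x = 0" if "x : ball y (norm y - R)" for x
   proof -
    have "norm y <= norm x + norm (y - x)" by (metis add.commute diff_add_cancel norm_triangle_ineq)
    thus ?thesis using that hz[of x] by (simp add: dist_norm)
   qed
   have "0-lipschitz_on (ball y (norm y - R)) h"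
    by (rule lipschitz_onI) (simp_all add: z)
   thus ?thesis using lipschitz_derivative_norm_le[of h "G y" y 0 "norm y - R"] elim that by simp
  qed
  have "norm (G y) <= L" if "norm y <= R"
  proof (rule lipschitz_derivative_norm_le[of h "G y" y L 1])
   have "ball y 1 <= cball 0 (R+2)"
   proof
    fix x assume "x : ball y 1"
    moreover have "norm x <= norm y + norm (y - x)" by (metis norm_minus_commute norm_triangle_sub)
    ultimately show "x : cball 0 (R+2)" using that by (simp add: dist_norm)
   qed
   thus "L-lipschitz_on (ball y 1) h" by (rule lipschitz_on_subset[OF L])
  qed (use elim in auto)
  thus ?case using out L0 by (cases "norm y <= R") auto
 qed
 define tt where "tt n x = integral (cbox (- a) a) (%y. h y * \<rho> n (x - y))" for n x
 have conv: "integral (cbox (- a) a) (%y. h y * q y) = (LINT y|lebesgue. q y * h y)" if q: "continuous_on UNIV q" for q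
 proof -
  have "(%y. h y * q y) absolutely_integrable_on cbox (- a) a"
   by (intro absolutely_integrable_continuous continuous_intros continuous_on_subset[OF cont] continuous_on_subset[OF q]) auto
  from set_lebesgue_integral_eq_integral(2)[OF this]
  have "integral (cbox (- a) a) (%y. h y * q y) = (LINT y:cbox (- a) a|lebesgue. h y * q y)" by simp
  also have "... = (LINT y|lebesgue. q y * h y)"
   unfolding set_lebesgue_integral_def
  proof (rule Bochner_Integration.integral_cong[OF refl])
   fix y
   have "y : cbox (- a) a | h y = 0" using a hz[of y] by (cases "norm y <= R") auto
   thus "indicator (cbox (- a) a) y *R (h y * q y) = q y * h y" by auto
  qed
  finally show ?thesis .
 qed
 have tteq: "tt n x = (LINT y|lebesgue. \<rho> n (x - y) *R h y)" for n x
  unfolding tt_def real_scaleR_def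
  by (rule conv) (intro continuous_intros continuous_on_compose2[OF mf(5)], auto)
 define \<Gamma> where "\<Gamma> n x = (LINT y|lebesgue. \<rho> n (x - y) *R G y)" for n x
 have d\<rho>: "(\<rho> n has_derivative (%e. grad (\<rho> n) z <.> e)) (at z)" for n z
  using mf(1)[of "Suc 0" n] by (intro has_derivative_grad) simp
 have cg: "continuous_on UNIV (grad (\<rho> n))" for n by (rule C1_continuous_grad[OF mf(1)])
 have der: "(tt n has_derivative (%e. \<Gamma> n x <.> e)) (at x)" for n x
 proof -
  let ?H = "%y. \<rho> n (x - y) *R G y - h y *R grad (\<rho> n) (x - y)"
  have "integral\<^sup>L lebesgue ?H = 0"
  proof (rule compactly_supported_lipschitz_gradient(2))
   show "locally_lipschitz_on UNIV (%y. h y * \<rho> n (x - y))"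
    by (intro locally_lipschitz_on_mult ll locally_lipschitz_reflect_translate C1_imp_locally_lipschitz mf(1)) simp
   show "h y * \<rho> n (x - y) = 0" if "norm y > R" for y using hz that by simp
   show "AE y in lebesgue. y : UNIV --> ((%y. h y * \<rho> n (x - y)) has_derivative (%e. ?H y <.> e)) (at y)"
    using d
   proof eventually_elim
    case (elim y)
    have "((%y. x - y) has_derivative (%e. - e)) (at y)" by (auto intro!: derivative_eq_intros)
    from has_derivative_compose[OF this d\<rho>]
    have "((%y. \<rho> n (x - y)) has_derivative (%e. grad (\<rho> n) (x - y) <.> (- e))) (at y)" .
    from has_derivative_mult[OF conjunct1[OF elim] this]
    show ?case by (simp add: inner_diff_left algebra_simps)
   qed
  qed simp_all
  moreover have i1: "integrable lebesgue (%y. h y *R grad (\<rho> n) (x - y))"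
  proof -
   have "integrable lborel (%y. h y *R grad (\<rho> n) (x - y))"
    by (rule continuous_compact_support_integrable[where R=R])
      (auto simp: hz intro!: continuous_intros cont continuous_on_compose2[OF cg])
   thus ?thesis by (simp add: integrable_completion borel_measurable_integrable)
  qed
  ultimately have eq: "\<Gamma> n x = (LINT y|lebesgue. h y *R grad (\<rho> n) (x - y))"
   using mollified_integrable[OF \<rho> Gi, of n x] by (simp add: \<Gamma>_def)
  have fr: "frechet_derivative (\<rho> n) (at z) = (%e. grad (\<rho> n) z <.> e)" for z
   by (rule frechet_derivative_eqI[OF d\<rho>])
  have "(tt n has_derivative (%e. integral (cbox (- a) a) (%y. h y * (grad (\<rho> n) (x - y) <.> e)))) (at x)"
   using has_derivative_convolution[OF continuous_on_subset[OF cont] mf(1), of "-a" a n x] unfolding fr tt_def by simp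
  moreover have "integral (cbox (- a) a) (%y. h y * (grad (\<rho> n) (x - y) <.> e)) = \<Gamma> n x <.> e" for e
  proof -
   have "integral (cbox (- a) a) (%y. h y * (grad (\<rho> n) (x - y) <.> e)) = (LINT y|lebesgue. (grad (\<rho> n) (x - y) <.> e) * h y)"
    by (rule conv) (intro continuous_intros continuous_on_compose2[OF cg], auto)
   also have "... = (LINT y|lebesgue. (h y *R grad (\<rho> n) (x - y)) <.> e)" by (simp add: mult.commute)
   also have "... = \<Gamma> n x <.> e" unfolding eq by (rule integral_inner_left) (use i1 in blast)
   finally show ?thesis .
  qed
  ultimately show ?thesis by simp
 qed
 have gtt: "grad (tt n) x = \<Gamma> n x" for n x by (rule grad_eqI[OF der])
 obtain r where r: "r > 0" "!!x. K ~= {} ==> infdist x K <= r ==> x : Om"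
 proof (cases "K = {}")
  case False thus ?thesis using compact_nonempty_subset_open_collar[OF K(1) Om K(2)] that by blast
 qed (use that[of 1] in simp)
 define D where "D = real CARD('d)"
 have Dn: "D / real (Suc n) <= D" for n unfolding D_def by (simp add: field_simps)
 have ttsup: "EX y:K. norm (x - y) <= D / real (Suc n)" if "tt n x ~= 0" for n x
 proof (rule ccontr)
  assume "\<not> ?thesis"
  hence "h y = 0 | \<rho> n (x - y) = 0" for y using K(3)[of y] mf(4)[of n "x - y"] unfolding D_def by (meson not_less)
  hence "(%y. \<rho> n (x - y) *R h y) = (%y. 0)" by (metis mult_zero_left mult_zero_right real_scaleR_def)
  thus False using that unfolding tteq by simp
 qed
 have test: "test_function Om (tt n)" if "D / real (Suc n) <= r" for n
 proof -
  have ne: "closure {x. tt n x ~= 0} = {} | K ~= {}" using ttsup by fastforce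
  have sub: "closure {x. tt n x ~= 0} <= {x. infdist x K <= r}"
  proof (rule closure_minimal)
   show "{x. tt n x ~= 0} <= {x. infdist x K <= r}"
   proof
    fix x assume "x : {x. tt n x ~= 0}"
    then obtain y where "y : K" "norm (x - y) <= D / real (Suc n)" using ttsup by blast
    thus "x : {x. infdist x K <= r}" using infdist_le[of y K x] \<open>D / real (Suc n) <= r\<close> by (simp add: dist_norm)
   qed
   show "closed {x. infdist x K <= r}" by (intro closed_Collect_le continuous_intros)
  qed
  have bd: "bounded (closure {x. tt n x ~= 0})"
  proof (rule bounded_subset[of "cball 0 (R + D)"])
   show "closure {x. tt n x ~= 0} <= cball 0 (R + D)"
   proof (rule closure_minimal)
    show "{x. tt n x ~= 0} <= cball 0 (R + D)"
    proof
     fix x assume "x : {x. tt n x ~= 0}"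
     then obtain y where "y : K" "norm (x - y) <= D / real (Suc n)" using ttsup by blast
     thus "x : cball 0 (R + D)" using R(2)[of y] Dn[of n] norm_triangle_sub[of x y] by simp
    qed
   qed simp
  qed simp
  have "C_on k UNIV (tt n)" for k
   unfolding tt_def by (intro C_on_convolution continuous_on_subset[OF cont] mf(1)) simp
  thus ?thesis unfolding test_function_def smooth_on_def
   using ne sub r(2) bd by (auto simp: compact_eq_bounded_closed)
 qed
 obtain M where M: "!!x. \<bar>h x\<bar> <= M" "M >= 0"
 proof -
  have "bounded (h ` cball 0 R)" by (intro compact_imp_bounded compact_continuous_image continuous_on_subset[OF cont]) auto
  then obtain M where M: "!!x. x : cball 0 R ==> \<bar>h x\<bar> <= M" unfolding bounded_iff by (metis imageI real_norm_def)
  have "\<bar>h x\<bar> <= \<bar>M\<bar>" for x using M[of x] hz[of x] by (cases "norm x <= R") auto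
  thus ?thesis using that[of "\<bar>M\<bar>"] by simp
 qed
 let ?B = "cball (0::real^'d) (R + D)"
 have iB: "integrable lebesgue (%x. c * indicator ?B x :: real)" for c
  using emeasure_bounded_finite[OF bounded_cball, of "0::real^'d" "R+D"]
  by (intro integrable_mult_right integrable_real_indicator) (auto simp: emeasure_completion)
 have far: "\<rho> n (x - y) = 0 | norm y > R" if "norm x > R + D" for n x y
 proof -
  have "norm (x - y) > D | norm y > R" using that norm_triangle_sub[of x y] by linarith
  thus ?thesis using mf(4)[of n "x - y"] Dn[of n] unfolding D_def by (meson le_less_trans)
 qed
 have ttb: "(h x - tt n x)^2 <= (2 * M)^2 * indicator ?B x" for n x
 proof (cases "x : ?B")
  case True
  have "\<bar>tt n x\<bar> <= M" using mollified_norm_le[OF \<rho> hi, of n x 0 M] M unfolding tteq by simp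
  hence "\<bar>h x - tt n x\<bar> <= \<bar>2 * M\<bar>" using M(1)[of x] by linarith
  thus ?thesis using True abs_le_square_iff[of "h x - tt n x" "2 * M"] by simp
 next
  case False
  hence f: "norm x > R + D" by simp
  have "\<bar>tt n x\<bar> <= 0"
   using mollified_norm_le[OF \<rho> hi, of n x 0 0] far[OF f, of n] hz unfolding tteq by fastforce
  moreover have "h x = 0" using f hz[of x] by (simp add: D_def)
  ultimately show ?thesis using False by simp
 qed
 have \<Gamma>b: "AE x in lebesgue. norm ((norm (G x - \<Gamma> n x))^2) <= (2 * L)^2 * indicator ?B x" for n
  using Gb
 proof eventually_elim
  case (elim x)
  show ?case
  proof (cases "x : ?B")
   case True
   have "AE y in lebesgue. \<rho> n (x - y) ~= 0 --> norm (G y - 0) <= L"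
    using Gb by eventually_elim simp
   from mollified_norm_le[OF \<rho> Gi this] have "norm (\<Gamma> n x) <= L" unfolding \<Gamma>_def by simp
   hence "norm (G x - \<Gamma> n x) <= 2 * L" using elim norm_triangle_ineq4[of "G x" "\<Gamma> n x"] by linarith
   thus ?thesis using True power_mono[of "norm (G x - \<Gamma> n x)" "2 * L" 2] by simp
  next
   case False
   hence f: "norm x > R + D" by simp
   have "AE y in lebesgue. \<rho> n (x - y) ~= 0 --> norm (G y - 0) <= 0"
    using Gb by eventually_elim (use far[OF f, of n] in auto)
   from mollified_norm_le[OF \<rho> Gi this] have "\<Gamma> n x = 0" unfolding \<Gamma>_def by simp
   moreover have "G x = 0" using elim f by (simp add: D_def)
   ultimately show ?thesis using False by simp
  qed
 qed
 have hm: "h : borel_measurable lebesgue" "G : borel_measurable lebesgue" using hi Gi by auto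
 have C1tt: "C_on (Suc 0) UNIV (tt n)" for n
  unfolding tt_def by (intro C_on_convolution continuous_on_subset[OF cont] mf(1)) simp
 have ttm: "tt n : borel_measurable lebesgue" "\<Gamma> n : borel_measurable lebesgue" for n
 proof -
  show "tt n : borel_measurable lebesgue"
   using C_on_SucD[OF C1tt[of n]] by (intro measurable_completion) (simp add: borel_measurable_continuous_onI)
  have "\<Gamma> n = grad (tt n)" using gtt by (simp add: fun_eq_iff)
  thus "\<Gamma> n : borel_measurable lebesgue"
   using C1_continuous_grad[OF C1tt[of n]] by (intro measurable_completion) (simp add: borel_measurable_continuous_onI)
 qed
 have t1: "AE x in lebesgue. (%n. (h x - tt n x)^2) \<longlonglongrightarrow> 0"
 proof (rule AE_I2)
  fix x
  have "isCont h x" using cont by (simp add: continuous_on_eq_continuous_at)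
  hence "(%n. tt n x) \<longlonglongrightarrow> h x" unfolding tteq by (rule mollified_tendsto[OF \<rho> hi])
  hence "(%n. (h x - tt n x)^2) \<longlonglongrightarrow> (h x - h x)^2" by (intro tendsto_intros)
  thus "(%n. (h x - tt n x)^2) \<longlonglongrightarrow> 0" by simp
 qed
 have t2: "AE x in lebesgue. (%n. (norm (G x - \<Gamma> n x))^2) \<longlonglongrightarrow> 0"
  using d
 proof eventually_elim
  case (elim x)
  hence "(%n. \<Gamma> n x) \<longlonglongrightarrow> G x" unfolding \<Gamma>_def by (intro mollified_tendsto[OF \<rho> Gi]) simp
  hence "(%n. (norm (G x - \<Gamma> n x))^2) \<longlonglongrightarrow> (norm (G x - G x))^2" by (intro tendsto_intros)
  thus ?case by simp
 qed
 have m1: "(%x. (h x - tt n x)^2) : borel_measurable lebesgue" "(%x. (norm (G x - \<Gamma> n x))^2) : borel_measurable lebesgue" for n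
  using hm ttm by simp_all
 have b1: "AE x in lebesgue. norm ((h x - tt n x)^2) <= (2 * M)^2 * indicator ?B x" for n
  using ttb by (intro AE_I2) simp
 have l1: "(%n. \<integral>x. (h x - tt n x)^2 \<partial>lebesgue) \<longlonglongrightarrow> (\<integral>x. (0::real) \<partial>(lebesgue :: (real^'d) measure))"
  by (rule integral_dominated_convergence[OF _ m1(1) iB t1 b1]) simp
 have l2: "(%n. \<integral>x. (norm (G x - \<Gamma> n x))^2 \<partial>lebesgue) \<longlonglongrightarrow> (\<integral>x. (0::real) \<partial>(lebesgue :: (real^'d) measure))"
  by (rule integral_dominated_convergence[OF _ m1(2) iB t2 \<Gamma>b]) simp
 have "(%n. D / real (Suc n)) \<longlonglongrightarrow> D * 0"
  unfolding divide_inverse by (intro tendsto_mult tendsto_const LIMSEQ_inverse_real_of_nat)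
 hence l3: "eventually (%n. D / real (Suc n) < r) sequentially" using r(1) by (intro order_tendstoD) auto
 have "eventually (%n. (LINT x|lebesgue. (h x - tt n x)^2) < e) sequentially" "eventually (%n. (LINT x|lebesgue. (norm (G x - \<Gamma> n x))^2) < e) sequentially"
  using l1 l2 e by (auto intro!: order_tendstoD)
 with l3 have "eventually (%n. D / real (Suc n) < r & (LINT x|lebesgue. (h x - tt n x)^2) < e & (LINT x|lebesgue. (norm (G x - \<Gamma> n x))^2) < e) sequentially"
  by eventually_elim simp
 then obtain n where n: "D / real (Suc n) < r" "(LINT x|lebesgue. (h x - tt n x)^2) < e" "(LINT x|lebesgue. (norm (G x - \<Gamma> n x))^2) < e"
  using eventually_happens'[OF sequentially_bot] by blast
 have "integrable lebesgue (%x. (h x - tt n x)^2)"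
  by (rule integrable_AE_bound[OF m1(1) iB b1])
 moreover have "integrable lebesgue (%x. (norm (G x - \<Gamma> n x))^2)"
  by (rule integrable_AE_bound[OF m1(2) iB \<Gamma>b])
 ultimately show ?thesis using test[of n] n gtt by (intro exI[of _ "tt n"]) simp
qed

section \<open>Level sets are null sets\<close>

lemma C1_derivative_bound_on_compact:
 fixes f :: "'a::euclidean_space => 'b::real_normed_vector"
 assumes "C_on (Suc 0) U f" "compact K" "K <= U"
 shows "EX C>=0. ALL x:K. ALL e. norm (frechet_derivative f (at x) e) <= C * norm e"
proof -
 let ?D = "%x. frechet_derivative f (at x)"
 have "EX B. ALL y:K. norm (?D y b) <= B" if "b : Basis" for b
 proof -
  have "continuous_on K (%y. ?D y b)"
   using assms(1) that by (intro continuous_on_subset[OF _ assms(3)]) auto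
  hence "bounded ((%y. ?D y b) ` K)" by (intro compact_imp_bounded compact_continuous_image assms(2))
  thus ?thesis unfolding bounded_iff by blast
 qed
 then obtain B where B: "!!b y. b : Basis ==> y : K ==> norm (?D y b) <= B b" by metis
 show ?thesis
 proof (intro exI[of _ "\<Sum>b\<in>Basis. \<bar>B b\<bar>"] conjI ballI allI)
  show "0 <= (\<Sum>b\<in>Basis. \<bar>B b\<bar>)" by (intro sum_nonneg) auto
  fix y v assume y: "y : K"
  have lin: "linear (?D y)" using C_on_Suc_has_derivative[OF assms(1)] y assms(3) has_derivative_linear by blast
  have "norm (?D y v) = norm (\<Sum>b\<in>Basis. (v <.> b) *R ?D y b)"
   by (subst euclidean_representation[of v, symmetric], subst linear_sum[OF lin]) (simp add: linear_scale[OF lin])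
  also have "... <= (\<Sum>b\<in>Basis. norm ((v <.> b) *R ?D y b))" by (rule norm_sum)
  also have "... <= (\<Sum>b\<in>Basis. norm v * \<bar>B b\<bar>)"
  proof (rule sum_mono)
   fix b :: 'a assume b: "b : Basis"
   have "norm (?D y b) <= \<bar>B b\<bar>" using B[OF b y] by linarith
   thus "norm ((v <.> b) *R ?D y b) <= norm v * \<bar>B b\<bar>"
    using Basis_le_norm[OF b, of v] by (simp add: mult_mono)
  qed
  finally show "norm (?D y v) <= (\<Sum>b\<in>Basis. \<bar>B b\<bar>) * norm v" by (simp add: sum_distrib_left mult.commute)
 qed
qed

lemma C1_lipschitz_on_segments:
 fixes f :: "'a::euclidean_space => 'b::real_normed_vector"
 assumes "C_on (Suc 0) U f" "compact K" "K <= U"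
 shows "EX C>=0. ALL x z. closed_segment x z <= K --> norm (f x - f z) <= C * norm (x - z)"
proof -
 obtain C where C: "C >= 0" "!!x e. x : K ==> norm (frechet_derivative f (at x) e) <= C * norm e"
  using C1_derivative_bound_on_compact[OF assms] by blast
 have "norm (f x - f z) <= C * norm (x - z)" if s: "closed_segment x z <= K" for x z
 proof (rule differentiable_bound[of "closed_segment x z" f "%x. frechet_derivative f (at x)"])
  fix w assume w: "w : closed_segment x z"
  hence "w : U" using s assms(3) by blast
  thus "(f has_derivative frechet_derivative f (at w)) (at w within closed_segment x z)"
   using C_on_Suc_has_derivative[OF assms(1)] has_derivative_at_withinI by blast
  show "onorm (frechet_derivative f (at w)) <= C"
   using C s w by (intro onorm_bound) auto
 qed auto
 thus ?thesis using C(1) by blast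
qed

lemma has_derivative_difference_quotient_LIMSEQ_vector:
 fixes f :: "'a::euclidean_space => 'b::euclidean_space"
 assumes "(f has_derivative f') (at x)"
 shows "(%n. real (Suc n) *R (f (x + b /R real (Suc n)) - f x)) \<longlonglongrightarrow> f' b"
 unfolding tendsto_componentwise_iff[of _ "f' b"]
proof
 fix c :: 'b assume "c : Basis"
 have "((%x. f x <.> c) has_derivative (%e. f' e <.> c)) (at x)" using assms by (rule has_derivative_inner_left)
 from has_derivative_difference_quotient_LIMSEQ[OF this, of b]
 show "(%n. (real (Suc n) *R (f (x + b /R real (Suc n)) - f x)) <.> c) \<longlonglongrightarrow> f' b <.> c"
  by (simp add: inner_diff_left)
qed

text \<open>A bounded set that is disjoint from all its small translates in one direction is null: finitely
  many disjoint translates of any number fit into a fixed ball.\<close>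

lemma negligible_if_disjoint_translates:
 fixes Z :: "'a::euclidean_space set"
 assumes Z: "Z : sets borel" "bounded Z" and r: "r > 0"
  and dis: "!!z t. z : Z ==> 0 < t ==> t < r ==> z + t *R e ~: Z"
 shows "negligible Z"
proof -
 obtain B where B: "B > 0" "!!z. z : Z ==> norm z <= B" using Z(2) bounded_pos by metis
 let ?C = "cball (0::'a) (B + r * norm e)"
 define T where "T n k = (+) ((r * real k / (real n + 1)) *R e) ` Z" for n k :: nat
 have tr: "emeasure lborel (T n k) = emeasure lborel Z" and Tb: "T n k : sets borel" for n k
 proof -
  let ?c = "(r * real k / (real n + 1)) *R e"
  have eq: "T n k = (%x. - ?c + x) -` Z" unfolding T_def by (auto simp: image_iff algebra_simps intro!: bexI[of _ "x - ?c" for x])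
  have m: "(%x. - ?c + x) : borel_measurable borel" by simp
  thus "T n k : sets borel" unfolding eq using Z(1) measurable_sets_borel by blast
  have "emeasure lborel Z = emeasure (distr lborel borel ((+) (- ?c))) Z" by (simp add: lborel_distr_plus)
  also have "... = emeasure lborel ((+) (- ?c) -` Z)" using Z(1) by (subst emeasure_distr) auto
  finally show "emeasure lborel (T n k) = emeasure lborel Z" unfolding eq by simp
 qed
 have disj: "disjoint_family_on (T n) {..n}" for n
 proof -
  have "False" if kl: "k < l" "l <= n" and x: "x : T n k" "x : T n l" for k l x
  proof -
   obtain z z' where z: "z : Z" "z' : Z" "x = (r * real k / (real n + 1)) *R e + z" "x = (r * real l / (real n + 1)) *R e + z'"
    using x unfolding T_def by auto
   let ?t = "r * real l / (real n + 1) - r * real k / (real n + 1)"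
   have zz: "z = z' + ?t *R e" using z(3,4) by (simp add: scaleR_diff_left algebra_simps)
   have t: "?t = r * (real l - real k) / (real n + 1)" by (simp add: diff_divide_distrib right_diff_distrib)
   have "?t > 0" unfolding t using kl r by simp
   moreover have "?t < r"
   proof -
    have "r * (real l - real k) < r * (real n + 1)" using kl r by (intro mult_strict_left_mono) auto
    thus ?thesis unfolding t by (simp add: divide_less_eq)
   qed
   ultimately show False using dis[OF z(2), of ?t] z(1) zz by simp
  qed
  thus ?thesis unfolding disjoint_family_on_def by (metis atMost_iff disjoint_iff linorder_neqE_nat)
 qed
 have sub: "(\<Union>k\<in>{..n}. T n k) <= ?C" for n
 proof clarify
  fix x k assume k: "k <= n" "x : T n k"
  then obtain z where z: "z : Z" "x = (r * real k / (real n + 1)) *R e + z" unfolding T_def by auto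
  have "r * real k / (real n + 1) <= r" using k r by (simp add: divide_le_eq)
  hence "norm ((r * real k / (real n + 1)) *R e) <= r * norm e" using r mult_right_mono[of "r * real k / (real n + 1)" r "norm e"] by (simp del: times_divide_eq_left)
  thus "x : ?C" using z B(2)[OF z(1)] norm_triangle_ineq[of "(r * real k / (real n + 1)) *R e" z] by simp
 qed
 have "of_nat (Suc n) * emeasure lborel Z <= emeasure lborel ?C" for n
 proof -
  have "of_nat (Suc n) * emeasure lborel Z = (\<Sum>k\<in>{..n}. emeasure lborel (T n k))" by (simp add: tr)
  also have "... = emeasure lborel (\<Union>k\<in>{..n}. T n k)" using Tb disj by (intro sum_emeasure) auto
  also have "... <= emeasure lborel ?C" using sub by (intro emeasure_mono) auto
  finally show ?thesis .
 qed
 hence le: "of_nat n * emeasure lborel Z <= emeasure lborel ?C" for n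
  by (cases n) auto
 have "emeasure lborel Z = 0"
 proof (rule ccontr)
  assume ne: "emeasure lborel Z ~= 0"
  have "emeasure lborel Z < \<infinity>" using emeasure_bounded_finite[OF Z(2)] .
  then obtain c where c: "emeasure lborel Z = ennreal c" "c > 0"
   using ne by (metis ennreal_cases ennreal_0 infinity_ennreal_def less_irrefl less_le zero_le)
  have "emeasure lborel ?C < \<infinity>" by (rule emeasure_lborel_cball_finite)
  then obtain M where M: "emeasure lborel ?C = ennreal M" "M >= 0"
   by (metis ennreal_cases infinity_ennreal_def less_irrefl)
  obtain n where "M / c < real n" using reals_Archimedean2 by blast
  hence "M < real n * c" using c(2) by (simp add: divide_less_eq)
  moreover have "ennreal (real n * c) <= ennreal M"
   using le[of n] c M by (simp add: ennreal_mult' ennreal_of_nat_eq_real_of_nat)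
  ultimately show False using M(2) by (simp add: ennreal_le_iff)
 qed
 hence "Z : null_sets lborel" using Z(1) by auto
 thus ?thesis by (simp add: negligible_iff_null_sets null_sets_completionI)
qed

lemma negligible_if_locally_level_set:
 fixes Z :: "(real^'d) set"
 assumes Z: "closed Z"
  and loc: "!!p. p : Z ==> EX U h. open U & p : U & C_on (Suc 0) U h & grad h p ~= 0 & (ALL x:Z \<inter> U. h x = 0)"
 shows "negligible Z"
 unfolding locally_negligible_alt[of Z]
proof
 fix p assume p: "p : Z"
 then obtain U h where U: "open U" "p : U" "C_on (Suc 0) U h" "grad h p ~= 0" "!!x. x : Z ==> x : U ==> h x = 0"
  using loc[OF p] by (metis IntI)
 let ?g = "grad h p"
 have cg: "continuous_on U (%x. grad h x <.> ?g)" by (intro continuous_intros C1_continuous_grad U(3))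
 hence "open {x : U. grad h x <.> ?g > 0}"
  using continuous_open_preimage[OF cg U(1), of "{0<..}"] by (simp add: vimage_def Int_def)
 moreover have "p : {x : U. grad h x <.> ?g > 0}" using U(2,4) by simp
 ultimately obtain \<rho> where \<rho>: "\<rho> > 0" "ball p \<rho> <= {x : U. grad h x <.> ?g > 0}" using open_contains_ball by blast
 define W where "W = Z \<inter> ball p (\<rho>/2)"
 have ng: "norm ?g > 0" using U(4) by simp
 have "negligible W"
 proof (rule negligible_if_disjoint_translates[where e="?g" and r="\<rho> / 2 / norm ?g"])
  show "W : sets borel" unfolding W_def using Z by (intro sets.Int) auto
  show "bounded W" unfolding W_def by (meson bounded_Int bounded_ball)
  show "\<rho> / 2 / norm ?g > 0" using \<rho>(1) ng by simp
  fix z t assume z: "z : W" "0 < t" "t < \<rho> / 2 / norm ?g"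
  have "t * norm ?g < \<rho>/2" using z(3) ng by (simp add: pos_less_divide_eq)
  hence inb: "z + s *R ?g : ball p \<rho>" if "0 <= s" "s <= t" for s
  proof -
   have "s * norm ?g <= t * norm ?g" using that ng by (intro mult_right_mono) auto
   hence "norm (s *R ?g) < \<rho>/2" using that \<open>t * norm ?g < \<rho>/2\<close> by simp
   moreover have "norm (p - z) < \<rho>/2" using z(1) by (simp add: W_def dist_norm)
   ultimately have "norm ((p - z) - s *R ?g) < \<rho>" using norm_triangle_ineq4[of "p - z" "s *R ?g"] by linarith
   thus ?thesis by (simp add: dist_norm diff_diff_eq)
  qed
  have der: "((%s. h (z + s *R ?g)) has_real_derivative (grad h (z + s *R ?g) <.> ?g)) (at s)" if "0 <= s" "s <= t" for s
  proof -
   have "z + s *R ?g : U" using inb[OF that] \<rho>(2) by blast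
   hence "(h has_derivative (%e. grad h (z + s *R ?g) <.> e)) (at (z + s *R ?g))"
    using U(3) by (intro has_derivative_grad) simp
   moreover have "((%s. z + s *R ?g) has_derivative (%e. e *R ?g)) (at s)" by (auto intro!: derivative_eq_intros)
   ultimately have "((%s. h (z + s *R ?g)) has_derivative (%e. grad h (z + s *R ?g) <.> (e *R ?g))) (at s)"
    using has_derivative_compose by blast
   thus ?thesis by (simp add: has_field_derivative_def mult.commute[of _ "grad h (z + s *R ?g) <.> ?g"])
  qed
  have "h (z + 0 *R ?g) < h (z + t *R ?g)"
   by (rule DERIV_pos_imp_increasing[OF z(2)]) (use der inb \<rho>(2) in blast)
  moreover have "z : U" using z(1) \<rho> by (auto simp: W_def subset_iff)
  ultimately have "h (z + t *R ?g) > 0" using U(5)[of z] z(1) by (simp add: W_def)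
  thus "z + t *R ?g ~: W"
   using U(5)[of "z + t *R ?g"] inb[of t] z(2) \<rho>(2) by (auto simp: W_def subset_iff)
 qed
 moreover have "openin (top_of_set Z) W" unfolding W_def by (simp add: openin_open_Int)
 moreover have "p : W" using p \<rho>(1) by (simp add: W_def)
 ultimately show "EX U. openin (top_of_set Z) U & p : U & negligible U" by blast
qed

section \<open>The distance to a hypersurface\<close>

locale hypersurface_tube =
 fixes S :: "(real^'d) set" and R :: real and P :: "real^'d => real^'d"
 assumes hyp: "closed_hypersurface S" and R: "R > 0"
  and smooth: "smooth_on {x. infdist x S < R} P"
  and near: "infdist x S < R ==> P x : S & dist x (P x) = infdist x S"
begin

definition V :: "(real^'d) set" where "V = {x. infdist x S < R}"

definition Q :: "real^'d => real^'d" where "Q x = x - P x"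

definition N :: "real^'d => real^'d" where "N x = Q x /R infdist x S"

definition DQ :: "real^'d => real^'d => real^'d" where "DQ x = frechet_derivative Q (at x)"

definition K :: "(real^'d) set" where "K = {x. infdist x S <= 3/4 * R}"

lemma S_basic: "compact S" "closed S" "S ~= {}" "x : S ==> infdist x S = 0" "infdist x S = 0 ==> x : S" "infdist x S >= 0"
proof -
 show c: "compact S" and ne: "S ~= {}" using hyp by (simp_all add: closed_hypersurface_def)
 thus cl: "closed S" by (simp add: compact_imp_closed)
 show "x : S ==> infdist x S = 0" by simp
 show "infdist x S = 0 ==> x : S" using in_closed_iff_infdist_zero[OF cl ne] by simp
 show "infdist x S >= 0" by (rule infdist_nonneg)
qed

lemma open_V: "open V" unfolding V_def by (intro open_Collect_less continuous_intros)

lemma S_subset_V: "S <= V" using R by (auto simp: V_def)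

lemma K_subset_V: "K <= V" using R by (auto simp: V_def K_def)

lemma closed_infdist_le: "closed {x. infdist x S <= c}" by (intro closed_Collect_le continuous_intros)

lemma bounded_infdist_le: "bounded {x. infdist x S <= c}"
proof -
 obtain B where B: "!!y. y : S ==> norm y <= B" using S_basic(1) compact_imp_bounded bounded_iff by metis
 have "norm x <= B + c" if "infdist x S <= c" for x
 proof -
  obtain y where y: "y : S" "infdist x S = dist x y"
   using infdist_attains_inf[OF S_basic(2,3)] by blast
  thus ?thesis using B[of y] that norm_triangle_ineq2[of x y] by (simp add: dist_norm)
 qed
 thus ?thesis unfolding bounded_iff by blast
qed

lemma compact_K: "compact K"
 unfolding K_def compact_eq_bounded_closed using closed_infdist_le bounded_infdist_le by blast

lemma P_in: "x : V ==> P x : S" and norm_Q: "x : V ==> norm (Q x) = infdist x S"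
 using near by (auto simp: V_def Q_def dist_norm)

lemma P_fix: "y : S ==> P y = y" and Q_S: "y : S ==> Q y = 0"
 using norm_Q[of y] S_subset_V by (auto simp: Q_def)

lemma C_on_P: "C_on k V P" using smooth by (simp add: smooth_on_def V_def)

lemma C_on_Q: "C_on k V Q"
proof -
 have id: "C_on k V (%x. x)"
 proof (cases k)
  case (Suc m)
  show ?thesis unfolding Suc
   by (rule C_on_SucI[OF open_V, where f'="%x h. h"]) (auto intro: C_on_const[OF open_V])
 qed simp
 have "C_on k V (%x. x + (- P x))"
  by (intro C_on_add open_V id C_on_linear_image[OF _ _ C_on_P]) (simp add: bounded_linear_minus)
 thus ?thesis by (simp add: Q_def[abs_def])
qed

lemma continuous_P: "continuous_on V P" using C_on_P[of 0] by simp

lemma continuous_Q: "continuous_on V Q" using C_on_Q[of 0] by simp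

lemma isCont_Q: "x : V ==> isCont Q x"
 using continuous_Q open_V by (simp add: continuous_on_eq_continuous_at)

lemma DQ: "x : V ==> (Q has_derivative DQ x) (at x)"
 unfolding DQ_def by (rule C_on_Suc_has_derivative[OF C_on_Q])

lemma linear_DQ: "x : V ==> linear (DQ x)" using DQ has_derivative_linear by blast

lemma DP: "x : V ==> (P has_derivative (%e. e - DQ x e)) (at x)"
proof -
 assume x: "x : V"
 have "((%x. x - Q x) has_derivative (%e. e - DQ x e)) (at x)"
  by (intro has_derivative_diff has_derivative_ident DQ x)
 thus ?thesis by (simp add: Q_def)
qed

text \<open>Comparing the distance of \<open>y\<close> with the distance to the projection of \<open>x\<close>, and vice versa, squeezes
  the increment of the squared distance.\<close>

lemma has_derivative_infdist_sq:
 assumes x: "x : V"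
 shows "((%x. (infdist x S)^2) has_derivative (%e. 2 * (Q x <.> e))) (at x)"
proof -
 obtain e where e: "e > 0" "ball x e <= V" using open_V x open_contains_ball by blast
 show ?thesis
 proof (rule has_derivativeI_sandwich[OF e(1), where H="%y. 2 * norm (Q y - Q x) + norm (y - x)"])
  show "bounded_linear (%e. 2 * (Q x <.> e))"
   by (intro bounded_linear_const_mult bounded_linear_inner_right)
  fix y assume y: "y ~= x" "dist y x < e"
  hence yV: "y : V" using e(2) by (auto simp: dist_commute)
  have ub: "(infdist y S)^2 <= (norm (y - P x))^2" "(infdist x S)^2 <= (norm (x - P y))^2"
   using infdist_le[OF P_in[OF x], of y] infdist_le[OF P_in[OF yV], of x] S_basic(6)
   by (auto intro!: power_mono simp: dist_norm)
  have eq: "(infdist x S)^2 = (norm (x - P x))^2" "(infdist y S)^2 = (norm (y - P y))^2"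
   using norm_Q[OF x] norm_Q[OF yV] by (simp_all add: Q_def)
  let ?d = "(infdist y S)^2 - (infdist x S)^2 - 2 * (Q x <.> (y - x))"
  have "?d <= (norm (y - P x))^2 - (norm (x - P x))^2 - 2 * (Q x <.> (y - x))" using ub eq by simp
  also have "... = (norm (y - x))^2"
   unfolding power2_norm_eq_inner Q_def by (simp add: inner_diff_left inner_diff_right inner_commute)
  finally have 1: "?d <= (norm (y - x))^2" .
  have "?d >= (norm (y - P y))^2 - (norm (x - P y))^2 - 2 * (Q x <.> (y - x))" using ub eq by simp
  moreover have "(norm (y - P y))^2 - (norm (x - P y))^2 - 2 * (Q x <.> (y - x)) = 2 * ((Q y - Q x) <.> (y - x)) - (norm (y - x))^2"
   unfolding power2_norm_eq_inner Q_def by (simp add: inner_diff_left inner_diff_right inner_commute)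
  moreover have "(Q y - Q x) <.> (y - x) >= - (norm (Q y - Q x) * norm (y - x))"
   using Cauchy_Schwarz_ineq2[of "Q y - Q x" "y - x"] by linarith
  ultimately have 2: "?d >= - (2 * norm (Q y - Q x) * norm (y - x)) - (norm (y - x))^2" by simp
  have nn: "norm (Q y - Q x) * norm (y - x) >= 0" by simp
  have "\<bar>?d\<bar> <= (2 * norm (Q y - Q x) + norm (y - x)) * norm (y - x)"
  proof -
   have "(2 * norm (Q y - Q x) + norm (y - x)) * norm (y - x) = 2 * (norm (Q y - Q x) * norm (y - x)) + (norm (y - x))^2"
    by (simp add: power2_eq_square algebra_simps)
   thus ?thesis using 1 2 nn by linarith
  qed
  moreover have "norm (y - x) > 0" using y(1) by simp
  ultimately show "norm ((infdist y S)^2 - (infdist x S)^2 - 2 * (Q x <.> (y - x))) / norm (y - x) <= 2 * norm (Q y - Q x) + norm (y - x)"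
   by (simp add: divide_le_eq)
 next
  have "isCont (%y. 2 * norm (Q y - Q x) + norm (y - x)) x"
   by (intro continuous_intros isCont_Q x)
  thus "((%y. 2 * norm (Q y - Q x) + norm (y - x)) \<longlongrightarrow> 0) (at x)"
   unfolding isCont_def by simp
 qed
qed

lemma has_derivative_infdist:
 assumes x: "x : V" "x ~: S"
 shows "((%x. infdist x S) has_derivative (%e. N x <.> e)) (at x)"
proof -
 have p: "infdist x S > 0" using x(2) S_basic(5,6)[of x] by linarith
 have "(sqrt has_derivative (*) (inverse (sqrt ((infdist x S)^2)) / 2)) (at ((infdist x S)^2))"
  using DERIV_real_sqrt[of "(infdist x S)^2"] p by (simp add: has_field_derivative_def)
 from has_derivative_compose[OF has_derivative_infdist_sq[OF x(1)] this]
 have "((%x. sqrt ((infdist x S)^2)) has_derivative (%e. (inverse (infdist x S) / 2) * (2 * (Q x <.> e)))) (at x)"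
  using p by simp
 moreover have "(%x. sqrt ((infdist x S)^2)) = (%x. infdist x S)" using S_basic(6) by simp
 ultimately show ?thesis by (simp add: N_def)
qed

lemma norm_N: "x : V ==> x ~: S ==> norm (N x) = 1"
 using norm_Q[of x] S_basic(5,6)[of x] by (cases "infdist x S = 0") (auto simp: N_def)

text \<open>In a direction tangential to \<open>S\<close>, the defining function changes sign transversally within a
  distance of second order; hence the distance to \<open>S\<close> grows sublinearly.\<close>

lemma DQ_tangential:
 assumes y: "y : S" and U: "open U" "y : U" and h: "C_on (Suc 0) U h" "grad h y ~= 0" "S \<inter> U = {x : U. h x = 0}"
  and \<tau>: "grad h y <.> \<tau> = 0"
 shows "DQ y \<tau> = 0"
proof -
 let ?g = "grad h y"
 have yV: "y : V" using y S_subset_V by blast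
 have h0: "h y = 0" using h(3) y U(2) by blast
 have dh: "(h has_derivative (%e. grad h x <.> e)) (at x)" if "x : U" for x
  using h(1) that by (intro has_derivative_grad) simp
 have conth: "continuous_on U h" using C_on_SucD[OF h(1)] by simp
 have lim: "(%n. real (Suc n) *R (Q (y + \<tau> /R real (Suc n)) - Q y)) \<longlonglongrightarrow> DQ y \<tau>"
  by (rule has_derivative_difference_quotient_LIMSEQ_vector[OF DQ[OF yV]])
 have to_y: "(%n. y + v /R real (Suc n)) \<longlonglongrightarrow> y" for v
 proof -
  have "(%n. y + inverse (real (Suc n)) *R v) \<longlonglongrightarrow> y + 0 *R v"
   by (intro tendsto_intros LIMSEQ_inverse_real_of_nat)
  thus ?thesis by simp
 qed
 obtain e where e: "e > 0" "ball y e <= U" using U open_contains_ball by blast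
 have "norm (DQ y \<tau>) <= \<eta> * norm ?g" if \<eta>: "\<eta> > 0" for \<eta>
 proof -
  have gg: "?g <.> ?g > 0" using h(2) by simp
  have L: "(%n. real (Suc n) * (h (y + (\<tau> + c *R ?g) /R real (Suc n)) - h y)) \<longlonglongrightarrow> c * (?g <.> ?g)" for c
   using has_derivative_difference_quotient_LIMSEQ[OF dh[OF U(2)], of "\<tau> + c *R ?g"] \<tau> by (simp add: inner_add_right)
  have "\<eta> * (?g <.> ?g) > 0" "- \<eta> * (?g <.> ?g) < 0" using \<eta> gg by simp_all
  hence ev1: "eventually (%n. real (Suc n) * (h (y + (\<tau> + \<eta> *R ?g) /R real (Suc n)) - h y) > 0) sequentially"
   and ev2: "eventually (%n. real (Suc n) * (h (y + (\<tau> + (- \<eta>) *R ?g) /R real (Suc n)) - h y) < 0) sequentially"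
   using order_tendstoD(1)[OF L[of \<eta>]] order_tendstoD(2)[OF L[of "- \<eta>"]] by blast+
  have "eventually (%n. y + (\<tau> + c *R ?g) /R real (Suc n) : ball y e) sequentially" for c
   using topological_tendstoD[OF to_y open_ball] e(1) by simp
  note ev3 = this[of \<eta>] and ev4 = this[of "- \<eta>"]
  have ev5: "eventually (%n. y + \<tau> /R real (Suc n) : V) sequentially"
   using topological_tendstoD[OF to_y open_V yV] .
  have "eventually (%n. norm (real (Suc n) *R (Q (y + \<tau> /R real (Suc n)) - Q y)) <= \<eta> * norm ?g) sequentially"
   using ev1 ev2 ev3 ev4 ev5
  proof eventually_elim
   case (elim n)
   let ?a = "y + (\<tau> + (- \<eta>) *R ?g) /R real (Suc n)" and ?b = "y + (\<tau> + \<eta> *R ?g) /R real (Suc n)"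
   have ha: "h ?a < 0" and hb: "h ?b > 0" using elim(1,2) h0 by (auto simp: zero_less_mult_iff mult_less_0_iff simp del: of_nat_Suc)
   let ?p = "%s::real. y + (\<tau> + s *R ?g) /R real (Suc n)"
   have inb: "?p s : ball y e" if "- \<eta> <= s" "s <= \<eta>" for s
   proof -
    obtain w where w: "w = (s + \<eta>) / (2 * \<eta>)" by simp
    have u: "0 <= w" "w <= 1" using that \<eta> by (auto simp: w divide_simps)
    have s: "s = (1 - w) * (- \<eta>) + w * \<eta>" using \<eta> by (simp add: w field_simps)
    have "(1 - w) *R ?a + w *R ?b = y + (\<tau> + ((1 - w) * (- \<eta>) + w * \<eta>) *R ?g) /R real (Suc n)"
     unfolding scaleR_add_right scaleR_add_left scaleR_diff_left scaleR_scaleR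
     by (simp add: scaleR_add_left[symmetric] algebra_simps del: of_nat_Suc)
    hence "?p s = (1 - w) *R ?a + w *R ?b" using s by simp
    moreover have "(1 - w) *R ?a + w *R ?b : ball y e"
     using convexD[OF convex_ball elim(4,3), of "1 - w" w] u by simp
    ultimately show ?thesis by simp
   qed
   have "EX s. - \<eta> <= s & s <= \<eta> & h (?p s) = 0"
   proof (rule IVT')
    show "h (?p (- \<eta>)) <= 0" "0 <= h (?p \<eta>)" using ha hb by simp_all
    show "continuous_on {- \<eta>..\<eta>} (%s. h (?p s))"
     by (intro continuous_on_compose2[OF conth] continuous_intros) (use inb e(2) in auto)
   qed (use \<eta> in simp)
   then obtain s where s: "- \<eta> <= s" "s <= \<eta>" "h (?p s) = 0" by blast
   hence "?p s : S" using inb[of s] e(2) h(3) by blast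
   hence "infdist (y + \<tau> /R real (Suc n)) S <= dist (y + \<tau> /R real (Suc n)) (?p s)" by (rule infdist_le)
   also have "... = norm ((s / real (Suc n)) *R ?g)"
    by (simp add: dist_norm scaleR_add_right divide_inverse mult.commute del: of_nat_Suc)
   also have "... = \<bar>s\<bar> * norm ?g / real (Suc n)" by (simp del: of_nat_Suc)
   also have "... <= \<eta> * norm ?g / real (Suc n)" using s by (intro divide_right_mono mult_right_mono) auto
   finally have "norm (Q (y + \<tau> /R real (Suc n))) <= \<eta> * norm ?g / real (Suc n)"
    using norm_Q[OF elim(5)] by simp
   hence "real (Suc n) * norm (Q (y + \<tau> /R real (Suc n))) <= real (Suc n) * (\<eta> * norm ?g / real (Suc n))"
    by (intro mult_left_mono) auto
   thus ?case using Q_S[OF y] by (simp del: of_nat_Suc)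
  qed
  thus ?thesis using tendsto_norm[OF lim] by (intro tendsto_upperbound[of _ "norm (DQ y \<tau>)"]) auto
 qed
 hence small: "norm (DQ y \<tau>) <= e" if "e > 0" for e
 proof -
  have "norm ?g > 0" using h(2) by simp
  thus ?thesis using \<open>!!\<eta>. 0 < \<eta> ==> norm (DQ y \<tau>) <= \<eta> * norm ?g\<close>[of "e / norm ?g"] that by simp
 qed
 thus ?thesis using field_le_epsilon[of "norm (DQ y \<tau>)" 0] by simp
qed

lemma DQ_on_S_from_level_set:
 assumes y: "y : S" and U: "open U" "y : U" and h: "C_on (Suc 0) U h" "grad h y ~= 0" "S \<inter> U = {x : U. h x = 0}"
 defines "m == grad h y /R norm (grad h y)"
 shows "DQ y e = (m <.> e) *R m"
proof -
 let ?g = "grad h y"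
 have yV: "y : V" using y S_subset_V by blast
 have m1: "m <.> m = 1" "norm m = 1" using h(2) by (simp_all add: m_def dot_square_norm power2_eq_square)
 have to_y: "(%n. y + v /R real (Suc n)) \<longlonglongrightarrow> y" for v
 proof -
  have "(%n. y + inverse (real (Suc n)) *R v) \<longlonglongrightarrow> y + 0 *R v"
   by (intro tendsto_intros LIMSEQ_inverse_real_of_nat)
  thus ?thesis by simp
 qed
 have evV: "eventually (%n. y + m /R real (Suc n) : V) sequentially"
  using topological_tendstoD[OF to_y open_V yV] .
 have le1: "norm (DQ y m) <= 1"
 proof (rule tendsto_upperbound)
  show "(%n. norm (real (Suc n) *R (Q (y + m /R real (Suc n)) - Q y))) \<longlonglongrightarrow> norm (DQ y m)"
   by (intro tendsto_norm has_derivative_difference_quotient_LIMSEQ_vector DQ yV)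
  show "eventually (%n. norm (real (Suc n) *R (Q (y + m /R real (Suc n)) - Q y)) <= 1) sequentially"
   using evV
  proof eventually_elim
   case (elim n)
   have "norm (Q (y + m /R real (Suc n))) <= dist (y + m /R real (Suc n)) y"
    using norm_Q[OF elim] infdist_le[OF y] by simp
   also have "... = 1 / real (Suc n)" using m1 by (simp add: dist_norm divide_inverse del: of_nat_Suc)
   finally have "real (Suc n) * norm (Q (y + m /R real (Suc n))) <= real (Suc n) * (1 / real (Suc n))"
    by (intro mult_left_mono) auto
   thus ?case using Q_S[OF y] by (simp del: of_nat_Suc)
  qed
 qed simp
 have "(h has_derivative (%e. ?g <.> e)) (at (P y))"
  using h(1) U(2) P_fix[OF y] by (intro has_derivative_grad[THEN has_derivative_eq_rhs]) simp_all
 from has_derivative_compose[OF DP[OF yV] this]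
 have "((%x. h (P x)) has_derivative (%e. ?g <.> (e - DQ y e))) (at y)" by simp
 from has_derivative_difference_quotient_LIMSEQ[OF this, of m]
 have lim: "(%n. real (Suc n) * (h (P (y + m /R real (Suc n))) - h (P y))) \<longlonglongrightarrow> ?g <.> (m - DQ y m)" .
 have "isCont P y" using continuous_P open_V yV by (simp add: continuous_on_eq_continuous_at)
 from isCont_tendsto_compose[OF this to_y] have "(%n. P (y + m /R real (Suc n))) \<longlonglongrightarrow> y" using P_fix[OF y] by simp
 hence evU: "eventually (%n. P (y + m /R real (Suc n)) : U) sequentially" using topological_tendstoD U by blast
 have "eventually (%n. real (Suc n) * (h (P (y + m /R real (Suc n))) - h (P y)) = 0) sequentially"
  using evU evV
 proof eventually_elim
  case (elim n)
  have "h (P (y + m /R real (Suc n))) = 0" using P_in[OF elim(2)] elim(1) h(3) by blast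
  moreover have "h (P y) = 0" using P_fix[OF y] y U(2) h(3) by auto
  ultimately show ?case by simp
 qed
 from LIMSEQ_unique[OF lim tendsto_eventually[OF this]] have "?g <.> (m - DQ y m) = 0" .
 hence "m <.> (m - DQ y m) = 0" by (simp add: m_def)
 hence in1: "m <.> DQ y m = 1" using m1 by (simp add: inner_diff_right)
 have "(norm (DQ y m - m))^2 = (norm (DQ y m))^2 - 1"
  using in1 m1 by (simp add: power2_norm_eq_inner inner_diff_left inner_diff_right inner_commute)
 also have "... <= 0" using le1 power_mono[OF le1, of 2] by simp
 finally have mm: "DQ y m = m" by simp
 have "DQ y (e - (m <.> e) *R m) = 0"
 proof (rule DQ_tangential[OF y U h])
  have g: "?g = norm ?g *R m" using h(2) by (simp add: m_def)
  have "m <.> (e - (m <.> e) *R m) = 0" using m1 by (simp add: inner_diff_right)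
  thus "?g <.> (e - (m <.> e) *R m) = 0" by (subst g) simp
 qed
 thus ?thesis using linear_DQ[OF yV] mm by (simp add: linear_diff linear_scale)
qed

lemma hypersurface_local:
 assumes "y : S"
 obtains U h where "open U" "y : U" "C_on (Suc 0) U h" "grad h y ~= 0" "S \<inter> U = {x : U. h x = 0}"
  "!!x. x : U ==> grad h x ~= 0"
proof -
 obtain U h where U: "open U" "y : U" "smooth_on U h" "ALL x:U. grad h x ~= 0" "S \<inter> U = {x : U. h x = 0}"
  using hyp assms unfolding closed_hypersurface_def by blast
 show ?thesis
  by (rule that[OF U(1,2) _ _ U(5)]) (use U in \<open>auto simp only: smooth_on_def\<close>)
qed

lemma DQ_on_S:
 assumes "y : S" obtains \<nu> where "norm \<nu> = 1" "!!e. DQ y e = (\<nu> <.> e) *R \<nu>"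
proof -
 obtain U h where U: "open U" "y : U" "C_on (Suc 0) U h" "grad h y ~= 0" "S \<inter> U = {x : U. h x = 0}"
  by (rule hypersurface_local[OF assms])
 show ?thesis
  by (rule that[of "grad h y /R norm (grad h y)"]) (use DQ_on_S_from_level_set[OF assms U] U(4) in auto)
qed

text \<open>The projection is a critical point of the distance along \<open>S\<close>, so \<open>x - P x\<close> is normal to \<open>S\<close>.\<close>

lemma Q_normal:
 assumes x: "x : V"
 shows "DQ (P x) (Q x) = Q x"
proof -
 let ?y = "P x"
 have y: "?y : S" using P_in[OF x] .
 hence yV: "?y : V" using S_subset_V by blast
 obtain \<nu> where \<nu>: "norm \<nu> = 1" "!!e. DQ ?y e = (\<nu> <.> e) *R \<nu>" using DQ_on_S[OF y] by blast
 have "Q x <.> (e - DQ ?y e) = 0" for e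
 proof -
  let ?k = "%t. (norm (x - P (?y + t *R e)))^2"
  have l: "((%t::real. ?y + t *R e) has_derivative (%t. t *R e)) (at 0)" by (auto intro!: derivative_eq_intros)
  have "(P has_derivative (%e. e - DQ ?y e)) (at (?y + 0 *R e))" using DP[OF yV] by simp
  from has_derivative_compose[OF l this]
  have dP: "((%t. P (?y + t *R e)) has_derivative (%t. t *R e - DQ ?y (t *R e))) (at 0)" .
  have d1: "((%t. x - P (?y + t *R e)) has_derivative (%t. - (t *R (e - DQ ?y e)))) (at 0)"
   using has_derivative_diff[OF has_derivative_const[of x] dP] linear_scale[OF linear_DQ[OF yV]]
   by (simp add: scaleR_diff_right algebra_simps)
  have "((%t. (x - P (?y + t *R e)) <.> (x - P (?y + t *R e))) has_derivative
    (%t. (x - P (?y + 0 *R e)) <.> (- (t *R (e - DQ ?y e))) + (- (t *R (e - DQ ?y e))) <.> (x - P (?y + 0 *R e)))) (at 0)"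
   by (rule has_derivative_inner[OF d1 d1])
  moreover have "(%t. (x - P (?y + 0 *R e)) <.> (- (t *R (e - DQ ?y e))) + (- (t *R (e - DQ ?y e))) <.> (x - P (?y + 0 *R e)))
    = (*) (- 2 * (Q x <.> (e - DQ ?y e)))"
   using P_fix[OF y] by (simp add: fun_eq_iff Q_def inner_commute[of "e - DQ ?y e"])
  ultimately have kd: "(?k has_real_derivative (- 2 * (Q x <.> (e - DQ ?y e)))) (at 0)"
   unfolding has_field_derivative_def power2_norm_eq_inner by simp
  have "EX d>0. ALL t. \<bar>0 - t\<bar> < d --> ?k 0 <= ?k t"
  proof -
   obtain r where r: "r > 0" "ball ?y r <= V" using open_V yV open_contains_ball by blast
   have "?k 0 <= ?k t" if "\<bar>0 - t\<bar> < r / (norm e + 1)" for t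
   proof -
    have "\<bar>t\<bar> * norm e <= \<bar>t\<bar> * (norm e + 1)" by (intro mult_left_mono) auto
    also have "... < r"
    proof -
     have "norm e + 1 > 0" using norm_ge_zero[of e] by linarith
     thus ?thesis using that by (simp add: pos_less_divide_eq)
    qed
    finally have "?y + t *R e : V" using r(2) by (auto simp: dist_norm subset_iff)
    from infdist_le[OF P_in[OF this], of x] have "norm (Q x) <= norm (x - P (?y + t *R e))"
     using norm_Q[OF x] by (simp add: dist_norm)
    thus ?thesis using P_fix[OF y] by (simp add: Q_def power_mono)
   qed
   moreover have "r / (norm e + 1) > 0" using r(1) by (intro divide_pos_pos) (auto simp: add_nonneg_pos)
   ultimately show ?thesis by blast
  qed
  then obtain d where d: "d > 0" "ALL t. \<bar>0 - t\<bar> < d --> ?k 0 <= ?k t" by blast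
  show ?thesis using DERIV_local_min[OF kd d] by simp
 qed
 from this[of "Q x"] have "Q x <.> Q x = (\<nu> <.> Q x)^2" by (simp add: \<nu>(2) inner_diff_right inner_commute power2_eq_square)
 moreover have "\<nu> <.> \<nu> = 1" using \<nu>(1) by (simp add: dot_square_norm)
 ultimately have "(Q x - (\<nu> <.> Q x) *R \<nu>) <.> (Q x - (\<nu> <.> Q x) *R \<nu>) = 0"
  by (simp add: inner_diff_left inner_diff_right inner_commute power2_eq_square del: inner_eq_zero_iff)
 hence "Q x = (\<nu> <.> Q x) *R \<nu>" by simp
 thus ?thesis by (simp add: \<nu>(2))
qed

lemma DQ_P_eq:
 assumes x: "x : V" "x ~: S"
 shows "DQ (P x) e = (N x <.> e) *R N x"
proof -
 have y: "P x : S" using P_in[OF x(1)] .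
 hence yV: "P x : V" using S_subset_V by blast
 obtain \<nu> where \<nu>: "norm \<nu> = 1" "!!e. DQ (P x) e = (\<nu> <.> e) *R \<nu>" using DQ_on_S[OF y] by blast
 have p: "infdist x S > 0" using x(2) S_basic(5,6)[of x] by linarith
 have "DQ (P x) (N x) = N x"
  using Q_normal[OF x(1)] linear_scale[OF linear_DQ[OF yV]] by (simp add: N_def)
 hence Nx: "N x = (\<nu> <.> N x) *R \<nu>" by (simp add: \<nu>(2))
 define c where "c = \<nu> <.> N x"
 have Nc: "N x = c *R \<nu>" using Nx by (simp add: c_def)
 have "\<bar>c\<bar> = 1" using norm_N[OF x] \<nu>(1) by (simp add: Nc)
 hence "c * c = 1" by (metis abs_mult_self_eq mult.right_neutral)
 thus ?thesis by (simp add: Nc \<nu>(2))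
qed

definition DN :: "real^'d => real^'d => real^'d" where
 "DN x e = (DQ x e - (N x <.> e) *R N x) /R infdist x S"

lemma has_derivative_N:
 assumes x: "x : V" "x ~: S"
 shows "(N has_derivative DN x) (at x)"
proof -
 have p: "infdist x S > 0" using x(2) S_basic(5,6)[of x] by linarith
 have "((%x. inverse (infdist x S)) has_derivative (%e. - (inverse (infdist x S) * (N x <.> e) * inverse (infdist x S)))) (at x)"
  by (rule Deriv.has_derivative_inverse[OF _ has_derivative_infdist[OF x]]) (use p in simp)
 from has_derivative_scaleR[OF this DQ[OF x(1)]]
 have "((%x. inverse (infdist x S) *R Q x) has_derivative
   (%e. inverse (infdist x S) *R DQ x e + (- (inverse (infdist x S) * (N x <.> e) * inverse (infdist x S))) *R Q x)) (at x)" .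
 moreover have "(%e. inverse (infdist x S) *R DQ x e + (- (inverse (infdist x S) * (N x <.> e) * inverse (infdist x S))) *R Q x) = DN x"
  by (simp add: fun_eq_iff DN_def N_def scaleR_diff_right)
 moreover have "(%x. inverse (infdist x S) *R Q x) = N" by (simp add: fun_eq_iff N_def)
 ultimately show ?thesis by simp
qed

lemma segment_to_P_in_K:
 assumes x: "x : K"
 shows "closed_segment x (P x) <= K"
proof
 fix w assume w: "w : closed_segment x (P x)"
 have xV: "x : V" using x K_subset_V by blast
 have "infdist w S <= dist w (P x)" by (rule infdist_le[OF P_in[OF xV]])
 also have "... <= dist x (P x)" using dist_in_closed_segment[OF w] by (simp add: dist_commute)
 also have "... = infdist x S" using norm_Q[OF xV] by (simp add: Q_def dist_norm)
 finally show "w : K" using x by (simp add: K_def)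
qed

lemma DQ_lipschitz:
 "EX C>=0. ALL x z e. closed_segment x z <= K --> norm (DQ x e - DQ z e) <= C * norm (x - z) * norm e"
proof -
 have "EX C>=0. ALL x z. closed_segment x z <= K --> norm (DQ x b - DQ z b) <= C * norm (x - z)" if "b : Basis" for b
 proof -
  have "C_on (Suc 0) V (%x. DQ x b)" unfolding DQ_def by (rule has_derivative_C1_any_direction[OF C_on_Q open_V])
  from C1_lipschitz_on_segments[OF this compact_K K_subset_V] show ?thesis .
 qed
 then obtain C where C: "!!b. b : Basis ==> C b >= 0"
  "!!b x z. b : Basis ==> closed_segment x z <= K ==> norm (DQ x b - DQ z b) <= C b * norm (x - z)" by metis
 show ?thesis
 proof (intro exI[of _ "\<Sum>b\<in>Basis. C b"] conjI allI impI)
  show "0 <= (\<Sum>b\<in>Basis. C b)" using C(1) by (rule sum_nonneg)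
  fix x z e assume s: "closed_segment x z <= K"
  hence xz: "x : V" "z : V" using K_subset_V by auto
  have "DQ x e - DQ z e = DQ x (\<Sum>b\<in>Basis. (e <.> b) *R b) - DQ z (\<Sum>b\<in>Basis. (e <.> b) *R b)"
   by (simp only: euclidean_representation)
  also have "... = (\<Sum>b\<in>Basis. (e <.> b) *R (DQ x b - DQ z b))"
   using linear_DQ xz by (simp add: linear_sum linear_scale sum_subtractf scaleR_diff_right)
  also have "norm ... <= (\<Sum>b\<in>Basis. norm ((e <.> b) *R (DQ x b - DQ z b)))" by (rule norm_sum)
  also have "... <= (\<Sum>b\<in>Basis. norm e * (C b * norm (x - z)))"
  proof (rule sum_mono)
   fix b :: "real^'d" assume b: "b : Basis"
   show "norm ((e <.> b) *R (DQ x b - DQ z b)) <= norm e * (C b * norm (x - z))"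
    using Basis_le_norm[OF b, of e] C(2)[OF b s] by (auto intro!: mult_mono)
  qed
  also have "... = (\<Sum>b\<in>Basis. C b) * norm (x - z) * norm e" by (simp add: sum_distrib_left sum_distrib_right mult_ac)
  finally show "norm (DQ x e - DQ z e) <= (\<Sum>b\<in>Basis. C b) * norm (x - z) * norm e" .
 qed
qed

text \<open>On \<open>S\<close> the derivative of \<open>x - P x\<close> is the projection onto the normal line, so the singular
  denominator in the derivative of \<open>N\<close> is compensated.\<close>

lemma DN_bounded: "EX C>=0. ALL x:K - S. ALL e. norm (DN x e) <= C * norm e"
proof -
 obtain C where C: "C >= 0" "!!x z e. closed_segment x z <= K ==> norm (DQ x e - DQ z e) <= C * norm (x - z) * norm e"
  using DQ_lipschitz by blast
 have "norm (DN x e) <= C * norm e" if x: "x : K - S" for x e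
 proof -
  have xV: "x : V" "x ~: S" using x K_subset_V by auto
  have p: "infdist x S > 0" using xV(2) S_basic(5,6)[of x] by linarith
  have "norm (DQ x e - DQ (P x) e) <= C * norm (x - P x) * norm e" using C(2) segment_to_P_in_K x by blast
  hence "norm (DQ x e - (N x <.> e) *R N x) <= C * infdist x S * norm e"
   using DQ_P_eq[OF xV] norm_Q[OF xV(1)] by (simp add: Q_def)
  hence "norm (DQ x e - (N x <.> e) *R N x) / infdist x S <= C * norm e"
   using p by (simp add: divide_le_eq mult_ac)
  thus ?thesis using p by (simp add: DN_def divide_inverse mult.commute)
 qed
 thus ?thesis using C(1) by blast
qed

lemma continuous_N: "continuous_on (V - S) N"
 using has_derivative_N by (intro continuous_at_imp_continuous_on) (auto intro: has_derivative_continuous)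

lemma negligible_S: "negligible S"
proof (rule negligible_if_locally_level_set[OF S_basic(2)])
 fix p assume "p : S"
 then obtain U h where "open U" "p : U" "C_on (Suc 0) U h" "grad h p ~= 0" "S \<inter> U = {x : U. h x = 0}"
  by (rule hypersurface_local)
 thus "EX U h. open U & p : U & C_on (Suc 0) U h & grad h p ~= 0 & (ALL x:S \<inter> U. h x = 0)" by blast
qed

lemma negligible_distance_level:
 assumes c: "0 < c" "c < R"
 shows "negligible {x. infdist x S = c}"
proof (rule negligible_if_locally_level_set)
 show "closed {x. infdist x S = c}" by (intro closed_Collect_eq continuous_intros)
 fix p assume p: "p : {x. infdist x S = c}"
 have pV: "p : V - S" using p c by (auto simp: V_def)
 have d: "((%x. infdist x S + - c) has_derivative (%e. N x <.> e)) (at x)" if "x : V - S" for x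
  using has_derivative_add[OF has_derivative_infdist[of x] has_derivative_const[of "- c"]] that by simp
 have o: "open (V - S)" using open_V S_basic(2) by (simp add: open_Diff)
 have "C_on (Suc 0) (V - S) (%x. infdist x S + - c)"
  by (rule C_on_SucI[OF o d]) (auto intro!: continuous_intros continuous_N)
 moreover have "grad (%x. infdist x S + - c) p = N p" by (rule grad_eqI[OF d[OF pV]])
 moreover have "N p ~= 0" using norm_N[of p] pV by auto
 ultimately show "EX U h. open U & p : U & C_on (Suc 0) U h & grad h p ~= 0 & (ALL x:{x. infdist x S = c} \<inter> U. h x = 0)"
  using o pV by (intro exI[of _ "V - S"] exI[of _ "%x. infdist x S + - c"]) auto
qed

lemma AE_notin_S: "AE x in lebesgue. x ~: S"
 using negligible_S by (simp add: negligible_iff_null_sets AE_not_in)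

lemma AE_infdist_neq: "0 < c ==> c < R ==> AE x in lebesgue. infdist x S ~= c"
 using AE_not_in[of "{x. infdist x S = c}" lebesgue] negligible_distance_level[of c]
 by (simp add: negligible_iff_null_sets)

end

section \<open>Hausdorff measure is a Borel measure\<close>

text \<open>Caratheodory's criterion.  Points of \<open>A\<close> off a closed set \<open>F\<close> are sorted into shells by their
  distance to \<open>F\<close>; every other shell is separated, so the shells have summable measure and the thin
  ones near \<open>F\<close> can be dropped.\<close>

lemma caratheodory_criterion_closed:
 fixes \<mu> :: "'a::metric_space set => ennreal"
 assumes mono: "!!A B. A <= B ==> \<mu> A <= \<mu> B"
  and csub: "!!A. \<mu> (\<Union>i. A i) <= (\<Sum>i. \<mu> (A i))" and empty: "\<mu> {} = 0"
  and metric: "!!A B d. d > 0 ==> (!!a b. a : A ==> b : B ==> d <= dist a b) ==> \<mu> A + \<mu> B <= \<mu> (A \<union> B)"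
  and F: "closed F"
 shows "\<mu> (A \<inter> F) + \<mu> (A - F) <= \<mu> A"
proof (cases "F = {}")
 case True thus ?thesis by (simp add: empty)
next
 case ne: False
 have sub2: "\<mu> (X \<union> Y) <= \<mu> X + \<mu> Y" for X Y
 proof -
  have "\<mu> (X \<union> Y) <= \<mu> (\<Union>i::nat. if i = 0 then X else if i = 1 then Y else {})" by (intro mono) (auto split: if_splits intro: exI[of _ 0] exI[of _ 1])
  also have "... <= (\<Sum>i. \<mu> (if i = 0 then X else if i = 1 then Y else {}))" by (rule csub)
  also have "... = (\<Sum>i\<in>{0,1::nat}. \<mu> (if i = 0 then X else if i = 1 then Y else {}))"
   by (rule suminf_finite) (auto simp: empty)
  finally show ?thesis by simp
 qed
 let ?d = "%x. infdist x F"
 define T where "T k = {x : A. ?d x >= inverse (real (Suc k))}" for k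
 define B where "B k = {x : A. ?d x >= inverse (real (Suc (Suc k))) & ?d x < inverse (real (Suc k))}" for k
 have sep: "\<mu> X + \<mu> Y <= \<mu> (X \<union> Y)" if "!!x. x : X ==> ?d x <= s" "!!y. y : Y ==> ?d y >= t" "s < t" for X Y s t
 proof (rule metric[of "t - s"])
  fix a b assume ab: "a : X" "b : Y"
  have "\<bar>?d a - ?d b\<bar> <= dist a b" by (rule infdist_triangle_abs)
  thus "t - s <= dist a b" using that(1)[OF ab(1)] that(2)[OF ab(2)] by linarith
 qed (use that(3) in simp)
 have T: "\<mu> (A \<inter> F) + \<mu> (T k) <= \<mu> A" for k
 proof -
  have "\<mu> (A \<inter> F) + \<mu> (T k) <= \<mu> ((A \<inter> F) \<union> T k)"
   by (rule sep[where s=0 and t="inverse (real (Suc k))"]) (auto simp: T_def)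
  also have "... <= \<mu> A" by (intro mono) (auto simp: T_def)
  finally show ?thesis .
 qed
 have alt: "(\<Sum>i<m. \<mu> (B (2 * i + c))) <= \<mu> (\<Union>i<m. B (2 * i + c))" for m c
 proof (induction m)
  case (Suc m)
  have "(\<Sum>i<Suc m. \<mu> (B (2 * i + c))) <= \<mu> (B (2 * m + c)) + \<mu> (\<Union>i<m. B (2 * i + c))"
   using add_left_mono[OF Suc] by (simp add: add.commute)
  also have "... <= \<mu> (B (2 * m + c) \<union> (\<Union>i<m. B (2 * i + c)))"
  proof (rule sep[where s="inverse (real (Suc (2 * m + c)))" and t="if m = 0 then 2 else inverse (real (2 * m + c))"])
   show "?d x <= inverse (real (Suc (2 * m + c)))" if "x : B (2 * m + c)" for x
    using that by (simp add: B_def)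
   show "(if m = 0 then 2 else inverse (real (2 * m + c))) <= ?d y" if y: "y : (\<Union>i<m. B (2 * i + c))" for y
   proof -
    obtain i where i: "i < m" "y : B (2 * i + c)" using y by blast
    have "inverse (real (2 * m + c)) <= inverse (real (Suc (Suc (2 * i + c))))"
     using i(1) by (intro le_imp_inverse_le) auto
    also have "... <= ?d y" using i(2) by (simp add: B_def)
    finally show ?thesis using i(1) by simp
   qed
   show "inverse (real (Suc (2 * m + c))) < (if m = 0 then 2 else inverse (real (2 * m + c)))"
    by (auto intro!: less_imp_inverse_less intro: le_less_trans[of _ 1] simp: inverse_le_1_iff)
  qed
  also have "... = \<mu> (\<Union>i<Suc m. B (2 * i + c))" by (simp add: lessThan_Suc)
  finally show ?case .
 qed (simp add: empty)
 have UB: "\<mu> (\<Union>i<m. B (2 * i + c)) <= \<mu> A" for m c by (intro mono) (auto simp: B_def)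
 have part: "(\<Sum>j<n. \<mu> (B j)) <= 2 * \<mu> A" for n
 proof -
  have "(\<Sum>j<n. \<mu> (B j)) <= (\<Sum>j<2*n. \<mu> (B j))" by (intro sum_mono2) auto
  also have "... = (\<Sum>i<n. \<mu> (B (2 * i + 0))) + (\<Sum>i<n. \<mu> (B (2 * i + 1)))"
   by (induction n) (simp_all add: algebra_simps)
  also have "... <= \<mu> A + \<mu> A" using alt[of 0 n] alt[of 1 n] UB[of 0 n] UB[of 1 n] by (intro add_mono) (auto intro: order_trans)
  finally show ?thesis by (simp add: mult_2)
 qed
 show ?thesis
 proof (cases "\<mu> A = \<infinity>")
  case False
  hence fin: "\<mu> A < \<infinity>" by (simp add: less_top)
  have Bfin: "\<mu> (B j) < \<infinity>" for j
   using mono[of "B j" A] fin by (auto simp: B_def elim: le_less_trans)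
  define b where "b j = enn2real (\<mu> (B j))" for j
  have b: "\<mu> (B j) = ennreal (b j)" "b j >= 0" for j using Bfin[of j] by (simp_all add: b_def)
  have "summable b"
  proof (rule summableI_nonneg_bounded[where x="enn2real (2 * \<mu> A)"])
   fix n
   have "ennreal (\<Sum>j<n. b j) = (\<Sum>j<n. \<mu> (B j))" using b by (simp add: sum_ennreal)
   hence "ennreal (\<Sum>j<n. b j) <= 2 * \<mu> A" using part by simp
   moreover have "2 * \<mu> A < \<infinity>" using fin by (simp add: ennreal_mult_less_top)
   ultimately show "(\<Sum>j<n. b j) <= enn2real (2 * \<mu> A)"
    using b(2) by (metis enn2real_ennreal enn2real_mono infinity_ennreal_def sum_nonneg)
  qed (rule b(2))
  show ?thesis
  proof (rule ennreal_le_epsilon)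
   fix e :: real assume e: "0 < e"
   obtain k where k: "norm (\<Sum>i. b (i + k)) < e" using suminf_exist_split[OF e \<open>summable b\<close>] by blast
   have sm: "summable (%i. b (i + k))" using \<open>summable b\<close> by (simp add: summable_iff_shift)
   have "A - F <= T k \<union> (\<Union>i. B (i + k))"
   proof
    fix x assume x: "x : A - F"
    have p: "?d x > 0" using x F ne in_closed_iff_infdist_zero[OF F ne, of x] infdist_nonneg[of x F] by force
    show "x : T k \<union> (\<Union>i. B (i + k))"
    proof (cases "x : T k")
     case nT: False
     define n where "n = (LEAST n. inverse (real (Suc n)) <= ?d x)"
     have ex: "EX n. inverse (real (Suc n)) <= ?d x" using reals_Archimedean[OF p] less_imp_le by blast
     have n1: "inverse (real (Suc n)) <= ?d x" unfolding n_def using ex by (rule LeastI_ex)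
     have nk: "n > k"
     proof (rule ccontr)
      assume "\<not> k < n"
      hence "inverse (real (Suc k)) <= inverse (real (Suc n))" by (intro le_imp_inverse_le) auto
      hence "inverse (real (Suc k)) <= ?d x" using n1 by (rule order_trans)
      thus False using nT x by (simp add: T_def)
     qed
     then obtain m where m: "n = Suc m" by (cases n) auto
     have "\<not> inverse (real (Suc m)) <= ?d x" using not_less_Least[of m "%n. inverse (real (Suc n)) <= ?d x"] m unfolding n_def by auto
     hence "x : B m" using n1 m x by (auto simp: B_def)
     hence "x : B ((m - k) + k)" using nk m by simp
     thus ?thesis by blast
    qed simp
   qed
   hence "\<mu> (A - F) <= \<mu> (T k \<union> (\<Union>i. B (i + k)))" by (rule mono)
   also have "... <= \<mu> (T k) + \<mu> (\<Union>i. B (i + k))" by (rule sub2)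
   also have "... <= \<mu> (T k) + (\<Sum>i. \<mu> (B (i + k)))" by (intro add_left_mono csub)
   also have "(\<Sum>i. \<mu> (B (i + k))) = ennreal (\<Sum>i. b (i + k))" unfolding b(1) using b(2) sm by (intro suminf_ennreal2) auto
   also have "... <= ennreal e" using k by (intro ennreal_leI) auto
   finally have "\<mu> (A - F) <= \<mu> (T k) + ennreal e" by simp
   hence "\<mu> (A \<inter> F) + \<mu> (A - F) <= (\<mu> (A \<inter> F) + \<mu> (T k)) + ennreal e"
    by (simp add: add.assoc add_left_mono)
   also have "... <= \<mu> A + ennreal e" using T by (intro add_right_mono)
   finally show "\<mu> (A \<inter> F) + \<mu> (A - F) <= \<mu> A + ennreal e" .
  qed
 qed simp
qed

lemma caratheodory_criterion:
 fixes \<mu> :: "'a::metric_space set => ennreal"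
 assumes mono: "!!A B. A <= B ==> \<mu> A <= \<mu> B"
  and csub: "!!A. \<mu> (\<Union>i. A i) <= (\<Sum>i. \<mu> (A i))" and empty: "\<mu> {} = 0"
  and metric: "!!A B d. d > 0 ==> (!!a b. a : A ==> b : B ==> d <= dist a b) ==> \<mu> A + \<mu> B <= \<mu> (A \<union> B)"
 shows "measure_space UNIV (sets borel) \<mu>"
proof -
 have sub2: "\<mu> (X \<union> Y) <= \<mu> X + \<mu> Y" for X Y
 proof -
  have "\<mu> (X \<union> Y) <= \<mu> (\<Union>i::nat. if i = 0 then X else if i = 1 then Y else {})" by (intro mono) (auto split: if_splits intro: exI[of _ 0] exI[of _ 1])
  also have "... <= (\<Sum>i. \<mu> (if i = 0 then X else if i = 1 then Y else {}))" by (rule csub)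
  also have "... = (\<Sum>i\<in>{0,1::nat}. \<mu> (if i = 0 then X else if i = 1 then Y else {}))"
   by (rule suminf_finite) (auto simp: empty)
  finally show ?thesis by simp
 qed
 have oms: "outer_measure_space (Pow UNIV) \<mu>"
  unfolding outer_measure_space_def positive_def increasing_def countably_subadditive_def
  using mono csub empty by auto
 let ?L = "lambda_system UNIV (Pow UNIV) \<mu>"
 interpret P: sigma_algebra UNIV "Pow (UNIV :: 'a set)" by (rule sigma_algebra_Pow)
 have ms: "measure_space UNIV ?L \<mu>" using P.caratheodory_lemma[OF oms] .
 then interpret L: sigma_algebra UNIV ?L by (simp add: measure_space_def)
 have cl: "F : ?L" if F: "closed F" for F
 proof -
  have "\<mu> (A \<inter> F) + \<mu> (A - F) = \<mu> A" for A
  proof (rule antisym)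
   show "\<mu> (A \<inter> F) + \<mu> (A - F) <= \<mu> A" by (rule caratheodory_criterion_closed[OF mono csub empty metric F])
   have "\<mu> A = \<mu> ((A \<inter> F) \<union> (A - F))" by (simp add: Int_Diff_Un)
   also have "... <= \<mu> (A \<inter> F) + \<mu> (A - F)" by (rule sub2)
   finally show "\<mu> A <= \<mu> (A \<inter> F) + \<mu> (A - F)" .
  qed
  thus ?thesis unfolding P.lambda_system_eq by simp
 qed
 have "sets (borel :: 'a measure) <= ?L"
 proof -
  have "{S :: 'a set. open S} <= ?L"
  proof
   fix S :: "'a set" assume "S : {S. open S}"
   hence "- S : ?L" by (intro cl) (simp add: closed_Compl)
   hence "UNIV - - S : ?L" by (rule L.compl_sets)
   thus "S : ?L" by (simp add: Compl_eq_Diff_UNIV[symmetric])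
  qed
  hence "sigma_sets UNIV {S :: 'a set. open S} <= ?L" by (rule L.sigma_sets_subset)
  thus ?thesis by (simp add: borel_def)
 qed
 moreover have "sigma_algebra UNIV (sets (borel :: 'a measure))"
  using sets.sigma_algebra_axioms[of "borel :: 'a measure"] by simp
 ultimately show ?thesis using measure_down[OF ms] by blast
qed

definition hausdorff_weight :: "nat => 'a::metric_space set => ennreal" where
 "hausdorff_weight n C = ennreal (unit_ball_vol (real n) * (diameter C / 2) ^ n)"

definition hausdorff_covers :: "real => 'a::metric_space set => (nat => 'a set) set" where
 "hausdorff_covers \<delta> A = {C. A <= (\<Union>i. C i) & (ALL i. bounded (C i) & diameter (C i) <= \<delta>)}"

lemma hausdorff_pre_alt: "hausdorff_pre n \<delta> A = (INF C\<in>hausdorff_covers \<delta> A. \<Sum>i. hausdorff_weight n (C i))"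
 by (simp add: hausdorff_pre_def hausdorff_weight_def hausdorff_covers_def)

lemma hausdorff_pre_mono: "A <= B ==> hausdorff_pre n \<delta> A <= hausdorff_pre n \<delta> B"
 unfolding hausdorff_pre_alt by (rule INF_superset_mono) (auto simp: hausdorff_covers_def)

lemma hausdorff_pre_antimono: "\<delta> <= \<delta>' ==> hausdorff_pre n \<delta>' A <= hausdorff_pre n \<delta> A"
 unfolding hausdorff_pre_alt by (rule INF_superset_mono) (auto simp: hausdorff_covers_def intro: order_trans)

lemma hausdorff_weight_empty: "n > 0 ==> hausdorff_weight n {} = 0"
 by (simp add: hausdorff_weight_def)

lemma hausdorff_pre_empty: "n > 0 ==> \<delta> > 0 ==> hausdorff_pre n \<delta> ({} :: 'a::metric_space set) = 0"
proof -
 assume "n > 0" "\<delta> > 0"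
 hence "hausdorff_pre n \<delta> ({} :: 'a set) <= (\<Sum>i. hausdorff_weight n ({} :: 'a set))"
  unfolding hausdorff_pre_alt by (intro INF_lower) (auto simp: hausdorff_covers_def)
 thus ?thesis using \<open>n > 0\<close> by (simp add: hausdorff_weight_empty)
qed

lemma hausdorff_pre_countably_subadditive:
 "hausdorff_pre n \<delta> (\<Union>i. A i) <= (\<Sum>i. hausdorff_pre n \<delta> (A i))"
proof (rule ennreal_le_epsilon)
 fix e :: real assume fin: "(\<Sum>i. hausdorff_pre n \<delta> (A i)) < top" and e: "0 < e"
 have "hausdorff_pre n \<delta> (A i) < top" for i
  using fin by (metis ennreal_suminf_lessD)
 have "EX C:hausdorff_covers \<delta> (A i). (\<Sum>j. hausdorff_weight n (C j)) < hausdorff_pre n \<delta> (A i) + ennreal (e * (1/2) ^ Suc i)" for i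
 proof -
  have "hausdorff_pre n \<delta> (A i) < hausdorff_pre n \<delta> (A i) + ennreal (e * (1/2) ^ Suc i)"
  proof -
   obtain p where p: "hausdorff_pre n \<delta> (A i) = ennreal p" "p >= 0"
    using \<open>hausdorff_pre n \<delta> (A i) < top\<close> by (metis ennreal_cases less_irrefl)
   have "e * (1/2) ^ Suc i > 0" using e by simp
   thus ?thesis unfolding p(1) using p(2) by (simp add: ennreal_plus[symmetric] ennreal_lessI del: ennreal_plus)
  qed
  thus ?thesis by (subst (asm) (1) hausdorff_pre_alt) (simp add: INF_less_iff)
 qed
 then obtain C where C: "!!i. C i : hausdorff_covers \<delta> (A i)"
  "!!i. (\<Sum>j. hausdorff_weight n (C i j)) < hausdorff_pre n \<delta> (A i) + ennreal (e * (1/2) ^ Suc i)" by metis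
 define D where "D k = (case prod_decode k of (i, j) => C i j)" for k
 have "D : hausdorff_covers \<delta> (\<Union>i. A i)"
  unfolding hausdorff_covers_def
 proof (intro CollectI conjI allI)
  show "(\<Union>i. A i) <= (\<Union>k. D k)"
  proof
   fix x assume "x : (\<Union>i. A i)"
   then obtain i j where "x : C i j" using C(1) unfolding hausdorff_covers_def by blast
   hence "x : D (prod_encode (i, j))" by (simp add: D_def)
   thus "x : (\<Union>k. D k)" by blast
  qed
  show "bounded (D k)" "diameter (D k) <= \<delta>" for k
   using C(1) unfolding D_def hausdorff_covers_def by (auto split: prod.split)
 qed
 hence "hausdorff_pre n \<delta> (\<Union>i. A i) <= (\<Sum>k. hausdorff_weight n (D k))"
  unfolding hausdorff_pre_alt by (rule INF_lower)
 also have "... = (\<Sum>k. (%(i, j). hausdorff_weight n (C i j)) (prod_decode k))"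
  by (rule suminf_cong) (simp add: D_def split: prod.split)
 also have "... = (\<Sum>i. \<Sum>j. hausdorff_weight n (C i j))"
  by (rule suminf_ennreal_2dimen) simp
 also have "... <= (\<Sum>i. hausdorff_pre n \<delta> (A i) + ennreal (e * (1/2) ^ Suc i))"
  using C(2) by (intro suminf_le less_imp_le) auto
 also have "... = (\<Sum>i. hausdorff_pre n \<delta> (A i)) + (\<Sum>i. ennreal (e * (1/2) ^ Suc i))"
  by (rule suminf_add[symmetric]) auto
 also have "(\<Sum>i. ennreal (e * (1/2) ^ Suc i)) = ennreal (\<Sum>i. e * (1/2) ^ Suc i)"
  using e by (intro suminf_ennreal2 summable_mult sums_summable[OF power_half_series]) auto
 also have "(\<Sum>i. e * (1/2) ^ Suc i) = e"
  using suminf_mult[OF sums_summable[OF power_half_series], of e] sums_unique[OF power_half_series] by simp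
 finally show "hausdorff_pre n \<delta> (\<Union>i. A i) <= (\<Sum>i. hausdorff_pre n \<delta> (A i)) + ennreal e" .
qed

text \<open>A set of diameter less than \<open>d\<close> cannot meet both of two sets at distance \<open>d\<close>.\<close>

lemma hausdorff_pre_separated:
 assumes n: "n > 0" and \<delta>: "0 < \<delta>" "\<delta> < d" and sep: "!!a b. a : A ==> b : B ==> d <= dist a b"
 shows "hausdorff_pre n \<delta> A + hausdorff_pre n \<delta> B <= hausdorff_pre n \<delta> (A \<union> B)"
 unfolding hausdorff_pre_alt[of n \<delta> "A \<union> B"]
proof (rule INF_greatest)
 fix C assume C: "C : hausdorff_covers \<delta> (A \<union> B)"
 define CA where "CA i = (if C i \<inter> A = {} then {} else C i)" for i
 define CB where "CB i = (if C i \<inter> B = {} then {} else C i)" for i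
 have "CA : hausdorff_covers \<delta> A" "CB : hausdorff_covers \<delta> B"
  using C \<delta> unfolding hausdorff_covers_def CA_def CB_def by (auto simp: subset_iff) blast+
 hence "hausdorff_pre n \<delta> A + hausdorff_pre n \<delta> B <= (\<Sum>i. hausdorff_weight n (CA i)) + (\<Sum>i. hausdorff_weight n (CB i))"
  unfolding hausdorff_pre_alt by (intro add_mono INF_lower)
 also have "... = (\<Sum>i. hausdorff_weight n (CA i) + hausdorff_weight n (CB i))" by (rule suminf_add) auto
 also have "... <= (\<Sum>i. hausdorff_weight n (C i))"
 proof (rule suminf_le)
  fix i
  have "C i \<inter> A = {} | C i \<inter> B = {}"
  proof (rule ccontr)
   assume "\<not> ?thesis"
   then obtain a b where ab: "a : C i" "a : A" "b : C i" "b : B" by blast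
   have "dist a b <= diameter (C i)" using C ab by (intro diameter_bounded_bound) (auto simp: hausdorff_covers_def)
   also have "... <= \<delta>" using C by (simp add: hausdorff_covers_def)
   finally show False using sep[OF ab(2,4)] \<delta> by simp
  qed
  thus "hausdorff_weight n (CA i) + hausdorff_weight n (CB i) <= hausdorff_weight n (C i)"
   by (auto simp: CA_def CB_def hausdorff_weight_empty n)
 qed auto
 finally show "hausdorff_pre n \<delta> A + hausdorff_pre n \<delta> B <= (\<Sum>i. hausdorff_weight n (C i))" .
qed

definition hausdorff_outer :: "nat => 'a::metric_space set => ennreal" where
 "hausdorff_outer n A = (SUP \<delta>\<in>{0<..}. hausdorff_pre n \<delta> A)"

lemma hausdorff_outer_separated:
 assumes n: "n > 0" and d: "0 < d" and sep: "!!a b. a : A ==> b : B ==> d <= dist a b"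
 shows "hausdorff_outer n A + hausdorff_outer n B <= hausdorff_outer n (A \<union> B)"
proof -
 have le: "hausdorff_pre n \<delta> A + hausdorff_pre n \<delta>' B <= hausdorff_outer n (A \<union> B)" if "\<delta> > 0" "\<delta>' > 0" for \<delta> \<delta>'
 proof -
  define r where "r = min (min \<delta> \<delta>') (d/2)"
  have r: "0 < r" "r < d" "r <= \<delta>" "r <= \<delta>'" using that d by (auto simp: r_def)
  have "hausdorff_pre n \<delta> A + hausdorff_pre n \<delta>' B <= hausdorff_pre n r A + hausdorff_pre n r B"
   using r by (intro add_mono hausdorff_pre_antimono)
  also have "... <= hausdorff_pre n r (A \<union> B)" by (rule hausdorff_pre_separated[OF n r(1,2) sep])
  also have "... <= hausdorff_outer n (A \<union> B)" unfolding hausdorff_outer_def using r(1) by (intro SUP_upper) auto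
  finally show ?thesis .
 qed
 have ne: "{0<..} ~= ({} :: real set)" by (auto intro: gt_ex)
 have "hausdorff_outer n A + hausdorff_pre n \<delta>' B <= hausdorff_outer n (A \<union> B)" if "\<delta>' > 0" for \<delta>'
  unfolding hausdorff_outer_def[of n A] ennreal_SUP_add_left[OF ne, symmetric] using le that by (intro SUP_least) auto
 thus ?thesis
  unfolding hausdorff_outer_def[of n B] add.commute[of "hausdorff_outer n A"] ennreal_SUP_add_left[OF ne, symmetric]
  by (intro SUP_least) (simp add: add.commute)
qed

lemma sets_hausdorff_measure: "sets (hausdorff_measure n :: 'a::metric_space measure) = sets borel"
 "space (hausdorff_measure n :: 'a::metric_space measure) = UNIV"
proof -
 show "sets (hausdorff_measure n :: 'a measure) = sets borel"
  unfolding hausdorff_measure_def using sets.sigma_sets_eq[of "borel :: 'a measure"]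
  by (subst sets_measure_of) auto
 thus "space (hausdorff_measure n :: 'a measure) = UNIV" using sets_eq_imp_space_eq[of "hausdorff_measure n :: 'a measure" borel] by simp
qed

lemma emeasure_hausdorff_measure:
 assumes n: "n > 0" and A: "A : sets borel"
 shows "emeasure (hausdorff_measure n) A = hausdorff_outer n A"
  "hausdorff_pre n \<delta> A <= emeasure (hausdorff_measure n) A | \<delta> <= 0"
proof -
 have "measure_space UNIV (sets borel) (hausdorff_outer n :: 'a set => ennreal)"
 proof (rule caratheodory_criterion)
  show "hausdorff_outer n A <= hausdorff_outer n B" if "A <= B" for A B :: "'a set"
   unfolding hausdorff_outer_def using that by (intro SUP_mono) (auto intro: hausdorff_pre_mono)
  show "hausdorff_outer n (\<Union>i. A i) <= (\<Sum>i. hausdorff_outer n (A i))" for A :: "nat => 'a set"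
   unfolding hausdorff_outer_def[of n "\<Union>i. A i"]
  proof (rule SUP_least)
   fix \<delta> :: real assume "\<delta> : {0<..}"
   hence "(\<Sum>i. hausdorff_pre n \<delta> (A i)) <= (\<Sum>i. hausdorff_outer n (A i))"
    unfolding hausdorff_outer_def by (intro suminf_le SUP_upper) auto
   thus "hausdorff_pre n \<delta> (\<Union>i. A i) <= (\<Sum>i. hausdorff_outer n (A i))"
    using hausdorff_pre_countably_subadditive order_trans by blast
  qed
  show "hausdorff_outer n ({} :: 'a set) = 0"
   unfolding hausdorff_outer_def using hausdorff_pre_empty[OF n] by (intro SUP_eq_const) (auto intro: gt_ex)
 qed (rule hausdorff_outer_separated[OF n])
 moreover have "hausdorff_measure n = measure_of UNIV (sets borel) (hausdorff_outer n :: 'a set => ennreal)"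
  by (simp add: hausdorff_measure_def hausdorff_outer_def[abs_def])
 ultimately show e: "emeasure (hausdorff_measure n) A = hausdorff_outer n A"
 proof (intro emeasure_measure_of[of _ UNIV "sets borel"])
  have sb: "sets (hausdorff_measure n :: 'a measure) = sets borel" by (rule sets_hausdorff_measure)
  show "A : sets (hausdorff_measure n)" using A sb by simp
  assume ms: "measure_space UNIV (sets borel) (hausdorff_outer n :: 'a set => ennreal)"
  show "positive (sets (hausdorff_measure n)) (hausdorff_outer n :: 'a set => ennreal)"
   "countably_additive (sets (hausdorff_measure n)) (hausdorff_outer n :: 'a set => ennreal)"
   unfolding sb using ms by (simp_all add: measure_space_def)
 qed simp_all
 show "hausdorff_pre n \<delta> A <= emeasure (hausdorff_measure n) A | \<delta> <= 0"
  unfolding e hausdorff_outer_def by (cases "\<delta> > 0") (auto intro: SUP_upper)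
qed

section \<open>Integration over thin tubes\<close>

context hypersurface_tube
begin

text \<open>All points whose projection lies near \<open>y\<close> are close to the normal line through \<open>y\<close>: their
  displacement is normal to \<open>S\<close> at the projection, and the normal line turns slowly.\<close>

lemma near_normal_line:
 "EX c>=1. ALL y \<nu> x. y : S --> (ALL e. DQ y e = (\<nu> <.> e) *R \<nu>) --> infdist x S < R --> norm (P x - y) <= R / 4 -->
   norm (x - (y + (\<nu> <.> Q x) *R \<nu>)) <= c * norm (P x - y)"
proof -
 obtain C where C: "C >= 0" "!!x z e. closed_segment x z <= K ==> norm (DQ x e - DQ z e) <= C * norm (x - z) * norm e"
  using DQ_lipschitz by blast
 have "norm (x - (y + (\<nu> <.> Q x) *R \<nu>)) <= (1 + C * R) * norm (P x - y)"
  if y: "y : S" and \<nu>: "ALL e. DQ y e = (\<nu> <.> e) *R \<nu>" and x: "infdist x S < R" and d: "norm (P x - y) <= R / 4" for x y \<nu>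
 proof -
  have xV: "x : V" using x by (simp add: V_def)
  have seg: "closed_segment (P x) y <= K"
  proof
   fix w assume "w : closed_segment (P x) y"
   hence "dist w y <= dist (P x) y" using dist_in_closed_segment[of w "P x" y] by (simp add: dist_commute)
   hence "infdist w S <= R / 4" using infdist_le[OF y, of w] d by (simp add: dist_norm)
   thus "w : K" using R by (simp add: K_def)
  qed
  have "norm (Q x - DQ y (Q x)) <= C * norm (P x - y) * norm (Q x)"
   using C(2)[OF seg, of "Q x"] Q_normal[OF xV] by simp
  also have "... <= C * norm (P x - y) * R"
   using norm_Q[OF xV] x C(1) by (intro mult_left_mono) auto
  finally have 1: "norm (Q x - (\<nu> <.> Q x) *R \<nu>) <= C * R * norm (P x - y)" using \<nu> by (simp add: mult_ac)
  have "x - (y + (\<nu> <.> Q x) *R \<nu>) = (P x - y) + (Q x - (\<nu> <.> Q x) *R \<nu>)" by (simp add: Q_def)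
  hence "norm (x - (y + (\<nu> <.> Q x) *R \<nu>)) <= norm (P x - y) + norm (Q x - (\<nu> <.> Q x) *R \<nu>)"
   by (metis norm_triangle_ineq)
  thus ?thesis using 1 by (simp add: algebra_simps)
 qed
 thus ?thesis using C(1) R by (intro exI[of _ "1 + C * R"]) auto
qed

lemma segment_neighbourhood_measure:
 fixes y \<nu> :: "real^'d"
 assumes t: "0 < t" "t <= \<rho>" and c: "c >= 0" and \<nu>: "norm \<nu> = 1"
 shows "EX W:sets borel. {x. EX s. \<bar>s\<bar> <= \<rho> & norm (x - (y + s *R \<nu>)) <= c * t} <= W &
  emeasure lborel W <= ennreal (5 * unit_ball_vol (real CARD('d)) * (c + 1) ^ CARD('d) * \<rho> * t ^ (CARD('d) - 1))"
proof -
 define m where "m = \<lceil>\<rho> / t\<rceil>"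
 have m1: "real_of_int m <= \<rho> / t + 1" "\<rho> / t <= real_of_int m" unfolding m_def by linarith+
 have rt: "1 <= \<rho> / t" using t by simp
 have m0: "m >= 0" using m1(2) rt by linarith
 define W where "W = (\<Union>k\<in>{-m..m}. cball (y + (of_int k * t) *R \<nu>) ((c + 1) * t))"
 have sub: "{x. EX s. \<bar>s\<bar> <= \<rho> & norm (x - (y + s *R \<nu>)) <= c * t} <= W"
 proof clarify
  fix x s assume s: "\<bar>s\<bar> <= \<rho>" "norm (x - (y + s *R \<nu>)) <= c * t"
  define k where "k = \<lfloor>s / t\<rfloor>"
  have st: "\<bar>s / t\<bar> <= \<rho> / t" using s(1) t by (simp add: divide_right_mono)
  have "k <= m" unfolding k_def using st m1(2) by linarith
  moreover have "- m <= k" unfolding k_def using st m1(2) by linarith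
  moreover have "x : cball (y + (of_int k * t) *R \<nu>) ((c + 1) * t)"
  proof -
   have "of_int k <= s / t" "s / t < of_int k + 1" unfolding k_def by linarith+
   hence "of_int k * t <= s" "s < (of_int k + 1) * t" using t by (simp_all add: pos_le_divide_eq pos_divide_less_eq)
   hence "\<bar>s - of_int k * t\<bar> <= t" by (simp add: algebra_simps)
   hence a: "norm ((s - of_int k * t) *R \<nu>) <= t" using \<nu> by simp
   have eq: "x - (y + (of_int k * t) *R \<nu>) = (x - (y + s *R \<nu>)) + (s - of_int k * t) *R \<nu>" by (simp add: scaleR_diff_left)
   have "norm (x - (y + (of_int k * t) *R \<nu>)) <= c * t + t"
    unfolding eq using norm_triangle_ineq[of "x - (y + s *R \<nu>)" "(s - of_int k * t) *R \<nu>"] a s(2) by linarith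
   thus ?thesis by (simp add: dist_norm norm_minus_commute algebra_simps)
  qed
  ultimately show "x : W" unfolding W_def by auto
 qed
 let ?v = "unit_ball_vol (real CARD('d)) * ((c + 1) * t) ^ CARD('d)"
 have "emeasure lborel W <= (\<Sum>k\<in>{-m..m}. emeasure lborel (cball (y + (of_int k * t) *R \<nu>) ((c + 1) * t)))"
  unfolding W_def by (intro emeasure_subadditive_finite) auto
 also have "... = (\<Sum>k\<in>{-m..m}. ennreal ?v)"
  using c t by (intro sum.cong refl) (simp add: emeasure_cball)
 also have "... = ennreal (real (card {-m..m}) * ?v)"
  by (simp add: ennreal_mult' ennreal_of_nat_eq_real_of_nat)
 also have "... <= ennreal (5 * unit_ball_vol (real CARD('d)) * (c + 1) ^ CARD('d) * \<rho> * t ^ (CARD('d) - 1))"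
 proof (rule ennreal_leI)
  have "real (card {-m..m}) = 2 * real_of_int m + 1" using m0 by simp
  also have "... <= 5 * (\<rho> / t)" using m1(1) rt by simp
  finally have "real (card {-m..m}) * ?v <= 5 * (\<rho> / t) * ?v" using c t by (intro mult_right_mono) auto
  also have "... = 5 * unit_ball_vol (real CARD('d)) * (c + 1) ^ CARD('d) * \<rho> * (t ^ CARD('d) / t)"
   by (simp add: power_mult_distrib)
  also have "t ^ CARD('d) / t = t ^ (CARD('d) - 1)"
   using t by (simp add: power_diff)
  finally show "real (card {-m..m}) * ?v <= 5 * unit_ball_vol (real CARD('d)) * (c + 1) ^ CARD('d) * \<rho> * t ^ (CARD('d) - 1)" .
 qed
 finally show ?thesis using sub by (intro bexI[of _ W]) (auto simp: W_def)
qed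

lemma tube_slice_cover:
 assumes d2: "CARD('d) >= 2"
 shows "EX C>=0. ALL \<rho> E. 0 < \<rho> --> \<rho> <= R / 4 --> bounded E --> diameter E <= \<rho> -->
  (EX W:sets borel. {x. infdist x S < \<rho> & P x : E} <= W & emeasure lborel W <= ennreal (C * \<rho> * diameter E ^ (CARD('d) - 1)))"
proof -
 obtain c where c: "c >= 1" "!!y \<nu> x. y : S ==> (ALL e. DQ y e = (\<nu> <.> e) *R \<nu>) ==> infdist x S < R ==> norm (P x - y) <= R / 4 ==>
   norm (x - (y + (\<nu> <.> Q x) *R \<nu>)) <= c * norm (P x - y)" using near_normal_line by blast
 define C where "C = 5 * unit_ball_vol (real CARD('d)) * (c + 1) ^ CARD('d)"
 have C0: "C >= 0" using c(1) by (simp add: C_def)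
 have "EX W:sets borel. {x. infdist x S < \<rho> & P x : E} <= W & emeasure lborel W <= ennreal (C * \<rho> * diameter E ^ (CARD('d) - 1))"
  if \<rho>: "0 < \<rho>" "\<rho> <= R / 4" and E: "bounded E" "diameter E <= \<rho>" for \<rho> E
 proof (cases "EX y:E. y : S")
  case False
  hence "{x. infdist x S < \<rho> & P x : E} = {}" using P_in \<rho> R by (auto simp: V_def)
  thus ?thesis by (intro bexI[of _ "{}"]) auto
 next
  case True
  then obtain y where y: "y : E" "y : S" by blast
  obtain \<nu> where \<nu>: "norm \<nu> = 1" "!!e. DQ y e = (\<nu> <.> e) *R \<nu>" using DQ_on_S[OF y(2)] by blast
  let ?t = "diameter E"
  have t0: "?t >= 0" using E(1) by (rule diameter_ge_0)
  have pt: "\<bar>\<nu> <.> Q x\<bar> <= \<rho> & norm (x - (y + (\<nu> <.> Q x) *R \<nu>)) <= c * ?t" if x: "infdist x S < \<rho>" "P x : E" for x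
  proof
   have xR: "infdist x S < R" using x(1) \<rho> R by linarith
   have Pt: "norm (P x - y) <= ?t" using diameter_bounded_bound[OF E(1) x(2) y(1)] by (simp add: dist_norm)
   have "\<bar>\<nu> <.> Q x\<bar> <= norm \<nu> * norm (Q x)" by (rule Cauchy_Schwarz_ineq2)
   thus "\<bar>\<nu> <.> Q x\<bar> <= \<rho>" using \<nu>(1) norm_Q[of x] xR x(1) by (simp add: V_def)
   have "norm (x - (y + (\<nu> <.> Q x) *R \<nu>)) <= c * norm (P x - y)"
    by (rule c(2)[OF y(2) _ xR]) (use \<nu>(2) Pt E(2) \<rho>(2) in auto)
   also have "... <= c * ?t" using c(1) Pt by (intro mult_left_mono) auto
   finally show "norm (x - (y + (\<nu> <.> Q x) *R \<nu>)) <= c * ?t" .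
  qed
  show ?thesis
  proof (cases "?t = 0")
   case t: False
   have "EX W:sets borel. {x. EX s. \<bar>s\<bar> <= \<rho> & norm (x - (y + s *R \<nu>)) <= c * ?t} <= W &
     emeasure lborel W <= ennreal (5 * unit_ball_vol (real CARD('d)) * (c + 1) ^ CARD('d) * \<rho> * ?t ^ (CARD('d) - 1))"
    by (rule segment_neighbourhood_measure) (use t t0 E(2) c(1) \<nu>(1) in auto)
   thus ?thesis using pt unfolding C_def by (elim bexE) (intro bexI, auto)
  next
   case t: True
   define W where "W = (+) y ` span {\<nu>}"
   have "{x. infdist x S < \<rho> & P x : E} <= W"
   proof clarify
    fix x assume "infdist x S < \<rho>" "P x : E"
    hence "x = y + (\<nu> <.> Q x) *R \<nu>" using pt[of x] t by simp
    moreover have "(\<nu> <.> Q x) *R \<nu> : span {\<nu>}" by (simp add: span_base span_scale)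
    ultimately show "x : W" unfolding W_def by blast
   qed
   moreover have "closed W" unfolding W_def by (intro closed_translation) (simp add: closed_subspace)
   moreover have "negligible W"
   proof -
    have "dim (span {\<nu>}) <= 1" by (simp add: dim_singleton)
    hence "negligible (span {\<nu>})" using d2 by (intro negligible_lowdim) (simp add: dim_span)
    thus ?thesis unfolding W_def by (rule negligible_translation)
   qed
   ultimately have "emeasure lebesgue W = 0" "emeasure lebesgue W = emeasure lborel W"
    by (auto simp: negligible_iff_null_sets emeasure_completion)
   hence "emeasure lborel W = 0" by simp
   thus ?thesis using \<open>{x. infdist x S < \<rho> & P x : E} <= W\<close> \<open>closed W\<close> by (intro bexI[of _ W]) auto
  qed
 qed
 thus ?thesis using C0 by blast
qed

lemma tube_measure_le_hausdorff:
 assumes d2: "CARD('d) >= 2"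
 shows "EX C>0. ALL \<rho> A. 0 < \<rho> --> \<rho> <= R / 4 --> A : sets borel -->
  emeasure lborel {x. infdist x S < \<rho> & P x : A} <= ennreal (C * \<rho>) * emeasure (hausdorff_measure (CARD('d) - 1)) A"
proof -
 let ?n = "CARD('d) - 1"
 have n: "?n > 0" using d2 by simp
 obtain C where C: "C >= 0" "!!\<rho> E. 0 < \<rho> ==> \<rho> <= R / 4 ==> bounded E ==> diameter E <= \<rho> ==>
  EX W:sets borel. {x. infdist x S < \<rho> & P x : E} <= W & emeasure lborel W <= ennreal (C * \<rho> * diameter E ^ ?n)"
  using tube_slice_cover[OF d2] by blast
 obtain u where u_def: "u = unit_ball_vol (real ?n)" by simp
 have u: "u > 0" unfolding u_def by (rule unit_ball_vol_pos) simp
 define C' where "C' = C * 2 ^ ?n / u + 1"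
 have C': "C' > 0" using C(1) u by (auto simp: C'_def intro: add_nonneg_pos)
 have "emeasure lborel {x. infdist x S < \<rho> & P x : A} <= ennreal (C' * \<rho>) * emeasure (hausdorff_measure ?n) A"
  if \<rho>: "0 < \<rho>" "\<rho> <= R / 4" and A: "A : sets borel" for \<rho> A
 proof -
  let ?X = "{x. infdist x S < \<rho> & P x : A}"
  let ?c = "ennreal (C' * \<rho>)"
  have c: "?c ~= 0" "?c ~= top" "0 < C' * \<rho>" using C' \<rho>(1) by auto
  have "emeasure lborel ?X / ?c <= hausdorff_pre ?n \<rho> A"
   unfolding hausdorff_pre_alt
  proof (rule INF_greatest)
   fix E assume E: "E : hausdorff_covers \<rho> A"
   hence bd: "bounded (E i)" "diameter (E i) <= \<rho>" for i by (auto simp: hausdorff_covers_def)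
   have "ALL i. EX W. W : sets borel & {x. infdist x S < \<rho> & P x : E i} <= W & emeasure lborel W <= ennreal (C * \<rho> * diameter (E i) ^ ?n)"
    using C(2)[OF \<rho> bd] by (intro allI) (simp only: Bex_def)
   from choice[OF this] obtain W where W0: "ALL i. W i : sets borel & {x. infdist x S < \<rho> & P x : E i} <= W i & emeasure lborel (W i) <= ennreal (C * \<rho> * diameter (E i) ^ ?n)"
    by (elim exE)
   hence W: "W i : sets borel" "{x. infdist x S < \<rho> & P x : E i} <= W i"
    "emeasure lborel (W i) <= ennreal (C * \<rho> * diameter (E i) ^ ?n)" for i by simp_all
   have "A <= (\<Union>i. E i)" using E by (simp add: hausdorff_covers_def)
   hence "?X <= (\<Union>i. W i)" using W(2) by blast
   hence "emeasure lborel ?X <= emeasure lborel (\<Union>i. W i)" using W(1) by (intro emeasure_mono) auto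
   also have "... <= (\<Sum>i. emeasure lborel (W i))" using W(1) by (intro emeasure_subadditive_countably) auto
   also have "... <= (\<Sum>i. ?c * hausdorff_weight ?n (E i))"
   proof (rule suminf_le)
    fix i
    have dE: "diameter (E i) >= 0" using E by (intro diameter_ge_0) (simp add: hausdorff_covers_def)
    have "C * \<rho> * diameter (E i) ^ ?n = (C * 2 ^ ?n / u) * \<rho> * (u * (diameter (E i) / 2) ^ ?n)"
     using u by (simp add: power_divide)
    also have "... <= C' * \<rho> * (u * (diameter (E i) / 2) ^ ?n)"
     using \<rho>(1) dE u by (intro mult_right_mono) (auto simp: C'_def)
    finally have "ennreal (C * \<rho> * diameter (E i) ^ ?n) <= ennreal (C' * \<rho> * (u * (diameter (E i) / 2) ^ ?n))"
     by (rule ennreal_leI)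
    also have "... = ?c * hausdorff_weight ?n (E i)"
     unfolding hausdorff_weight_def u_def[symmetric] using c(3) by (intro ennreal_mult') simp
    finally show "emeasure lborel (W i) <= ?c * hausdorff_weight ?n (E i)" using W(3)[of i] by (rule order_trans[rotated])
   qed auto
   also have "... = ?c * (\<Sum>i. hausdorff_weight ?n (E i))" by (rule ennreal_suminf_cmult)
   finally have "emeasure lborel ?X <= ?c * (\<Sum>i. hausdorff_weight ?n (E i))" .
   moreover have "0 < ?c" using c(3) by simp
   ultimately show "emeasure lborel ?X / ?c <= (\<Sum>i. hausdorff_weight ?n (E i))"
    by (intro divide_le_posI_ennreal)
  qed
  also have "... <= emeasure (hausdorff_measure ?n) A"
   using emeasure_hausdorff_measure(2)[OF n A, of \<rho>] \<rho>(1) by auto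
  finally have "emeasure lborel ?X / ?c * ?c <= emeasure (hausdorff_measure ?n) A * ?c" by (rule mult_right_mono) simp
  moreover have "emeasure lborel ?X / ?c * ?c = emeasure lborel ?X"
  proof -
   have "emeasure lborel ?X / ?c * ?c = emeasure lborel ?X * ?c / ?c" by (simp add: ennreal_times_divide mult.commute)
   thus ?thesis using c by (simp add: ennreal_mult_divide_eq)
  qed
  ultimately show ?thesis by (simp add: mult.commute)
 qed
 thus ?thesis using C' by blast
qed

lemma tube_integral_le_hausdorff:
 assumes d2: "CARD('d) >= 2"
 shows "EX C>0. ALL \<rho> g. 0 < \<rho> --> \<rho> <= R / 4 --> g : borel_measurable borel -->
  (\<integral>\<^sup>+x. g (P x) * indicator {x. infdist x S < \<rho>} x \<partial>lborel) <= ennreal (C * \<rho>) * (\<integral>\<^sup>+y. g y \<partial>hausdorff_measure (CARD('d) - 1))"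
proof -
 let ?H = "hausdorff_measure (CARD('d) - 1) :: (real^'d) measure"
 obtain C where C: "C > 0" "!!\<rho> A. 0 < \<rho> ==> \<rho> <= R / 4 ==> A : sets borel ==>
  emeasure lborel {x. infdist x S < \<rho> & P x : A} <= ennreal (C * \<rho>) * emeasure ?H A"
  using tube_measure_le_hausdorff[OF d2] by blast
 have "(\<integral>\<^sup>+x. g (P x) * indicator {x. infdist x S < \<rho>} x \<partial>lborel) <= ennreal (C * \<rho>) * (\<integral>\<^sup>+y. g y \<partial>?H)"
  if \<rho>: "0 < \<rho>" "\<rho> <= R / 4" and g: "g : borel_measurable borel" for \<rho> g
 proof -
  let ?T = "{x. infdist x S < \<rho>}"
  have oT: "open ?T" by (intro open_Collect_less continuous_intros)
  have sub: "?T <= V" using \<rho> R by (auto simp: V_def)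
  have Tb: "?T : sets borel" using oT by simp
  let ?M = "restrict_space lborel ?T"
  have Pm: "P : measurable ?M borel"
   using borel_measurable_continuous_on_restrict[OF continuous_on_subset[OF continuous_P sub]]
   by (simp cong: measurable_cong_sets add: sets_restrict_space)
  let ?D = "distr ?M borel P" and ?E = "density ?H (%y. ennreal (C * \<rho>))"
  have "(\<integral>\<^sup>+x. g (P x) * indicator ?T x \<partial>lborel) = (\<integral>\<^sup>+x. g (P x) \<partial>?M)"
   using Tb by (simp add: nn_integral_restrict_space)
  also have "... = (\<integral>\<^sup>+y. g y \<partial>?D)" by (rule nn_integral_distr[OF Pm, symmetric]) (use g in simp)
  also have "... <= (\<integral>\<^sup>+y. g y \<partial>?E)"
  proof (rule nn_integral_mono_measure)
   show "sets ?D = sets ?E" by (simp add: sets_hausdorff_measure)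
   show "?D <= ?E"
   proof (rule le_measure[THEN iffD2])
    show "sets ?D = sets ?E" by (simp add: sets_hausdorff_measure)
    show "ALL A:sets ?D. emeasure ?D A <= emeasure ?E A"
    proof
     fix A assume "A : sets ?D"
     hence A: "A : sets borel" by simp
     have "emeasure ?D A = emeasure ?M (P -` A \<inter> ?T)"
      using A by (subst emeasure_distr[OF Pm]) (auto simp: space_restrict_space)
     also have "... = emeasure lborel (P -` A \<inter> ?T)" using Tb by (intro emeasure_restrict_space) auto
     also have "P -` A \<inter> ?T = {x. infdist x S < \<rho> & P x : A}" by auto
     also have "emeasure lborel ... <= ennreal (C * \<rho>) * emeasure ?H A" by (rule C(2)[OF \<rho> A])
     also have "... = emeasure ?E A" using A by (simp add: emeasure_density_const sets_hausdorff_measure)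
     finally show "emeasure ?D A <= emeasure ?E A" .
    qed
   qed
  qed
  also have "... = ennreal (C * \<rho>) * (\<integral>\<^sup>+y. g y \<partial>?H)"
   using g by (subst nn_integral_density) (auto simp: nn_integral_cmult measurable_cong_sets[OF sets_hausdorff_measure(1) refl])
  finally show ?thesis .
 qed
 thus ?thesis using C(1) by blast
qed

end

section \<open>The divergence theorem in an annulus\<close>

lemma compact_integrable_indicator:
 fixes f :: "'a::euclidean_space => real"
 assumes "compact A" "continuous_on A f"
 shows "integrable lebesgue (%x. indicator A x * f x)"
 using borel_integrable_compact[OF assms] by (simp add: integrable_completion borel_measurable_integrable)

context hypersurface_tube
begin

lemma open_V_S: "open (V - S)" using open_V S_basic(2) by (simp add: open_Diff)

lemma continuous_DN: "continuous_on (V - S) (%x. DN x e)"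
proof -
 have "continuous_on V (%x. DQ x e)"
  using has_derivative_C1_any_direction[OF C_on_Q open_V, of 0 e] by (simp add: DQ_def)
 hence "continuous_on (V - S) (%x. DQ x e)" by (rule continuous_on_subset) auto
 moreover have "infdist x S ~= 0" if "x : V - S" for x using S_basic(5)[of x] that by auto
 ultimately show ?thesis unfolding DN_def by (intro continuous_intros continuous_N) auto
qed

lemma C1_N: "C_on (Suc 0) (V - S) N"
 by (rule C_on_SucI[OF open_V_S, where f'=DN]) (auto intro!: has_derivative_N continuous_DN)

lemma C1_N_component: "C_on (Suc 0) (V - S) (%x. N x $ i)"
 by (rule C_on_linear_image[OF bounded_linear_vec_nth open_V_S C1_N])

definition trDN :: "real^'d => real" where "trDN x = (\<Sum>i\<in>UNIV. DN x (axis i 1) $ i)"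

lemma continuous_trDN: "continuous_on (V - S) trDN"
 unfolding trDN_def by (intro continuous_intros continuous_DN)

lemma trDN_bounded: "EX C>=0. ALL x:K - S. \<bar>trDN x\<bar> <= C"
proof -
 obtain C where C: "C >= 0" "!!x e. x : K - S ==> norm (DN x e) <= C * norm e" using DN_bounded by blast
 have "\<bar>trDN x\<bar> <= real CARD('d) * C" if "x : K - S" for x
 proof -
  have "\<bar>trDN x\<bar> <= (\<Sum>i\<in>UNIV. \<bar>DN x (axis i 1) $ i\<bar>)" unfolding trDN_def by (rule sum_abs)
  also have "... <= (\<Sum>i\<in>(UNIV::'d set). C)"
  proof (rule sum_mono)
   fix i show "\<bar>DN x (axis i 1) $ i\<bar> <= C"
    using component_le_norm_cart[of "DN x (axis i 1)" i] C(2)[OF that, of "axis i 1"] by simp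
  qed
  finally show ?thesis by simp
 qed
 thus ?thesis using C(1) by (intro exI[of _ "real CARD('d) * C"]) auto
qed

definition annulus :: "real => real => (real^'d) set" where
 "annulus p q = {x. p <= infdist x S & infdist x S <= q}"

lemma compact_annulus: "compact (annulus p q)"
proof -
 have "annulus p q = {x. infdist x S <= q} \<inter> {x. p <= infdist x S}" by (auto simp: annulus_def)
 moreover have "closed {x. p <= infdist x S}" by (intro closed_Collect_le continuous_intros)
 ultimately show ?thesis unfolding compact_eq_bounded_closed
  using closed_infdist_le[of q] bounded_infdist_le[of q] by (auto intro: bounded_subset)
qed

lemma annulus_subset: "0 < p ==> q <= 3/4 * R ==> annulus p q <= K - S" "0 < p ==> q <= 3/4 * R ==> annulus p q <= V - S"
 using K_subset_V by (auto simp: annulus_def K_def)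

text \<open>The field \<open>w\<^sup>2 b(d) N\<close>, where \<open>d\<close> is the distance to \<open>S\<close>, is supported in an annulus, so the integral
  of its divergence vanishes.\<close>

lemma divergence_identity:
 assumes c: "0 < c1" "c2 <= 3/4 * R" and w: "C_on (Suc 0) (V - S) w"
  and b: "!!z. 0 < z ==> (b has_real_derivative b' z) (at z)" "continuous_on {0<..} b'"
   "!!z. z <= c1 ==> b z = 0" "!!z. z >= c2 ==> b z = 0"
 shows "integral\<^sup>L lebesgue (%x. indicator (V - S) x * (2 * w x * b (infdist x S) * (grad w x <.> N x)
   + (w x)^2 * b' (infdist x S) + (w x)^2 * b (infdist x S) * trDN x)) = 0"
proof -
 let ?U = "V - S"
 have dpos: "infdist x S > 0" if "x : ?U" for x using S_basic(5,6)[of x] that by force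
 have db: "((%x. b (infdist x S)) has_derivative (%e. b' (infdist x S) * (N x <.> e))) (at x)" if x: "x : ?U" for x
 proof -
  have "(b has_derivative (*) (b' (infdist x S))) (at (infdist x S))"
   using b(1)[OF dpos[OF x]] by (simp add: has_field_derivative_def)
  from has_derivative_compose[OF has_derivative_infdist this] x show ?thesis by auto
 qed
 have cb: "continuous_on ?U (%x. b' (infdist x S))"
  by (intro continuous_on_compose2[OF b(2)] continuous_intros) (use dpos in auto)
 have Cb: "C_on (Suc 0) ?U (%x. b (infdist x S))"
  by (rule C_on_SucI[OF open_V_S db]) (auto intro!: continuous_intros cb continuous_N)
 have dw: "(w has_derivative (%e. grad w x <.> e)) (at x)" if "x : ?U" for x
  using w that by (intro has_derivative_grad) simp
 define X where "X i x = (w x * w x) * (b (infdist x S) * N x $ i)" for i x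
 have XC: "C_on (Suc 0) ?U (X i)" for i
  unfolding X_def by (intro C_on_mult open_V_S w Cb C1_N_component)
 have Xz: "X i x = 0" if "x ~: annulus c1 c2" for i x
  using b(3,4)[of "infdist x S"] that by (auto simp: X_def annulus_def)
 have An: "annulus c1 c2 <= ?U" by (rule annulus_subset(2)[OF c])
 have Ac: "closed (annulus c1 c2)" using compact_annulus by (simp add: compact_imp_closed)
 have Xll: "locally_lipschitz_on UNIV (X i)" for i
  unfolding locally_lipschitz_on_def
 proof
  fix x
  show "EX r>0. EX L. L-lipschitz_on (ball x r) (X i)"
  proof (cases "x : ?U")
   case True
   thus ?thesis using C1_imp_locally_lipschitz[OF XC open_V_S, of i] unfolding locally_lipschitz_on_def by blast
  next
   case False
   hence "x : - annulus c1 c2" using An by blast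
   then obtain r where r: "r > 0" "ball x r <= - annulus c1 c2" using Ac open_contains_ball[of "- annulus c1 c2"] by (auto simp: open_Compl)
   have "0-lipschitz_on (ball x r) (X i)"
    by (rule lipschitz_onI) (use r Xz in \<open>auto simp: subset_iff\<close>)
   thus ?thesis using r(1) by blast
  qed
 qed
 obtain B where B: "!!x. x : annulus c1 c2 ==> norm x <= B"
  using compact_imp_bounded[OF compact_annulus] bounded_iff by metis
 have Xsup: "X i x = 0" if "norm x > B" for i x using Xz[of x i] B[of x] that by fastforce
 define row where "row i x = (\<chi> j. DN x (axis j 1) $ i)" for i x
 have DNrow: "DN x e $ i = row i x <.> e" if "x : ?U" for x e i
 proof -
  have "linear (%e. DN x e $ i)"
   using has_derivative_linear[OF has_derivative_N[of x]] that linear_compose[of "DN x" "%v. v $ i"]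
   by (simp add: o_def bounded_linear.linear[OF bounded_linear_vec_nth])
  thus ?thesis unfolding row_def by (rule linear_functional_eq_inner)
 qed
 define G where "G i x = indicator ?U x *R ((2 * w x * b (infdist x S) * N x $ i) *R grad w x
   + ((w x)^2 * b' (infdist x S) * N x $ i) *R N x + ((w x)^2 * b (infdist x S)) *R row i x)" for i x
 have dX: "(X i has_derivative (%e. G i x <.> e)) (at x)" for i x
 proof (cases "x : ?U")
  case True
  have dN: "((%x. N x $ i) has_derivative (%e. row i x <.> e)) (at x)"
   using bounded_linear.has_derivative[OF bounded_linear_vec_nth has_derivative_N[of x]] True DNrow[OF True] by auto
  show ?thesis unfolding X_def
   by (rule has_derivative_eq_rhs[OF has_derivative_mult[OF has_derivative_mult[OF dw[OF True] dw[OF True]] has_derivative_mult[OF db[OF True] dN]]])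
     (use True in \<open>simp add: G_def fun_eq_iff inner_add_left power2_eq_square algebra_simps\<close>)
 next
  case False
  hence xA: "x : - annulus c1 c2" using An by blast
  have oA: "open (- annulus c1 c2)" using Ac by (simp add: open_Compl)
  have z: "((%x. 0::real) has_derivative (%e. 0)) (at x)" by simp
  have "(X i has_derivative (%e. 0)) (at x)"
   by (rule has_derivative_transform_within_open[OF z oA xA]) (metis Xz ComplD)
  thus ?thesis using False by (simp add: G_def)
 qed
 have GI: "integrable lebesgue (G i)" and G0: "integral\<^sup>L lebesgue (G i) = 0" for i
 proof -
  have ae: "AE x in lebesgue. x : UNIV --> (X i has_derivative (%e. G i x <.> e)) (at x)" using dX by (intro AE_I2) blast
  have s: "UNIV : sets lebesgue" by simp
  show "integrable lebesgue (G i)" using compactly_supported_lipschitz_gradient(1)[OF Xll Xsup s ae] by simp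
  show "integral\<^sup>L lebesgue (G i) = 0" using compactly_supported_lipschitz_gradient(2)[OF Xll Xsup s ae refl] .
 qed
 have "integral\<^sup>L lebesgue (%x. \<Sum>i\<in>UNIV. G i x $ i) = (\<Sum>i\<in>UNIV. integral\<^sup>L lebesgue (%x. G i x $ i))"
  using GI by (intro Bochner_Integration.integral_sum integrable_bounded_linear[OF bounded_linear_vec_nth]) auto
 also have "... = 0" using G0 integral_bounded_linear[OF bounded_linear_vec_nth GI] by (intro sum.neutral) simp
 also have "(%x. \<Sum>i\<in>UNIV. G i x $ i) = (%x. indicator ?U x * (2 * w x * b (infdist x S) * (grad w x <.> N x)
   + (w x)^2 * b' (infdist x S) + (w x)^2 * b (infdist x S) * trDN x))"
 proof
  fix x
  show "(\<Sum>i\<in>UNIV. G i x $ i) = indicator ?U x * (2 * w x * b (infdist x S) * (grad w x <.> N x)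
   + (w x)^2 * b' (infdist x S) + (w x)^2 * b (infdist x S) * trDN x)"
  proof (cases "x : ?U")
   case True
   have "(\<Sum>i\<in>UNIV. G i x $ i) = (\<Sum>i\<in>UNIV. 2 * w x * b (infdist x S) * (grad w x $ i * N x $ i)
     + (w x)^2 * b' (infdist x S) * (N x $ i * N x $ i) + (w x)^2 * b (infdist x S) * (DN x (axis i 1) $ i))"
    using True by (intro sum.cong refl) (simp add: G_def row_def mult_ac)
   also have "... = 2 * w x * b (infdist x S) * (\<Sum>i\<in>UNIV. grad w x $ i * N x $ i)
     + (w x)^2 * b' (infdist x S) * (\<Sum>i\<in>UNIV. N x $ i * N x $ i) + (w x)^2 * b (infdist x S) * trDN x"
    unfolding trDN_def sum_distrib_left sum.distrib by simp
   also have "(\<Sum>i\<in>UNIV. grad w x $ i * N x $ i) = grad w x <.> N x" by (simp add: inner_vec_def)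
   also have "(\<Sum>i\<in>UNIV. N x $ i * N x $ i) = 1"
   proof -
    have "N x <.> N x = 1" using norm_N[of x] True by (simp add: dot_square_norm)
    thus ?thesis by (simp add: inner_vec_def)
   qed
   finally show ?thesis using True by simp
  qed (simp add: G_def)
 qed
 finally show ?thesis .
qed

end

section \<open>Hardy inequality near a hypersurface\<close>

lemma smooth_step_derivative:
 assumes "cutoff \<phi>"
 shows "EX (H :: real => real) H' M. (ALL t. (H has_real_derivative H' t) (at t)) & continuous_on UNIV H' & (ALL t. 0 <= H' t & H' t <= M) &
  (ALL t. t < 0 | t > 1 --> H' t = 0) & (ALL t<=0. H t = 0) & (ALL t>=1. H t = 1) & (ALL t. 0 <= H t & H t <= 1)"
proof -
 obtain H :: "real => real" where H: "!!k. C_on k UNIV H" "!!t. t <= 0 ==> H t = 0" "!!t. t >= 1 ==> H t = 1"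
  "!!t. 0 <= H t" "!!t. H t <= 1" "mono H" using smooth_step_exists[OF assms] by blast
 define H' where "H' t = frechet_derivative H (at t) 1" for t
 have d: "(H has_real_derivative H' t) (at t)" for t
 proof -
  have f: "(H has_derivative frechet_derivative H (at t)) (at t)"
   using C_on_Suc_has_derivative[OF H(1)] by simp
  have "frechet_derivative H (at t) = (*) (H' t)"
  proof
   fix e :: real
   have "frechet_derivative H (at t) (e *R 1) = e *R frechet_derivative H (at t) 1"
    by (rule linear_scale[OF has_derivative_linear[OF f]])
   thus "frechet_derivative H (at t) e = H' t * e" by (simp add: H'_def)
  qed
  thus ?thesis using f by (simp add: has_field_derivative_def)
 qed
 have c: "continuous_on UNIV H'" using H(1)[of 1] by (simp add: H'_def[abs_def])
 have nn: "H' t >= 0" for t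
 proof (rule ccontr)
  assume "\<not> 0 <= H' t"
  then obtain e where "e > 0" "!!h. 0 < h ==> h < e ==> H (t + h) < H t" using DERIV_neg_dec_right[OF d[of t]] by auto
  hence "H (t + e/2) < H t" by simp
  moreover have "H t <= H (t + e/2)" using H(6) \<open>e > 0\<close> by (simp add: monoD)
  ultimately show False by simp
 qed
 have z: "H' t = 0" if "t < 0 | t > 1" for t
 proof -
  have "(H has_real_derivative 0) (at t)"
  proof (cases "t < 0")
   case True
   have "((%x::real. 0::real) has_real_derivative 0) (at t)" by simp
   thus ?thesis
    by (rule has_field_derivative_transform_within_open[where S="{..<0}"]) (use True H(2) in auto)
  next
   case False
   hence "t > 1" using that by simp
   have "((%x::real. 1::real) has_real_derivative 0) (at t)" by simp
   thus ?thesis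
    by (rule has_field_derivative_transform_within_open[where S="{1<..}"]) (use \<open>t > 1\<close> H(3) in auto)
  qed
  thus ?thesis using d DERIV_unique by blast
 qed
 have "bounded (H' ` {0..1})" by (intro compact_imp_bounded compact_continuous_image continuous_on_subset[OF c]) auto
 then obtain M where "ALL t:{0..1}. \<bar>H' t\<bar> <= M" unfolding bounded_iff by auto
 hence M: "\<bar>H' t\<bar> <= M" if "t : {0..1}" for t using that by blast
 have "H' t <= \<bar>M\<bar>" for t using M[of t] z[of t] by (cases "t : {0..1}") auto
 thus ?thesis using d c nn z H(2-5) by (intro exI[of _ H] exI[of _ H'] exI[of _ "\<bar>M\<bar>"]) blast
qed

lemma absorb_cross_term:
 fixes q s w W :: real
 assumes "0 <= q" "q <= 1" "s > 0"
 shows "2 * w * (q / s) * W <= w^2 * (q / s^2) / 4 + 4 * W^2"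
proof -
 have "0 <= (w / (2 * s) - 2 * W)^2" by simp
 also have "... = w^2 / (4 * s^2) - 2 * w * W / s + 4 * W^2"
  using assms(3) by (simp add: power2_eq_square field_simps)
 finally have "2 * w * W / s <= w^2 / (4 * s^2) + 4 * W^2" by simp
 hence "q * (2 * w * W / s) <= q * (w^2 / (4 * s^2) + 4 * W^2)" using assms(1) by (rule mult_left_mono)
 also have "... <= q * (w^2 / (4 * s^2)) + 1 * (4 * W^2)"
  using assms(2) mult_right_mono[OF assms(2), of "4 * W^2"] by (simp add: distrib_left)
 finally show ?thesis by (simp add: field_simps)
qed

context hypersurface_tube
begin

abbreviation "D x == infdist x S"

lemma ramp_product_derivative:
 fixes \<rho> :: real
 assumes H: "!!t. (H has_real_derivative H' t) (at t)" "continuous_on UNIV H'" and \<rho>: "\<rho> > 0"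
 defines "q == (%z. H (2 * z / \<rho> - 1) * H ((R/2 - z) / (R/4)))"
  and "q' == (%z. H' (2 * z / \<rho> - 1) * (2 / \<rho>) * H ((R/2 - z) / (R/4)) - H (2 * z / \<rho> - 1) * (H' ((R/2 - z) / (R/4)) * (4 / R)))"
 shows "(q has_real_derivative q' z) (at z)" "continuous_on UNIV q'" "continuous_on UNIV q"
proof -
 have 1: "((%z. H (2 * z / \<rho> - 1)) has_real_derivative H' (2 * z / \<rho> - 1) * (2 / \<rho>)) (at z)" for z
  by (rule DERIV_chain2[OF H(1)]) (use \<rho> in \<open>auto intro!: derivative_eq_intros\<close>)
 have 2: "((%z. H ((R/2 - z) / (R/4))) has_real_derivative H' ((R/2 - z) / (R/4)) * (- 4 / R)) (at z)" for z
  by (rule DERIV_chain2[OF H(1)]) (use R in \<open>auto intro!: derivative_eq_intros simp: field_simps\<close>)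
 show d: "(q has_real_derivative q' z) (at z)" for z
  unfolding q_def q'_def using DERIV_mult[OF 1 2, of z] by (rule DERIV_cong) (simp add: algebra_simps)
 have cH: "continuous_on UNIV H" using H(1) by (meson DERIV_isCont continuous_at_imp_continuous_on)
 show "continuous_on UNIV q'"
  unfolding q'_def by (intro continuous_intros continuous_on_compose2[OF H(2)] continuous_on_compose2[OF cH]) (use R \<rho> in auto)
 show "continuous_on UNIV q" using d by (meson DERIV_isCont continuous_at_imp_continuous_on)
qed

lemma continuous_on_C1_grad_N:
 assumes "C_on (Suc 0) (V - S) w"
 shows "continuous_on (V - S) w" "continuous_on (V - S) (%x. grad w x <.> N x)"
 using C_on_SucD[OF assms] by (auto intro!: continuous_intros C1_continuous_grad assms continuous_N)

lemma indicator_annulus_mult: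
 "[|x ~: annulus p q ==> f = 0; annulus p q <= U|] ==> indicator U x * f = indicator (annulus p q) x * (f :: real)"
 by (auto simp: indicator_def)

text \<open>Hardy's inequality away from \<open>S\<close>: the divergence of \<open>w\<^sup>2 N / (d + \<kappa>)\<close> contains
  \<open>- w\<^sup>2 / (d + \<kappa>)\<^sup>2\<close>, and half of it absorbs the cross terms.  The cut-off near \<open>S\<close> leaves a
  boundary layer term.\<close>

lemma hardy_annulus:
 assumes \<phi>: "cutoff \<phi>"
 shows "EX C>0. ALL w \<kappa> \<rho>. C_on (Suc 0) (V - S) w --> 0 < \<kappa> --> 0 < \<rho> --> \<rho> < R / 4 -->
  (LINT x|lebesgue. indicator (annulus \<rho> (R/4)) x * ((w x)^2 / (D x + \<kappa>)^2)) <=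
  C * (LINT x|lebesgue. indicator (annulus (\<rho>/2) (R/2)) x * ((w x)^2 + (grad w x <.> N x)^2)) +
  C / (\<kappa> * \<rho>) * (LINT x|lebesgue. indicator (annulus (\<rho>/2) \<rho>) x * (w x)^2)"
proof -
 obtain H H' :: "real => real" and M where H: "!!t. (H has_real_derivative H' t) (at t)" "continuous_on UNIV H'"
  "!!t. 0 <= H' t" "!!t. H' t <= M" "!!t. t < 0 | t > 1 ==> H' t = 0" "!!t. t <= 0 ==> H t = 0" "!!t. t >= 1 ==> H t = 1"
  "!!t. 0 <= H t" "!!t. H t <= 1" using smooth_step_derivative[OF \<phi>] by blast
 have M0: "M >= 0" using H(3,4)[of 0] by linarith
 obtain T where T: "T >= 0" "!!x. x : K - S ==> \<bar>trDN x\<bar> <= T" using trDN_bounded by blast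
 define C where "C = 8 + 8 * T^2 + 4 * M"
 have C: "C > 0" "8 * T^2 <= C" "8 <= C" "4 * M <= C" using M0 zero_le_power2[of T] unfolding C_def by linarith+
 have "(LINT x|lebesgue. indicator (annulus \<rho> (R/4)) x * ((w x)^2 / (D x + \<kappa>)^2)) <=
  C * (LINT x|lebesgue. indicator (annulus (\<rho>/2) (R/2)) x * ((w x)^2 + (grad w x <.> N x)^2)) +
  C / (\<kappa> * \<rho>) * (LINT x|lebesgue. indicator (annulus (\<rho>/2) \<rho>) x * (w x)^2)"
  if w: "C_on (Suc 0) (V - S) w" and \<kappa>: "0 < \<kappa>" and \<rho>: "0 < \<rho>" "\<rho> < R / 4" for w \<kappa> \<rho>
 proof -
  define \<tau> \<zeta> where "\<tau> z = H (2 * z / \<rho> - 1)" and "\<zeta> z = H ((R/2 - z) / (R/4))" for z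
  define \<tau>' \<zeta>' where "\<tau>' z = H' (2 * z / \<rho> - 1) * (2 / \<rho>)" and "\<zeta>' z = H' ((R/2 - z) / (R/4)) * (4 / R)" for z
  define q q' where "q z = \<tau> z * \<zeta> z" and "q' z = \<tau>' z * \<zeta> z - \<tau> z * \<zeta>' z" for z
  have q: "(q has_real_derivative q' z) (at z)" "continuous_on UNIV q'" "continuous_on UNIV q" for z
   using ramp_product_derivative[OF H(1,2) \<rho>(1)] unfolding q_def[abs_def] q'_def[abs_def] \<tau>_def \<tau>'_def \<zeta>_def \<zeta>'_def by blast+
  have q01: "0 <= q z" "q z <= 1" for z
   using H(8,9) unfolding q_def \<tau>_def \<zeta>_def by (auto intro: mult_le_one)
  define b b' where "b z = q z / (z + \<kappa>)" and "b' z = q' z / (z + \<kappa>) - q z / (z + \<kappa>)^2" for z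
  have db: "(b has_real_derivative b' z) (at z)" if "0 < z" for z
  proof -
   have "((%z. z + \<kappa>) has_real_derivative 1) (at z)" by (auto intro!: derivative_eq_intros)
   from DERIV_divide[OF q(1) this] show ?thesis
    unfolding b_def b'_def
    by (rule DERIV_cong) (use \<kappa> that in \<open>simp_all add: diff_divide_distrib power2_eq_square\<close>)
  qed
  have cb: "continuous_on {0<..} b'"
   unfolding b'_def by (intro continuous_intros continuous_on_subset[OF q(2)] continuous_on_subset[OF q(3)]) (use \<kappa> in auto)
  have b0: "b z = 0" if "z <= \<rho>/2" for z
  proof -
   have "2 * z / \<rho> - 1 <= 0" using that \<rho>(1) by (simp add: divide_le_eq)
   thus ?thesis by (simp add: b_def q_def \<tau>_def H(6))
  qed
  have b1: "b z = 0" if "z >= R/2" for z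
  proof -
   have "(R/2 - z) / (R/4) <= 0" using that R by (simp add: divide_nonpos_pos)
   thus ?thesis by (simp add: b_def q_def \<zeta>_def H(6))
  qed
  let ?A = "annulus (\<rho>/2) (R/2)"
  have AU: "?A <= V - S" "?A <= K - S" using annulus_subset[of "\<rho>/2" "R/2"] \<rho> R by auto
  define f where "f x = 2 * w x * b (D x) * (grad w x <.> N x) + (w x)^2 * b' (D x) + (w x)^2 * b (D x) * trDN x" for x
  have I0: "integral\<^sup>L lebesgue (%x. indicator (V - S) x * f x) = 0"
   unfolding f_def
   by (rule divergence_identity[where ?c1.0="\<rho>/2" and ?c2.0="R/2"]) (use \<rho> R w db cb b0 b1 in auto)
  have b'z: "b' z = 0" if "z < \<rho>/2 | z > R/2" for z
  proof -
   have "q z = 0 & q' z = 0"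
   proof (cases "z < \<rho>/2")
    case True
    hence "2 * z / \<rho> - 1 < 0" using \<rho>(1) by (simp add: divide_less_eq)
    thus ?thesis by (simp add: q_def q'_def \<tau>_def \<tau>'_def H(5,6))
   next
    case False
    hence "(R/2 - z) / (R/4) < 0" using that R by (simp add: divide_neg_pos)
    thus ?thesis by (simp add: q_def q'_def \<zeta>_def \<zeta>'_def H(5,6))
   qed
   thus ?thesis by (simp add: b'_def)
  qed
  have fz: "f x = 0" if "x ~: ?A" for x
  proof -
   have "D x < \<rho>/2 | D x > R/2" using that by (auto simp: annulus_def)
   thus ?thesis using b'z[of "D x"] b0[of "D x"] b1[of "D x"] by (auto simp: f_def)
  qed
  have eqf: "indicator (V - S) x * f x = indicator ?A x * f x" for x
   by (rule indicator_annulus_mult) (use fz AU(1) in auto)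
  note cw = continuous_on_C1_grad_N[OF w]
  have Dpos: "D x > 0" if "x : V - S" for x using S_basic(5,6)[of x] that by force
  have fc: "continuous_on ?A f"
  proof (rule continuous_on_subset[OF _ AU(1)])
   have "continuous_on {0<..} b" using db by (meson DERIV_isCont continuous_at_imp_continuous_on greaterThan_iff)
   thus "continuous_on (V - S) f"
    unfolding f_def
    by (intro continuous_intros cw continuous_trDN continuous_on_compose2[OF cb] continuous_on_compose2[OF \<open>continuous_on {0<..} b\<close>])
      (use Dpos in auto)
  qed
  have If: "integrable lebesgue (%x. indicator ?A x * f x)" by (rule compact_integrable_indicator[OF compact_annulus fc])
  have I0': "integral\<^sup>L lebesgue (%x. indicator ?A x * f x) = 0" using I0 unfolding eqf .
  have i1: "integrable lebesgue (%x. indicator ?A x * ((w x)^2 + (grad w x <.> N x)^2))"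
   by (intro compact_integrable_indicator compact_annulus continuous_intros continuous_on_subset[OF cw(1) AU(1)] continuous_on_subset[OF cw(2) AU(1)])
  have AB: "annulus (\<rho>/2) \<rho> <= V - S" "annulus \<rho> (R/4) <= V - S" using annulus_subset(2)[of "\<rho>/2" \<rho>] annulus_subset(2)[of \<rho> "R/4"] \<rho> R by auto
  have i2: "integrable lebesgue (%x. indicator (annulus (\<rho>/2) \<rho>) x * (w x)^2)"
   by (intro compact_integrable_indicator compact_annulus continuous_intros continuous_on_subset[OF cw(1) AB(1)])
  have i3: "integrable lebesgue (%x. indicator (annulus \<rho> (R/4)) x * ((w x)^2 / (D x + \<kappa>)^2))"
  proof (intro compact_integrable_indicator compact_annulus continuous_intros continuous_on_subset[OF cw(1) AB(2)] ballI)
   fix x show "(D x + \<kappa>)^2 ~= 0" using S_basic(6)[of x] \<kappa> by (simp add: add_nonneg_eq_0_iff)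
  qed
  have pt: "indicator (annulus \<rho> (R/4)) x * ((w x)^2 / (D x + \<kappa>)^2) <=
    C * (indicator ?A x * ((w x)^2 + (grad w x <.> N x)^2)) + C / (\<kappa> * \<rho>) * (indicator (annulus (\<rho>/2) \<rho>) x * (w x)^2) - 2 * (indicator ?A x * f x)" for x
  proof (cases "x : ?A")
   case False
   hence "x ~: annulus \<rho> (R/4)" "x ~: annulus (\<rho>/2) \<rho>" using \<rho> R by (auto simp: annulus_def)
   thus ?thesis using False by simp
  next
   case True
   let ?s = "D x + \<kappa>" and ?W = "grad w x <.> N x"
   have s: "?s > 0" "?s >= \<kappa>" using S_basic(6)[of x] \<kappa> by linarith+
   have Tx: "\<bar>trDN x\<bar> <= T" using T(2) True AU(2) by blast
   let ?m = "(w x)^2 * (q (D x) / ?s^2)"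
   have m0: "?m >= 0" using q01 s by simp
   have e: "?m = (w x)^2 * (q' (D x) / ?s) + 2 * w x * (q (D x) / ?s) * ?W + (w x)^2 * (q (D x) / ?s) * trDN x - f x"
    unfolding f_def b_def b'_def by (simp add: algebra_simps)
   have t1: "2 * w x * (q (D x) / ?s) * ?W <= ?m / 4 + 4 * ?W^2"
    using absorb_cross_term[OF q01(1,2)[of "D x"] s(1), of "w x" ?W] by simp
   have t2: "(w x)^2 * (q (D x) / ?s) * trDN x <= ?m / 4 + 4 * (T^2 * (w x)^2)"
   proof -
    have gen: "X <= m / 4 + 4 * Z" if "Z' = 2 * X" "Z' <= m / 4 + 4 * Y" "Y <= Z" "0 <= Z" "0 <= m" for X Y Z Z' m :: real
     using that by linarith
    have c: "2 * w x * (q (D x) / ?s) * (w x * trDN x) <= ?m / 4 + 4 * (w x * trDN x)^2"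
     using absorb_cross_term[OF q01(1,2)[of "D x"] s(1), of "w x" "w x * trDN x"] by simp
    have y: "(w x * trDN x)^2 <= T^2 * (w x)^2"
    proof -
     have "(trDN x)^2 <= T^2" using Tx T(1) abs_le_square_iff[of "trDN x" T] by simp
     thus ?thesis using mult_right_mono[of "(trDN x)^2" "T^2" "(w x)^2"] by (simp add: power_mult_distrib mult.commute)
    qed
    have e2: "2 * w x * (q (D x) / ?s) * (w x * trDN x) = 2 * ((w x)^2 * (q (D x) / ?s) * trDN x)"
     by (simp add: power2_eq_square)
    have "T^2 * (w x)^2 >= 0" by simp
    thus ?thesis by (rule gen[OF e2 c y _ m0])
   qed
   have t3: "(w x)^2 * (q' (D x) / ?s) <= 2 * M / (\<kappa> * \<rho>) * (indicator (annulus (\<rho>/2) \<rho>) x * (w x)^2)"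
   proof -
    have z1: "0 <= \<tau> (D x)" "0 <= \<zeta>' (D x)" "0 <= \<zeta> (D x)" "\<zeta> (D x) <= 1" "0 <= \<tau>' (D x)" "\<tau>' (D x) <= M * (2 / \<rho>)"
     using H(3,4,8,9) R \<rho>(1) unfolding \<tau>_def \<zeta>_def \<tau>'_def \<zeta>'_def by (auto intro!: mult_nonneg_nonneg divide_right_mono mult_left_mono)
    have "q' (D x) <= \<tau>' (D x) * \<zeta> (D x)" unfolding q'_def using z1 by simp
    also have "... <= \<tau>' (D x) * 1" using z1 by (intro mult_left_mono)
    finally have q'1: "q' (D x) <= \<tau>' (D x)" by simp
    show ?thesis
    proof (cases "x : annulus (\<rho>/2) \<rho>")
     case a: True
     have "q' (D x) / ?s <= \<tau>' (D x) / ?s" using q'1 s by (simp add: divide_right_mono)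
     also have "... <= M * (2 / \<rho>) / \<kappa>" using z1 s \<kappa> M0 \<rho>(1) by (intro frac_le) auto
     finally have "(w x)^2 * (q' (D x) / ?s) <= (w x)^2 * (M * (2 / \<rho>) / \<kappa>)" by (rule mult_left_mono) simp
     thus ?thesis using a by (simp add: mult_ac)
    next
     case False
     hence "D x > \<rho>" using True by (auto simp: annulus_def)
     hence "2 * D x / \<rho> - 1 > 1" using \<rho>(1) by (simp add: less_divide_eq)
     hence "\<tau>' (D x) = 0" by (simp add: \<tau>'_def H(5))
     hence "q' (D x) / ?s <= 0" using q'1 s by (simp add: divide_nonpos_pos)
     thus ?thesis using False mult_nonneg_nonpos[of "(w x)^2" "q' (D x) / ?s"] by simp
    qed
   qed
   have mm: "?m <= 8 * ?W^2 + 8 * T^2 * (w x)^2 + 4 * M / (\<kappa> * \<rho>) * (indicator (annulus (\<rho>/2) \<rho>) x * (w x)^2) - 2 * f x"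
    using e t1 t2 t3 by (simp add: algebra_simps)
   have "8 * ?W^2 <= C * ?W^2" "8 * T^2 * (w x)^2 <= C * (w x)^2" using C by (auto intro!: mult_right_mono)
   moreover have "4 * M / (\<kappa> * \<rho>) * (indicator (annulus (\<rho>/2) \<rho>) x * (w x)^2) <= C / (\<kappa> * \<rho>) * (indicator (annulus (\<rho>/2) \<rho>) x * (w x)^2)"
    using C \<kappa> \<rho>(1) by (intro mult_right_mono divide_right_mono) auto
   moreover have "indicator (annulus \<rho> (R/4)) x * ((w x)^2 / ?s^2) <= ?m"
   proof (cases "x : annulus \<rho> (R/4)")
    case a: True
    hence "2 * D x / \<rho> - 1 >= 1" "(R/2 - D x) / (R/4) >= 1" using \<rho>(1) R by (auto simp: annulus_def le_divide_eq)
    hence "q (D x) = 1" by (simp add: q_def \<tau>_def \<zeta>_def H(7))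
    thus ?thesis using a by simp
   qed (use m0 in simp)
   ultimately show ?thesis using mm True by (simp add: distrib_left)
  qed
  have "(LINT x|lebesgue. indicator (annulus \<rho> (R/4)) x * ((w x)^2 / (D x + \<kappa>)^2)) <=
    (LINT x|lebesgue. C * (indicator ?A x * ((w x)^2 + (grad w x <.> N x)^2)) + C / (\<kappa> * \<rho>) * (indicator (annulus (\<rho>/2) \<rho>) x * (w x)^2) - 2 * (indicator ?A x * f x))"
   using i1 i2 i3 If pt by (intro integral_mono) auto
  also have "... = C * (LINT x|lebesgue. indicator ?A x * ((w x)^2 + (grad w x <.> N x)^2)) +
   C / (\<kappa> * \<rho>) * (LINT x|lebesgue. indicator (annulus (\<rho>/2) \<rho>) x * (w x)^2) - 2 * integral\<^sup>L lebesgue (%x. indicator ?A x * f x)"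
   using i1 i2 If by (subst Bochner_Integration.integral_diff) (auto simp del: indicator_simps)
  finally show ?thesis unfolding I0' by simp
 qed
 thus ?thesis using C(1) by blast
qed

text \<open>The same field with \<open>w = 1\<close> and the increasing profile \<open>d / (d + \<kappa>)\<close> bounds the integral of a
  kernel of unit mass across \<open>S\<close>, without any information on the area of \<open>S\<close>.\<close>

lemma layer_kernel_annulus:
 assumes \<phi>: "cutoff \<phi>"
 shows "EX C>0. ALL \<kappa> \<rho>. 0 < \<kappa> --> 0 < \<rho> --> \<rho> < R / 4 -->
  (LINT x|lebesgue. indicator (annulus \<rho> (R/4)) x * (\<kappa> / (D x + \<kappa>)^2)) <= C"
proof -
 obtain H H' :: "real => real" and M where H: "!!t. (H has_real_derivative H' t) (at t)" "continuous_on UNIV H'"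
  "!!t. 0 <= H' t" "!!t. H' t <= M" "!!t. t < 0 | t > 1 ==> H' t = 0" "!!t. t <= 0 ==> H t = 0" "!!t. t >= 1 ==> H t = 1"
  "!!t. 0 <= H t" "!!t. H t <= 1" using smooth_step_derivative[OF \<phi>] by blast
 have M0: "M >= 0" using H(3,4)[of 0] by linarith
 obtain T where T: "T >= 0" "!!x. x : K - S ==> \<bar>trDN x\<bar> <= T" using trDN_bounded by blast
 let ?B = "annulus 0 (R/2)"
 have iB: "integrable lebesgue (%x. indicator ?B x * (1::real))" by (intro compact_integrable_indicator compact_annulus) simp
 define C where "C = (M * (4 / R) + T) * (LINT x|lebesgue. indicator ?B x * 1) + 1"
 have C0: "C > 0" unfolding C_def using M0 T(1) R by (intro add_nonneg_pos mult_nonneg_nonneg) auto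
 have "(LINT x|lebesgue. indicator (annulus \<rho> (R/4)) x * (\<kappa> / (D x + \<kappa>)^2)) <= C" if \<kappa>: "0 < \<kappa>" and \<rho>: "0 < \<rho>" "\<rho> < R / 4" for \<kappa> \<rho>
 proof -
  define \<tau> \<zeta> where "\<tau> z = H (2 * z / \<rho> - 1)" and "\<zeta> z = H ((R/2 - z) / (R/4))" for z
  define \<tau>' \<zeta>' where "\<tau>' z = H' (2 * z / \<rho> - 1) * (2 / \<rho>)" and "\<zeta>' z = H' ((R/2 - z) / (R/4)) * (4 / R)" for z
  define q q' where "q z = \<tau> z * \<zeta> z" and "q' z = \<tau>' z * \<zeta> z - \<tau> z * \<zeta>' z" for z
  have q: "(q has_real_derivative q' z) (at z)" "continuous_on UNIV q'" "continuous_on UNIV q" for z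
   using ramp_product_derivative[OF H(1,2) \<rho>(1)] unfolding q_def[abs_def] q'_def[abs_def] \<tau>_def \<tau>'_def \<zeta>_def \<zeta>'_def by blast+
  have q01: "0 <= q z" "q z <= 1" for z
   using H(8,9) unfolding q_def \<tau>_def \<zeta>_def by (auto intro: mult_le_one)
  define b b' where "b z = q z * (z / (z + \<kappa>))" and "b' z = q' z * (z / (z + \<kappa>)) + q z * (\<kappa> / (z + \<kappa>)^2)" for z
  have db: "(b has_real_derivative b' z) (at z)" if "0 < z" for z
  proof -
   have "((%z. z / (z + \<kappa>)) has_real_derivative \<kappa> / (z + \<kappa>)^2) (at z)"
    using \<kappa> that by (auto intro!: derivative_eq_intros simp: power2_eq_square)
   from DERIV_mult[OF q(1) this] show ?thesis unfolding b_def b'_def by (rule DERIV_cong) (simp add: algebra_simps)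
  qed
  have cb: "continuous_on {0<..} b'"
   unfolding b'_def by (intro continuous_intros continuous_on_subset[OF q(2)] continuous_on_subset[OF q(3)]) (use \<kappa> in auto)
  have b0: "b z = 0" if "z <= \<rho>/2" for z
  proof -
   have "2 * z / \<rho> - 1 <= 0" using that \<rho>(1) by (simp add: divide_le_eq)
   thus ?thesis by (simp add: b_def q_def \<tau>_def H(6))
  qed
  have b1: "b z = 0" if "z >= R/2" for z
  proof -
   have "(R/2 - z) / (R/4) <= 0" using that R by (simp add: divide_nonpos_pos)
   thus ?thesis by (simp add: b_def q_def \<zeta>_def H(6))
  qed
  let ?A = "annulus (\<rho>/2) (R/2)"
  have AU: "?A <= V - S" "?A <= K - S" using annulus_subset[of "\<rho>/2" "R/2"] \<rho> R by auto
  define f where "f x = b' (D x) + b (D x) * trDN x" for x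
  have g0: "grad (%x. 1) x = (0 :: real^'d)" for x by (rule grad_eqI) simp
  have "integral\<^sup>L lebesgue (%x. indicator (V - S) x * (2 * 1 * b (D x) * (grad (%x. 1) x <.> N x) + 1^2 * b' (D x) + 1^2 * b (D x) * trDN x)) = 0"
   by (rule divergence_identity[where ?c1.0="\<rho>/2" and ?c2.0="R/2" and w="%x. 1"])
     (use \<rho> R db cb b0 b1 in \<open>auto simp del: C_on.simps intro!: C_on_const[OF open_V_S]\<close>)
  hence I0: "integral\<^sup>L lebesgue (%x. indicator (V - S) x * f x) = 0" by (simp add: g0 f_def)
  have b'z: "b' z = 0" if "z < \<rho>/2 | z > R/2" for z
  proof -
   have "q z = 0 & q' z = 0"
   proof (cases "z < \<rho>/2")
    case True
    hence "2 * z / \<rho> - 1 < 0" using \<rho>(1) by (simp add: divide_less_eq)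
    thus ?thesis by (simp add: q_def q'_def \<tau>_def \<tau>'_def H(5,6))
   next
    case False
    hence "(R/2 - z) / (R/4) < 0" using that R by (simp add: divide_neg_pos)
    thus ?thesis by (simp add: q_def q'_def \<zeta>_def \<zeta>'_def H(5,6))
   qed
   thus ?thesis by (simp add: b'_def)
  qed
  have fz: "f x = 0" if "x ~: ?A" for x
  proof -
   have "D x < \<rho>/2 | D x > R/2" using that by (auto simp: annulus_def)
   thus ?thesis using b'z[of "D x"] b0[of "D x"] b1[of "D x"] by (auto simp: f_def)
  qed
  have eqf: "indicator (V - S) x * f x = indicator ?A x * f x" for x
   by (rule indicator_annulus_mult) (use fz AU(1) in auto)
  have Dpos: "D x > 0" if "x : V - S" for x using S_basic(5,6)[of x] that by force
  have fc: "continuous_on ?A f"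
  proof (rule continuous_on_subset[OF _ AU(1)])
   have "continuous_on {0<..} b" using db by (meson DERIV_isCont continuous_at_imp_continuous_on greaterThan_iff)
   thus "continuous_on (V - S) f"
    unfolding f_def
    by (intro continuous_intros continuous_trDN continuous_on_compose2[OF cb] continuous_on_compose2[OF \<open>continuous_on {0<..} b\<close>])
      (use Dpos in auto)
  qed
  have If: "integrable lebesgue (%x. indicator ?A x * f x)" by (rule compact_integrable_indicator[OF compact_annulus fc])
  have I0': "integral\<^sup>L lebesgue (%x. indicator ?A x * f x) = 0" using I0 unfolding eqf .
  have i3: "integrable lebesgue (%x. indicator (annulus \<rho> (R/4)) x * (\<kappa> / (D x + \<kappa>)^2))"
  proof (intro compact_integrable_indicator compact_annulus continuous_intros ballI)
   fix x show "(D x + \<kappa>)^2 ~= 0" using S_basic(6)[of x] \<kappa> by (simp add: add_nonneg_eq_0_iff)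
  qed
  have pt: "indicator (annulus \<rho> (R/4)) x * (\<kappa> / (D x + \<kappa>)^2) <= (M * (4 / R) + T) * (indicator ?B x * 1) + indicator ?A x * f x" for x
  proof (cases "x : ?A")
   case False
   hence "x ~: annulus \<rho> (R/4)" using \<rho> R by (auto simp: annulus_def)
   thus ?thesis using False M0 T(1) R by simp
  next
   case True
   have s: "D x + \<kappa> > 0" "D x >= 0" using S_basic(6)[of x] \<kappa> by linarith+
   let ?\<beta> = "D x / (D x + \<kappa>)"
   have \<beta>: "0 <= ?\<beta>" "?\<beta> <= 1" using s \<kappa> by auto
   have Tx: "\<bar>trDN x\<bar> <= T" using T(2) True AU(2) by blast
   have z1: "0 <= \<tau> (D x)" "\<tau> (D x) <= 1" "0 <= \<zeta>' (D x)" "\<zeta>' (D x) <= M * (4 / R)" "0 <= \<zeta> (D x)" "0 <= \<tau>' (D x)"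
    using H(3,4,8,9) R \<rho>(1) unfolding \<tau>_def \<zeta>_def \<tau>'_def \<zeta>'_def by (auto intro!: mult_nonneg_nonneg divide_right_mono mult_left_mono)
   have "\<tau> (D x) * \<zeta>' (D x) <= 1 * (M * (4 / R))" using z1 by (intro mult_mono) auto
   hence "q' (D x) >= - (M * (4 / R))" unfolding q'_def using mult_nonneg_nonneg[OF z1(6,5)] by linarith
   moreover have "M * (4 / R) >= 0" using M0 R by simp
   ultimately have t1: "q' (D x) * ?\<beta> >= - (M * (4 / R))"
    using \<beta> by (smt (verit) mult_left_le mult_nonneg_nonneg mult_right_mono mult_minus_left)
   have "\<bar>b (D x) * trDN x\<bar> <= 1 * T"
   proof -
    have "0 <= b (D x)" "b (D x) <= 1" unfolding b_def using q01[of "D x"] \<beta> by (auto intro: mult_le_one mult_nonneg_nonneg simp del: times_divide_eq_right)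
    thus ?thesis unfolding abs_mult using Tx by (intro mult_mono) auto
   qed
   hence t2: "b (D x) * trDN x >= - T" by linarith
   have "indicator (annulus \<rho> (R/4)) x * (\<kappa> / (D x + \<kappa>)^2) <= q (D x) * (\<kappa> / (D x + \<kappa>)^2)"
   proof (cases "x : annulus \<rho> (R/4)")
    case a: True
    hence "2 * D x / \<rho> - 1 >= 1" "(R/2 - D x) / (R/4) >= 1" using \<rho>(1) R by (auto simp: annulus_def le_divide_eq)
    hence "q (D x) = 1" by (simp add: q_def \<tau>_def \<zeta>_def H(7))
    thus ?thesis using a by simp
   qed (use q01 \<kappa> in simp)
   also have "... = f x - q' (D x) * ?\<beta> - b (D x) * trDN x" by (simp add: f_def b'_def)
   also have "... <= f x + M * (4 / R) + T" using t1 t2 by linarith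
   finally show ?thesis using True \<rho> by (auto simp: annulus_def)
  qed
  have "(LINT x|lebesgue. indicator (annulus \<rho> (R/4)) x * (\<kappa> / (D x + \<kappa>)^2)) <= (LINT x|lebesgue. (M * (4 / R) + T) * (indicator ?B x * 1) + indicator ?A x * f x)"
   using iB i3 If pt by (intro integral_mono Bochner_Integration.integrable_add integrable_mult_right) auto
  also have "... = (M * (4 / R) + T) * (LINT x|lebesgue. indicator ?B x * 1) + integral\<^sup>L lebesgue (%x. indicator ?A x * f x)"
   using iB If by (subst Bochner_Integration.integral_add) (auto simp del: indicator_simps)
  finally show ?thesis unfolding I0' C_def by simp
 qed
 thus ?thesis using C0 by blast
qed

definition core :: "(real^'d) set" where "core = {x. infdist x S <= R / 4}"

lemma core_annulus_LIMSEQ: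
 fixes f :: "real^'d => real"
 assumes "integrable lebesgue (%x. indicator core x * f x)"
 shows "(%n. \<integral>x. indicator (annulus (R / 4 / real (n + 2)) (R/4)) x * f x \<partial>lebesgue) \<longlonglongrightarrow> (LINT x|lebesgue. indicator core x * f x)"
proof (rule integral_dominated_convergence[where w="%x. norm (indicator core x * f x)"])
 let ?A = "%n. annulus (R / 4 / real (n + 2)) (R/4)"
 have sub: "?A n <= core" for n by (auto simp: annulus_def core_def)
 show "(%x. indicator core x * f x) : borel_measurable lebesgue" using assms by (rule borel_measurable_integrable)
 show "(%x. indicator (?A n) x * f x) : borel_measurable lebesgue" for n
 proof -
  have "(%x. indicator (?A n) x * (indicator core x * f x)) : borel_measurable lebesgue"
  proof (rule borel_measurable_times[OF _ borel_measurable_integrable[OF assms]])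
   show "(indicator (?A n) :: real^'d => real) : borel_measurable lebesgue"
    using compact_annulus by (intro borel_measurable_indicator) (simp add: borel_compact sets_completionI_sets)
  qed
  moreover have "(%x. indicator (?A n) x * (indicator core x * f x)) = (%x. indicator (?A n) x * f x)"
   using sub[of n] by (auto simp: indicator_def fun_eq_iff)
  ultimately show ?thesis by (simp only:)
 qed
 show "integrable lebesgue (%x. norm (indicator core x * f x))" using assms by (rule integrable_norm)
 show "AE x in lebesgue. norm (indicator (?A n) x * f x) <= norm (indicator core x * f x)" for n
  using sub[of n] by (intro AE_I2) (auto simp: indicator_def)
 show "AE x in lebesgue. (%n. indicator (?A n) x * f x) \<longlonglongrightarrow> indicator core x * f x"
  using AE_notin_S
 proof eventually_elim
  case (elim x)
  hence p: "D x > 0" using S_basic(5,6)[of x] by force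
  obtain m where m: "R / 4 / D x < real m" using reals_Archimedean2 by blast
  have "indicator (?A n) x * f x = indicator core x * f x" if "n >= m" for n
  proof -
   have "R / 4 / D x <= real (n + 2)" using m that by simp
   hence "R / 4 <= real (n + 2) * D x" using p by (simp only: pos_divide_le_eq)
   moreover have "real (n + 2) > 0" by simp
   ultimately have "R / 4 / real (n + 2) <= D x" by (simp only: pos_divide_le_eq mult.commute)
   thus ?thesis by (auto simp: indicator_def annulus_def core_def)
  qed
  thus ?case by (intro tendsto_eventually) (auto simp: eventually_sequentially)
 qed
qed

lemma layer_kernel_bound:
 assumes \<phi>: "cutoff \<phi>"
 shows "EX C>0. ALL \<kappa>>0. integrable lebesgue (%x. indicator core x * (\<kappa> / (D x + \<kappa>)^2)) & (LINT x|lebesgue. indicator core x * (\<kappa> / (D x + \<kappa>)^2)) <= C"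
proof -
 obtain C where C: "C > 0" "!!\<kappa> \<rho>. 0 < \<kappa> ==> 0 < \<rho> ==> \<rho> < R / 4 ==>
  (LINT x|lebesgue. indicator (annulus \<rho> (R/4)) x * (\<kappa> / (D x + \<kappa>)^2)) <= C" using layer_kernel_annulus[OF \<phi>] by blast
 have "integrable lebesgue (%x. indicator core x * (\<kappa> / (D x + \<kappa>)^2)) & (LINT x|lebesgue. indicator core x * (\<kappa> / (D x + \<kappa>)^2)) <= C" if \<kappa>: "\<kappa> > 0" for \<kappa>
 proof
  have cc: "compact core" unfolding core_def using compact_annulus[of 0 "R/4"] S_basic(6) by (simp add: annulus_def)
  show i: "integrable lebesgue (%x. indicator core x * (\<kappa> / (D x + \<kappa>)^2))"
  proof (intro compact_integrable_indicator cc continuous_intros ballI)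
   fix x show "(D x + \<kappa>)^2 ~= 0" using S_basic(6)[of x] \<kappa> by (simp add: add_nonneg_eq_0_iff)
  qed
  show "(LINT x|lebesgue. indicator core x * (\<kappa> / (D x + \<kappa>)^2)) <= C"
  proof (rule LIMSEQ_le_const2[OF core_annulus_LIMSEQ[OF i]])
   have "R / 4 / real (n + 2) < R / 4" for n using R by (simp add: divide_less_eq)
   thus "EX N. ALL n>=N. (LINT x|lebesgue. indicator (annulus (R / 4 / real (n + 2)) (R/4)) x * (\<kappa> / (D x + \<kappa>)^2)) <= C"
    using C(2)[OF \<kappa>] R by auto
  qed
 qed
 thus ?thesis using C(1) by blast
qed

lemma C1_normal_component:
 fixes a :: "real^'d => real^'d"
 assumes a: "C_on (Suc 0) V a"
 shows "C_on (Suc 0) (V - S) (%x. a x <.> N x)"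
  "x : V - S ==> grad (%x. a x <.> N x) x <.> e = a x <.> DN x e + frechet_derivative a (at x) e <.> N x"
proof -
 let ?Da = "%x. frechet_derivative a (at x)"
 have da: "(a has_derivative ?Da x) (at x)" if "x : V" for x by (rule C_on_Suc_has_derivative[OF a that])
 have d: "((%x. a x <.> N x) has_derivative (%e. a x <.> DN x e + ?Da x e <.> N x)) (at x)" if "x : V - S" for x
  using that by (intro has_derivative_inner da has_derivative_N) auto
 have ca: "continuous_on (V - S) a" using C_on_SucD[OF a] by (auto intro: continuous_on_subset)
 show C: "C_on (Suc 0) (V - S) (%x. a x <.> N x)"
 proof (rule C_on_SucI[OF open_V_S d])
  fix e :: "real^'d" assume "e : Basis"
  hence "continuous_on (V - S) (%x. ?Da x e)" using a by (auto intro: continuous_on_subset)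
  thus "C_on 0 (V - S) (%x. a x <.> DN x e + ?Da x e <.> N x)"
   by (auto intro!: continuous_intros ca continuous_DN continuous_N)
 qed
 show "grad (%x. a x <.> N x) x <.> e = a x <.> DN x e + ?Da x e <.> N x" if x: "x : V - S"
 proof -
  have "((%x. a x <.> N x) has_derivative (%e. grad (%x. a x <.> N x) x <.> e)) (at x)"
   using C x by (intro has_derivative_grad) simp
  from has_derivative_unique[OF this d[OF x]] show ?thesis by meson
 qed
qed

lemma frechet_norm_le_grads:
 fixes a :: "real^'d => real^'m"
 assumes a: "a differentiable (at x)"
 shows "(norm (frechet_derivative a (at x) e))^2 <= (\<Sum>i\<in>UNIV. (norm (grad (%x. a x $ i) x))^2) * (norm e)^2"
proof -
 have d: "(a has_derivative frechet_derivative a (at x)) (at x)" using a by (simp add: frechet_derivative_works)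
 have c: "frechet_derivative a (at x) e $ i = grad (%x. a x $ i) x <.> e" for i
 proof -
  have di: "((%x. a x $ i) has_derivative (%e. frechet_derivative a (at x) e $ i)) (at x)"
   by (rule bounded_linear.has_derivative[OF bounded_linear_vec_nth d])
  hence "((%x. a x $ i) has_derivative (%e. grad (%x. a x $ i) x <.> e)) (at x)"
   by (intro has_derivative_grad) (auto simp: differentiable_def)
  from has_derivative_unique[OF di this] show ?thesis by meson
 qed
 have "(norm (frechet_derivative a (at x) e))^2 = (\<Sum>i\<in>UNIV. (grad (%x. a x $ i) x <.> e)^2)"
  unfolding power2_norm_eq_inner[of "frechet_derivative a (at x) e"] inner_vec_def[of "frechet_derivative a (at x) e" "frechet_derivative a (at x) e"] c
  by (simp add: power2_eq_square)
 also have "... <= (\<Sum>i\<in>UNIV. (norm (grad (%x. a x $ i) x))^2 * (norm e)^2)"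
 proof (rule sum_mono)
  fix i
  have "\<bar>grad (%x. a x $ i) x <.> e\<bar> <= \<bar>norm (grad (%x. a x $ i) x) * norm e\<bar>"
   using Cauchy_Schwarz_ineq2[of "grad (%x. a x $ i) x" e] by simp
  thus "(grad (%x. a x $ i) x <.> e)^2 <= (norm (grad (%x. a x $ i) x))^2 * (norm e)^2"
   unfolding abs_le_square_iff by (simp add: power_mult_distrib)
 qed
 finally show ?thesis by (simp add: sum_distrib_right)
qed

definition energy_density :: "(real^'d => real^'d) => real^'d => real" where
 "energy_density a x = (norm (a x))^2 + (\<Sum>i\<in>UNIV. (norm (grad (%x. a x $ i) x))^2)"

text \<open>The boundary layer term of Hardy's inequality is controlled by the normal component on \<open>S\<close>,
  because the normals at \<open>x\<close> and at its projection agree up to sign.\<close>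

lemma boundary_layer_le_hausdorff:
 assumes d2: "CARD('d) >= 2"
 shows "EX C>0. ALL a h. C_on (Suc 0) V a --> 0 <= h -->
   (\<integral>\<^sup>+y. ennreal (a y <.> DQ y (a y)) * indicator S y \<partial>hausdorff_measure (CARD('d) - 1)) <= ennreal h -->
   (EX B. ALL \<rho>. 0 < \<rho> --> \<rho> <= R / 8 --> (LINT x|lebesgue. indicator (annulus (\<rho>/2) \<rho>) x * (a x <.> N x)^2) <= C * \<rho> * h + B * \<rho>^2)"
proof -
 let ?H = "hausdorff_measure (CARD('d) - 1) :: (real^'d) measure"
 obtain C where C: "C > 0" "!!\<rho> g. 0 < \<rho> ==> \<rho> <= R / 4 ==> g : borel_measurable borel ==>
  (\<integral>\<^sup>+x. g (P x) * indicator {x. infdist x S < \<rho>} x \<partial>lborel) <= ennreal (C * \<rho>) * (\<integral>\<^sup>+y. g y \<partial>?H)"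
  using tube_integral_le_hausdorff[OF d2] by blast
 have "EX B. ALL \<rho>. 0 < \<rho> --> \<rho> <= R / 8 --> (LINT x|lebesgue. indicator (annulus (\<rho>/2) \<rho>) x * (a x <.> N x)^2) <= (4 * C) * \<rho> * h + B * \<rho>^2"
  if a: "C_on (Suc 0) V a" and h: "0 <= h" "(\<integral>\<^sup>+y. ennreal (a y <.> DQ y (a y)) * indicator S y \<partial>?H) <= ennreal h" for a h
 proof -
  have ca: "continuous_on V a" using C_on_SucD[OF a] by simp
  have aDa: "(a y <.> \<nu>)^2 = a y <.> DQ y (a y)" if "!!e. DQ y e = (\<nu> <.> e) *R \<nu>" for y \<nu>
   by (simp add: that inner_commute power2_eq_square)
  define g where "g y = ennreal (a y <.> DQ y (a y)) * indicator S y" for y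
  have gm: "g : borel_measurable borel"
  proof -
   have lin: "DQ y (a y) = (\<Sum>i\<in>UNIV. (a y $ i) *R DQ y (axis i 1))" if "y : V" for y
   proof -
    have "DQ y (a y) = DQ y (\<Sum>i\<in>UNIV. (a y $ i) *R axis i 1)"
     using basis_expansion[of "a y"] by (simp add: scalar_mult_eq_scaleR)
    thus ?thesis using linear_DQ[OF that] by (simp add: linear_sum linear_scale)
   qed
   have cDQ: "continuous_on V (%y. DQ y e)" for e
    using has_derivative_C1_any_direction[OF C_on_Q open_V, of 0 e] by (simp add: DQ_def)
   have "continuous_on V (%y. a y <.> (\<Sum>i\<in>UNIV. (a y $ i) *R DQ y (axis i 1)))"
    by (intro continuous_intros ca cDQ)
   hence "continuous_on V (%y. a y <.> DQ y (a y))" by (rule continuous_on_eq) (simp add: lin)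
   hence "continuous_on S (%y. a y <.> DQ y (a y))" using S_subset_V by (rule continuous_on_subset)
   hence "(%y. indicator S y *R (a y <.> DQ y (a y))) : borel_measurable borel"
    using S_basic(2) by (intro borel_measurable_continuous_on_indicator) auto
   hence "(%y. ennreal (indicator S y *R (a y <.> DQ y (a y)))) : borel_measurable borel" by measurable
   moreover have "ennreal (indicator S y *R (a y <.> DQ y (a y))) = g y" for y by (simp add: g_def indicator_def)
   ultimately show ?thesis by simp
  qed
  obtain L where L: "L >= 0" "!!x z. closed_segment x z <= K ==> norm (a x - a z) <= L * norm (x - z)"
   using C1_lipschitz_on_segments[OF a compact_K K_subset_V] by blast
  have pt: "(a x <.> N x)^2 <= 2 * (a (P x) <.> DQ (P x) (a (P x))) + 2 * L^2 * (D x)^2" if x: "x : K - S" for x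
  proof -
   have xV: "x : V" "x ~: S" using x K_subset_V by auto
   have "a x <.> N x = a (P x) <.> N x + (a x - a (P x)) <.> N x" by (simp add: inner_diff_left)
   moreover have "\<bar>(a x - a (P x)) <.> N x\<bar> <= L * D x"
   proof -
    have "\<bar>(a x - a (P x)) <.> N x\<bar> <= norm (a x - a (P x)) * norm (N x)" by (rule Cauchy_Schwarz_ineq2)
    also have "... <= L * norm (x - P x)" using L(2)[OF segment_to_P_in_K] x norm_N[OF xV] by simp
    finally show ?thesis using norm_Q[OF xV(1)] by (simp add: Q_def)
   qed
   ultimately have "(a x <.> N x)^2 <= 2 * (a (P x) <.> N x)^2 + 2 * (L * D x)^2"
   proof -
    assume e: "a x <.> N x = a (P x) <.> N x + (a x - a (P x)) <.> N x" and b: "\<bar>(a x - a (P x)) <.> N x\<bar> <= L * D x"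
    have "((a x - a (P x)) <.> N x)^2 <= (L * D x)^2" using b by (metis abs_ge_zero power2_abs power_mono)
    moreover have "(p + q)^2 <= 2 * p^2 + 2 * q^2" for p q :: real
     using zero_le_power2[of "p - q"] by (simp add: power2_eq_square algebra_simps)
    ultimately show ?thesis unfolding e by (smt (verit))
   qed
   thus ?thesis using aDa[of "P x" "N x"] DQ_P_eq[OF xV] by (simp add: power_mult_distrib)
  qed
  have cK: "emeasure lborel K < \<infinity>" using emeasure_bounded_finite[OF compact_imp_bounded[OF compact_K]] .
  define v where "v = measure lborel K"
  have v: "emeasure lborel K = ennreal v" "v >= 0" using cK by (auto simp: v_def emeasure_eq_ennreal_measure)
  have "(LINT x|lebesgue. indicator (annulus (\<rho>/2) \<rho>) x * (a x <.> N x)^2) <= (4 * C) * \<rho> * h + (2 * L^2 * v) * \<rho>^2"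
   if \<rho>: "0 < \<rho>" "\<rho> <= R / 8" for \<rho>
  proof -
   let ?A = "annulus (\<rho>/2) \<rho>"
   have AK: "?A <= K - S" "?A <= V - S" using annulus_subset[of "\<rho>/2" \<rho>] \<rho> R by auto
   have cw: "continuous_on ?A (%x. (a x <.> N x)^2)"
    by (intro continuous_intros continuous_on_subset[OF ca] continuous_on_subset[OF continuous_N]) (use AK in auto)
   have i: "integrable lborel (%x. indicator ?A x * (a x <.> N x)^2)"
    using borel_integrable_compact[OF compact_annulus cw] by simp
   have "ennreal (LINT x|lebesgue. indicator ?A x * (a x <.> N x)^2) = ennreal (\<integral>x. indicator ?A x * (a x <.> N x)^2 \<partial>lborel)"
    using i by (simp add: integral_completion borel_measurable_integrable)
   also have "... = (\<integral>\<^sup>+x. ennreal (indicator ?A x * (a x <.> N x)^2) \<partial>lborel)"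
    by (rule nn_integral_eq_integral[symmetric, OF i]) auto
   also have "... <= (\<integral>\<^sup>+x. 2 * (g (P x) * indicator {x. infdist x S < 2 * \<rho>} x) + ennreal (2 * L^2 * \<rho>^2) * indicator K x \<partial>lborel)"
   proof (rule nn_integral_mono)
    fix x
    show "ennreal (indicator ?A x * (a x <.> N x)^2) <= 2 * (g (P x) * indicator {x. infdist x S < 2 * \<rho>} x) + ennreal (2 * L^2 * \<rho>^2) * indicator K x"
    proof (cases "x : ?A")
     case True
     hence xx: "x : K - S" "x : V" "D x <= \<rho>" using AK by (auto simp: annulus_def)
     have "(D x)^2 <= \<rho>^2" using xx(3) S_basic(6) by (intro power_mono)
     hence "2 * L^2 * (D x)^2 <= 2 * L^2 * \<rho>^2" by (intro mult_left_mono) auto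
     hence "(a x <.> N x)^2 <= 2 * (a (P x) <.> DQ (P x) (a (P x))) + 2 * L^2 * \<rho>^2" using pt[OF xx(1)] by linarith
     hence "ennreal ((a x <.> N x)^2) <= ennreal (2 * (a (P x) <.> DQ (P x) (a (P x))) + 2 * L^2 * \<rho>^2)" by (rule ennreal_leI)
     also have "... = 2 * ennreal (a (P x) <.> DQ (P x) (a (P x))) + ennreal (2 * L^2 * \<rho>^2)"
     proof -
      have "a (P x) <.> DQ (P x) (a (P x)) >= 0"
       using aDa[of "P x" "N x"] DQ_P_eq[of x] xx by (metis DiffD2 zero_le_power2)
      thus ?thesis by (subst ennreal_plus) (auto simp: ennreal_mult')
     qed
     finally show ?thesis using True xx P_in[OF xx(2)] \<rho>(1) by (simp add: g_def)
    qed simp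
   qed
   also have "... = 2 * (\<integral>\<^sup>+x. g (P x) * indicator {x. infdist x S < 2 * \<rho>} x \<partial>lborel) + ennreal (2 * L^2 * \<rho>^2) * emeasure lborel K"
   proof -
    let ?T = "{x. infdist x S < 2 * \<rho>}"
    have oT: "open ?T" by (intro open_Collect_less continuous_intros)
    have sub: "?T <= V" using \<rho> R by (auto simp: V_def)
    have Pm: "P : measurable (restrict_space lborel ?T) borel"
     using borel_measurable_continuous_on_restrict[OF continuous_on_subset[OF continuous_P sub]]
     by (simp cong: measurable_cong_sets add: sets_restrict_space)
    have "(%x. g (P x)) : borel_measurable (restrict_space lborel ?T)"
     using measurable_compose[OF Pm gm] .
    hence m1: "(%x. g (P x) * indicator ?T x) : borel_measurable lborel"
     using oT by (subst (asm) borel_measurable_restrict_space_iff_ennreal) auto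
    have [measurable]: "K : sets lborel" using compact_K by (simp add: borel_compact)
    have m2: "(%x. ennreal (2 * L^2 * \<rho>^2) * indicator K x) : borel_measurable lborel" by measurable
    have "K : sets lborel" by measurable
    thus ?thesis
     using m1 m2 by (subst nn_integral_add) (auto simp: nn_integral_cmult nn_integral_cmult_indicator)
   qed
   also have "... <= 2 * (ennreal (C * (2 * \<rho>)) * ennreal h) + ennreal (2 * L^2 * \<rho>^2) * ennreal v"
   proof -
    have "(\<integral>\<^sup>+x. g (P x) * indicator {x. infdist x S < 2 * \<rho>} x \<partial>lborel) <= ennreal (C * (2 * \<rho>)) * (\<integral>\<^sup>+y. g y \<partial>?H)"
     by (rule C(2)) (use \<rho> gm in auto)
    also have "... <= ennreal (C * (2 * \<rho>)) * ennreal h" using h(2) unfolding g_def by (intro mult_left_mono) auto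
    finally show ?thesis unfolding v(1) by (intro add_mono mult_left_mono) auto
   qed
   also have "... = ennreal ((4 * C) * \<rho> * h + (2 * L^2 * v) * \<rho>^2)"
   proof -
    have "2 * (ennreal (C * (2 * \<rho>)) * ennreal h) = ennreal ((4 * C) * \<rho> * h)"
     using C(1) \<rho>(1) h(1) by (simp add: ennreal_mult'[symmetric] ennreal_mult''[symmetric] mult_ac flip: ennreal_numeral)
    moreover have "ennreal (2 * L^2 * \<rho>^2) * ennreal v = ennreal ((2 * L^2 * v) * \<rho>^2)"
     using v(2) by (simp add: ennreal_mult'[symmetric] mult_ac)
    ultimately show ?thesis using C(1) \<rho>(1) h(1) v(2) by (simp add: ennreal_plus[symmetric] del: ennreal_plus)
   qed
   finally show ?thesis
    using C(1) \<rho>(1) h(1) v(2) by (subst (asm) ennreal_le_iff) (auto intro!: add_nonneg_nonneg mult_nonneg_nonneg)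
  qed
  thus ?thesis by blast
 qed
 thus ?thesis using C(1) by (intro exI[of _ "4 * C"]) auto
qed

lemma hardy_tangential:
 assumes \<phi>: "cutoff \<phi>" and d2: "CARD('d) >= 2"
 shows "EX C>0. ALL a h \<kappa>. C_on (Suc 0) V a --> 0 <= h --> 0 < \<kappa> -->
   (\<integral>\<^sup>+y. ennreal (a y <.> DQ y (a y)) * indicator S y \<partial>hausdorff_measure (CARD('d) - 1)) <= ennreal h -->
   integrable lebesgue (%x. indicator core x * ((a x <.> N x)^2 / (D x + \<kappa>)^2)) &
   (LINT x|lebesgue. indicator core x * ((a x <.> N x)^2 / (D x + \<kappa>)^2)) <= C * (LINT x|lebesgue. indicator K x * energy_density a x) + C * h / \<kappa>"
proof -
 obtain C1 where C1: "C1 > 0" "!!w \<kappa> \<rho>. C_on (Suc 0) (V - S) w ==> 0 < \<kappa> ==> 0 < \<rho> ==> \<rho> < R / 4 ==>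
  (LINT x|lebesgue. indicator (annulus \<rho> (R/4)) x * ((w x)^2 / (D x + \<kappa>)^2)) <=
  C1 * (LINT x|lebesgue. indicator (annulus (\<rho>/2) (R/2)) x * ((w x)^2 + (grad w x <.> N x)^2)) +
  C1 / (\<kappa> * \<rho>) * (LINT x|lebesgue. indicator (annulus (\<rho>/2) \<rho>) x * (w x)^2)" using hardy_annulus[OF \<phi>] by blast
 obtain C2 where C2: "C2 > 0" "!!a h. C_on (Suc 0) V a ==> 0 <= h ==>
   (\<integral>\<^sup>+y. ennreal (a y <.> DQ y (a y)) * indicator S y \<partial>hausdorff_measure (CARD('d) - 1)) <= ennreal h ==>
   (EX B. ALL \<rho>. 0 < \<rho> --> \<rho> <= R / 8 --> (LINT x|lebesgue. indicator (annulus (\<rho>/2) \<rho>) x * (a x <.> N x)^2) <= C2 * \<rho> * h + B * \<rho>^2)"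
  using boundary_layer_le_hausdorff[OF d2] by blast
 obtain C3 where C3: "C3 >= 0" "!!x e. x : K - S ==> norm (DN x e) <= C3 * norm e" using DN_bounded by blast
 define C where "C = C1 * (3 + 2 * C3^2) + C1 * C2"
 have C: "C > 0" "C1 * (3 + 2 * C3^2) <= C" "C1 * C2 <= C"
 proof -
  have "C1 * (3 + 2 * C3^2) > 0" "C1 * C2 > 0" using C1(1) C2(1) by (auto intro!: mult_pos_pos add_pos_nonneg)
  thus "C > 0" "C1 * (3 + 2 * C3^2) <= C" "C1 * C2 <= C" by (simp_all add: C_def)
 qed
 have "integrable lebesgue (%x. indicator core x * ((a x <.> N x)^2 / (D x + \<kappa>)^2)) &
   (LINT x|lebesgue. indicator core x * ((a x <.> N x)^2 / (D x + \<kappa>)^2)) <= C * (LINT x|lebesgue. indicator K x * energy_density a x) + C * h / \<kappa>"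
  if a: "C_on (Suc 0) V a" and h: "0 <= h"
   "(\<integral>\<^sup>+y. ennreal (a y <.> DQ y (a y)) * indicator S y \<partial>hausdorff_measure (CARD('d) - 1)) <= ennreal h" and \<kappa>: "0 < \<kappa>" for a h \<kappa>
 proof
  have ca: "continuous_on V a" using C_on_SucD[OF a] by simp
  have core_K: "core <= K" using R by (auto simp: core_def K_def)
  have ccore: "compact core" unfolding core_def using compact_annulus[of 0 "R/4"] S_basic(6) by (simp add: annulus_def)
  let ?w = "%x. a x <.> N x"
  let ?f = "%x. (?w x)^2 / (D x + \<kappa>)^2"
  have s: "D x + \<kappa> >= \<kappa>" for x using S_basic(6)[of x] by simp
  note cw = C1_normal_component[OF a]
  have w_le: "(?w x)^2 <= (norm (a x))^2" if "x : V - S" for x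
  proof -
   have "\<bar>?w x\<bar> <= norm (a x) * norm (N x)" by (rule Cauchy_Schwarz_ineq2)
   hence "\<bar>?w x\<bar> <= \<bar>norm (a x)\<bar>" using norm_N[of x] that by simp
   thus ?thesis by (simp only: abs_le_square_iff)
  qed
  show i: "integrable lebesgue (%x. indicator core x * ?f x)"
  proof (rule integrable_AE_bound[where g="%x. indicator core x * ((norm (a x))^2 / \<kappa>^2)"])
   have N0: "N x = 0" if "x : S" for x using that by (simp add: N_def)
   have "(%x. indicator (core - S) x *R ?f x) : borel_measurable borel"
   proof (rule borel_measurable_continuous_on_indicator)
    show "core - S : sets borel" using ccore S_basic(2) by (intro sets.Diff borel_compact borel_closed)
    have "continuous_on (V - S) ?f"
     by (intro continuous_intros continuous_on_C1_grad_N(1)[OF cw(1)]) (use s \<kappa> in \<open>auto simp: add_nonneg_eq_0_iff S_basic(6)\<close>)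
    thus "continuous_on (core - S) ?f" by (rule continuous_on_subset) (use core_K K_subset_V in auto)
   qed
   moreover have "(%x. indicator (core - S) x *R ?f x) = (%x. indicator core x * ?f x)"
    using N0 by (auto simp: fun_eq_iff indicator_def)
   ultimately have "(%x. indicator core x * ?f x) : borel_measurable borel" by (simp only:)
   thus "(%x. indicator core x * ?f x) : borel_measurable lebesgue" by (intro measurable_completion) simp
   show "integrable lebesgue (%x. indicator core x * ((norm (a x))^2 / \<kappa>^2))"
    using \<kappa> core_K K_subset_V by (intro compact_integrable_indicator ccore continuous_intros continuous_on_subset[OF ca]) auto
   show "AE x in lebesgue. norm (indicator core x * ?f x) <= indicator core x * ((norm (a x))^2 / \<kappa>^2)"
    using AE_notin_S
   proof eventually_elim
    case (elim x)
    show ?case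
    proof (cases "x : core")
     case True
     hence xU: "x : V - S" using elim core_K K_subset_V by auto
     have "?f x <= (norm (a x))^2 / \<kappa>^2"
     proof (rule frac_le[OF _ w_le[OF xU]])
      show "\<kappa>^2 <= (D x + \<kappa>)^2" using s[of x] \<kappa> by (intro power_mono) auto
     qed (use \<kappa> in auto)
     thus ?thesis using True by simp
    qed simp
   qed
  qed
  obtain B where B: "!!\<rho>. 0 < \<rho> ==> \<rho> <= R / 8 ==> (LINT x|lebesgue. indicator (annulus (\<rho>/2) \<rho>) x * (?w x)^2) <= C2 * \<rho> * h + B * \<rho>^2"
   using C2(2)[OF a h] by blast
  let ?I = "\<integral>x. indicator K x * energy_density a x \<partial>lebesgue"
  have ed: "continuous_on V (energy_density a)"
  proof -
   have "C_on (Suc 0) V (%x. a x $ i)" for i by (rule C_on_linear_image[OF bounded_linear_vec_nth open_V a])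
   hence "continuous_on V (grad (%x. a x $ i))" for i by (rule C1_continuous_grad)
   thus ?thesis unfolding energy_density_def[abs_def] by (intro continuous_intros ca)
  qed
  have iK: "integrable lebesgue (%x. indicator K x * energy_density a x)"
   by (rule compact_integrable_indicator[OF compact_K continuous_on_subset[OF ed K_subset_V]])
  have ed0: "energy_density a x >= 0" for x unfolding energy_density_def by (intro add_nonneg_nonneg sum_nonneg) auto
  have main: "(LINT x|lebesgue. indicator (annulus \<rho> (R/4)) x * ?f x) <= C * ?I + C * h / \<kappa> + C1 * B / \<kappa> * \<rho>"
   if \<rho>: "0 < \<rho>" "\<rho> <= R / 8" for \<rho>
  proof -
   let ?A = "annulus (\<rho>/2) (R/2)"
   have AU: "?A <= V - S" "?A <= K - S" using annulus_subset[of "\<rho>/2" "R/2"] \<rho> R by auto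
   have c: "continuous_on ?A (%x. (?w x)^2 + (grad ?w x <.> N x)^2)"
    by (intro continuous_intros continuous_on_subset[OF continuous_on_C1_grad_N(1)[OF cw(1)] AU(1)] continuous_on_subset[OF continuous_on_C1_grad_N(2)[OF cw(1)] AU(1)])
   have "(LINT x|lebesgue. indicator ?A x * ((?w x)^2 + (grad ?w x <.> N x)^2)) <= (LINT x|lebesgue. (3 + 2 * C3^2) * (indicator K x * energy_density a x))"
   proof (rule integral_mono)
    show "integrable lebesgue (%x. indicator ?A x * ((?w x)^2 + (grad ?w x <.> N x)^2))"
     by (rule compact_integrable_indicator[OF compact_annulus c])
    show "integrable lebesgue (%x. (3 + 2 * C3^2) * (indicator K x * energy_density a x))" using iK by (rule integrable_mult_right)
    fix x
    show "indicator ?A x * ((?w x)^2 + (grad ?w x <.> N x)^2) <= (3 + 2 * C3^2) * (indicator K x * energy_density a x)"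
    proof (cases "x : ?A")
     case True
     hence x: "x : K - S" "x : V - S" using AU by auto
     let ?\<Sigma> = "\<Sum>i\<in>UNIV. (norm (grad (%x. a x $ i) x))^2"
     let ?Da = "frechet_derivative a (at x) (N x)"
     have n1: "norm (N x) = 1" using norm_N[of x] x by auto
     have g: "grad ?w x <.> N x = a x <.> DN x (N x) + ?Da <.> N x" by (rule cw(2)[OF x(2)])
     have 1: "(a x <.> DN x (N x))^2 <= C3^2 * (norm (a x))^2"
     proof -
      have "\<bar>a x <.> DN x (N x)\<bar> <= norm (a x) * norm (DN x (N x))" by (rule Cauchy_Schwarz_ineq2)
      also have "... <= norm (a x) * C3" using C3(2)[OF x(1), of "N x"] n1 by (intro mult_left_mono) auto
      also have "... = \<bar>C3 * norm (a x)\<bar>" using C3(1) by (simp add: mult.commute)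
      finally show ?thesis unfolding abs_le_square_iff by (simp add: power_mult_distrib)
     qed
     have 2: "(?Da <.> N x)^2 <= ?\<Sigma>"
     proof -
      have "\<bar>?Da <.> N x\<bar> <= \<bar>norm ?Da\<bar>" using Cauchy_Schwarz_ineq2[of ?Da "N x"] n1 by simp
      hence "(?Da <.> N x)^2 <= (norm ?Da)^2" by (simp only: abs_le_square_iff)
      also have "... <= ?\<Sigma> * (norm (N x))^2"
       using a x(2) by (intro frechet_norm_le_grads) simp
      finally show ?thesis using n1 by simp
     qed
     have "(grad ?w x <.> N x)^2 <= 2 * (a x <.> DN x (N x))^2 + 2 * (?Da <.> N x)^2"
      unfolding g using zero_le_power2[of "a x <.> DN x (N x) - ?Da <.> N x"] by (simp add: power2_eq_square algebra_simps)
     hence "(?w x)^2 + (grad ?w x <.> N x)^2 <= (1 + 2 * C3^2) * (norm (a x))^2 + 2 * ?\<Sigma>"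
      using 1 2 w_le[OF x(2)] by (simp add: algebra_simps)
     also have "... <= (3 + 2 * C3^2) * (norm (a x))^2 + (3 + 2 * C3^2) * ?\<Sigma>"
      by (intro add_mono mult_right_mono sum_nonneg) auto
     also have "... = (3 + 2 * C3^2) * energy_density a x" by (simp add: energy_density_def distrib_left)
     finally show ?thesis using True x by simp
    qed (use ed0 in simp)
   qed
   also have "... = (3 + 2 * C3^2) * ?I" by simp
   finally have X: "C1 * (LINT x|lebesgue. indicator ?A x * ((?w x)^2 + (grad ?w x <.> N x)^2)) <= C1 * ((3 + 2 * C3^2) * ?I)"
    using C1(1) by (intro mult_left_mono) auto
   have Y: "C1 / (\<kappa> * \<rho>) * (LINT x|lebesgue. indicator (annulus (\<rho>/2) \<rho>) x * (?w x)^2) <= C1 / (\<kappa> * \<rho>) * (C2 * \<rho> * h + B * \<rho>^2)"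
    using B[OF \<rho>] C1(1) \<kappa> \<rho>(1) by (intro mult_left_mono) auto
   have "C1 / (\<kappa> * \<rho>) * (C2 * \<rho> * h + B * \<rho>^2) = (C1 * C2) * (h / \<kappa>) + C1 * B / \<kappa> * \<rho>"
    using \<kappa> \<rho>(1) by (simp add: field_simps power2_eq_square)
   moreover have "(C1 * C2) * (h / \<kappa>) <= C * (h / \<kappa>)" using C(3) h(1) \<kappa> by (intro mult_right_mono) auto
   moreover have "C1 * ((3 + 2 * C3^2) * ?I) <= C * ?I"
   proof -
    have "?I >= 0" using ed0 by (intro integral_nonneg_AE) (auto simp: indicator_def)
    thus ?thesis using mult_right_mono[OF C(2)] by (simp add: mult.assoc)
   qed
   moreover have "(LINT x|lebesgue. indicator (annulus \<rho> (R/4)) x * ?f x) <=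
    C1 * (LINT x|lebesgue. indicator ?A x * ((?w x)^2 + (grad ?w x <.> N x)^2)) +
    C1 / (\<kappa> * \<rho>) * (LINT x|lebesgue. indicator (annulus (\<rho>/2) \<rho>) x * (?w x)^2)"
    by (rule C1(2)[OF cw(1) \<kappa> \<rho>(1)]) (use \<rho> R in auto)
   ultimately show ?thesis using X Y by simp
  qed
  let ?r = "%n. R / 4 / real (n + 2)"
  have r: "0 < ?r n" "?r n <= R / 8" for n
  proof -
   show "0 < ?r n" using R by simp
   have "?r n <= R / 4 / 2" using R by (intro divide_left_mono) auto
   thus "?r n <= R / 8" by simp
  qed
  have e: "Suc (n + 1) = n + 2" for n by simp
  have "(%n. (R / 4) * inverse (real (n + 2))) \<longlonglongrightarrow> (R / 4) * 0"
   using LIMSEQ_ignore_initial_segment[OF LIMSEQ_inverse_real_of_nat, of 1] unfolding e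
   by (intro tendsto_mult tendsto_const)
  hence "?r \<longlonglongrightarrow> 0" unfolding divide_inverse mult_zero_right .
  hence "(%n. C * ?I + C * h / \<kappa> + C1 * B / \<kappa> * ?r n) \<longlonglongrightarrow> C * ?I + C * h / \<kappa> + C1 * B / \<kappa> * 0"
   by (intro tendsto_intros)
  hence lim: "(%n. C * ?I + C * h / \<kappa> + C1 * B / \<kappa> * ?r n) \<longlonglongrightarrow> C * ?I + C * h / \<kappa>" by simp
  show "(LINT x|lebesgue. indicator core x * ?f x) <= C * ?I + C * h / \<kappa>"
   by (rule LIMSEQ_le[OF core_annulus_LIMSEQ[OF i] lim]) (intro exI[of _ 0] allI impI main[OF r])
 qed
 thus ?thesis using C(1) by blast
qed

end

section \<open>The signed distance\<close>

locale enclosed_tube = hypersurface_tube S R P for S :: "(real^'d) set" and R :: real and P :: "real^'d => real^'d" +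
 fixes W :: "(real^'d) set"
 assumes enc: "encloses S W"
begin

abbreviation "sd == sdist S W"

lemma W_basic: "open W" "frontier W = S" "interior (closure W) = W" "x : W ==> x ~: S" "x ~: W ==> x ~: S ==> x : - closure W"
proof -
 show o: "open W" and f: "frontier W = S" and "interior (closure W) = W" using enc by (simp_all add: encloses_def)
 show "x : W ==> x ~: S" using f o by (auto simp: frontier_def interior_open)
 show "x ~: W ==> x ~: S ==> x : - closure W" using f o by (auto simp: frontier_def interior_open)
qed

lemma connected_same_side:
 assumes "connected C" "C \<inter> S = {}" "x : C" "y : C"
 shows "x : W \<longleftrightarrow> y : W"
 using connected_Int_frontier[OF assms(1), of W] assms(2-4) W_basic(2) by blast

lemma abs_sd: "\<bar>sd x\<bar> = D x" by (simp add: sdist_def infdist_nonneg)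

lemma sd_lipschitz: "1-lipschitz_on UNIV sd"
proof -
 have cross: "D x + D y <= dist x y" if "x : W" "y ~: W" for x y
 proof -
  have "closed_segment x y \<inter> S ~= {}"
   using connected_same_side[of "closed_segment x y" x y] that connected_segment(1) by auto
  then obtain w where w: "w : closed_segment x y" "w : S" by blast
  have "D x <= dist x w" "D y <= dist y w" using infdist_le[OF w(2)] by auto
  moreover have "dist x y = dist x w + dist w y" using w(1) between_mem_segment[of x y w] by (simp add: between)
  ultimately show ?thesis by (simp add: dist_commute)
 qed
 show ?thesis
 proof (rule lipschitz_onI)
  fix x y :: "real^'d"
  have "\<bar>D x - D y\<bar> <= dist x y" by (rule infdist_triangle_abs)
  thus "dist (sd x) (sd y) <= 1 * dist x y"
   using cross[of x y] cross[of y x] S_basic(6)[of x] S_basic(6)[of y]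
   by (auto simp: sdist_def dist_real_def dist_commute)
 qed simp
qed

definition side :: "real^'d => real" where "side x = (if x : W then 1 else - 1)"

lemma sd_eq_side: "sd x = side x * D x" by (simp add: sdist_def side_def)

lemma side_locally_constant:
 assumes "x ~: S" shows "EX U. open U & x : U & (ALL y:U. side y = side x)"
proof (cases "x : W")
 case True thus ?thesis using W_basic(1) by (intro exI[of _ W]) (simp add: side_def)
next
 case False
 hence "x : - closure W" using W_basic(5) assms by blast
 moreover have "y ~: W" if "y : - closure W" for y using that closure_subset[of W] by blast
 ultimately show ?thesis using False by (intro exI[of _ "- closure W"]) (auto simp: side_def open_Compl)
qed

lemma has_derivative_sd:
 assumes x: "x : V - S"
 shows "(sd has_derivative (%e. (side x *R N x) <.> e)) (at x)"
proof -
 obtain U where U: "open U" "x : U" "!!y. y : U ==> side y = side x" using side_locally_constant[of x] x by blast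
 have "((%y. side x * D y) has_derivative (%e. side x * (N x <.> e))) (at x)"
  using x by (intro has_derivative_mult_right has_derivative_infdist) auto
 hence "(sd has_derivative (%e. side x * (N x <.> e))) (at x)"
  by (rule has_derivative_transform_within_open[OF _ U(1,2)]) (simp add: sd_eq_side U(3))
 thus ?thesis by simp
qed

lemma grad_sd: "x : V - S ==> grad sd x = side x *R N x"
 by (rule grad_eqI[OF has_derivative_sd])

lemma norm_grad_sd: "x : V - S ==> norm (grad sd x) = 1"
 using norm_N[of x] by (simp add: grad_sd side_def)

lemma isCont_grad_sd:
 assumes x: "x : V - S"
 shows "isCont (grad sd) x"
proof -
 obtain U where U: "open U" "x : U" "!!y. y : U ==> side y = side x" using side_locally_constant[of x] x by blast
 have "continuous_on (U \<inter> (V - S)) (%y. side x *R N y)"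
  by (intro continuous_intros continuous_on_subset[OF continuous_N]) auto
 hence "continuous_on (U \<inter> (V - S)) (grad sd)"
  by (rule continuous_on_eq) (simp add: grad_sd U(3))
 moreover have "open (U \<inter> (V - S))" using U(1) open_V_S by blast
 ultimately show ?thesis using U(2) x by (simp add: continuous_on_eq_continuous_at)
qed

text \<open>Along the gradient of a defining function, points on one side of \<open>S\<close> near \<open>y\<close> can be moved to a
  common ball without meeting \<open>S\<close>.  Since \<open>W\<close> is the interior of its closure, the two sides are
  different.\<close>

lemma orientation:
 assumes y: "y : S" and U: "open U" "y : U" and h: "C_on (Suc 0) U h" "grad h y ~= 0" "S \<inter> U = {x : U. h x = 0}"
 shows "EX \<sigma> r. (\<sigma> = 1 | \<sigma> = - 1) & 0 < r & (ALL x:ball y r. x : U & (h x > 0 --> side x = \<sigma>) & (h x < 0 --> side x = - \<sigma>))"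
proof -
 let ?g = "grad h y"
 have cg: "continuous_on U (%x. grad h x <.> ?g)" by (intro continuous_intros C1_continuous_grad h(1))
 hence "open {x : U. grad h x <.> ?g > 0}"
  using continuous_open_preimage[OF cg U(1), of "{0<..}"] by (simp add: vimage_def Int_def)
 moreover have "y : {x : U. grad h x <.> ?g > 0}" using U(2) h(2) by simp
 ultimately obtain \<rho> where \<rho>: "\<rho> > 0" "ball y \<rho> <= {x : U. grad h x <.> ?g > 0}" using open_contains_ball by blast
 have ng: "norm ?g > 0" using h(2) by simp
 define s where "s = \<rho> / 2 / norm ?g"
 have s: "s > 0" "s * norm ?g = \<rho> / 2" using \<rho>(1) ng by (simp_all add: s_def)
 have ch: "continuous_on U h" using C_on_SucD[OF h(1)] by simp
 have h0: "h y = 0" using h(3) y U(2) by blast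
 have inb: "x + t *R ?g : ball y \<rho>" if "x : ball y (\<rho>/2)" "\<bar>t\<bar> <= s" for x t
 proof -
  have "\<bar>t\<bar> * norm ?g <= s * norm ?g" using that(2) ng by (intro mult_right_mono) auto
  hence "norm (t *R ?g) <= \<rho>/2" using s(2) by simp
  moreover have "norm (y - x) < \<rho>/2" using that(1) by (simp add: dist_norm)
  ultimately have "norm ((y - x) - t *R ?g) < \<rho>" using norm_triangle_ineq4[of "y - x" "t *R ?g"] by linarith
  thus ?thesis by (simp add: dist_norm diff_diff_eq)
 qed
 have incr: "h (x + t1 *R ?g) < h (x + t2 *R ?g)" if x: "x : ball y (\<rho>/2)" and t: "- s <= t1" "t1 < t2" "t2 <= s" for x t1 t2
 proof (rule DERIV_pos_imp_increasing[OF t(2)])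
  fix t assume t': "t1 <= t" "t <= t2"
  have "\<bar>t\<bar> <= s" using t t' by linarith
  hence m: "x + t *R ?g : {x : U. grad h x <.> ?g > 0}" using inb[OF x] \<rho>(2) by blast
  have "(h has_derivative (%e. grad h (x + t *R ?g) <.> e)) (at (x + t *R ?g))"
   using h(1) m by (intro has_derivative_grad) simp
  moreover have "((%s. x + s *R ?g) has_derivative (%e. e *R ?g)) (at t)" by (auto intro!: derivative_eq_intros)
  ultimately have "((%s. h (x + s *R ?g)) has_derivative (%e. grad h (x + t *R ?g) <.> (e *R ?g))) (at t)"
   using has_derivative_compose by blast
  hence "((%s. h (x + s *R ?g)) has_real_derivative grad h (x + t *R ?g) <.> ?g) (at t)"
   by (simp add: has_field_derivative_def mult.commute[of _ "grad h (x + t *R ?g) <.> ?g"])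
  thus "EX D. ((%s. h (x + s *R ?g)) has_real_derivative D) (at t) & 0 < D" using m by blast
 qed
 define p where "p c = y + (c * s) *R ?g" for c :: real
 have yb: "y : ball y (\<rho>/2)" using \<rho>(1) by simp
 have pU: "p c : U" if "c = 1 | c = - 1" for c
 proof -
  have "\<bar>c * s\<bar> <= s" using that s(1) by auto
  thus ?thesis using inb[OF yb] \<rho>(2) unfolding p_def by blast
 qed
 have hp: "h (p 1) > 0" "h (p (- 1)) < 0"
  using incr[OF yb, of 0 s] incr[OF yb, of "- s" 0] h0 s(1) by (simp_all add: p_def)
 have "open {x : U. h x > 0}" "open {x : U. h x < 0}"
  using continuous_open_preimage[OF ch U(1), of "{0<..}"] continuous_open_preimage[OF ch U(1), of "{..<0}"]
  by (simp_all add: vimage_def Int_def)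
 then obtain r1 r2 where r1: "r1 > 0" "ball (p 1) r1 <= {x : U. h x > 0}" and r2: "r2 > 0" "ball (p (- 1)) r2 <= {x : U. h x < 0}"
  using hp pU open_contains_ball by (metis (mono_tags, lifting) mem_Collect_eq)
 define r where "r = min (min r1 r2) (\<rho>/2)"
 have r: "r > 0" "r <= r1" "r <= r2" "r <= \<rho>/2" using r1 r2 \<rho>(1) by (auto simp: r_def)
 have same: "x : W \<longleftrightarrow> p c : W" if x: "x : ball y r" and c: "c = 1 | c = - 1" "c * h x > 0" for x c
 proof -
  let ?x' = "x + (c * s) *R ?g"
  let ?C = "closed_segment x ?x' \<union> closed_segment ?x' (p c)"
  have xb: "x : ball y (\<rho>/2)" using x r(4) by auto
  have pos1: "z : U & c * h z > 0" if z: "z : closed_segment x ?x'" for z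
  proof -
   obtain u where u: "0 <= u" "u <= 1" "z = x + (u * c * s) *R ?g"
    using z unfolding closed_segment_image_interval by (auto simp: algebra_simps)
   have us: "u * s <= s" "0 <= u * s" using u s(1) by (auto simp: mult_left_le_one_le)
   have zb: "z : ball y \<rho>" unfolding u(3) using c(1) us by (intro inb[OF xb]) (auto simp: abs_mult mult_ac)
   have "c * h z > 0"
   proof (cases "u = 0")
    case True thus ?thesis using c(2) u(3) by simp
   next
    case False
    hence p0: "u * s > 0" using u s(1) by simp
    show ?thesis
    proof (cases "c = 1")
     case True
     hence "h (x + 0 *R ?g) < h (x + (u * s) *R ?g)" using us p0 s(1) by (intro incr[OF xb]) auto
     thus ?thesis using True c(2) u(3) by simp
    next
     case False
     hence cm: "c = - 1" using c(1) by simp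
     have "h (x + (- (u * s)) *R ?g) < h (x + 0 *R ?g)" using us p0 s(1) by (intro incr[OF xb]) auto
     thus ?thesis using cm c(2) u(3) by simp
    qed
   qed
   thus ?thesis using zb \<rho>(2) by blast
  qed
  have pos2: "z : U & c * h z > 0" if z: "z : closed_segment ?x' (p c)" for z
  proof -
   have "?x' : ball (p c) r" using x by (simp add: p_def dist_norm)
   moreover have "p c : ball (p c) r" using r(1) by simp
   ultimately have "z : ball (p c) r" using z closed_segment_subset[of ?x' "ball (p c) r" "p c"] convex_ball by blast
   from c(1) show ?thesis
   proof
    assume c1: "c = 1"
    hence "z : {x : U. h x > 0}" using \<open>z : ball (p c) r\<close> subset_ball[OF r(2), of "p 1"] r1(2) by blast
    thus ?thesis using c1 by simp
   next
    assume c1: "c = - 1"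
    hence "z : {x : U. h x < 0}" using \<open>z : ball (p c) r\<close> subset_ball[OF r(3), of "p (- 1)"] r2(2) by blast
    thus ?thesis using c1 by simp
   qed
  qed
  have "?C \<inter> S = {}"
  proof -
   have "z ~: S" if "z : ?C" for z
   proof
    assume "z : S"
    moreover have "z : U" "c * h z > 0" using pos1 pos2 that by blast+
    ultimately have "h z = 0" using h(3) by blast
    thus False using \<open>c * h z > 0\<close> by simp
   qed
   thus ?thesis by blast
  qed
  moreover have "connected ?C" by (intro connected_Un connected_segment) auto
  ultimately show ?thesis by (intro connected_same_side[of ?C]) auto
 qed
 have bU: "ball y r <= U" using \<rho> r(4) by (auto simp: subset_iff)
 have cases: "x : W & (h x > 0 & p 1 : W | h x < 0 & p (-1) : W) | x : S | x ~: W & (h x > 0 & p 1 ~: W | h x < 0 & p (-1) ~: W)" if x: "x : ball y r" for x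
 proof -
  have "h x = 0 ==> x : S" using x bU h(3) by blast
  thus ?thesis using same[OF x, of 1] same[OF x, of "- 1"] by (cases "h x" "0::real" rule: linorder_cases) auto
 qed
 have yW: "y ~: W" using y W_basic(4) by blast
 have neq: "p 1 : W \<longleftrightarrow> p (- 1) ~: W"
 proof (rule ccontr)
  assume "\<not> ?thesis"
  then consider "p 1 : W" "p (- 1) : W" | "p 1 ~: W" "p (- 1) ~: W" by blast
  thus False
  proof cases
   case 1
   have "ball y r <= closure W"
   proof
    fix x assume "x : ball y r"
    hence "x : W | x : S" using cases 1 by blast
    thus "x : closure W" using closure_subset W_basic(2) by (auto simp: frontier_def)
   qed
   hence "y : interior (closure W)" using r(1) by (meson centre_in_ball interior_maximal open_ball subsetD)
   thus False using W_basic(3) yW by simp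
  next
   case 2
   have "y : closure W" using y W_basic(2) by (auto simp: frontier_def)
   hence "ball y r \<inter> W ~= {}" using r(1) open_Int_closure_eq_empty[of "ball y r" W] centre_in_ball[of y r] by (metis IntI empty_iff open_ball)
   then obtain x where "x : ball y r" "x : W" by blast
   thus False using cases[of x] 2 W_basic(4) by blast
  qed
 qed
 show ?thesis
 proof (rule exI[of _ "side (p 1)"], rule exI[of _ r], intro conjI ballI)
  show "side (p 1) = 1 | side (p 1) = - 1" by (simp add: side_def)
  fix x assume x: "x : ball y r"
  show "x : U" using x bU by blast
  show "h x > 0 --> side x = side (p 1)" using same[OF x, of 1] by (auto simp: side_def)
  show "h x < 0 --> side x = - side (p 1)" using same[OF x, of "- 1"] neq by (auto simp: side_def)
 qed (rule r(1))
qed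

text \<open>On \<open>S\<close> the modulus of the signed distance is known to first order from \<open>x - P x\<close>, and its sign
  from the defining function.\<close>

lemma DQ_eq_grad_sd:
 assumes y: "y : S"
 shows "DQ y e = (grad sd y <.> e) *R grad sd y" "norm (grad sd y) = 1"
proof -
 obtain U h where U: "open U" "y : U" and h: "C_on (Suc 0) U h" "grad h y ~= 0" "S \<inter> U = {x : U. h x = 0}"
  by (rule hypersurface_local[OF y])
 define m where "m = grad h y /R norm (grad h y)"
 have ng: "norm (grad h y) > 0" using h(2) by simp
 have DQm: "DQ y e = (m <.> e) *R m" for e using DQ_on_S_from_level_set[OF y U h] by (simp add: m_def)
 have m1: "norm m = 1" using h(2) by (simp add: m_def)
 obtain \<sigma> r where \<sigma>: "\<sigma> = 1 | \<sigma> = - 1" and r: "0 < r" "!!x. x : ball y r ==> h x > 0 ==> side x = \<sigma>" "!!x. x : ball y r ==> h x < 0 ==> side x = - \<sigma>"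
  using orientation[OF y U h] by blast
 have yV: "y : V" using y S_subset_V by blast
 have sy: "sd y = 0" using abs_sd[of y] S_basic(4)[OF y] by simp
 have h0: "h y = 0" using h(3) y U(2) by blast
 have gm: "grad h y = norm (grad h y) *R m" using h(2) by (simp add: m_def)
 have "(sd has_derivative (%e. (\<sigma> *R m) <.> e)) (at y)"
  unfolding has_derivative_at_alt
 proof (intro conjI allI impI)
  show "bounded_linear (%e. (\<sigma> *R m) <.> e)" by (rule bounded_linear_inner_right)
  fix \<eta>0 :: real assume "\<eta>0 > 0"
  define \<eta> where "\<eta> = \<eta>0 / 3"
  have \<eta>: "\<eta> > 0" using \<open>\<eta>0 > 0\<close> by (simp add: \<eta>_def)
  have dh: "(h has_derivative (%e. grad h y <.> e)) (at y)" using h(1) U(2) by (intro has_derivative_grad) simp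
  obtain d1 where d1: "d1 > 0" "!!x. norm (x - y) < d1 ==> norm (Q x - Q y - DQ y (x - y)) <= \<eta> * norm (x - y)"
   using DQ[OF yV] \<eta> unfolding has_derivative_at_alt by blast
  obtain d2 where d2: "d2 > 0" "!!x. norm (x - y) < d2 ==> norm (h x - h y - grad h y <.> (x - y)) <= (\<eta> * norm (grad h y)) * norm (x - y)"
   using dh \<eta> ng unfolding has_derivative_at_alt by (metis mult_pos_pos)
  obtain d3 where d3: "d3 > 0" "ball y d3 <= V" using open_V yV open_contains_ball by blast
  show "EX d>0. ALL x. norm (x - y) < d --> norm (sd x - sd y - (\<sigma> *R m) <.> (x - y)) <= \<eta>0 * norm (x - y)"
  proof (intro exI[of _ "min (min d1 d2) (min d3 r)"] conjI allI impI)
   show "0 < min (min d1 d2) (min d3 r)" using d1 d2 d3 r by simp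
   fix x assume x: "norm (x - y) < min (min d1 d2) (min d3 r)"
   let ?c = "m <.> (x - y)"
   have xr: "x : ball y r" "x : V" using x d3(2) by (auto simp: dist_norm norm_minus_commute subset_iff)
   have "norm (Q x - ?c *R m) <= \<eta> * norm (x - y)" using d1(2)[of x] x Q_S[OF y] by (simp add: DQm)
   moreover have "\<bar>norm (Q x) - norm (?c *R m)\<bar> <= norm (Q x - ?c *R m)" by (rule norm_triangle_ineq3)
   ultimately have A: "\<bar>\<bar>sd x\<bar> - \<bar>?c\<bar>\<bar> <= \<eta> * norm (x - y)" using norm_Q[OF xr(2)] abs_sd[of x] m1 by simp
   have "\<bar>h x - norm (grad h y) * ?c\<bar> <= (\<eta> * norm (grad h y)) * norm (x - y)"
   proof -
    have "grad h y <.> (x - y) = norm (grad h y) * ?c" using ng by (simp add: m_def)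
    thus ?thesis using d2(2)[of x] x h0 by simp
   qed
   hence B: "\<bar>h x - norm (grad h y) * ?c\<bar> <= norm (grad h y) * (\<eta> * norm (x - y))" by (simp add: mult_ac)
   have "\<bar>sd x - \<sigma> * ?c\<bar> <= 3 * (\<eta> * norm (x - y))"
   proof (cases "\<bar>?c\<bar> <= \<eta> * norm (x - y)")
    case True
    hence "\<bar>sd x\<bar> <= 2 * (\<eta> * norm (x - y))" using A by linarith
    moreover have "\<bar>\<sigma> * ?c\<bar> <= \<eta> * norm (x - y)" using True \<sigma> by auto
    ultimately show ?thesis by linarith
   next
    case False
    have e0: "0 <= \<eta> * norm (x - y)" using \<eta> by simp
    have "side x * sgn ?c = \<sigma>"
    proof (cases "?c > 0")
     case True
     hence "norm (grad h y) * (\<eta> * norm (x - y)) < norm (grad h y) * ?c" using False ng by (intro mult_strict_left_mono) auto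
     hence "h x > 0" using B by linarith
     thus ?thesis using r(2)[OF xr(1)] True by simp
    next
     case nc: False
     hence "norm (grad h y) * (\<eta> * norm (x - y)) < norm (grad h y) * (- ?c)" using False ng by (intro mult_strict_left_mono) auto
     hence "h x < 0" using B by simp
     thus ?thesis using r(3)[OF xr(1)] nc False e0 by (simp add: sgn_real_def)
    qed
    moreover have "side x = 1 | side x = - 1" by (simp add: side_def)
    moreover have "sd x = side x * \<bar>sd x\<bar>" using abs_sd[of x] sd_eq_side[of x] by simp
    ultimately have "\<bar>sd x - \<sigma> * ?c\<bar> = \<bar>\<bar>sd x\<bar> - \<bar>?c\<bar>\<bar>"
     by (auto simp: sgn_real_def split: if_splits)
    thus ?thesis using A e0 by linarith
   qed
   thus "norm (sd x - sd y - (\<sigma> *R m) <.> (x - y)) <= \<eta>0 * norm (x - y)" by (simp add: sy \<eta>_def)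
  qed
 qed
 hence "grad sd y = \<sigma> *R m" by (rule grad_eqI)
 thus "DQ y e = (grad sd y <.> e) *R grad sd y" "norm (grad sd y) = 1" using \<sigma> m1 by (auto simp: DQm)
qed

end

section \<open>The transition profile\<close>

lemma double_well_facts:
 assumes "double_well f g"
 shows "continuous_on {0..} g" "!!s. 0 <= s ==> 0 <= g s" "!!s. 0 <= s ==> f s = (g s)^2 / 2" "g 0 = 0" "g 1 = 0"
  "EX s0. 0 < s0 & s0 < 1 & (ALL s t. 0 <= s --> s <= t --> t <= s0 --> g s <= g t) & (ALL s t. s0 <= s --> s <= t --> t <= 1 --> g t <= g s)"
proof -
 show nn: "!!s. 0 <= s ==> 0 <= g s" and fg: "!!s. 0 <= s ==> f s = (g s)^2 / 2" and "g 0 = 0" "g 1 = 0"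
  using assms unfolding double_well_def by auto
 have lip: "ALL s>=0. EX r>0. EX L. L-lipschitz_on (cball s r \<inter> {0..}) g" using assms unfolding double_well_def by blast
 show "continuous_on {0..} g"
  unfolding continuous_on_eq_continuous_within
 proof
  fix s :: real assume s: "s : {0..}"
  then obtain r L where r: "r > 0" "L-lipschitz_on (cball s r \<inter> {0..}) g" using lip by auto
  have "continuous (at s within cball s r \<inter> {0..}) g"
   by (rule lipschitz_on_continuous_within[OF r(2)]) (use r s in auto)
  moreover have "at s within cball s r \<inter> {0..} = at s within {0..}"
   by (rule at_within_nhd[of s "ball s r"]) (use r in auto)
  ultimately show "continuous (at s within {0..}) g" by simp
 qed
 have dif: "f differentiable (at s within {0..})" if "s >= 0" for s
 proof -
  have "ALL k. ALL s>=0. (hderiv ^^ k) f differentiable (at s within {0..})" using assms unfolding double_well_def by blast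
  from spec[OF this, of 0] show ?thesis using that by simp
 qed
 have cf: "continuous_on {0..} f"
  unfolding continuous_on_eq_continuous_within using dif differentiable_imp_continuous_within by auto
 have df: "(f has_real_derivative hderiv f s) (at s)" if "s > 0" for s
 proof -
  have i: "at s within {0..} = at s" by (rule at_within_interior) (use that in simp)
  have "f differentiable (at s)" using dif[of s] that i by simp
  hence "(f has_vector_derivative vector_derivative f (at s)) (at s)" by (simp add: vector_derivative_works)
  thus ?thesis using i by (simp add: hderiv_def has_real_derivative_iff_has_vector_derivative)
 qed
 have "EX s0. 0 < s0 & s0 < 1 & (ALL s:{0<..<s0}. hderiv f s > 0) & (ALL s:{s0<..<1}. hderiv f s < 0)"
  using assms unfolding double_well_def by (elim conjE)
 then obtain s0 where s0: "0 < s0" "s0 < 1" "ALL s:{0<..<s0}. hderiv f s > 0" "ALL s:{s0<..<1}. hderiv f s < 0"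
  by blast
 have root: "g s <= g t" if "f s <= f t" "0 <= s" "0 <= t" for s t
 proof (rule power2_le_imp_le)
  show "(g s)^2 <= (g t)^2" using that(1) fg[OF that(2)] fg[OF that(3)] by simp
 qed (rule nn[OF that(3)])
 have "g s <= g t" if "0 <= s" "s <= t" "t <= s0" for s t
 proof (cases "s = t")
  case False
  have "f s < f t"
  proof (rule DERIV_pos_imp_increasing_open[where f=f and a=s and b=t])
   show "s < t" using that False by simp
   show "EX y. (f has_real_derivative y) (at x) & 0 < y" if "s < x" "x < t" for x
    by (rule exI[of _ "hderiv f x"]) (use that \<open>0 <= s\<close> \<open>t <= s0\<close> s0(3) df[of x] in simp)
   show "continuous_on {s..t} f" by (rule continuous_on_subset[OF cf]) (use \<open>0 <= s\<close> in auto)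
  qed
  thus ?thesis using root that by simp
 qed simp
 moreover have "g t <= g s" if "s0 <= s" "s <= t" "t <= 1" for s t
 proof (cases "s = t")
  case False
  have "f s > f t"
  proof (rule DERIV_neg_imp_decreasing_open[where f=f and a=s and b=t])
   show "s < t" using that False by simp
   show "EX y. (f has_real_derivative y) (at x) & y < 0" if "s < x" "x < t" for x
    by (rule exI[of _ "hderiv f x"]) (use that \<open>s0 <= s\<close> \<open>t <= 1\<close> s0(1,4) df[of x] in simp)
   show "continuous_on {s..t} f" by (rule continuous_on_subset[OF cf]) (use \<open>s0 <= s\<close> s0(1) in auto)
  qed
  thus ?thesis using root that s0 by simp
 qed simp
 ultimately show "EX s0. 0 < s0 & s0 < 1 & (ALL s t. 0 <= s --> s <= t --> t <= s0 --> g s <= g t) & (ALL s t. s0 <= s --> s <= t --> t <= 1 --> g t <= g s)"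
  using s0(1,2) by blast
qed

lemma lipschitz_from_derivative_bound:
 fixes f :: "real => real"
 assumes "!!x. (f has_real_derivative f' x) (at x)" "!!x. \<bar>f' x\<bar> <= L"
 shows "L-lipschitz_on UNIV f"
proof (rule lipschitz_onI)
 show "0 <= L" using assms(2)[of 0] by linarith
 fix x y
 have "norm (f x - f y) <= L * norm (x - y)"
  by (rule field_differentiable_bound[of UNIV f f' L]) (use assms in auto)
 thus "dist (f x) (f y) <= L * dist x y" by (simp add: dist_norm)
qed

definition profile :: "(real => real) => real => real => (real => real) => real => real => bool" where
 "profile g r \<epsilon> p a b \<longleftrightarrow> - r <= a & a < 0 & 0 < b & b <= r & (EX L. L-lipschitz_on UNIV p) &
   (ALL z<=a. p z = 0) & (ALL z>=b. p z = 1) & (ALL z. 0 <= p z & p z <= 1) &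
   (ALL z:{a<..<b}. (p has_real_derivative (g (p z) + \<epsilon> / r) / \<epsilon>) (at z) & \<bar>z\<bar> * (g (p z) + \<epsilon> / r) <= \<epsilon>) &
   (ALL z<=0. integral {0..p z} g <= g (p z)) & (ALL z>=0. integral {p z..1} g <= g (p z))"

text \<open>Adding \<open>\<epsilon> / r\<close> to the speed of the optimal profile makes it reach both wells within distance \<open>r\<close>.
  The profile is the inverse of the travel time; since \<open>g\<close> is monotone on either side of its maximum,
  the travel time from the maximum to a value is at most the length of the value interval over the
  speed at its far end.\<close>

lemma profile_exists:
 assumes dw: "double_well f g" and r: "r > 0" and \<epsilon>: "\<epsilon> > 0"
 shows "EX p a b. profile g r \<epsilon> p a b"
proof -
 note F = double_well_facts[OF dw]
 obtain s0 where s0: "0 < s0" "s0 < 1" and up: "!!s t. 0 <= s ==> s <= t ==> t <= s0 ==> g s <= g t"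
  and down: "!!s t. s0 <= s ==> s <= t ==> t <= 1 ==> g t <= g s" using F(6) by blast
 define cl :: "real => real" where "cl s = max 0 (min 1 s)" for s
 have cl01: "0 <= cl s" "cl s <= 1" for s by (auto simp: cl_def)
 have clid: "cl s = s" if "0 <= s" "s <= 1" for s using that by (auto simp: cl_def)
 define \<kappa> where "\<kappa> = \<epsilon> / r"
 have \<kappa>: "\<kappa> > 0" using r \<epsilon> by (simp add: \<kappa>_def)
 define G where "G s = g (cl s)" for s
 have Gid: "G s = g s" if "0 <= s" "s <= 1" for s using clid[OF that] by (simp add: G_def)
 have G0: "G s >= 0" for s using F(2) cl01 by (simp add: G_def)
 have GM: "G s <= g s0" for s
 proof (cases "cl s <= s0")
  case True thus ?thesis using up[of "cl s" s0] cl01 by (simp add: G_def)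
 next
  case False thus ?thesis using down[of s0 "cl s"] cl01[of s] by (simp add: G_def)
 qed
 have cG: "continuous_on UNIV G"
  unfolding G_def cl_def by (intro continuous_on_compose2[OF F(1)] continuous_intros) auto
 have pos: "G s + \<kappa> > 0" for s using G0[of s] \<kappa> by linarith
 let ?t' = "%s. \<epsilon> / (G s + \<kappa>)"
 have ct: "continuous_on UNIV ?t'" by (intro continuous_intros cG) (use pos in \<open>auto simp: less_imp_neq[symmetric]\<close>)
 have "isCont ?t' s" for s using ct by (simp add: continuous_on_eq_continuous_at)
 then obtain T0 where T0: "!!s. (T0 has_vector_derivative ?t' s) (at s)"
  using einterval_antiderivative[of "-\<infinity>" "\<infinity>" ?t'] by auto
 define T where "T s = T0 s - T0 s0" for s
 have dT: "(T has_real_derivative ?t' s) (at s)" for s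
  unfolding T_def using T0[of s] by (auto intro!: derivative_eq_intros simp: has_real_derivative_iff_has_vector_derivative)
 have Ts0: "T s0 = 0" by (simp add: T_def)
 have t'pos: "?t' s > 0" for s using \<epsilon> pos by simp
 have incT: "T s < T u" if "s < u" for s u
  by (rule DERIV_pos_imp_increasing[OF that]) (use dT t'pos in blast)
 have injT: "inj T" using incT by (intro injI) (metis less_irrefl linorder_neqE_linordered_idom)
 have mvt: "EX \<xi>. s < \<xi> & \<xi> < u & T u - T s = (u - s) * ?t' \<xi>" if "s < u" for s u
  using MVT2[OF that, of T ?t'] dT by blast
 have cT: "isCont T s" for s using dT DERIV_isCont by blast
 let ?l = "\<epsilon> / (g s0 + \<kappa>)"
 have gs0: "g s0 + \<kappa> > 0" using F(2)[of s0] s0 \<kappa> by linarith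
 have l0: "?l > 0" using \<epsilon> gs0 by simp
 have t'low: "?t' s >= ?l" for s using GM[of s] pos[of s] \<epsilon> by (intro divide_left_mono) auto
 have surjT: "EX s. T s = z" for z
 proof -
  define B where "B = (\<bar>z\<bar> + 1) / ?l"
  have B0: "B > 0" unfolding B_def by (rule divide_pos_pos[OF _ l0]) simp
  have Bl: "B * ?l = \<bar>z\<bar> + 1" using B_def nonzero_eq_divide_eq[of ?l B "\<bar>z\<bar> + 1"] less_imp_neq[OF l0] by metis
  obtain \<xi>1 where x1: "T s0 - T (s0 - B) = (s0 - (s0 - B)) * ?t' \<xi>1" using mvt[of "s0 - B" s0] B0 by auto
  obtain \<xi>2 where x2: "T (s0 + B) - T s0 = (s0 + B - s0) * ?t' \<xi>2" using mvt[of s0 "s0 + B"] B0 by auto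
  have "B * ?l <= B * ?t' \<xi>1" "B * ?l <= B * ?t' \<xi>2" using B0 t'low by (auto intro!: mult_left_mono simp del: times_divide_eq_right)
  hence "T (s0 - B) <= z" "z <= T (s0 + B)" using x1 x2 Bl Ts0 by auto
  hence "EX s>=s0 - B. s <= s0 + B & T s = z" using B0 cT by (intro IVT) auto
  thus ?thesis by blast
 qed
 define q where "q = inv T"
 have "surj T" unfolding surj_def using surjT by metis
 hence Tq: "T (q z) = z" and qT: "q (T s) = s" for z s
  using injT by (simp_all add: q_def surj_f_inv_f)
 have monoq: "q x < q y" if "x < y" for x y
 proof (rule ccontr)
  assume "\<not> q x < q y" hence "T (q y) <= T (q x)" using incT[of "q y" "q x"] by (cases "q y = q x") auto
  thus False using Tq that by simp
 qed
 have dq: "(q has_real_derivative (G (q z) + \<kappa>) / \<epsilon>) (at z)" for z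
 proof -
  have "isCont q (T (q z))"
   by (rule isCont_inverse_function[of 1 "q z" q T]) (use qT cT in auto)
  hence cq: "isCont q z" using Tq by simp
  have "(q has_real_derivative inverse (?t' (q z))) (at z)"
  proof (rule DERIV_inverse_function[where f=T and a="z - 1" and b="z + 1"])
   show "(T has_real_derivative ?t' (q z)) (at (q z))" by (rule dT)
   show "?t' (q z) ~= 0" by (rule not_sym[OF less_imp_neq[OF t'pos]])
  qed (use Tq cq in auto)
  thus ?thesis by simp
 qed
 have qlip: "((g s0 + \<kappa>) / \<epsilon>)-lipschitz_on UNIV q"
  by (rule lipschitz_from_derivative_bound[OF dq]) (use GM pos \<epsilon> in \<open>auto simp: abs_of_pos intro!: divide_right_mono\<close>)
 define p where "p z = cl (q z)" for z
 have t'up: "?t' s <= r" for s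
 proof -
  have "?t' s <= \<epsilon> / \<kappa>" using G0[of s] \<kappa> \<epsilon> by (intro divide_left_mono) (auto intro: add_nonneg_pos)
  thus ?thesis using r \<epsilon> by (simp add: \<kappa>_def)
 qed
 have a: "- r <= T 0" "T 0 < 0"
 proof -
  show "T 0 < 0" using incT[OF s0(1)] Ts0 by simp
  obtain \<xi> where "T s0 - T 0 = (s0 - 0) * ?t' \<xi>" using mvt[OF s0(1)] by blast
  moreover have "s0 * ?t' \<xi> <= 1 * r" using s0 t'up[of \<xi>] t'pos[of \<xi>] by (intro mult_mono) auto
  ultimately show "- r <= T 0" using Ts0 by simp
 qed
 have b: "T 1 <= r" "0 < T 1"
 proof -
  show "0 < T 1" using incT[OF s0(2)] Ts0 by simp
  obtain \<xi> where "T 1 - T s0 = (1 - s0) * ?t' \<xi>" using mvt[OF s0(2)] by blast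
  moreover have "(1 - s0) * ?t' \<xi> <= 1 * r" using s0 t'up[of \<xi>] t'pos[of \<xi>] by (intro mult_mono) auto
  ultimately show "T 1 <= r" using Ts0 by simp
 qed
 have mq: "q x <= q y" if "x <= y" for x y using monoq[of x y] that by (cases "x = y") auto
 have q0: "q (T 0) = 0" "q (T 1) = 1" "q 0 = s0" using qT[of s0] qT[of 0] qT[of 1] Ts0 by auto
 have inside: "0 < q z & q z < 1 & p z = q z" if "z : {T 0<..<T 1}" for z
  using monoq[of "T 0" z] monoq[of z "T 1"] q0 that by (auto simp: p_def clid)
 have p01: "0 <= p z" "p z <= 1" for z using cl01 by (auto simp: p_def)
 have pl: "p z = 0" if "z <= T 0" for z using mq[OF that] q0 by (simp add: p_def cl_def)
 have pr: "p z = 1" if "T 1 <= z" for z using mq[OF that] q0 by (simp add: p_def cl_def)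
 have ps: "p z <= s0" if "z <= 0" for z using mq[OF that] q0 s0 by (auto simp: p_def cl_def)
 have ps': "p z >= s0" if "z >= 0" for z using mq[OF that] q0 s0 by (auto simp: p_def cl_def)
 show ?thesis
  unfolding profile_def
 proof (rule exI[of _ p], rule exI[of _ "T 0"], rule exI[of _ "T 1"], intro conjI ballI allI impI)
  show "- r <= T 0" "T 0 < 0" "0 < T 1" "T 1 <= r" using a b by auto
  show "EX L. L-lipschitz_on UNIV p"
  proof -
   have "1-lipschitz_on UNIV cl" by (rule lipschitz_onI) (auto simp: cl_def dist_real_def)
   hence "(1 * ((g s0 + \<kappa>) / \<epsilon>))-lipschitz_on UNIV (%z. cl (q z))"
    by (intro lipschitz_on_compose2[OF qlip]) (auto intro: lipschitz_on_subset)
   thus ?thesis unfolding p_def[abs_def] by blast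
  qed
  show "p z = 0" if "z <= T 0" for z using pl that .
  show "p z = 1" if "T 1 <= z" for z using pr that .
  show "0 <= p z" "p z <= 1" for z using p01 by auto
 next
  fix z assume z: "z : {T 0<..<T 1}"
  note i = inside[OF z]
  have "(q has_real_derivative (g (p z) + \<epsilon> / r) / \<epsilon>) (at z)"
   using dq[of z] i Gid[of "q z"] by (simp add: \<kappa>_def)
  thus "(p has_real_derivative (g (p z) + \<epsilon> / r) / \<epsilon>) (at z)"
   by (rule has_field_derivative_transform_within_open[where S="{T 0<..<T 1}"]) (use z inside in auto)
  have sp: "g (p z) + \<kappa> > 0" using F(2)[of "p z"] p01 \<kappa> by (simp add: add_nonneg_pos)
  have "\<bar>z\<bar> <= \<epsilon> / (g (p z) + \<kappa>)"
  proof (cases "z = 0")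
   case True thus ?thesis using sp \<epsilon> by simp
  next
   case nz: False
   show ?thesis
   proof (cases "z < 0")
    case True
    hence lt: "q z < s0" using monoq[of z 0] q0 by simp
    obtain \<xi> where x: "q z < \<xi>" "\<xi> < s0" "T s0 - T (q z) = (s0 - q z) * ?t' \<xi>" using mvt[OF lt] by blast
    have "?t' \<xi> <= \<epsilon> / (g (p z) + \<kappa>)"
     using up[of "q z" \<xi>] Gid[of \<xi>] x i s0 sp \<epsilon> pos[of \<xi>] by (intro divide_left_mono) auto
    moreover have "(s0 - q z) * ?t' \<xi> <= 1 * ?t' \<xi>" using i s0 lt t'pos[of \<xi>] by (intro mult_right_mono) auto
    ultimately show ?thesis using x(3) Ts0 Tq[of z] True by auto
   next
    case False
    hence lt: "s0 < q z" using monoq[of 0 z] q0 nz by simp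
    obtain \<xi> where x: "s0 < \<xi>" "\<xi> < q z" "T (q z) - T s0 = (q z - s0) * ?t' \<xi>" using mvt[OF lt] by blast
    have "?t' \<xi> <= \<epsilon> / (g (p z) + \<kappa>)"
     using down[of \<xi> "q z"] Gid[of \<xi>] x i s0 sp \<epsilon> pos[of \<xi>] by (intro divide_left_mono) auto
    moreover have "(q z - s0) * ?t' \<xi> <= 1 * ?t' \<xi>" using i s0 lt t'pos[of \<xi>] by (intro mult_right_mono) auto
    ultimately show ?thesis using x(3) Ts0 Tq[of z] False by auto
   qed
  qed
  thus "\<bar>z\<bar> * (g (p z) + \<epsilon> / r) <= \<epsilon>" using sp by (simp add: pos_le_divide_eq \<kappa>_def)
 next
  fix z :: real assume "z <= 0"
  have "integral {0..p z} g <= integral {0..p z} (%s. g (p z))"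
   using ps[OF \<open>z <= 0\<close>] up
   by (intro integral_le integrable_continuous_real continuous_on_subset[OF F(1)]) auto
  also have "... = p z * g (p z)" using p01 by simp
  also have "... <= 1 * g (p z)" using p01 F(2) by (intro mult_right_mono) auto
  finally show "integral {0..p z} g <= g (p z)" by simp
 next
  fix z :: real assume "0 <= z"
  have "integral {p z..1} g <= integral {p z..1} (%s. g (p z))"
   using ps'[OF \<open>0 <= z\<close>] down p01[of z] s0
   by (intro integral_le integrable_continuous_real continuous_on_subset[OF F(1)]) auto
  also have "... = (1 - p z) * g (p z)" using p01 by simp
  also have "... <= 1 * g (p z)" using p01 F(2) by (intro mult_right_mono) auto
  finally show "integral {p z..1} g <= g (p z)" by simp
 qed
qed

section \<open>Square integrable fields\<close>

lemma square_integrable_iff: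
 assumes "open Om"
 shows "square_integrable Om f \<longleftrightarrow> f : borel_measurable (leb Om) & integrable (leb Om) (%x. (norm (f x))^2)"
 unfolding square_integrable_def
 by (simp add: set_lebesgue_on[OF open_in_sets_lebesgue[OF assms]] set_borel_measurable_lebesgue_on[OF open_in_sets_lebesgue[OF assms]])

lemma norm_add_squared_le:
 fixes a b :: "'a::real_normed_vector"
 shows "(norm (a + b))^2 <= 2 * (norm a)^2 + 2 * (norm b)^2"
proof -
 have "(norm (a + b))^2 <= (norm a + norm b)^2" by (intro power_mono norm_triangle_ineq) simp
 also have "... <= 2 * (norm a)^2 + 2 * (norm b)^2"
  using sum_squares_bound[of "norm a" "norm b"] by (simp add: power2_sum)
 finally show ?thesis .
qed

lemma norm_vec_squared: "(norm (x :: 'a::real_normed_vector^'n))^2 = (\<Sum>i\<in>UNIV. (norm (x $ i))^2)"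
 by (simp add: norm_vec_def L2_set_def sum_nonneg)

lemma square_integrable_add:
 fixes f h :: "'a::euclidean_space => 'b::euclidean_space"
 assumes o: "open Om" and f: "square_integrable Om f" and h: "square_integrable Om h"
 shows "square_integrable Om (%x. f x + h x)"
 unfolding square_integrable_iff[OF o]
proof
 note F = f[unfolded square_integrable_iff[OF o]] and H = h[unfolded square_integrable_iff[OF o]]
 show m: "(%x. f x + h x) : borel_measurable (leb Om)" using F H by (intro borel_measurable_add) auto
 show "integrable (leb Om) (%x. (norm (f x + h x))^2)"
 proof (rule Bochner_Integration.integrable_bound)
  show "integrable (leb Om) (%x. 2 * (norm (f x))^2 + 2 * (norm (h x))^2)" using F H by (intro Bochner_Integration.integrable_add integrable_mult_right) auto
  show "(%x. (norm (f x + h x))^2) : borel_measurable (leb Om)" using m by measurable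
  show "AE x in leb Om. norm ((norm (f x + h x))^2) <= norm (2 * (norm (f x))^2 + 2 * (norm (h x))^2)"
   using norm_add_squared_le by (intro AE_I2) auto
 qed
qed

lemma square_integrable_scale:
 fixes f :: "'a::euclidean_space => 'b::euclidean_space" and c :: "'a => real"
 assumes o: "open Om" and f: "square_integrable Om f" and c: "c : borel_measurable (leb Om)" "!!x. x : Om ==> \<bar>c x\<bar> <= B"
 shows "square_integrable Om (%x. c x *R f x)"
 unfolding square_integrable_iff[OF o]
proof
 note F = f[unfolded square_integrable_iff[OF o]]
 show m: "(%x. c x *R f x) : borel_measurable (leb Om)" using F c by (intro borel_measurable_scaleR) auto
 have "integrable (leb Om) (%x. (c x)^2 *R (norm (f x))^2)"
 proof (rule integrable_bounded_mult(1)[where B="B^2"])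
  show "(%x. (c x)^2) : borel_measurable (leb Om)" using c by (intro borel_measurable_power)
  show "\<bar>(c x)^2\<bar> <= B^2" if "x : space (leb Om)" for x
   using power_mono[of "\<bar>c x\<bar>" B 2] c(2)[of x] that by simp
 qed (use F in auto)
 thus "integrable (leb Om) (%x. (norm (c x *R f x))^2)" by (simp add: power_mult_distrib)
qed

lemma square_integrable_diff:
 fixes f h :: "'a::euclidean_space => 'b::euclidean_space"
 assumes o: "open Om" and f: "square_integrable Om f" and h: "square_integrable Om h"
 shows "square_integrable Om (%x. f x - h x)"
 using square_integrable_add[OF o f square_integrable_scale[OF o h, of "%_. - 1" 1]] by simp

lemma square_integrable_cong_AE:
 fixes f h :: "'a::euclidean_space => 'b::euclidean_space"
 assumes o: "open Om" and f: "square_integrable Om f" and ae: "AE x\<in>Om in lebesgue. f x = h x"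
 shows "square_integrable Om h"
proof -
 note so = open_in_sets_lebesgue[OF o]
 have ae2: "AE x\<in>Om in lebesgue. (norm (f x))^2 = (norm (h x))^2" using ae by eventually_elim auto
 show ?thesis
  using f AE_eq_lebesgue_on_imp(2)[OF so ae] AE_eq_lebesgue_on_imp(1)[OF so ae2] by (simp add: square_integrable_iff[OF o])
qed

lemma square_integrable_component:
 fixes f :: "'a::euclidean_space => 'b::euclidean_space^'n"
 assumes o: "open Om" and f: "square_integrable Om f"
 shows "square_integrable Om (%x. f x $ j)"
 unfolding square_integrable_iff[OF o]
proof
 note F = f[unfolded square_integrable_iff[OF o]]
 have "(%y::'b^'n. y $ j) : borel_measurable borel" by (intro borel_measurable_continuous_onI continuous_intros)
 thus m: "(%x. f x $ j) : borel_measurable (leb Om)" using measurable_compose[of f "leb Om" borel] F by auto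
 show "integrable (leb Om) (%x. (norm (f x $ j))^2)"
 proof (rule Bochner_Integration.integrable_bound)
  show "integrable (leb Om) (%x. (norm (f x))^2)" using F by blast
  show "(%x. (norm (f x $ j))^2) : borel_measurable (leb Om)" using m by measurable
  show "AE x in leb Om. norm ((norm (f x $ j))^2) <= norm ((norm (f x))^2)"
   by (intro AE_I2) (simp add: power_mono Finite_Cartesian_Product.norm_nth_le)
 qed
qed

lemma square_integrable_vec:
 fixes f :: "'a::euclidean_space => 'b::euclidean_space^'n"
 assumes o: "open Om" and f: "!!j. square_integrable Om (%x. f x $ j)"
 shows "square_integrable Om f"
 unfolding square_integrable_iff[OF o]
proof
 note F = f[unfolded square_integrable_iff[OF o]]
 have "(%x. \<Sum>j\<in>UNIV. axis j (f x $ j)) : borel_measurable (leb Om)"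
 proof (rule borel_measurable_sum)
  fix j :: 'n
  have "(%y::'b. axis j y :: 'b^'n) : borel_measurable borel"
   unfolding axis_def
  proof (intro borel_measurable_continuous_onI continuous_on_vec_lambda)
   fix i show "continuous_on UNIV (%y::'b. if i = j then y else 0)" by (cases "i = j") auto
  qed
  thus "(%x. axis j (f x $ j) :: 'b^'n) : borel_measurable (leb Om)"
   using measurable_compose[of "%x. f x $ j" "leb Om" borel] F by auto
 qed
 moreover have "(\<Sum>j\<in>UNIV. axis j (f x $ j)) = f x" for x by (simp add: vec_eq_iff axis_def)
 ultimately show "f : borel_measurable (leb Om)" by simp
 show "integrable (leb Om) (%x. (norm (f x))^2)" unfolding norm_vec_squared using F by (intro Bochner_Integration.integrable_sum) auto
qed

lemma square_integrable_product:
 assumes o: "open Om" and f: "square_integrable Om f" and h: "square_integrable Om h"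
 shows "integrable (leb Om) (%x. f x *R h x)" "integrable (leb Om) (%x. \<bar>f x\<bar> * norm (h x))"
proof -
 note F = f[unfolded square_integrable_iff[OF o]] and H = h[unfolded square_integrable_iff[OF o]]
 have i: "integrable (leb Om) (%x. (norm (f x))^2 + (norm (h x))^2)" using F H by auto
 have m: "(%x. f x *R h x) : borel_measurable (leb Om)" using F H by (intro borel_measurable_scaleR) auto
 have le: "norm (f x *R h x) <= norm ((norm (f x))^2 + (norm (h x))^2)" for x
 proof -
  have "0 <= \<bar>f x\<bar> * norm (h x)" by simp
  moreover have "2 * (\<bar>f x\<bar> * norm (h x)) <= (norm (f x))^2 + (norm (h x))^2" using sum_squares_bound[of "\<bar>f x\<bar>" "norm (h x)"] by simp
  moreover have "norm ((norm (f x))^2 + (norm (h x))^2) = (norm (f x))^2 + (norm (h x))^2" by simp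
  ultimately show ?thesis unfolding norm_scaleR by linarith
 qed
 show p: "integrable (leb Om) (%x. f x *R h x)"
  by (rule Bochner_Integration.integrable_bound[OF i m]) (use le in auto)
 show "integrable (leb Om) (%x. \<bar>f x\<bar> * norm (h x))" using integrable_norm[OF p] by simp
qed

lemma integrable_const_bounded_open:
 fixes Om :: "'a::euclidean_space set"
 assumes "open Om" "bounded Om" shows "integrable (leb Om) (%x. c :: real)"
 by (rule finite_measure.integrable_const[OF finite_measure_lebesgue_on]) (use assms bounded_set_imp_lmeasurable open_in_sets_lebesgue in blast)

lemma square_integrable_const:
 assumes "open Om" "bounded Om" shows "square_integrable Om (%x. c)"
 using integrable_const_bounded_open[OF assms] by (simp add: square_integrable_iff[OF assms(1)])

text \<open>Products of \<open>L\<^sup>2\<close>-close functions are \<open>L\<^sup>1\<close>-close.\<close>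

lemma square_integrable_product_close:
 fixes h h' :: "'a::euclidean_space => 'b::euclidean_space"
 assumes o: "open Om" and f: "square_integrable Om f" "square_integrable Om f'" and h: "square_integrable Om h" "square_integrable Om h'"
  and t: "0 < t" "t <= 1" and cf: "(LINT x|leb Om. (f x - f' x)^2) <= t^2" and ch: "(LINT x|leb Om. (norm (h x - h' x))^2) <= t^2"
 shows "(LINT x|leb Om. norm (f x *R h x - f' x *R h' x)) <= t * ((LINT x|leb Om. (f x)^2) + (LINT x|leb Om. (norm (h x))^2) + 2)"
proof -
 let ?M = "leb Om"
 define a b where "a x = f x - f' x" and "b x = h x - h' x" for x
 have a: "square_integrable Om a" and b: "square_integrable Om b"
  unfolding a_def[abs_def] b_def[abs_def] by (intro square_integrable_diff o f h)+
 note I = f(1)[unfolded square_integrable_iff[OF o]] h(1)[unfolded square_integrable_iff[OF o]]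
  a[unfolded square_integrable_iff[OF o]] b[unfolded square_integrable_iff[OF o]]
 have young: "p * q <= t / 2 * q^2 + 1 / (2 * t) * p^2" for p q :: real
  using sum_squares_bound[of "p" "t * q"] t(1) by (simp add: field_simps power2_eq_square)
 let ?B = "%x. (t / 2 * (norm (h x))^2 + 1 / (2 * t) * (norm (a x))^2) + (t / 2 * (norm (f x))^2 + 1 / (2 * t) * (norm (b x))^2) + ((norm (a x))^2 + (norm (b x))^2) / 2"
 have "(LINT x|?M. norm (f x *R h x - f' x *R h' x)) <= (LINT x|?M. ?B x)"
 proof (rule integral_mono_AE')
  show "integrable ?M ?B" using I by (intro Bochner_Integration.integrable_add integrable_mult_right integrable_divide) auto
  show "AE x in ?M. norm (f x *R h x - f' x *R h' x) <= ?B x"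
  proof (rule AE_I2)
   fix x
   have "f x *R h x - f' x *R h' x = a x *R h x + f x *R b x - a x *R b x" by (simp add: a_def b_def algebra_simps)
   hence "norm (f x *R h x - f' x *R h' x) <= norm (a x *R h x) + norm (f x *R b x) + norm (a x *R b x)"
    by (simp only:) (rule order_trans[OF norm_triangle_ineq4 add_right_mono[OF norm_triangle_ineq]])
   also have "... = norm (a x) * norm (h x) + norm (b x) * norm (f x) + norm (a x) * norm (b x)" by (simp add: mult.commute)
   also have "... <= ?B x"
   proof (intro add_mono young)
    show "norm (a x) * norm (b x) <= ((norm (a x))^2 + (norm (b x))^2) / 2" using sum_squares_bound[of "norm (a x)" "norm (b x)"] by simp
   qed
   finally show "norm (f x *R h x - f' x *R h' x) <= ?B x" .
  qed
  show "AE x in ?M. 0 <= ?B x" using t(1) by (intro AE_I2) auto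
 qed
 also have "(LINT x|?M. ?B x) = (t / 2 * (LINT x|?M. (norm (h x))^2) + 1 / (2 * t) * (LINT x|?M. (norm (a x))^2)) + (t / 2 * (LINT x|?M. (norm (f x))^2) + 1 / (2 * t) * (LINT x|?M. (norm (b x))^2)) + ((LINT x|?M. (norm (a x))^2) + (LINT x|?M. (norm (b x))^2)) / 2"
  using I by simp
 also have "... <= t * ((LINT x|?M. (f x)^2) + (LINT x|?M. (norm (h x))^2) + 2)"
 proof -
  have A: "(LINT x|?M. (norm (a x))^2) <= t^2" "(LINT x|?M. (norm (b x))^2) <= t^2" using cf ch by (simp_all add: a_def b_def)
  have "1 / (2 * t) * X <= t / 2" if "X <= t^2" for X using that t(1) by (simp add: field_simps power2_eq_square)
  from this[OF A(1)] this[OF A(2)] have B: "1 / (2 * t) * (LINT x|?M. (norm (a x))^2) <= t / 2" "1 / (2 * t) * (LINT x|?M. (norm (b x))^2) <= t / 2" by blast+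
  have "t^2 <= t" using t by (simp add: power2_eq_square mult_left_le)
  have key: "(t / 2 * p + a1) + (t / 2 * q + b1) + (a2 + b2) / 2 <= t * (q + p + 2)"
   if "0 <= p" "0 <= q" "a1 <= t / 2" "b1 <= t / 2" "a2 <= t^2" "b2 <= t^2" for p q a1 b1 a2 b2
  proof -
   have nn: "0 <= t * p" "0 <= t * q" using that t(1) by auto
   have eq: "t / 2 * p = (t * p) / 2" "t / 2 * q = (t * q) / 2" "t * (q + p + 2) = t * q + t * p + 2 * t"
    by (simp_all add: algebra_simps)
   have lin: "u / 2 + a1 + (v / 2 + b1) + (a2 + b2) / 2 <= v + u + 2 * t" if "0 <= u" "0 <= v" "a1 <= t / 2" "b1 <= t / 2" "a2 <= t" "b2 <= t" for u v a2 b2 :: real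
    using that by (simp add: field_simps)
   show ?thesis unfolding eq by (rule lin[OF nn that(3,4) order_trans[OF that(5) \<open>t^2 <= t\<close>] order_trans[OF that(6) \<open>t^2 <= t\<close>]])
  qed
  have "(LINT x|?M. (f x)^2) = (LINT x|?M. (norm (f x))^2)" by simp
  thus ?thesis by (simp only:) (rule key; use A B in simp)
 qed
 finally show ?thesis .
qed

lemma square_integrable_bounded:
 fixes h :: "'a::euclidean_space => 'b::euclidean_space"
 assumes o: "open Om" and bd: "bounded Om" and m: "h : borel_measurable (leb Om)" and B: "!!x. x : Om ==> norm (h x) <= B"
 shows "square_integrable Om h"
 unfolding square_integrable_iff[OF o]
proof (intro conjI m Bochner_Integration.integrable_bound[OF integrable_const_bounded_open[OF o bd, of "B^2"]])
 show "(%x. (norm (h x))^2) : borel_measurable (leb Om)" using m by measurable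
 show "AE x in leb Om. norm ((norm (h x))^2) <= norm (B^2)"
  using B by (intro AE_I2) (auto intro: power_mono)
qed

lemma integral_lebesgue_on_le_lebesgue:
 fixes f :: "'a::euclidean_space => real"
 assumes o: "open Om" and i: "integrable lebesgue f" and nn: "!!x. 0 <= f x"
 shows "integrable (leb Om) f" "integral\<^sup>L (leb Om) f <= integral\<^sup>L lebesgue f"
proof -
 have so: "Om : sets lebesgue" by (rule open_in_sets_lebesgue[OF o])
 have si: "integrable lebesgue (%x. indicator Om x *R f x)" using integrable_mult_indicator[OF so i] .
 thus "integrable (leb Om) f" using integrable_restrict_space[of Om lebesgue f] so by simp
 have "integral\<^sup>L (leb Om) f = (LINT x|lebesgue. indicator Om x *R f x)" using integral_restrict_space[of Om lebesgue f] so by simp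
 also have "... <= integral\<^sup>L lebesgue f" by (rule integral_mono[OF si i]) (use nn in \<open>auto simp: indicator_def\<close>)
 finally show "integral\<^sup>L (leb Om) f <= integral\<^sup>L lebesgue f" .
qed

text \<open>\<open>G\<close> is the gradient of \<open>w\<close> as the \<open>L\<^sup>2\<close> limit of gradients of functions from a class \<open>\<A>\<close>.\<close>

definition gradient_limit :: "((real^'d => real) => bool) => (real^'d) set => (real^'d => real) => (real^'d => real^'d) => bool" where
 "gradient_limit \<A> Om w G \<longleftrightarrow> square_integrable Om w & square_integrable Om G &
   (ALL e>0. EX w'. \<A> w' & square_integrable Om w' & square_integrable Om (grad w') &
    (LINT x|leb Om. (w x - w' x)^2) < e & (LINT x|leb Om. (norm (G x - grad w' x))^2) < e)"

lemma gradient_limit_mono: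
 assumes "gradient_limit \<A> Om w G" "!!w. \<A> w ==> \<B> w"
 shows "gradient_limit \<B> Om w G"
 using assms unfolding gradient_limit_def by meson

lemma L1_approximation_weak_grad:
 fixes Om :: "(real^'d) set"
 assumes o: "open Om" and w: "square_integrable Om w" and gl: "gradient_limit (C_on (Suc 0) Om) Om z H"
  and f: "square_integrable Om f" "!!z'. C_on (Suc 0) Om z' ==> square_integrable Om z' ==> square_integrable Om (f' z')"
  and c: "!!z'. (LINT x|leb Om. (f x - f' z' x)^2) <= (LINT x|leb Om. (z x - z' x)^2)"
  and wg: "!!z'. C_on (Suc 0) Om z' ==> weak_grad Om (%x. f' z' x * z' x) (%x. b *R f' z' x *R grad z' x)"
  and b: "b >= 0"
 shows "weak_grad Om (%x. f x * z x) (%x. b *R f x *R H x)"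
proof (rule weak_grad_closed[OF o])
 have z: "square_integrable Om z" and H: "square_integrable Om H" using gl by (auto simp: gradient_limit_def)
 have i1: "integrable (leb Om) (%x. p x * q x)" if "square_integrable Om p" "square_integrable Om q" for p q :: "real^'d => real"
  using square_integrable_product(1)[OF o that] by simp
 have i2: "integrable (leb Om) (%x. b *R p x *R q x)" if "square_integrable Om p" "square_integrable Om q" for p and q :: "real^'d => real^'d"
  using square_integrable_product(1)[OF o that] by (rule integrable_scaleR_right)
 show "integrable (leb Om) (%x. f x * z x)" "integrable (leb Om) (%x. b *R f x *R H x)" using i1 i2 f z H by auto
 fix e :: real assume e: "e > 0"
 let ?I = "%q. \<integral>x. q x \<partial>leb Om"
 define C where "C = (1 + b) * (?I (%x. (f x)^2) + ?I (%x. (z x)^2) + ?I (%x. (norm (H x))^2) + 2)"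
 have nn: "0 <= ?I (%x. (f x)^2)" "0 <= ?I (%x. (z x)^2)" "0 <= ?I (%x. (norm (H x))^2)" by auto
 have C: "C > 0" unfolding C_def using b nn by (intro mult_pos_pos) linarith+
 define t where "t = min 1 (e / (2 * C))"
 have t: "0 < t" "t <= 1" "t * C < e"
 proof -
  show "0 < t" "t <= 1" using e C by (auto simp: t_def)
  have "t * C <= e / (2 * C) * C" unfolding t_def using C by (intro mult_right_mono) auto
  thus "t * C < e" using C e by simp
 qed
 have "t^2 > 0" using t by simp
 then obtain z' where z': "C_on (Suc 0) Om z'" "square_integrable Om z'" "square_integrable Om (grad z')"
  "?I (%x. (z x - z' x)^2) < t^2" "?I (%x. (norm (H x - grad z' x))^2) < t^2"
  using gl unfolding gradient_limit_def by blast
 have f'z: "square_integrable Om (f' z')" "?I (%x. (f x - f' z' x)^2) <= t^2" using f(2)[OF z'(1,2)] c[of z'] z'(4) by auto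
 show "EX w' G'. weak_grad Om w' G' & integrable (leb Om) w' & integrable (leb Om) G' &
    ?I (%x. norm (f x * z x - w' x)) < e & ?I (%x. norm (b *R f x *R H x - G' x)) < e"
 proof (intro exI conjI)
  show "weak_grad Om (%x. f' z' x * z' x) (%x. b *R f' z' x *R grad z' x)" by (rule wg[OF z'(1)])
  show "integrable (leb Om) (%x. f' z' x * z' x)" "integrable (leb Om) (%x. b *R f' z' x *R grad z' x)"
   using i1 i2 z' f'z by auto
  have "?I (%x. norm (f x *R z x - f' z' x *R z' x)) <= t * (?I (%x. (f x)^2) + ?I (%x. (norm (z x))^2) + 2)"
   by (rule square_integrable_product_close[OF o]) (use f f'z z z' t in auto)
  also have "... <= t * C"
  proof (rule mult_left_mono)
   have "1 * (?I (%x. (f x)^2) + ?I (%x. (z x)^2) + 2) <= C" unfolding C_def using b nn by (intro mult_mono) auto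
   thus "?I (%x. (f x)^2) + ?I (%x. (norm (z x))^2) + 2 <= C" by simp
  qed (use t in simp)
  finally show "?I (%x. norm (f x * z x - f' z' x * z' x)) < e" using t(3) by simp
  have "?I (%x. norm (f x *R H x - f' z' x *R grad z' x)) <= t * (?I (%x. (f x)^2) + ?I (%x. (norm (H x))^2) + 2)"
   by (rule square_integrable_product_close[OF o]) (use f f'z z' H t in auto)
  hence "b * ?I (%x. norm (f x *R H x - f' z' x *R grad z' x)) <= b * (t * (?I (%x. (f x)^2) + ?I (%x. (norm (H x))^2) + 2))"
   using b by (rule mult_left_mono)
  also have "... = t * (b * (?I (%x. (f x)^2) + ?I (%x. (norm (H x))^2) + 2))" by simp
  also have "... <= t * C" unfolding C_def using t b nn by (intro mult_left_mono mult_mono) auto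
  also have "... < e" by (rule t(3))
  also have "b * ?I (%x. norm (f x *R H x - f' z' x *R grad z' x)) = ?I (%x. norm (b *R f x *R H x - b *R f' z' x *R grad z' x))"
  proof -
   have "b *R f x *R H x - b *R f' z' x *R grad z' x = b *R (f x *R H x - f' z' x *R grad z' x)" for x
    by (simp only: scaleR_diff_right)
   thus ?thesis using b by (simp only: norm_scaleR abs_of_nonneg) simp
  qed
  finally show "?I (%x. norm (b *R f x *R H x - b *R f' z' x *R grad z' x)) < e" .
 qed
qed

lemma C1_weak_grad:
 fixes Om :: "(real^'d) set" and w :: "real^'d => real"
 assumes o: "open Om" and w: "C_on (Suc 0) Om w"
 shows "x : Om ==> (w has_derivative (%e. grad w x <.> e)) (at x)" "weak_grad Om w (grad w)"
  "weak_grad Om (%x. w x * w x) (%x. 2 *R w x *R grad w x)"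
proof -
 show d: "(w has_derivative (%e. grad w x <.> e)) (at x)" if "x : Om" for x using w that by (intro has_derivative_grad) simp
 note ll = C1_imp_locally_lipschitz[OF w o]
 show "weak_grad Om w (grad w)" by (rule weak_grad_of_locally_lipschitz[OF o ll]) (use d in auto)
 show "weak_grad Om (%x. w x * w x) (%x. 2 *R w x *R grad w x)"
 proof (rule weak_grad_of_locally_lipschitz[OF o locally_lipschitz_on_mult[OF ll ll]], intro AE_I2 impI)
  fix x assume "x : Om"
  from has_derivative_mult[OF d[OF this] d[OF this]]
  show "((%x. w x * w x) has_derivative (%e. (2 *R w x *R grad w x) <.> e)) (at x)" by (simp add: mult_ac)
 qed
qed

lemma weak_grad_of_gradient_limit:
 fixes Om :: "(real^'d) set"
 assumes o: "open Om" and bd: "bounded Om" and gl: "gradient_limit (C_on (Suc 0) Om) Om w G"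
 shows "weak_grad Om w G" "weak_grad Om (%x. w x * w x) (%x. 2 *R w x *R G x)"
proof -
 have w: "square_integrable Om w" using gl by (simp add: gradient_limit_def)
 show "weak_grad Om (%x. w x * w x) (%x. 2 *R w x *R G x)"
  by (rule L1_approximation_weak_grad[OF o w gl w, of "%z. z"]) (use C1_weak_grad(3)[OF o] in auto)
 have "weak_grad Om (%x. 1 * w x) (%x. 1 *R 1 *R G x)"
  by (rule L1_approximation_weak_grad[OF o w gl square_integrable_const[OF o bd], of "%_ _. 1"])
   (use C1_weak_grad(2)[OF o] square_integrable_const[OF o bd] in auto)
 thus "weak_grad Om w G" by simp
qed

lemma test_function_C1:
 fixes tt :: "real^'d => real"
 assumes o: "open Om" and bd: "bounded Om" and tt: "test_function Om tt"
 shows "C_on (Suc 0) Om tt" "square_integrable Om tt" "square_integrable Om (grad tt)"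
proof -
 have "C_on (Suc 0) UNIV tt" using tt unfolding test_function_def smooth_on_def by blast
 thus "C_on (Suc 0) Om tt" by (auto intro: continuous_on_subset)
 obtain M where M: "!!x. \<bar>tt x\<bar> <= M & norm (grad tt x) <= M" using test_function_facts(8)[OF tt] by blast
 show "square_integrable Om tt" "square_integrable Om (grad tt)"
  using M by (auto intro!: square_integrable_bounded[OF o bd, where B=M] continuous_measurable_lebesgue_on test_function_facts(3,4)[OF tt])
qed

section \<open>Sobolev fields and their products with Lipschitz functions\<close>

text \<open>Multiplication by a Lipschitz function with compact support turns limits of \<open>C\<^sup>1\<close> functions into
  limits of test functions, because a product of a \<open>C\<^sup>1\<close> function with it can be mollified.\<close>

lemma gradient_limit_times_lipschitz:
 fixes Om :: "(real^'d) set" and s :: "real^'d => real"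
 assumes \<phi>: "cutoff \<phi>" and o: "open Om" and bd: "bounded Om" and gl: "gradient_limit (C_on (Suc 0) Om) Om w G"
  and s: "locally_lipschitz_on UNIV s" "!!x. \<bar>s x\<bar> <= B" and gs: "gs : borel_measurable (leb Om)" "!!x. norm (gs x) <= L"
  and K: "compact K" "K <= Om" "!!x. x ~: K ==> s x = 0 & gs x = 0"
  and d: "AE x in lebesgue. (s has_derivative (%e. gs x <.> e)) (at x) & isCont gs x"
 shows "gradient_limit (test_function Om) Om (%x. s x * w x) (%x. s x *R G x + w x *R gs x)"
proof -
 have w: "square_integrable Om w" and G: "square_integrable Om G" using gl by (auto simp: gradient_limit_def)
 have cs: "continuous_on UNIV s" by (rule locally_lipschitz_on_imp_continuous[OF s(1)])
 have sm: "s : borel_measurable (leb Om)" by (rule continuous_measurable_lebesgue_on[OF cs])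
 have sq: "square_integrable Om (%x. s x * w' x) & square_integrable Om (%x. s x *R G' x + w' x *R gs x)"
  if w': "square_integrable Om w'" and G': "square_integrable Om G'" for w' G'
 proof
  show "square_integrable Om (%x. s x * w' x)" using square_integrable_scale[OF o w' sm, of B] s(2) by simp
  have "square_integrable Om (%x. s x *R G' x)" by (rule square_integrable_scale[OF o G' sm, of B]) (use s(2) in simp)
  moreover have "square_integrable Om (%x. w' x *R gs x)"
   unfolding square_integrable_iff[OF o]
  proof
   have i: "w' : borel_measurable (leb Om)" "integrable (leb Om) (%x. (w' x)^2)"
    using w' by (auto simp: square_integrable_iff[OF o])
   show m: "(%x. w' x *R gs x) : borel_measurable (leb Om)" using i(1) gs(1) by (rule borel_measurable_scaleR)
   show "integrable (leb Om) (%x. (norm (w' x *R gs x))^2)"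
   proof (rule Bochner_Integration.integrable_bound)
    show "integrable (leb Om) (%x. L^2 * (w' x)^2)" using i(2) by simp
    show "(%x. (norm (w' x *R gs x))^2) : borel_measurable (leb Om)" using m by measurable
    show "AE x in leb Om. norm ((norm (w' x *R gs x))^2) <= norm (L^2 * (w' x)^2)"
     using gs(2) by (intro AE_I2) (auto simp: power_mult_distrib mult.commute[of "L^2"] intro!: mult_left_mono power_mono)
   qed
  qed
  ultimately show "square_integrable Om (%x. s x *R G' x + w' x *R gs x)" by (rule square_integrable_add[OF o])
 qed
 have "EX tt. test_function Om tt & square_integrable Om tt & square_integrable Om (grad tt) &
    (LINT x|leb Om. (s x * w x - tt x)^2) < e & (LINT x|leb Om. (norm (s x *R G x + w x *R gs x - grad tt x))^2) < e" if e: "e > 0" for e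
 proof -
  let ?I = "%q. \<integral>x. q x \<partial>leb Om"
  define c where "c = B^2 + L^2 + 1"
  have c: "c >= 1" "B^2 <= c" "L^2 <= c" by (auto simp: c_def)
  define e' where "e' = e / (16 * c)"
  have e': "e' > 0" "16 * (c * e') = e" using e c by (auto simp: e'_def)
  obtain w' where w': "C_on (Suc 0) Om w'" "square_integrable Om w'" "square_integrable Om (grad w')"
   "?I (%x. (w x - w' x)^2) < e'" "?I (%x. (norm (G x - grad w' x))^2) < e'"
   using gl e'(1) unfolding gradient_limit_def by blast
  define h where "h x = w' x * s x" for x
  define H where "H x = s x *R grad w' x + w' x *R gs x" for x
  have cl: "closure {x. s x ~= 0} <= Om"
   by (rule order_trans[OF closure_minimal K(2)]) (use K in \<open>auto simp: compact_imp_closed\<close>)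
  have off: "EX U. open U & x : U & (ALL y:U. h y = 0 & H y = 0)" if "x ~: Om" for x
   using K that by (intro exI[of _ "- K"]) (auto simp: open_Compl compact_imp_closed h_def H_def)
  have dH: "AE x in lebesgue. (h has_derivative (%e. H x <.> e)) (at x) & isCont H x"
   using d
  proof eventually_elim
   case (elim x)
   show ?case
   proof (cases "x : Om")
    case True
    have "(h has_derivative (%e. w' x * (gs x <.> e) + (grad w' x <.> e) * s x)) (at x)"
     unfolding h_def by (rule has_derivative_mult[OF C1_weak_grad(1)[OF o w'(1) True]]) (use elim in blast)
    moreover have "(%e. w' x * (gs x <.> e) + (grad w' x <.> e) * s x) = (%e. H x <.> e)" by (simp add: H_def algebra_simps fun_eq_iff)
    ultimately have hd: "(h has_derivative (%e. H x <.> e)) (at x)" by simp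
    have "isCont (grad w') x" using continuous_on_eq_continuous_at[OF o, THEN iffD1, OF C1_continuous_grad[OF w'(1)]] True by blast
    moreover have "isCont w' x" by (rule has_derivative_continuous[OF C1_weak_grad(1)[OF o w'(1) True]])
    moreover have "isCont s x" using continuous_on_eq_continuous_at[OF open_UNIV, THEN iffD1, OF cs] by blast
    moreover have "isCont gs x" using elim by blast
    ultimately have "isCont H x" unfolding H_def by (intro continuous_intros)
    thus ?thesis using hd by blast
   next
    case False
    from off[OF False] obtain U where U: "open U" "x : U" "ALL y:U. h y = 0 & H y = 0" by (elim exE conjE)
    have "((%_. 0) has_derivative (%e. H x <.> e)) (at x)" using U by simp
    hence "(h has_derivative (%e. H x <.> e)) (at x)" by (rule has_derivative_transform_within_open[OF _ U(1,2)]) (use U in simp)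
    moreover have "continuous_on U H" using continuous_on_const[of U 0] by (rule continuous_on_eq) (use U in simp)
    hence "isCont H x" using continuous_on_eq_continuous_at[OF U(1)] U(2) by blast
    ultimately show ?thesis by blast
   qed
  qed
  have ll: "locally_lipschitz_on UNIV h"
   using locally_lipschitz_on_mult_zero_extension[OF C1_imp_locally_lipschitz[OF w'(1) o] s(1) cl] by (simp add: h_def[abs_def])
  have e8: "e / 8 > 0" using e by simp
  obtain tt where tt: "test_function Om tt" "integrable lebesgue (%x. (h x - tt x)^2)" "integrable lebesgue (%x. (norm (H x - grad tt x))^2)"
   "(LINT x|lebesgue. (h x - tt x)^2) < e / 8" "(LINT x|lebesgue. (norm (H x - grad tt x))^2) < e / 8"
   using lipschitz_approx_by_test_functions[OF \<phi> o ll K(1,2) _ dH e8] K(3) by (auto simp: h_def)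
  note tt1 = integral_lebesgue_on_le_lebesgue[OF o tt(2)] and tt2 = integral_lebesgue_on_le_lebesgue[OF o tt(3)]
  have i1: "integrable (leb Om) (%x. (w x - w' x)^2)" and i2: "integrable (leb Om) (%x. (norm (G x - grad w' x))^2)"
   using square_integrable_diff[OF o w w'(2)] square_integrable_diff[OF o G w'(3)] by (auto simp: square_integrable_iff[OF o])
  have s2: "(s x)^2 <= c" and g2: "(norm (gs x))^2 <= c" for x
   using power_mono[OF s(2)[of x], of 2] power_mono[OF gs(2)[of x], of 2] c by auto
  have "?I (%x. (s x * w x - tt x)^2) <= ?I (%x. 2 * (c * (w x - w' x)^2) + 2 * (h x - tt x)^2)"
  proof (rule integral_mono_AE')
   show "AE x in leb Om. (s x * w x - tt x)^2 <= 2 * (c * (w x - w' x)^2) + 2 * (h x - tt x)^2"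
   proof (rule AE_I2)
    fix x
    have "s x * w x - tt x = s x * (w x - w' x) + (h x - tt x)" by (simp add: h_def algebra_simps)
    hence "(s x * w x - tt x)^2 = (norm (s x * (w x - w' x) + (h x - tt x)))^2" by (simp only: real_norm_def power2_abs)
    also have "... <= 2 * ((s x)^2 * (w x - w' x)^2) + 2 * (h x - tt x)^2"
     using norm_add_squared_le[of "s x * (w x - w' x)" "h x - tt x"] by (simp add: power_mult_distrib)
    also have "... <= 2 * (c * (w x - w' x)^2) + 2 * (h x - tt x)^2" using s2[of x] by (intro add_right_mono mult_left_mono mult_right_mono) auto
    finally show "(s x * w x - tt x)^2 <= 2 * (c * (w x - w' x)^2) + 2 * (h x - tt x)^2" .
   qed
   show "AE x in leb Om. 0 <= 2 * (c * (w x - w' x)^2) + 2 * (h x - tt x)^2" using c by (intro AE_I2) simp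
  qed (use i1 tt1 in simp)
  also have "... = 2 * (c * ?I (%x. (w x - w' x)^2)) + 2 * ?I (%x. (h x - tt x)^2)" using i1 tt1 by simp
  also have "... < e"
  proof -
   have "c * ?I (%x. (w x - w' x)^2) <= c * e'" using w' c by (intro mult_left_mono) auto
   thus ?thesis using tt1(2) tt(4) e'(2) e by simp
  qed
  finally have r1: "?I (%x. (s x * w x - tt x)^2) < e" .
  have "?I (%x. (norm (s x *R G x + w x *R gs x - grad tt x))^2) <= ?I (%x. 4 * (c * (norm (G x - grad w' x))^2) + 4 * (c * (w x - w' x)^2) + 2 * (norm (H x - grad tt x))^2)"
  proof (rule integral_mono_AE')
   show "AE x in leb Om. (norm (s x *R G x + w x *R gs x - grad tt x))^2 <= 4 * (c * (norm (G x - grad w' x))^2) + 4 * (c * (w x - w' x)^2) + 2 * (norm (H x - grad tt x))^2"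
   proof (rule AE_I2)
    fix x
    let ?a = "s x *R (G x - grad w' x)" and ?b = "(w x - w' x) *R gs x"
    have "s x *R G x + w x *R gs x - grad tt x = (?a + ?b) + (H x - grad tt x)" by (simp add: H_def algebra_simps)
    hence 1: "(norm (s x *R G x + w x *R gs x - grad tt x))^2 <= 2 * (norm (?a + ?b))^2 + 2 * (norm (H x - grad tt x))^2"
     by (simp only: norm_add_squared_le)
    have 2: "(norm ?a)^2 <= c * (norm (G x - grad w' x))^2" using s2[of x] by (simp add: power_mult_distrib mult_right_mono)
    have 3: "(norm ?b)^2 <= c * (w x - w' x)^2" using g2[of x] by (simp add: power_mult_distrib mult.commute[of _ "(norm (gs x))^2"] mult_right_mono)
    show "(norm (s x *R G x + w x *R gs x - grad tt x))^2 <= 4 * (c * (norm (G x - grad w' x))^2) + 4 * (c * (w x - w' x)^2) + 2 * (norm (H x - grad tt x))^2"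
     using 1 2 3 norm_add_squared_le[of ?a ?b] by linarith
   qed
   show "AE x in leb Om. 0 <= 4 * (c * (norm (G x - grad w' x))^2) + 4 * (c * (w x - w' x)^2) + 2 * (norm (H x - grad tt x))^2" using c by (intro AE_I2) simp
  qed (use i1 i2 tt2 in simp)
  also have "... = 4 * (c * ?I (%x. (norm (G x - grad w' x))^2)) + 4 * (c * ?I (%x. (w x - w' x)^2)) + 2 * ?I (%x. (norm (H x - grad tt x))^2)" using i1 i2 tt2 by simp
  also have "... < e"
  proof -
   have "c * ?I (%x. (w x - w' x)^2) <= c * e'" "c * ?I (%x. (norm (G x - grad w' x))^2) <= c * e'" using w' c by (auto intro!: mult_left_mono)
   thus ?thesis using tt2(2) tt(5) e'(2) e by simp
  qed
  finally show ?thesis using r1 tt(1) test_function_C1[OF o bd tt(1)] by blast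
 qed
 thus ?thesis unfolding gradient_limit_def using sq[OF w G] by blast
qed

lemma W12_facts:
 assumes o: "open Om" and u: "u : W12 Om"
 shows "square_integrable Om u" "weak_grad Om (%x. u x $ j) (%x. wjac Om u x $ j)" "square_integrable Om (wjac Om u)"
  "(W12_norm Om u)^2 = (LINT x|leb Om. (norm (u x))^2) + (LINT x|leb Om. (norm (wjac Om u x))^2)"
proof -
 show "square_integrable Om u" "square_integrable Om (wjac Om u)" using u by (auto simp: W12_def)
 have e: "(%x. wjac Om u x $ j) = wgrad Om (%x. u x $ j)" by (simp add: wjac_def fun_eq_iff)
 have "EX G. weak_grad Om (%x. u x $ j) G" using u by (simp add: W12_def)
 thus "weak_grad Om (%x. u x $ j) (%x. wjac Om u x $ j)" unfolding e using wgrad_works by blast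
 show "(W12_norm Om u)^2 = (LINT x|leb Om. (norm (u x))^2) + (LINT x|leb Om. (norm (wjac Om u x))^2)"
  unfolding W12_norm_def by (simp add: set_lebesgue_on[OF open_in_sets_lebesgue[OF o]])
qed

lemma W12_criterion:
 fixes Om :: "(real^'d) set" and u :: "real^'d => real^3"
 assumes \<phi>: "cutoff \<phi>" and o: "open Om" and u: "square_integrable Om u"
  and G: "!!j. weak_grad Om (%x. u x $ j) (%x. G x $ j)" "square_integrable Om G"
 shows "AE x\<in>Om in lebesgue. wjac Om u x = G x" "u : W12 Om"
  "(W12_norm Om u)^2 = (LINT x|leb Om. (norm (u x))^2) + (LINT x|leb Om. (norm (G x))^2)"
proof -
 have "AE x in lebesgue. ALL j. x : Om --> wgrad Om (%y. u y $ j) x = G x $ j"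
  by (intro eventually_all_finite wgrad_eq_AE[OF \<phi> o G(1)])
 thus ae: "AE x\<in>Om in lebesgue. wjac Om u x = G x" by eventually_elim (simp add: wjac_def vec_eq_iff)
 have ae': "AE x\<in>Om in lebesgue. G x = wjac Om u x" using ae by eventually_elim simp
 show uW: "u : W12 Om" using u G(1) square_integrable_cong_AE[OF o G(2) ae'] by (auto simp: W12_def)
 have "AE x\<in>Om in lebesgue. (norm (wjac Om u x))^2 = (norm (G x))^2" using ae by eventually_elim simp
 from integral_lebesgue_on_cong_AE[OF open_in_sets_lebesgue[OF o] this] show "(W12_norm Om u)^2 = (LINT x|leb Om. (norm (u x))^2) + (LINT x|leb Om. (norm (G x))^2)"
  using W12_facts(4)[OF o uW] by simp
qed

lemma weak_grad_diff:
 fixes w :: "real^'d => real"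
 assumes "open Om" "weak_grad Om w G" "weak_grad Om w' G'"
 shows "weak_grad Om (%x. w x - w' x) (%x. G x - G' x)"
 using weak_grad_lincomb[OF assms, of 1 "- 1"] by simp

lemma W12_norm_diff:
 fixes Om :: "(real^'d) set"
 assumes \<phi>: "cutoff \<phi>" and o: "open Om" and u: "square_integrable Om u" "!!j. weak_grad Om (%x. u x $ j) (%x. G x $ j)" "square_integrable Om G"
  and v: "square_integrable Om v" "!!j. weak_grad Om (%x. v x $ j) (%x. H x $ j)" "square_integrable Om H"
 shows "(W12_norm Om (%x. u x - v x))^2 = (LINT x|leb Om. (norm (u x - v x))^2) + (LINT x|leb Om. (norm (G x - H x))^2)"
 by (rule W12_criterion(3)[OF \<phi> o]) (use u v in \<open>auto intro!: square_integrable_diff[OF o] weak_grad_diff[OF o]\<close>)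

lemma smooth_component_C1:
 fixes v :: "real^'d => real^3"
 assumes "open Om" "smooth_on Om v"
 shows "C_on (Suc 0) Om (%x. v x $ j)"
 by (rule C_on_linear_image[OF bounded_linear_vec_nth assms(1)]) (use assms(2) in \<open>simp add: smooth_on_def del: C_on.simps\<close>)

lemma smooth_W12_gradient:
 fixes v :: "real^'d => real^3"
 assumes \<phi>: "cutoff \<phi>" and o: "open Om" and v: "smooth_on Om v" "v : W12 Om"
 defines "G == (%x. \<chi> j. grad (%y. v y $ j) x)"
 shows "AE x\<in>Om in lebesgue. wjac Om v x = G x" "!!j. weak_grad Om (%x. v x $ j) (%x. G x $ j)" "square_integrable Om G"
  "(W12_norm Om v)^2 = (LINT x|leb Om. (norm (v x))^2) + (LINT x|leb Om. (norm (G x))^2)"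
proof -
 have wg: "weak_grad Om (%x. v x $ j) (grad (%x. v x $ j))" for j by (rule C1_weak_grad(2)[OF o smooth_component_C1[OF o v(1)]])
 thus w: "weak_grad Om (%x. v x $ j) (%x. G x $ j)" for j by (simp add: G_def)
 have "AE x in lebesgue. ALL j. x : Om --> wgrad Om (%y. v y $ j) x = grad (%y. v y $ j) x"
  by (intro eventually_all_finite wgrad_eq_AE[OF \<phi> o wg])
 thus ae: "AE x\<in>Om in lebesgue. wjac Om v x = G x" by eventually_elim (simp add: wjac_def G_def)
 show sG: "square_integrable Om G" by (rule square_integrable_cong_AE[OF o W12_facts(3)[OF o v(2)] ae])
 show "(W12_norm Om v)^2 = (LINT x|leb Om. (norm (v x))^2) + (LINT x|leb Om. (norm (G x))^2)"
  by (rule W12_criterion(3)[OF \<phi> o W12_facts(1)[OF o v(2)] w sG])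
qed

lemma component_squared_le: "(norm ((x :: 'a::real_normed_vector^'n) $ j))^2 <= (norm x)^2"
 by (simp add: power_mono Finite_Cartesian_Product.norm_nth_le)

lemma gradient_limit_of_smooth_approximation:
 fixes Om :: "(real^'d) set" and u :: "real^'d => real^3"
 assumes \<phi>: "cutoff \<phi>" and o: "open Om" and u: "u : W12 Om"
  and app: "!!e. e > 0 ==> EX v. smooth_on Om v & v : W12 Om & W12_norm Om (%x. v x - u x) < e"
 shows "gradient_limit (C_on (Suc 0) Om) Om (%x. u x $ j) (%x. wjac Om u x $ j)"
 unfolding gradient_limit_def
proof (intro conjI allI impI)
 note U = W12_facts[OF o u]
 show "square_integrable Om (%x. u x $ j)" "square_integrable Om (%x. wjac Om u x $ j)" using U by (auto intro: square_integrable_component[OF o])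
 fix e :: real assume e: "e > 0"
 then obtain v where v: "smooth_on Om v" "v : W12 Om" "W12_norm Om (%x. v x - u x) < sqrt e" using app[of "sqrt e"] by auto
 note V = W12_facts(1)[OF o v(2)] and VG = smooth_W12_gradient[OF \<phi> o v(1,2)]
 let ?G = "%x. \<chi> j. grad (%y. v y $ j) x"
 have N: "(W12_norm Om (%x. v x - u x))^2 = (LINT x|leb Om. (norm (v x - u x))^2) + (LINT x|leb Om. (norm (?G x - wjac Om u x))^2)"
  by (rule W12_norm_diff[OF \<phi> o V VG(2,3) U(1-3)])
 have "0 <= W12_norm Om (%x. v x - u x)" by (simp add: W12_norm_def set_lebesgue_integral_def)
 hence "(W12_norm Om (%x. v x - u x))^2 < (sqrt e)^2" by (intro power_strict_mono v(3)) auto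
 hence S: "(LINT x|leb Om. (norm (v x - u x))^2) + (LINT x|leb Om. (norm (?G x - wjac Om u x))^2) < e" using N e by simp
 have nn: "0 <= (LINT x|leb Om. (norm (v x - u x))^2)" "0 <= (LINT x|leb Om. (norm (?G x - wjac Om u x))^2)" by auto
 have le: "(LINT x|leb Om. (norm (f x $ j - h x $ j))^2) <= (LINT x|leb Om. (norm (h x - f x))^2)"
  if "square_integrable Om f" "square_integrable Om h" for f h :: "real^'d => 'b::euclidean_space^3"
 proof (rule integral_mono_AE')
  show "integrable (leb Om) (%x. (norm (h x - f x))^2)"
   using square_integrable_diff[OF o that(2,1)] by (simp add: square_integrable_iff[OF o])
  show "AE x in leb Om. (norm (f x $ j - h x $ j))^2 <= (norm (h x - f x))^2"
   using component_squared_le[of "h _ - f _" j] by (intro AE_I2) (simp add: norm_minus_commute)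
 qed simp
 show "EX w'. C_on (Suc 0) Om w' & square_integrable Om w' & square_integrable Om (grad w') &
    (LINT x|leb Om. (u x $ j - w' x)^2) < e & (LINT x|leb Om. (norm (wjac Om u x $ j - grad w' x))^2) < e"
 proof (intro exI[of _ "%x. v x $ j"] conjI)
  show "C_on (Suc 0) Om (%x. v x $ j)" by (rule smooth_component_C1[OF o v(1)])
  show "square_integrable Om (%x. v x $ j)" by (rule square_integrable_component[OF o V])
  show "square_integrable Om (grad (%x. v x $ j))" using square_integrable_component[OF o VG(3), of j] by simp
  have "(LINT x|leb Om. (u x $ j - v x $ j)^2) <= (LINT x|leb Om. (norm (v x - u x))^2)" using le[OF U(1) V] by simp
  thus "(LINT x|leb Om. (u x $ j - v x $ j)^2) < e" using S nn by linarith
  have "(LINT x|leb Om. (norm (wjac Om u x $ j - grad (%x. v x $ j) x))^2) <= (LINT x|leb Om. (norm (?G x - wjac Om u x))^2)"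
   using le[OF U(3) VG(3)] by simp
  thus "(LINT x|leb Om. (norm (wjac Om u x $ j - grad (%x. v x $ j) x))^2) < e" using S nn by linarith
 qed
qed

section \<open>The transition layer\<close>

lemma W12_0_criterion:
 fixes Om :: "(real^'d) set" and u :: "real^'d => real^3"
 assumes \<phi>: "cutoff \<phi>" and o: "open Om" and bd: "bounded Om"
  and gl: "!!j. gradient_limit (test_function Om) Om (%x. u x $ j) (%x. G x $ j)"
 shows "AE x\<in>Om in lebesgue. wjac Om u x = G x" "u : W12_0 Om"
proof -
 have u: "square_integrable Om u" and G: "square_integrable Om G"
  using gl unfolding gradient_limit_def by (auto intro: square_integrable_vec[OF o])
 have wg: "weak_grad Om (%x. u x $ j) (%x. G x $ j)" for j
  by (rule weak_grad_of_gradient_limit(1)[OF o bd gradient_limit_mono[OF gl]]) (rule test_function_C1(1)[OF o bd])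
 note C = W12_criterion[OF \<phi> o u wg G]
 show "AE x\<in>Om in lebesgue. wjac Om u x = G x" by (rule C(1))
 have "EX tt. test_function Om tt & W12_norm Om (%x. u x - tt x) < e" if e: "e > 0" for e
 proof -
  have "e^2 / 6 > 0" using e by simp
  hence "ALL j. EX tt. test_function Om tt & square_integrable Om tt & square_integrable Om (grad tt) &
   (LINT x|leb Om. (u x $ j - tt x)^2) < e^2 / 6 & (LINT x|leb Om. (norm (G x $ j - grad tt x))^2) < e^2 / 6"
   using gl unfolding gradient_limit_def by blast
  from choice[OF this] obtain tt where tt': "ALL j. test_function Om (tt j) & square_integrable Om (tt j) & square_integrable Om (grad (tt j)) &
   (LINT x|leb Om. (u x $ j - tt j x)^2) < e^2 / 6 & (LINT x|leb Om. (norm (G x $ j - grad (tt j) x))^2) < e^2 / 6" ..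
  have tt: "test_function Om (tt j)" "square_integrable Om (tt j)" "square_integrable Om (grad (tt j))"
   "(LINT x|leb Om. (u x $ j - tt j x)^2) < e^2 / 6" "(LINT x|leb Om. (norm (G x $ j - grad (tt j) x))^2) < e^2 / 6" for j
   using spec[OF tt', of j] by simp_all
  define T :: "real^'d => real^3" where "T x = (\<chi> j. tt j x)" for x
  define H :: "real^'d => real^'d^3" where "H x = (\<chi> j. grad (tt j) x)" for x
  have "smooth_on UNIV T"
   unfolding smooth_on_def
  proof
   fix k
   have c: "C_on k UNIV (tt j)" for j using tt(1)[of j] by (simp add: test_function_def smooth_on_def)
   have l: "C_on k UNIV (%x. tt j x *R (axis j 1 :: real^3))" for j
    by (rule C_on_linear_image[OF bounded_linear_scaleR_left open_UNIV c])
   have "C_on k UNIV (%x. tt 1 x *R (axis 1 1 :: real^3) + tt 2 x *R axis 2 1 + tt 3 x *R axis 3 1)"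
    by (intro C_on_add l open_UNIV)
   moreover have "(%x. tt 1 x *R (axis 1 1 :: real^3) + tt 2 x *R axis 2 1 + tt 3 x *R axis 3 1) = T"
    by (auto simp: fun_eq_iff vec_eq_iff forall_3 T_def axis_def)
   ultimately show "C_on k UNIV T" by simp
  qed
  moreover have sub: "closure {x. T x ~= 0} <= (\<Union>j\<in>UNIV. closure {x. tt j x ~= 0})"
  proof (rule closure_minimal)
   show "closed (\<Union>j\<in>UNIV. closure {x. tt j x ~= 0})" by (intro closed_UN finite) auto
   show "{x. T x ~= 0} <= (\<Union>j\<in>UNIV. closure {x. tt j x ~= 0})"
    using closure_subset by (fastforce simp: T_def vec_eq_iff)
  qed
  moreover have "compact (\<Union>j\<in>UNIV. closure {x. tt j x ~= 0})" "(\<Union>j\<in>UNIV. closure {x. tt j x ~= 0}) <= Om"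
   using tt(1) by (auto simp: test_function_def intro!: compact_UN)
  hence "compact (closure {x. T x ~= 0})" "closure {x. T x ~= 0} <= Om"
   using sub by (auto simp: compact_eq_bounded_closed intro: bounded_subset)
  ultimately have T: "test_function Om T" by (simp add: test_function_def)
  have sT: "square_integrable Om T" by (rule square_integrable_vec[OF o]) (simp add: T_def tt(2))
  have sH: "square_integrable Om H" by (rule square_integrable_vec[OF o]) (simp add: H_def tt(3))
  have wT: "weak_grad Om (%x. T x $ j) (%x. H x $ j)" for j
   using C1_weak_grad(2)[OF o test_function_C1(1)[OF o bd tt(1)[of j]]] by (simp add: T_def H_def)
  have sum3: "(\<Sum>j\<in>(UNIV::3 set). q j) < e^2 / 2" if "!!j. q j < e^2 / 6" for q :: "3 => real"
   using that[of 1] that[of 2] that[of 3] by (simp add: sum_3)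
  have i1: "integrable (leb Om) (%x. (norm (u x $ j - T x $ j))^2)" and i2: "integrable (leb Om) (%x. (norm (G x $ j - H x $ j))^2)" for j
   using square_integrable_component[OF o square_integrable_diff[OF o u sT], of j] square_integrable_component[OF o square_integrable_diff[OF o G sH], of j]
   by (auto simp: square_integrable_iff[OF o])
  have "(LINT x|leb Om. (norm (u x - T x))^2) = (\<Sum>j\<in>UNIV. \<integral>x. (norm (u x $ j - T x $ j))^2 \<partial>leb Om)"
   unfolding norm_vec_squared vector_minus_component by (rule Bochner_Integration.integral_sum) (rule i1)
  also have "... < e^2 / 2" using tt(4) by (intro sum3) (simp add: T_def)
  finally have 1: "(LINT x|leb Om. (norm (u x - T x))^2) < e^2 / 2" .
  have "(LINT x|leb Om. (norm (G x - H x))^2) = (\<Sum>j\<in>UNIV. \<integral>x. (norm (G x $ j - H x $ j))^2 \<partial>leb Om)"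
   unfolding norm_vec_squared[of "G _ - H _"] vector_minus_component by (rule Bochner_Integration.integral_sum) (rule i2)
  also have "... < e^2 / 2" using tt(5) by (intro sum3) (simp add: H_def)
  finally have "(W12_norm Om (%x. u x - T x))^2 < e^2"
   using 1 W12_norm_diff[OF \<phi> o u wg G sT wT sH] by simp
  hence "W12_norm Om (%x. u x - T x) < e" using e by (simp add: power_less_imp_less_base)
  thus ?thesis using T by blast
 qed
 thus "u : W12_0 Om" using C(2) by (simp add: W12_0_def)
qed

lemma double_well_bounded:
 assumes "double_well f g"
 shows "EX M>0. ALL t. 0 <= t --> t <= 1 --> g t <= M"
proof -
 have "bounded (g ` {0..1})"
  by (intro compact_imp_bounded compact_continuous_image continuous_on_subset[OF double_well_facts(1)[OF assms]]) auto
 then obtain M where "M > 0" "ALL y:g ` {0..1}. norm y <= M" by (auto simp: bounded_pos)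
 thus ?thesis by (intro exI[of _ M]) force
qed

locale transition_layer = enclosed_tube S R P W
 for S W :: "(real^'d) set" and R P +
 fixes Om :: "(real^'d) set" and f g \<phi> p :: "real => real" and r \<epsilon> a b :: real
 assumes dw: "double_well f g" and cut: "cutoff \<phi>" and prof: "profile g r \<epsilon> p a b" and r: "0 < r" "2 * r <= R / 4" and \<epsilon>: "0 < \<epsilon>" "\<epsilon> < 1"
  and Om: "open Om" "bounded Om" "V <= Om" "W <= Om"
begin

definition s :: "real^'d => real" where "s x = p (sd x)"
definition slope :: "real^'d => real" where "slope x = (if a < sd x & sd x < b then (g (s x) + \<epsilon> / r) / \<epsilon> else 0)"
definition gs :: "real^'d => real^'d" where "gs x = slope x *R grad sd x"

lemmas dwf = double_well_facts[OF dw]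

lemma ab: "- r <= a" "a < 0" "0 < b" "b <= r" "r < R" using prof r by (auto simp: profile_def)

lemma s01: "0 <= s x" "s x <= 1" using prof by (auto simp: profile_def s_def)

lemma s_outside: "sd x <= a ==> s x = 0" "b <= sd x ==> s x = 1" using prof by (auto simp: profile_def s_def)

lemma slope_nonneg: "0 <= slope x" using dwf(2)[OF s01(1)[of x]] \<epsilon> r by (simp add: slope_def)

lemma layer_cases:
 obtains "a < sd x" "sd x < b" "slope x = (g (s x) + \<epsilon> / r) / \<epsilon>" "\<bar>sd x\<bar> * (g (s x) + \<epsilon> / r) <= \<epsilon>" "D x <= r"
  | "sd x <= a | b <= sd x" "slope x = 0" "g (s x) = 0"
proof (cases "a < sd x & sd x < b")
 case True
 have "\<bar>sd x\<bar> * (g (s x) + \<epsilon> / r) <= \<epsilon>" using prof True by (simp add: profile_def s_def)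
 moreover have "D x <= r" using abs_sd[of x] ab True by linarith
 ultimately show ?thesis using that(1) True by (simp add: slope_def)
next
 case False
 hence "sd x <= a | b <= sd x" by linarith
 moreover from this have "g (s x) = 0" using s_outside[of x] dwf(4,5) by auto
 ultimately show ?thesis using that(2) False by (simp add: slope_def)
qed

lemma sd_slope_le: "\<bar>sd x\<bar> * slope x <= 1" "\<bar>sd x\<bar> * g (s x) <= \<epsilon>" "g (s x) <= \<epsilon> * slope x"
proof -
 have e: "\<epsilon> / r > 0" using \<epsilon> r by simp
 have "\<bar>sd x\<bar> * slope x <= 1 & \<bar>sd x\<bar> * g (s x) <= \<epsilon> & g (s x) <= \<epsilon> * slope x"
 proof (rule layer_cases[of x])
  assume A: "slope x = (g (s x) + \<epsilon> / r) / \<epsilon>" "\<bar>sd x\<bar> * (g (s x) + \<epsilon> / r) <= \<epsilon>"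
  have "\<bar>sd x\<bar> * g (s x) <= \<bar>sd x\<bar> * (g (s x) + \<epsilon> / r)" using e by (intro mult_left_mono) auto
  moreover have "\<bar>sd x\<bar> * slope x = (\<bar>sd x\<bar> * (g (s x) + \<epsilon> / r)) / \<epsilon>" "\<epsilon> * slope x = g (s x) + \<epsilon> / r" using \<epsilon> A(1) by simp_all
  ultimately show ?thesis using A(2) \<epsilon> e by simp
 qed (use \<epsilon> in simp)
 thus "\<bar>sd x\<bar> * slope x <= 1" "\<bar>sd x\<bar> * g (s x) <= \<epsilon>" "g (s x) <= \<epsilon> * slope x" by auto
qed

lemma slope_decay:
 assumes M: "!!t. 0 <= t ==> t <= 1 ==> g t <= M" "M > 0"
 shows "(D x + \<epsilon>) * slope x <= 1 + M + 1 / r"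
proof -
 have "\<epsilon> * slope x <= M + 1 / r"
 proof (rule layer_cases[of x])
  assume "slope x = (g (s x) + \<epsilon> / r) / \<epsilon>"
  hence "\<epsilon> * slope x = g (s x) + \<epsilon> / r" using \<epsilon> by simp
  moreover have "\<epsilon> / r <= 1 / r" using \<epsilon> r by (simp add: divide_right_mono)
  ultimately show ?thesis using M(1)[OF s01] by (simp add: add_mono)
 qed (use M r in simp)
 thus ?thesis using sd_slope_le(1)[of x] by (simp add: abs_sd distrib_right)
qed

lemma norm_grad_sd_le: "x : V ==> norm (grad sd x) = 1"
 using norm_grad_sd[of x] DQ_eq_grad_sd(2)[of x] by (cases "x : S") auto

lemma norm_gs: "norm (gs x) = slope x"
proof (rule layer_cases[of x])
 assume "D x <= r"
 hence "x : V" using ab by (simp add: V_def)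
 thus ?thesis using norm_grad_sd_le slope_nonneg by (simp add: gs_def)
qed (simp add: gs_def)

lemma slope_bounded: "EX L. ALL x. slope x <= L"
proof -
 obtain M where M: "M > 0" "!!t. 0 <= t ==> t <= 1 ==> g t <= M" using double_well_bounded[OF dw] by blast
 have "slope x <= (1 + M + 1 / r) / \<epsilon>" for x
 proof -
  have "\<epsilon> * slope x <= (D x + \<epsilon>) * slope x" using S_basic(6)[of x] slope_nonneg by (intro mult_right_mono) auto
  also have "... <= 1 + M + 1 / r" using slope_decay[of M x] M by blast
  finally show ?thesis using \<epsilon> by (simp add: pos_le_divide_eq mult.commute)
 qed
 thus ?thesis by blast
qed

definition support :: "(real^'d) set" where "support = closure W \<union> {x. D x <= r}"

lemma support: "compact support" "support <= Om" "x ~: support ==> s x = 0 & gs x = 0"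
proof -
 have "bounded W" using Om bounded_subset by blast
 moreover have "compact {x. D x <= r}" using closed_infdist_le[of r] bounded_infdist_le[of r] by (simp add: compact_eq_bounded_closed)
 ultimately show "compact support" unfolding support_def by (intro compact_Un) (auto simp: compact_closure)
 have "closure W <= W \<union> S" using W_basic(2) W_basic(1) by (auto simp: frontier_def interior_open)
 thus "support <= Om" using Om S_subset_V ab by (auto simp: support_def V_def)
 assume x: "x ~: support"
 hence "x ~: W" "D x > r" using closure_subset by (auto simp: support_def)
 hence "sd x <= a" "\<not> a < sd x" using ab by (auto simp: sdist_def)
 thus "s x = 0 & gs x = 0" using s_outside by (simp add: gs_def slope_def)
qed

lemma s_lipschitz: "EX L. L-lipschitz_on UNIV s"
proof -
 obtain L where "L-lipschitz_on UNIV p" using prof by (auto simp: profile_def)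
 hence "(L * 1)-lipschitz_on UNIV (%x. p (sd x))"
  by (intro lipschitz_on_compose2[OF sd_lipschitz]) (auto intro: lipschitz_on_subset)
 thus ?thesis unfolding s_def[abs_def] by blast
qed

lemma continuous_s: "continuous_on UNIV s"
 using s_lipschitz lipschitz_on_continuous_on by blast

lemma continuous_sd: "continuous_on UNIV sd"
 using sd_lipschitz lipschitz_on_continuous_on by blast

lemma continuous_g_s: "continuous_on UNIV (%x. g (s x))"
 by (rule continuous_on_compose2[OF dwf(1) continuous_s]) (use s01 in auto)

lemma gradient_s:
 assumes x: "x ~: S" "D x ~= - a" "D x ~= b"
 shows "(s has_derivative (%e. gs x <.> e)) (at x)" "isCont gs x"
proof -
 have cs: "sd x ~= a" "sd x ~= b" using x ab S_basic(6)[of x] by (auto simp: sdist_def split: if_splits)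
 have "(s has_derivative (%e. gs x <.> e)) (at x) & isCont gs x"
 proof (cases "a < sd x & sd x < b")
  case True
  hence xV: "x : V - S" using x(1) abs_sd[of x] ab by (auto simp: V_def)
  have "(p has_real_derivative slope x) (at (sd x))"
   using prof True by (simp add: profile_def slope_def s_def)
  hence dp: "(p has_derivative (%t. slope x * t)) (at (sd x))" by (simp add: has_field_derivative_def)
  have "(sd has_derivative (%e. grad sd x <.> e)) (at x)" using has_derivative_sd[OF xV] by (simp add: grad_sd[OF xV])
  from has_derivative_compose[OF this dp] have 1: "(s has_derivative (%e. gs x <.> e)) (at x)" by (simp add: s_def[abs_def] gs_def)
  let ?U = "{x. a < sd x & sd x < b}"
  have oU: "open ?U" using open_vimage[OF open_greaterThanLessThan continuous_sd, of a b] by (simp add: vimage_def)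
  have "isCont (%y. g (s y)) x" using continuous_g_s by (simp add: continuous_on_eq_continuous_at)
  hence "isCont (%y. ((g (s y) + \<epsilon> / r) / \<epsilon>) *R grad sd y) x" using \<epsilon> by (intro continuous_intros isCont_grad_sd[OF xV]) auto
  moreover have "\<forall>\<^sub>F y in nhds x. ((g (s y) + \<epsilon> / r) / \<epsilon>) *R grad sd y = gs y"
   using eventually_nhds_in_open[OF oU, of x] True by (auto elim!: eventually_mono simp: gs_def slope_def)
  ultimately have "isCont gs x" using isCont_cong[of "%y. ((g (s y) + \<epsilon> / r) / \<epsilon>) *R grad sd y" gs x] by simp
  thus ?thesis using 1 by blast
 next
  case False
  hence "sd x : {..<a} | sd x : {b<..}" using cs by auto
  then obtain U c where U: "open U" "x : U" "!!y. y : U ==> s y = c" "!!y. y : U ==> gs y = 0"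
  proof
   assume "sd x : {..<a}"
   thus thesis
    using that[of "sd -` {..<a}" 0] open_vimage[OF open_lessThan continuous_sd] s_outside(1) by (auto simp: gs_def slope_def)
  next
   assume "sd x : {b<..}"
   thus thesis
    using that[of "sd -` {b<..}" 1] open_vimage[OF open_greaterThan continuous_sd] s_outside(2) by (auto simp: gs_def slope_def)
  qed
  have "((%_. c) has_derivative (%e. gs x <.> e)) (at x)" using U(4)[OF U(2)] by simp
  hence "(s has_derivative (%e. gs x <.> e)) (at x)" by (rule has_derivative_transform_within_open[OF _ U(1,2)]) (simp add: U(3))
  moreover have "continuous_on U gs" using continuous_on_const[of U 0] by (rule continuous_on_eq) (simp add: U(4))
  hence "isCont gs x" using continuous_on_eq_continuous_at[OF U(1)] U(2) by blast
  ultimately show ?thesis by blast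
 qed
 thus "(s has_derivative (%e. gs x <.> e)) (at x)" "isCont gs x" by auto
qed

lemma AE_gradient_s: "AE x in lebesgue. (s has_derivative (%e. gs x <.> e)) (at x) & isCont gs x"
proof -
 have "AE x in lebesgue. D x ~= - a" "AE x in lebesgue. D x ~= b" by (rule AE_infdist_neq; use ab in simp)+
 with AE_notin_S show ?thesis by eventually_elim (use gradient_s in blast)
qed

lemma measurable_gs: "gs : borel_measurable (leb Om)"
proof -
 let ?U = "(sd -` {a<..<b}) - S"
 have U: "open ?U" by (intro open_Diff open_vimage continuous_sd S_basic(2) open_greaterThanLessThan)
 have UV: "?U <= V - S"
 proof
  fix x assume "x : ?U"
  thus "x : V - S" using abs_sd[of x] ab by (auto simp: V_def)
 qed
 have "continuous_on ?U (%x. ((g (s x) + \<epsilon> / r) / \<epsilon>) *R grad sd x)"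
  using \<epsilon> UV isCont_grad_sd by (intro continuous_intros continuous_on_subset[OF continuous_g_s] continuous_at_imp_continuous_on) auto
 hence "(%x. indicator ?U x *R (((g (s x) + \<epsilon> / r) / \<epsilon>) *R grad sd x)) : borel_measurable borel"
  using U by (intro borel_measurable_continuous_on_indicator) auto
 hence "(%x. indicator ?U x *R (((g (s x) + \<epsilon> / r) / \<epsilon>) *R grad sd x)) : borel_measurable (leb Om)"
  by (intro measurable_restrict_space1 measurable_completion) simp
 moreover have "AE x\<in>Om in lebesgue. indicator ?U x *R (((g (s x) + \<epsilon> / r) / \<epsilon>) *R grad sd x) = gs x"
  using AE_notin_S by eventually_elim (auto simp: gs_def slope_def indicator_def)
 ultimately show ?thesis by (rule AE_eq_lebesgue_on_imp(2)[OF open_in_sets_lebesgue[OF Om(1)], rotated])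
qed

lemma weak_grad_psi: "weak_grad Om (%x. integral {0..s x} g) (%x. g (s x) *R gs x)"
proof (rule weak_grad_of_locally_lipschitz[OF Om(1)])
 let ?h = "%t. g (max 0 t)"
 have ch: "continuous_on UNIV ?h" by (rule continuous_on_compose2[OF dwf(1)]) (auto intro!: continuous_intros)
 hence "isCont ?h t" for t by (simp add: continuous_on_eq_continuous_at)
 then obtain F where F: "!!t. (F has_vector_derivative ?h t) (at t)"
  using einterval_antiderivative[of "-\<infinity>" "\<infinity>" ?h] by auto
 have I: "integral {0..s x} g = F (s x) - F 0" for x
 proof -
  have "((%t. ?h t) has_integral (F (s x) - F 0)) {0..s x}"
   by (rule fundamental_theorem_of_calculus[OF s01(1)]) (rule has_vector_derivative_at_within[OF F])
  hence "(g has_integral (F (s x) - F 0)) {0..s x}" by (rule has_integral_eq[rotated]) auto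
  thus ?thesis by (rule integral_unique)
 qed
 have dF: "(F has_real_derivative ?h t) (at t)" for t using F[of t] by (simp add: has_real_derivative_iff_has_vector_derivative)
 obtain M where M: "M > 0" "!!t. 0 <= t ==> t <= 1 ==> g t <= M" using double_well_bounded[OF dw] by blast
 have "M-lipschitz_on {0..1} F"
 proof (rule lipschitz_onI)
  fix t u :: real assume tu: "t : {0..1}" "u : {0..1}"
  have "norm (F t - F u) <= M * norm (t - u)"
  proof (rule field_differentiable_bound[of "{0..1}" F ?h M])
   show "(F has_real_derivative ?h z) (at z within {0..1})" for z by (rule has_field_derivative_at_within[OF dF])
   show "norm (?h z) <= M" if "z : {0..1}" for z using that M(2)[of z] dwf(2)[of z] by (simp add: max_def)
  qed (use tu in auto)
  thus "dist (F t) (F u) <= M * dist t u" by (simp add: dist_norm)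
 qed (use M in simp)
 moreover obtain L where L: "L-lipschitz_on UNIV s" using s_lipschitz by blast
 ultimately have "(M * L)-lipschitz_on UNIV (%x. F (s x))"
  using s01 by (intro lipschitz_on_compose2[OF L]) (auto intro: lipschitz_on_subset)
 hence "(M * L)-lipschitz_on UNIV (%x. integral {0..s x} g)" by (simp add: I lipschitz_on_def dist_real_def)
 thus "locally_lipschitz_on Om (%x. integral {0..s x} g)" by (rule lipschitz_imp_locally_lipschitz)
 show "AE x\<in>Om in lebesgue. ((%x. integral {0..s x} g) has_derivative (%e. (g (s x) *R gs x) <.> e)) (at x)"
  using AE_gradient_s
 proof eventually_elim
  case (elim x)
  have "(F has_derivative (%t. g (s x) * t)) (at (s x))" using dF[of "s x"] s01(1)[of x] by (simp add: has_field_derivative_def max_def)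
  from has_derivative_compose[OF conjunct1[OF elim] this]
  have "((%x. F (s x) - F 0) has_derivative (%e. g (s x) * (gs x <.> e) - 0)) (at x)" by (intro has_derivative_diff has_derivative_const)
  thus ?case by (simp add: I)
 qed
qed

end

section \<open>Hardy inequality for a tangential trace\<close>

definition restrict_coords :: "('d::finite => 3) => real^3 => real^'d" where
 "restrict_coords \<iota> v = (\<chi> i. v $ \<iota> i)"

lemma inner_emb: "v <.> emb \<iota> a = restrict_coords \<iota> v <.> a"
proof -
 have "v <.> emb \<iota> a = (\<Sum>i\<in>UNIV. a $ i * (v <.> axis (\<iota> i) 1))" by (simp add: emb_def inner_sum_right)
 also have "... = restrict_coords \<iota> v <.> a" by (simp add: restrict_coords_def inner_axis inner_vec_def[of _ a] mult.commute)
 finally show ?thesis .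
qed

lemma sum_injective_le:
 fixes h :: "3 => real"
 assumes "inj (\<iota> :: 'd::finite => 3)" "!!j. 0 <= h j"
 shows "(\<Sum>i\<in>UNIV. h (\<iota> i)) <= (\<Sum>j\<in>UNIV. h j)"
proof -
 have "(\<Sum>i\<in>UNIV. h (\<iota> i)) = sum h (range \<iota>)" using sum.reindex[OF assms(1), of h] by simp
 also have "... <= sum h UNIV" using assms(2) by (intro sum_mono2) auto
 finally show ?thesis .
qed

lemma norm_restrict_coords:
 assumes "inj \<iota>" shows "norm (restrict_coords \<iota> v) <= norm v"
proof (rule power2_le_imp_le)
 show "(norm (restrict_coords \<iota> v))^2 <= (norm v)^2"
  unfolding norm_vec_squared using sum_injective_le[OF assms, of "%j. (norm (v $ j))^2"] by (simp add: restrict_coords_def)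
qed simp

lemma bounded_linear_restrict_coords: "bounded_linear (restrict_coords \<iota>)"
 by (subst linear_conv_bounded_linear[symmetric], rule linearI) (auto simp: restrict_coords_def vec_eq_iff)

lemma inner_emb_le:
 assumes "inj \<iota>" shows "\<bar>v <.> emb \<iota> a\<bar> <= norm v * norm a"
proof -
 have "\<bar>v <.> emb \<iota> a\<bar> <= norm (restrict_coords \<iota> v) * norm a" unfolding inner_emb by (rule Cauchy_Schwarz_ineq2)
 also have "... <= norm v * norm a" using norm_restrict_coords[OF assms] by (rule mult_right_mono) simp
 finally show ?thesis .
qed

lemma square_le_of_abs_le: "\<bar>x :: real\<bar> <= y ==> x^2 <= y^2"
 using power_mono[of "\<bar>x\<bar>" y 2] by simp

lemma le_of_le_add_all_small:
 fixes x y c :: real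
 assumes "!!e. 0 < e ==> e <= 1 ==> x <= y + e * c" "0 <= c"
 shows "x <= y"
proof (rule field_le_epsilon)
 fix e :: real assume e: "0 < e"
 define t where "t = min 1 (e / (c + 1))"
 have t: "0 < t" "t <= 1" "t <= e / (c + 1)" using e assms(2) by (auto simp: t_def)
 have "t * c <= e / (c + 1) * (c + 1)" using t e assms(2) by (intro mult_mono) auto
 also have "... = e" using assms(2) by simp
 finally show "x <= y + e" using assms(1)[OF t(1,2)] by linarith
qed

context enclosed_tube
begin

text \<open>Hardy's inequality passes to a field with tangential trace: the boundary term of smooth
  approximations \<open>v\<close> only sees \<open>v - T\<close> on \<open>S\<close>.\<close>

lemma hardy_trace:
 assumes \<phi>: "cutoff \<phi>" and d2: "CARD('d) >= 2" and i: "inj (\<iota> :: 'd => 3)" and o: "open Om" and VOm: "V <= Om"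
 shows "EX C>0. ALL w T \<kappa>. w : W12 Om --> 0 < \<kappa> -->
   (AE y in hausdorff_measure (CARD('d) - 1). y : S --> T y <.> emb \<iota> (grad sd y) = 0) -->
   (ALL e>0. EX v. smooth_on Om v & v : W12 Om & W12_norm Om (%x. v x - w x) < e &
    set_nn_integral (hausdorff_measure (CARD('d) - 1)) S (%y. ennreal ((norm (v y - T y))^2)) <= ennreal e) -->
   integrable (leb Om) (%x. indicator core x * ((w x <.> emb \<iota> (N x))^2 / (D x + \<kappa>)^2)) &
   (LINT x|leb Om. indicator core x * ((w x <.> emb \<iota> (N x))^2 / (D x + \<kappa>)^2)) <= C * (W12_norm Om w)^2"
proof -
 let ?H = "hausdorff_measure (CARD('d) - 1) :: (real^'d) measure"
 obtain C where C: "C > 0" "!!a h \<kappa>. C_on (Suc 0) V a ==> 0 <= h ==> 0 < \<kappa> ==>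
   (\<integral>\<^sup>+y. ennreal (a y <.> DQ y (a y)) * indicator S y \<partial>?H) <= ennreal h ==>
   integrable lebesgue (%x. indicator core x * ((a x <.> N x)^2 / (D x + \<kappa>)^2)) &
   (LINT x|lebesgue. indicator core x * ((a x <.> N x)^2 / (D x + \<kappa>)^2)) <= C * (LINT x|lebesgue. indicator K x * energy_density a x) + C * h / \<kappa>"
  using hardy_tangential[OF \<phi> d2] by blast
 have so: "Om : sets lebesgue" by (rule open_in_sets_lebesgue[OF o])
 have N1: "norm (N x) <= 1" if "x : core" for x
 proof (cases "x : S")
  case True thus ?thesis by (simp add: N_def)
 next
  case False
  thus ?thesis using that norm_N[of x] R by (simp add: core_def V_def)
 qed
 have Dk: "\<kappa> <= D x + \<kappa>" for \<kappa> x using S_basic(6)[of x] by simp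
 have meas: "(%x. indicator core x * ((w x <.> emb \<iota> (N x))^2 / (D x + \<kappa>)^2)) : borel_measurable (leb Om)"
  if w: "w : borel_measurable (leb Om)" for w :: "real^'d => real^3" and \<kappa>
 proof -
  let ?n = "%x. indicator (core - S) x *R N x"
  have cc: "closed core" unfolding core_def by (rule closed_infdist_le)
  have "core - S <= V - S" using R by (auto simp: core_def V_def)
  hence "?n : borel_measurable borel"
   using cc S_basic(2) by (intro borel_measurable_continuous_on_indicator continuous_on_subset[OF continuous_N]) auto
  hence n: "?n : borel_measurable (leb Om)" by (intro measurable_restrict_space1 measurable_completion) simp
  have "continuous_on UNIV (emb \<iota> :: real^'d => real^3)" unfolding emb_def by (intro continuous_intros)
  hence e: "(%x. emb \<iota> (?n x)) : borel_measurable (leb Om)"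
   using measurable_compose[OF n borel_measurable_continuous_onI] by auto
  have "(%x. (w x <.> emb \<iota> (?n x))^2 / (D x + \<kappa>)^2) : borel_measurable (leb Om)"
   by (intro borel_measurable_divide borel_measurable_power borel_measurable_inner w e continuous_measurable_lebesgue_on continuous_intros)
  moreover have "(w x <.> emb \<iota> (?n x))^2 / (D x + \<kappa>)^2 = indicator core x * ((w x <.> emb \<iota> (N x))^2 / (D x + \<kappa>)^2)" for x
   by (auto simp: indicator_def N_def emb_def)
  ultimately show ?thesis by simp
 qed
 have main: "integrable (leb Om) (%x. indicator core x * ((w x <.> emb \<iota> (N x))^2 / (D x + \<kappa>)^2)) &
   (LINT x|leb Om. indicator core x * ((w x <.> emb \<iota> (N x))^2 / (D x + \<kappa>)^2)) <= (4 * C) * (W12_norm Om w)^2"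
  if w: "w : W12 Om" and \<kappa>: "0 < \<kappa>" and tan: "AE y in ?H. y : S --> T y <.> emb \<iota> (grad sd y) = 0"
   and app: "ALL e>0. EX v. smooth_on Om v & v : W12 Om & W12_norm Om (%x. v x - w x) < e &
    set_nn_integral ?H S (%y. ennreal ((norm (v y - T y))^2)) <= ennreal e" for w T \<kappa>
 proof
  let ?q = "%w x. indicator core x * ((w x <.> emb \<iota> (N x))^2 / (D x + \<kappa>)^2)"
  note W = W12_facts[OF o w]
  have wm: "w : borel_measurable (leb Om)" and wi: "integrable (leb Om) (%x. (norm (w x))^2)"
   using W(1) by (auto simp: square_integrable_iff[OF o])
  have q0: "0 <= ?q w x" for w x by (simp add: indicator_def)
  have qb: "?q w x <= (norm (w x))^2 / \<kappa>^2" for w x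
  proof (cases "x : core")
   case True
   have "\<bar>w x <.> emb \<iota> (N x)\<bar> <= norm (w x) * norm (N x)" by (rule inner_emb_le[OF i])
   also have "... <= norm (w x) * 1" using N1[OF True] by (intro mult_left_mono) auto
   finally have "(w x <.> emb \<iota> (N x))^2 <= (norm (w x))^2" by (intro square_le_of_abs_le) simp
   moreover have "\<kappa>^2 <= (D x + \<kappa>)^2" using Dk[of \<kappa> x] \<kappa> by (intro power_mono) auto
   ultimately show ?thesis using True \<kappa> by (auto intro!: frac_le)
  qed simp
  show qi: "integrable (leb Om) (?q w)"
  proof (rule Bochner_Integration.integrable_bound[OF _ meas[OF wm]])
   show "integrable (leb Om) (%x. (norm (w x))^2 / \<kappa>^2)" using wi by simp
   show "AE x in leb Om. norm (?q w x) <= norm ((norm (w x))^2 / \<kappa>^2)"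
   proof (rule AE_I2)
    fix x
    have "norm (?q w x) = ?q w x" using q0[where w=w and x=x] by (simp only: real_norm_def abs_of_nonneg)
    also have "... <= (norm (w x))^2 / \<kappa>^2" by (rule qb)
    also have "... <= norm ((norm (w x))^2 / \<kappa>^2)" unfolding real_norm_def by (rule abs_ge_self)
    finally show "norm (?q w x) <= norm ((norm (w x))^2 / \<kappa>^2)" .
   qed
  qed
  let ?W = "(W12_norm Om w)^2"
  have "(LINT x|leb Om. ?q w x) <= (4 * C) * ?W + e * (4 * C + 2 * C / \<kappa> + 2 / \<kappa>^2)" if e: "0 < e" "e <= 1" for e
  proof -
   obtain v where v: "smooth_on Om v" "v : W12 Om" "W12_norm Om (%x. v x - w x) < e"
    "set_nn_integral ?H S (%y. ennreal ((norm (v y - T y))^2)) <= ennreal e" using app e(1) by blast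
   define J where "J x = (\<chi> j. grad (%y. v y $ j) x)" for x
   note VJ = smooth_W12_gradient[OF \<phi> o v(1,2), folded J_def] and V1 = W12_facts(1)[OF o v(2)]
   define a where "a x = restrict_coords \<iota> (v x)" for x
   have dif: "square_integrable Om (%x. v x - w x)" "square_integrable Om (%x. J x - wjac Om w x)"
    by (intro square_integrable_diff[OF o] V1 W VJ)+
   note I = dif[unfolded square_integrable_iff[OF o]] V1[unfolded square_integrable_iff[OF o]] VJ(3)[unfolded square_integrable_iff[OF o]]
    W(1)[unfolded square_integrable_iff[OF o]] W(3)[unfolded square_integrable_iff[OF o]]
   have Nd: "(W12_norm Om (%x. v x - w x))^2 = (LINT x|leb Om. (norm (v x - w x))^2) + (LINT x|leb Om. (norm (J x - wjac Om w x))^2)"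
    by (rule W12_norm_diff[OF \<phi> o V1 VJ(2,3) W(1-3)])
   have N0: "0 <= W12_norm Om (%x. v x - w x)" by (simp add: W12_norm_def set_lebesgue_integral_def)
   have "(W12_norm Om (%x. v x - w x))^2 <= e^2" using v(3) N0 by (intro power_mono) auto
   also have "e^2 <= e" using e by (simp add: power2_eq_square mult_left_le)
   finally have Ne: "(W12_norm Om (%x. v x - w x))^2 <= e" .
   have C1a: "C_on (Suc 0) V a"
   proof -
    have "C_on (Suc 0) Om v" using v(1) by (simp add: smooth_on_def del: C_on.simps)
    hence "C_on (Suc 0) V v" using VOm by (auto intro: continuous_on_subset)
    thus ?thesis unfolding a_def[abs_def] by (rule C_on_linear_image[OF bounded_linear_restrict_coords open_V])
   qed
   have "(\<integral>\<^sup>+y. ennreal (a y <.> DQ y (a y)) * indicator S y \<partial>?H) <= set_nn_integral ?H S (%y. ennreal ((norm (v y - T y))^2))"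
   proof (rule nn_integral_mono_AE)
    show "AE y in ?H. ennreal (a y <.> DQ y (a y)) * indicator S y <= ennreal ((norm (v y - T y))^2) * indicator S y"
     using tan
    proof eventually_elim
     case (elim y)
     have "a y <.> DQ y (a y) <= (norm (v y - T y))^2" if y: "y : S"
     proof -
      have "a y <.> DQ y (a y) = (a y <.> grad sd y)^2" by (simp add: DQ_eq_grad_sd(1)[OF y] power2_eq_square inner_commute)
      also have "a y <.> grad sd y = (v y - T y) <.> emb \<iota> (grad sd y)" using elim y by (simp add: a_def inner_emb[symmetric] inner_diff_left)
      also have "((v y - T y) <.> emb \<iota> (grad sd y))^2 <= (norm (v y - T y))^2"
       using inner_emb_le[OF i, of "v y - T y" "grad sd y"] DQ_eq_grad_sd(2)[OF y] by (intro square_le_of_abs_le) simp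
      finally show ?thesis .
     qed
     thus ?case by (auto simp: indicator_def intro: ennreal_leI)
    qed
   qed
   also note v(4)
   finally have "(\<integral>\<^sup>+y. ennreal (a y <.> DQ y (a y)) * indicator S y \<partial>?H) <= ennreal e" .
   from C(2)[OF C1a _ \<kappa> this] e have Ha: "integrable lebesgue (%x. indicator core x * ((a x <.> N x)^2 / (D x + \<kappa>)^2))"
    "(LINT x|lebesgue. indicator core x * ((a x <.> N x)^2 / (D x + \<kappa>)^2)) <= C * (LINT x|lebesgue. indicator K x * energy_density a x) + C * e / \<kappa>" by auto
   have qv: "?q v x = indicator core x * ((a x <.> N x)^2 / (D x + \<kappa>)^2)" for x by (simp add: inner_emb a_def)
   note qv1 = integral_lebesgue_on_le_lebesgue[OF o Ha(1), folded qv, OF q0[where w=v]]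
   have en: "energy_density a x <= (norm (v x))^2 + (norm (J x))^2" for x
   proof -
    have "(norm (a x))^2 <= (norm (v x))^2" unfolding a_def by (intro power_mono norm_restrict_coords[OF i]) simp
    moreover have "(\<Sum>i\<in>UNIV. (norm (grad (%x. a x $ i) x))^2) <= (norm (J x))^2"
     unfolding norm_vec_squared[of "J x"] using sum_injective_le[OF i, of "%j. (norm (J x $ j))^2"] by (simp add: a_def restrict_coords_def J_def)
    ultimately show ?thesis unfolding energy_density_def by (rule add_mono)
   qed
   have KOm: "K <= Om" using K_subset_V VOm by blast
   have iv: "integrable (leb Om) (%x. (norm (v x))^2 + (norm (J x))^2)" using I by auto
   have "(LINT x|lebesgue. indicator K x * energy_density a x) <= (LINT x|lebesgue. indicator Om x *R ((norm (v x))^2 + (norm (J x))^2))"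
   proof (rule integral_mono_AE')
    show "integrable lebesgue (%x. indicator Om x *R ((norm (v x))^2 + (norm (J x))^2))"
     using iv so integrable_restrict_space[of Om lebesgue "%x. (norm (v x))^2 + (norm (J x))^2"] by simp
    show "AE x in lebesgue. indicator K x * energy_density a x <= indicator Om x *R ((norm (v x))^2 + (norm (J x))^2)"
     using en KOm by (intro AE_I2) (auto simp: indicator_def)
   qed simp
   also have "... = (LINT x|leb Om. (norm (v x))^2 + (norm (J x))^2)"
    using so integral_restrict_space[of Om lebesgue "%x. (norm (v x))^2 + (norm (J x))^2"] by simp
   also have "... <= (LINT x|leb Om. (2 * (norm (v x - w x))^2 + 2 * (norm (w x))^2) + (2 * (norm (J x - wjac Om w x))^2 + 2 * (norm (wjac Om w x))^2))"
   proof (rule integral_mono[OF iv])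
    show "integrable (leb Om) (%x. (2 * (norm (v x - w x))^2 + 2 * (norm (w x))^2) + (2 * (norm (J x - wjac Om w x))^2 + 2 * (norm (wjac Om w x))^2))"
     using I by (intro Bochner_Integration.integrable_add integrable_mult_right) auto
    show "(norm (v x))^2 + (norm (J x))^2 <= (2 * (norm (v x - w x))^2 + 2 * (norm (w x))^2) + (2 * (norm (J x - wjac Om w x))^2 + 2 * (norm (wjac Om w x))^2)" for x
     using norm_add_squared_le[of "v x - w x" "w x"] norm_add_squared_le[of "J x - wjac Om w x" "wjac Om w x"] by simp
   qed
   also have "... = 2 * (W12_norm Om (%x. v x - w x))^2 + 2 * ?W" unfolding Nd W(4) using I by simp
   also have "... <= 2 * e + 2 * ?W" using Ne by simp
   finally have E: "C * (LINT x|lebesgue. indicator K x * energy_density a x) <= C * (2 * e + 2 * ?W)" using C(1) by (intro mult_left_mono) auto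
   have "(LINT x|leb Om. ?q w x) <= (LINT x|leb Om. 2 * ?q v x + 2 * ((norm (v x - w x))^2 / \<kappa>^2))"
   proof (rule integral_mono[OF qi])
    show "integrable (leb Om) (%x. 2 * ?q v x + 2 * ((norm (v x - w x))^2 / \<kappa>^2))"
     using qv1(1) I by (intro Bochner_Integration.integrable_add integrable_mult_right) (auto simp: qv)
    fix x
    have "?q w x <= 2 * ?q v x + 2 * ?q (%x. v x - w x) x"
    proof -
     have "w x <.> emb \<iota> (N x) = v x <.> emb \<iota> (N x) + - ((v x - w x) <.> emb \<iota> (N x))" by (simp add: inner_diff_left)
     hence "(w x <.> emb \<iota> (N x))^2 <= 2 * (v x <.> emb \<iota> (N x))^2 + 2 * ((v x - w x) <.> emb \<iota> (N x))^2"
      using norm_add_squared_le[of "v x <.> emb \<iota> (N x)" "- ((v x - w x) <.> emb \<iota> (N x))"] by simp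
     hence "(w x <.> emb \<iota> (N x))^2 / (D x + \<kappa>)^2 <= (2 * (v x <.> emb \<iota> (N x))^2 + 2 * ((v x - w x) <.> emb \<iota> (N x))^2) / (D x + \<kappa>)^2"
      by (rule divide_right_mono) simp
     thus ?thesis by (simp add: indicator_def add_divide_distrib)
    qed
    thus "?q w x <= 2 * ?q v x + 2 * ((norm (v x - w x))^2 / \<kappa>^2)" using qb[where w="%x. v x - w x" and x=x] by linarith
   qed
   also have "... = 2 * (LINT x|leb Om. ?q v x) + 2 * ((LINT x|leb Om. (norm (v x - w x))^2) / \<kappa>^2)"
   proof -
    have A: "integrable (leb Om) (%x. 2 * ?q v x)" by (intro integrable_mult_right qv1(1))
    have B: "integrable (leb Om) (%x. 2 * ((norm (v x - w x))^2 / \<kappa>^2))" using I by (intro integrable_mult_right) auto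
    show ?thesis by (simp only: Bochner_Integration.integral_add[OF A B] integral_mult_right_zero integral_divide_zero)
   qed
   also have "... <= 2 * (C * (2 * e + 2 * ?W) + C * e / \<kappa>) + 2 * (e / \<kappa>^2)"
   proof (intro add_mono mult_left_mono divide_right_mono)
    show "(LINT x|leb Om. ?q v x) <= C * (2 * e + 2 * ?W) + C * e / \<kappa>" using qv1(2) Ha(2)[folded qv] E by linarith
    have "0 <= (LINT x|leb Om. (norm (J x - wjac Om w x))^2)" by simp
    thus "(LINT x|leb Om. (norm (v x - w x))^2) <= e" using Nd Ne by linarith
   qed auto
   also have "... = (4 * C) * ?W + e * (4 * C + 2 * C / \<kappa> + 2 / \<kappa>^2)" by (simp add: algebra_simps)
   finally show ?thesis .
  qed
  moreover have "0 <= 4 * C + 2 * C / \<kappa> + 2 / \<kappa>^2" using C(1) \<kappa> by (intro add_nonneg_nonneg) simp_all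
  ultimately show "(LINT x|leb Om. ?q w x) <= (4 * C) * ?W" by (rule le_of_le_add_all_small)
 qed
 have "0 < 4 * C" using C(1) by simp
 thus ?thesis
  by - (rule exI[of _ "4 * C"], rule conjI, assumption, intro allI impI, rule main, assumption+)
qed

end

section \<open>The field across the layer\<close>

context transition_layer
begin

lemma layer_field:
 fixes \<iota> :: "'d => 3"
 assumes w: "w : W12 Om" and gl: "!!j. gradient_limit (C_on (Suc 0) Om) Om (%x. w x $ j) (%x. wjac Om w x $ j)"
  and n1: "AE x\<in>Om in lebesgue. norm (w x) = 1"
 defines "u == (%x. s x *R w x)"
 shows "u : W12_0 Om" "u : L_infty Om"
  "AE x\<in>Om in lebesgue. (norm (wjac Om u x))^2 = (s x)^2 * (norm (wjac Om w x))^2 + (slope x)^2"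
  "AE x\<in>Om in lebesgue. (wdiv \<iota> Om u x)^2 <= 2 * ((real CARD('d))^2 * (norm (wjac Om w x))^2) + 2 * (w x <.> emb \<iota> (gs x))^2"
  "AE x\<in>Om in lebesgue. psi g u x = integral {0..s x} g & wgrad Om (psi g u) x = g (s x) *R gs x"
proof -
 let ?J = "wjac Om w"
 define G :: "real^'d => real^'d^3" where "G x = (\<chi> j. s x *R ?J x $ j + w x $ j *R gs x)" for x
 obtain L where L: "!!x. slope x <= L" using slope_bounded by blast
 obtain Ls where "Ls-lipschitz_on UNIV s" using s_lipschitz by blast
 hence ll: "locally_lipschitz_on UNIV s" by (rule lipschitz_imp_locally_lipschitz)
 have "gradient_limit (test_function Om) Om (%x. s x * w x $ j) (%x. s x *R ?J x $ j + w x $ j *R gs x)" for j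
 proof (rule gradient_limit_times_lipschitz[OF cut Om(1,2) gl ll _ measurable_gs _ support AE_gradient_s])
  show "\<bar>s x\<bar> <= 1" for x using s01[of x] by simp
  show "norm (gs x) <= L" for x using L by (simp add: norm_gs)
 qed
 hence glu: "gradient_limit (test_function Om) Om (%x. u x $ j) (%x. G x $ j)" for j by (simp add: u_def G_def)
 note U = W12_0_criterion[OF cut Om(1,2) glu]
 show "u : W12_0 Om" by (rule U(2))
 show "u : L_infty Om"
 proof -
  have "set_borel_measurable lebesgue Om u" using U(2) by (simp add: W12_0_def W12_def square_integrable_def)
  moreover have "AE x\<in>Om in lebesgue. norm (u x) <= 1" using n1
   by eventually_elim (use s01 in \<open>simp add: u_def\<close>)
  ultimately show ?thesis by (auto simp: L_infty_def)
 qed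
 have orth: "AE x\<in>Om in lebesgue. (\<Sum>j\<in>UNIV. w x $ j *R ?J x $ j) = 0"
 proof -
  have q: "weak_grad Om (%x. w x $ j * w x $ j) (%x. 2 *R w x $ j *R ?J x $ j)" for j
   by (rule weak_grad_of_gradient_limit(2)[OF Om(1,2) gl])
  have "weak_grad Om (%x. 1 * (1 * (w x $ 1 * w x $ 1) + 1 * (w x $ 2 * w x $ 2)) + 1 * (w x $ 3 * w x $ 3))
   (%x. 1 *R (1 *R (2 *R w x $ 1 *R ?J x $ 1) + 1 *R (2 *R w x $ 2 *R ?J x $ 2)) + 1 *R (2 *R w x $ 3 *R ?J x $ 3))"
   by (intro weak_grad_lincomb Om(1) q)
  moreover have "AE x\<in>Om in lebesgue. 1 * (1 * (w x $ 1 * w x $ 1) + 1 * (w x $ 2 * w x $ 2)) + 1 * (w x $ 3 * w x $ 3) = 1"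
   using n1
  proof eventually_elim
   case (elim x)
   have "(norm (w x))^2 = 1 * (1 * (w x $ 1 * w x $ 1) + 1 * (w x $ 2 * w x $ 2)) + 1 * (w x $ 3 * w x $ 3)"
    unfolding norm_vec_squared sum_3 by (simp add: power2_eq_square)
   thus ?case using elim by auto
  qed
  ultimately have 1: "weak_grad Om (%x. 1) (%x. 1 *R (1 *R (2 *R w x $ 1 *R ?J x $ 1) + 1 *R (2 *R w x $ 2 *R ?J x $ 2)) + 1 *R (2 *R w x $ 3 *R ?J x $ 3))"
   by (rule weak_grad_cong_AE[OF Om(1)]) simp
  have "weak_grad Om (%x. 1) (%x. 0)"
   by (rule weak_grad_of_locally_lipschitz[OF Om(1) lipschitz_imp_locally_lipschitz[of 0]]) (auto simp: lipschitz_on_def)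
  from weak_grad_unique[OF cut Om(1) 1 this] show ?thesis
  proof eventually_elim
   case (elim x)
   have "2 *R (\<Sum>j\<in>UNIV. w x $ j *R ?J x $ j) = 1 *R (1 *R (2 *R w x $ 1 *R ?J x $ 1) + 1 *R (2 *R w x $ 2 *R ?J x $ 2)) + 1 *R (2 *R w x $ 3 *R ?J x $ 3)"
    unfolding sum_3 by (simp add: scaleR_add_right)
   thus ?case using elim by auto
  qed
 qed
 show "AE x\<in>Om in lebesgue. (norm (wjac Om u x))^2 = (s x)^2 * (norm (?J x))^2 + (slope x)^2"
  using U(1) n1 orth
 proof eventually_elim
  case (elim x)
  show ?case
  proof
   assume x: "x : Om"
   have "(norm (G x $ j))^2 = (s x)^2 * (norm (?J x $ j))^2 + 2 * s x * ((w x $ j *R ?J x $ j) <.> gs x) + (norm (w x $ j))^2 * (norm (gs x))^2" for j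
    unfolding power2_norm_eq_inner by (simp add: G_def inner_add_left inner_add_right inner_commute power2_eq_square algebra_simps)
   hence "(norm (G x))^2 = (s x)^2 * (norm (?J x))^2 + 2 * s x * ((\<Sum>j\<in>UNIV. w x $ j *R ?J x $ j) <.> gs x) + (norm (w x))^2 * (norm (gs x))^2"
    unfolding norm_vec_squared[of "G x"] norm_vec_squared[of "?J x"] norm_vec_squared[of "w x"]
    by (simp add: sum.distrib sum_distrib_left sum_distrib_right inner_sum_left)
   thus "(norm (wjac Om u x))^2 = (s x)^2 * (norm (?J x))^2 + (slope x)^2" using elim x by (simp add: norm_gs)
  qed
 qed
 show "AE x\<in>Om in lebesgue. (wdiv \<iota> Om u x)^2 <= 2 * ((real CARD('d))^2 * (norm (?J x))^2) + 2 * (w x <.> emb \<iota> (gs x))^2"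
  using U(1)
 proof eventually_elim
  case (elim x)
  show ?case
  proof
   assume x: "x : Om"
   let ?d = "s x * wdiv \<iota> Om w x" and ?n = "w x <.> emb \<iota> (gs x)"
   have "wdiv \<iota> Om u x = (\<Sum>i\<in>UNIV. s x * ?J x $ \<iota> i $ i + w x $ \<iota> i * gs x $ i)" using elim x by (simp add: wdiv_def G_def)
   also have "... = ?d + ?n" unfolding inner_emb by (simp add: wdiv_def sum.distrib sum_distrib_left restrict_coords_def inner_vec_def)
   finally have 1: "(wdiv \<iota> Om u x)^2 <= 2 * ?d^2 + 2 * ?n^2" using norm_add_squared_le[of ?d ?n] by simp
   have "\<bar>wdiv \<iota> Om w x\<bar> <= (\<Sum>i\<in>(UNIV::'d set). norm (?J x))"
    unfolding wdiv_def
   proof (rule order_trans[OF sum_abs sum_mono])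
    fix i
    have "\<bar>?J x $ \<iota> i $ i\<bar> <= norm (?J x $ \<iota> i)" using Finite_Cartesian_Product.norm_nth_le[of "?J x $ \<iota> i" i] by simp
    also have "... <= norm (?J x)" by (rule Finite_Cartesian_Product.norm_nth_le)
    finally show "\<bar>?J x $ \<iota> i $ i\<bar> <= norm (?J x)" .
   qed
   hence "\<bar>?d\<bar> <= 1 * (real CARD('d) * norm (?J x))" unfolding abs_mult using s01[of x] by (intro mult_mono) auto
   hence "?d^2 <= (real CARD('d))^2 * (norm (?J x))^2" unfolding power_mult_distrib[symmetric] by (intro square_le_of_abs_le) simp
   thus "(wdiv \<iota> Om u x)^2 <= 2 * ((real CARD('d))^2 * (norm (?J x))^2) + 2 * ?n^2" using 1 by linarith
  qed
 qed
 have ps: "AE x\<in>Om in lebesgue. psi g u x = integral {0..s x} g"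
  using n1 by eventually_elim (use s01 in \<open>simp add: psi_def u_def\<close>)
 hence ps': "AE x\<in>Om in lebesgue. integral {0..s x} g = psi g u x" by eventually_elim simp
 have "weak_grad Om (psi g u) (%x. g (s x) *R gs x)" by (rule weak_grad_cong_AE[OF Om(1) weak_grad_psi ps']) simp
 from wgrad_eq_AE[OF cut Om(1) this] ps
 show "AE x\<in>Om in lebesgue. psi g u x = integral {0..s x} g & wgrad Om (psi g u) x = g (s x) *R gs x"
  by eventually_elim simp
qed

lemma tilt_excess:
 assumes \<delta>: "0 < \<delta>" "2 * r <= \<delta>"
 shows "\<epsilon> / 2 * (slope x)^2 + 1 / \<epsilon> * ((g (s x))^2 / 2) - \<phi> (sd x / \<delta>) * (g (s x) * slope x) <= \<epsilon> * (1 / (2 * r^2) + 4 / \<delta>^2)"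
proof (rule layer_cases[of x])
 assume A: "slope x = (g (s x) + \<epsilon> / r) / \<epsilon>" "D x <= r"
 let ?y = "slope x" and ?z = "sd x / \<delta>"
 have g: "g (s x) = \<epsilon> * (?y - 1 / r)" using A(1) \<epsilon> r by (simp add: field_simps)
 have "\<epsilon> / 2 * y^2 + 1 / \<epsilon> * ((\<epsilon> * (y - c))^2 / 2) - (\<epsilon> * (y - c)) * y = \<epsilon> / 2 * c^2" for y c :: real
  using \<epsilon> by (simp add: power2_eq_square field_simps)
 from this[of ?y "1 / r"] have 1: "\<epsilon> / 2 * ?y^2 + 1 / \<epsilon> * ((g (s x))^2 / 2) - g (s x) * ?y = \<epsilon> * (1 / (2 * r^2))"
  unfolding g[symmetric] by (simp add: power_divide)
 have "\<bar>?z\<bar> <= 1 / 2" using A(2) \<delta> abs_sd[of x] by (simp add: field_simps)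
 hence "1 - 4 * ?z^2 <= \<phi> ?z" using cut unfolding cutoff_def by blast
 hence "(1 - \<phi> ?z) * (g (s x) * ?y) <= (4 * ?z^2) * (g (s x) * ?y)"
  using slope_nonneg dwf(2)[OF s01(1)[of x]] by (intro mult_right_mono) auto
 also have "... = 4 / \<delta>^2 * ((\<bar>sd x\<bar> * g (s x)) * (\<bar>sd x\<bar> * ?y))" by (simp add: power_divide power2_eq_square mult_ac)
 also have "... <= 4 / \<delta>^2 * (\<epsilon> * 1)"
  using sd_slope_le[of x] slope_nonneg \<epsilon> by (intro mult_left_mono mult_mono) auto
 finally show ?thesis using 1 by (simp add: algebra_simps)
next
 assume "slope x = 0" "g (s x) = 0"
 thus ?thesis using \<epsilon> by simp
qed

lemma eta_abs_le: "0 < \<delta> ==> \<bar>eta \<delta> z\<bar> <= \<bar>z\<bar>" by (auto simp: eta_def)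

lemma volume_excess:
 assumes \<delta>: "0 < \<delta>" and x: "x : Om" "x ~: S"
 shows "(sigma g * chi Om W x - sigma g + 2 * max (- (integral {0..s x} g - sigma g)) 0) * eta \<delta> (sd x) <= 2 * \<epsilon>"
  "integral {0..s x} g - sigma g <= 0"
proof -
 let ?A = "integral {0..s x} g" and ?B = "integral {s x..1} g"
 have gi: "g integrable_on {0..1}" by (intro integrable_continuous_real continuous_on_subset[OF dwf(1)]) auto
 have sum: "?A + ?B = sigma g" unfolding sigma_def by (rule Henstock_Kurzweil_Integration.integral_combine[OF s01 gi])
 have "0 <= integral {c..d} g" if "0 <= c" for c d
 proof (rule Henstock_Kurzweil_Integration.integral_nonneg)
  have "{c..d} <= {0..}" using that by auto
  thus "g integrable_on {c..d}" by (rule integrable_continuous_real[OF continuous_on_subset[OF dwf(1)]])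
  show "0 <= g t" if "t : {c..d}" for t using that \<open>0 <= c\<close> by (intro dwf(2)) simp
 qed
 hence nn: "0 <= ?A" "0 <= ?B" using s01[of x] by simp_all
 thus "?A - sigma g <= 0" using sum by linarith
 have m: "max (- (?A - sigma g)) 0 = ?B" using sum nn by simp
 have tail: "sd x <= 0 ==> ?A <= g (s x)" "0 <= sd x ==> ?B <= g (s x)" using prof by (auto simp: profile_def s_def)
 have key: "2 * (q * \<bar>sd x\<bar>) <= 2 * \<epsilon>" if "q <= g (s x)" for q
  using mult_right_mono[OF that, of "\<bar>sd x\<bar>"] sd_slope_le(2)[of x] by (simp add: mult.commute)
 show "(sigma g * chi Om W x - sigma g + 2 * max (- (?A - sigma g)) 0) * eta \<delta> (sd x) <= 2 * \<epsilon>"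
 proof (cases "x : W")
  case True
  hence c: "chi Om W x = 1" using closure_subset[of W] by (auto simp: chi_def indicator_def)
  have "0 <= sd x" using True S_basic(6)[of x] by (simp add: sdist_def)
  have "?B * eta \<delta> (sd x) <= ?B * \<bar>sd x\<bar>" using eta_abs_le[OF \<delta>, of "sd x"] nn by (intro mult_left_mono) auto
  thus ?thesis unfolding m c using key[OF tail(2)[OF \<open>0 <= sd x\<close>]] by simp
 next
  case False
  hence "x ~: closure W" using W_basic(5) x by blast
  hence c: "chi Om W x = - 1" using False x by (simp add: chi_def)
  have "sd x <= 0" using False S_basic(6)[of x] by (simp add: sdist_def)
  have "?A * - eta \<delta> (sd x) <= ?A * \<bar>sd x\<bar>" using eta_abs_le[OF \<delta>, of "sd x"] nn by (intro mult_left_mono) auto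
  hence le: "2 * (?A * - eta \<delta> (sd x)) <= 2 * \<epsilon>" using key[OF tail(1)[OF \<open>sd x <= 0\<close>]] by linarith
  have "sigma g * - 1 - sigma g + 2 * ?B = - 2 * ?A" using sum by linarith
  hence "(sigma g * - 1 - sigma g + 2 * ?B) * eta \<delta> (sd x) = 2 * (?A * - eta \<delta> (sd x))" by simp
  thus ?thesis unfolding m c using le by linarith
 qed
qed

lemma slope_squared_le:
 assumes M: "!!t. 0 <= t ==> t <= 1 ==> g t <= M" "M > 0" and q: "0 <= q"
 shows "(slope x)^2 * q <= (1 + M + 1 / r)^2 * (indicator core x * (q / (D x + \<epsilon>)^2))"
proof (rule layer_cases[of x])
 assume "D x <= r"
 hence c: "x : core" using r by (simp add: core_def)
 have p: "0 < D x + \<epsilon>" using S_basic(6)[of x] \<epsilon> by simp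
 have "((D x + \<epsilon>) * slope x)^2 <= (1 + M + 1 / r)^2" using slope_decay[OF M] slope_nonneg p by (intro power_mono) auto
 hence "(slope x)^2 <= (1 + M + 1 / r)^2 / (D x + \<epsilon>)^2" using p by (simp add: power_mult_distrib pos_le_divide_eq mult.commute)
 from mult_right_mono[OF this q] show ?thesis using c by simp
qed (use q in \<open>simp add: indicator_def\<close>)

end

context transition_layer
begin

lemma layer_energy:
 fixes \<iota> :: "'d => 3"
 assumes w: "w : W12 Om" and gl: "!!j. gradient_limit (C_on (Suc 0) Om) Om (%x. w x $ j) (%x. wjac Om w x $ j)"
  and n1: "AE x\<in>Om in lebesgue. norm (w x) = 1"
  and M: "!!t. 0 <= t ==> t <= 1 ==> g t <= M" "M > 0" and \<mu>: "0 < \<mu>" and \<delta>: "0 < \<delta>" "2 * r <= \<delta>"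
  and hq: "integrable (leb Om) (%x. indicator core x * ((w x <.> emb \<iota> (N x))^2 / (D x + \<epsilon>)^2))"
   "(LINT x|leb Om. indicator core x * ((w x <.> emb \<iota> (N x))^2 / (D x + \<epsilon>)^2)) <= Ch * (W12_norm Om w)^2"
  and lk: "integrable lebesgue (%x. indicator core x * (\<epsilon> / (D x + \<epsilon>)^2))"
   "(LINT x|lebesgue. indicator core x * (\<epsilon> / (D x + \<epsilon>)^2)) <= Cl"
 defines "u == (%x. s x *R w x)" and "c == (real CARD('d))^2" and "m == (1 + M + 1 / r)^2" and "vol == (LINT x|leb Om. 1)"
 shows "A_energy \<iota> Om \<mu> f \<epsilon> u <= (\<mu> * (c + m * Ch) + 1 / 2) * (W12_norm Om w)^2 + m * Cl"
  "E_energy \<iota> Om \<mu> f g \<phi> \<delta> S W \<epsilon> u + B_energy Om g \<delta> S W u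
    <= ((\<mu> * (c + m * Ch) + 1 / 2) * (W12_norm Om w)^2 + (1 / (2 * r^2) + 4 / \<delta>^2 + 2) * vol) * \<epsilon>"
proof -
 have so: "Om : sets lebesgue" by (rule open_in_sets_lebesgue[OF Om(1)])
 note U = layer_field[OF w gl n1, folded u_def] and Wf = W12_facts[OF Om(1) w]
 let ?J = "%x. (norm (wjac Om w x))^2"
 let ?q = "%x. indicator core x * ((w x <.> emb \<iota> (N x))^2 / (D x + \<epsilon>)^2)"
 let ?k = "%x. indicator core x * (\<epsilon> / (D x + \<epsilon>)^2)"
 let ?W = "(W12_norm Om w)^2"
 have AEon: "(AE x in leb Om. Q x) \<longleftrightarrow> (AE x\<in>Om in lebesgue. Q x)" for Q by (rule AE_lebesgue_on[OF so])
 have iJ: "integrable (leb Om) ?J" using Wf(3) by (simp add: square_integrable_iff[OF Om(1)])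
 have "0 <= (LINT x|leb Om. (norm (w x))^2)" by simp
 hence JW: "(LINT x|leb Om. ?J x) <= ?W" unfolding Wf(4) by linarith
 have k0: "0 <= ?k x" and q0: "0 <= ?q x" for x using \<epsilon> by (simp_all add: indicator_def)
 note ik = integral_lebesgue_on_le_lebesgue[OF Om(1) lk(1) k0]
 have kC: "(LINT x|leb Om. ?k x) <= Cl" using ik(2) lk(2) by linarith
 have m0: "0 <= m" and c0: "0 <= c" by (simp_all add: m_def c_def)
 have X0: "0 <= c * ?J x + m * ?q x" for x
  by (rule add_nonneg_nonneg[OF mult_nonneg_nonneg[OF c0 zero_le_power2] mult_nonneg_nonneg[OF m0 q0]])
 have sl: "(slope x)^2 * t <= m * (indicator core x * (t / (D x + \<epsilon>)^2))" if "0 <= t" for x t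
  unfolding m_def by (rule slope_squared_le[OF M that])
 have slk: "\<epsilon> * (slope x)^2 <= m * ?k x" for x using sl[of \<epsilon> x] \<epsilon> by (simp add: mult.commute)
 have div: "AE x\<in>Om in lebesgue. \<epsilon> / 2 * \<mu> * (wdiv \<iota> Om u x)^2 <= \<epsilon> * (\<mu> * (c * ?J x + m * ?q x))"
  using U(4)[where \<iota>=\<iota>] AE_notin_S
 proof eventually_elim
  case (elim x)
  have "(w x <.> emb \<iota> (gs x))^2 <= m * ?q x"
  proof (rule layer_cases[of x])
   assume "D x <= r"
   hence "x : V - S" using ab elim by (simp add: V_def)
   hence "w x <.> emb \<iota> (gs x) = slope x * side x * (w x <.> emb \<iota> (N x))" unfolding inner_emb by (simp add: gs_def grad_sd)
   hence "(w x <.> emb \<iota> (gs x))^2 = (slope x)^2 * (w x <.> emb \<iota> (N x))^2" by (simp add: power_mult_distrib side_def)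
   thus ?thesis using sl[of "(w x <.> emb \<iota> (N x))^2" x] by simp
  next
   assume "slope x = 0"
   hence "(w x <.> emb \<iota> (gs x))^2 = 0" unfolding inner_emb by (simp add: gs_def)
   thus ?thesis using mult_nonneg_nonneg[OF m0 q0[of x]] by linarith
  qed
  hence "2 * (c * ?J x) + 2 * (w x <.> emb \<iota> (gs x))^2 <= 2 * (c * ?J x + m * ?q x)"
   unfolding distrib_left by (intro add_left_mono mult_left_mono) auto
  hence "x : Om --> (wdiv \<iota> Om u x)^2 <= 2 * (c * ?J x + m * ?q x)" using elim(1)[folded c_def] by (blast intro: order_trans)
  hence "x : Om --> \<epsilon> / 2 * \<mu> * (wdiv \<iota> Om u x)^2 <= \<epsilon> / 2 * \<mu> * (2 * (c * ?J x + m * ?q x))"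
   using \<epsilon> \<mu> by (intro impI mult_left_mono) auto
  moreover have "\<epsilon> / 2 * \<mu> * (2 * t) = \<epsilon> * (\<mu> * t)" for t by simp
  ultimately show ?case by (simp only:)
 qed
 have idiv: "integrable (leb Om) (%x. c * ?J x + m * ?q x)" using iJ hq(1) by (intro Bochner_Integration.integrable_add integrable_mult_right)
 have Idiv: "(LINT x|leb Om. c * ?J x + m * ?q x) <= (c + m * Ch) * ?W"
 proof -
  have "(LINT x|leb Om. c * ?J x + m * ?q x) = c * (LINT x|leb Om. ?J x) + m * (LINT x|leb Om. ?q x)"
   by (simp only: Bochner_Integration.integral_add[OF integrable_mult_right[OF iJ] integrable_mult_right[OF hq(1)]] integral_mult_right_zero)
  also have "... <= c * ?W + m * (Ch * ?W)" using JW hq(2) m0 c0 by (intro add_mono mult_left_mono)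
  finally show ?thesis by (simp add: algebra_simps)
 qed
 have fu: "AE x\<in>Om in lebesgue. f (norm (u x)) = (g (s x))^2 / 2"
  using n1 by eventually_elim (use s01 dwf(3) in \<open>simp add: u_def\<close>)
 have s2: "(s x)^2 * ?J x <= ?J x" for x using s01[of x] power_mono[of "s x" 1 2] by (intro mult_left_le_one_le) auto
 let ?dens = "%x. \<epsilon> / 2 * (norm (wjac Om u x))^2 + 1 / \<epsilon> * f (norm (u x))"
 have dens: "AE x\<in>Om in lebesgue. ?dens x <= \<epsilon> / 2 * ?J x + (\<epsilon> / 2 * (slope x)^2 + 1 / \<epsilon> * ((g (s x))^2 / 2))"
  using U(3) fu
 proof eventually_elim
  case (elim x)
  have "\<epsilon> / 2 * ((s x)^2 * ?J x) <= \<epsilon> / 2 * ?J x" using s2 \<epsilon> by (intro mult_left_mono) auto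
  hence "\<epsilon> / 2 * ((s x)^2 * ?J x + (slope x)^2) + 1 / \<epsilon> * ((g (s x))^2 / 2) <= \<epsilon> / 2 * ?J x + (\<epsilon> / 2 * (slope x)^2 + 1 / \<epsilon> * ((g (s x))^2 / 2))"
   unfolding distrib_left[of "\<epsilon> / 2"] add.assoc by (rule add_right_mono)
  thus ?case using elim by (auto simp only:)
 qed
 have pot: "1 / \<epsilon> * ((g (s x))^2 / 2) <= \<epsilon> / 2 * (slope x)^2" for x
 proof -
  have "(g (s x))^2 <= (\<epsilon> * slope x)^2" using sd_slope_le(3)[of x] dwf(2)[OF s01(1)[of x]] by (intro power_mono) auto
  hence "1 / \<epsilon> * ((g (s x))^2 / 2) <= 1 / \<epsilon> * ((\<epsilon> * slope x)^2 / 2)" using \<epsilon> by (intro mult_left_mono) auto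
  also have "... = \<epsilon> / 2 * (slope x)^2" using \<epsilon> by (simp add: power2_eq_square)
  finally show ?thesis .
 qed
 show "A_energy \<iota> Om \<mu> f \<epsilon> u <= (\<mu> * (c + m * Ch) + 1 / 2) * ?W + m * Cl"
 proof -
  let ?X = "%x. \<mu> * (c * ?J x + m * ?q x) + (1 / 2 * ?J x + m * ?k x)"
  have i2: "integrable (leb Om) (%x. 1 / 2 * ?J x + m * ?k x)" using iJ ik(1) by (intro Bochner_Integration.integrable_add integrable_mult_right)
  have "A_energy \<iota> Om \<mu> f \<epsilon> u = (LINT x|leb Om. \<epsilon> / 2 * \<mu> * (wdiv \<iota> Om u x)^2 + \<epsilon> / 2 * (norm (wjac Om u x))^2 + 1 / \<epsilon> * f (norm (u x)))"
   unfolding A_energy_def by (rule set_lebesgue_on(2)[OF so])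
  also have "... <= (LINT x|leb Om. ?X x)"
  proof (rule integral_mono_AE')
   show "integrable (leb Om) ?X" by (rule Bochner_Integration.integrable_add[OF integrable_mult_right[OF idiv] i2])
   show "AE x in leb Om. \<epsilon> / 2 * \<mu> * (wdiv \<iota> Om u x)^2 + \<epsilon> / 2 * (norm (wjac Om u x))^2 + 1 / \<epsilon> * f (norm (u x)) <= ?X x"
    unfolding AEon using div dens
   proof eventually_elim
    case (elim x)
    show ?case
    proof
     assume x: "x : Om"
     have n: "0 <= \<mu> * (c * ?J x + m * ?q x)" by (rule mult_nonneg_nonneg[OF less_imp_le[OF \<mu>] X0])
     have 1: "\<epsilon> * (\<mu> * (c * ?J x + m * ?q x)) <= 1 * (\<mu> * (c * ?J x + m * ?q x))" using \<epsilon> by (intro mult_right_mono[OF _ n]) simp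
     have 2: "\<epsilon> / 2 * ?J x <= 1 / 2 * ?J x" using \<epsilon> by (intro mult_right_mono) auto
     have "\<epsilon> / 2 * (slope x)^2 + \<epsilon> / 2 * (slope x)^2 = \<epsilon> * (slope x)^2" by simp
     hence 3: "\<epsilon> / 2 * (slope x)^2 + 1 / \<epsilon> * ((g (s x))^2 / 2) <= m * ?k x"
      using order_trans[OF add_left_mono[OF pot[of x], of "\<epsilon> / 2 * (slope x)^2"]] slk[of x] by simp
     have "\<epsilon> / 2 * \<mu> * (wdiv \<iota> Om u x)^2 + ?dens x <= 1 * (\<mu> * (c * ?J x + m * ?q x)) + (1 / 2 * ?J x + m * ?k x)"
      using order_trans[OF elim(1)[rule_format, OF x] 1] order_trans[OF elim(2)[rule_format, OF x] add_mono[OF 2 3]] by (rule add_mono)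
     thus "\<epsilon> / 2 * \<mu> * (wdiv \<iota> Om u x)^2 + \<epsilon> / 2 * (norm (wjac Om u x))^2 + 1 / \<epsilon> * f (norm (u x)) <= ?X x" by (simp only: mult_1 add.assoc)
    qed
   qed
   show "AE x in leb Om. 0 <= ?X x"
    by (rule AE_I2, rule add_nonneg_nonneg[OF mult_nonneg_nonneg[OF less_imp_le[OF \<mu>] X0] add_nonneg_nonneg[OF _ mult_nonneg_nonneg[OF m0 k0]]]) simp
  qed
  also have "... = \<mu> * (LINT x|leb Om. c * ?J x + m * ?q x) + (1 / 2 * (LINT x|leb Om. ?J x) + m * (LINT x|leb Om. ?k x))"
   by (simp only: Bochner_Integration.integral_add[OF integrable_mult_right[OF idiv] i2]
    Bochner_Integration.integral_add[OF integrable_mult_right[OF iJ] integrable_mult_right[OF ik(1)]] integral_mult_right_zero)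
  also have "... <= \<mu> * ((c + m * Ch) * ?W) + (1 / 2 * ?W + m * Cl)"
   using Idiv JW kC \<mu> m0 by (intro add_mono mult_left_mono) auto
  finally show ?thesis by (simp add: algebra_simps)
 qed
 let ?V = "1 / (2 * r^2) + 4 / \<delta>^2"
 have i1: "integrable (leb Om) (%x. b)" for b :: real by (rule integrable_const_bounded_open[OF Om(1,2)])
 have Iconst: "(LINT x|leb Om. b) = b * vol" for b :: real
  unfolding vol_def integral_mult_right_zero[symmetric] by simp
 have E: "E_energy \<iota> Om \<mu> f g \<phi> \<delta> S W \<epsilon> u <= \<epsilon> * (\<mu> * ((c + m * Ch) * ?W)) + \<epsilon> * (1 / 2 * ?W + ?V * vol)"
  unfolding E_energy_def set_lebesgue_on(2)[OF so]
 proof (rule add_mono)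
  have "(LINT x|leb Om. \<epsilon> / 2 * \<mu> * (wdiv \<iota> Om u x)^2) <= (LINT x|leb Om. \<epsilon> * (\<mu> * (c * ?J x + m * ?q x)))"
  proof (rule integral_mono_AE')
   show "integrable (leb Om) (%x. \<epsilon> * (\<mu> * (c * ?J x + m * ?q x)))" by (intro integrable_mult_right idiv)
   show "AE x in leb Om. 0 <= \<epsilon> * (\<mu> * (c * ?J x + m * ?q x))"
    by (rule AE_I2, rule mult_nonneg_nonneg[OF less_imp_le[OF \<epsilon>(1)] mult_nonneg_nonneg[OF less_imp_le[OF \<mu>] X0]])
  qed (use div in \<open>simp add: AEon\<close>)
  also have "... = \<epsilon> * (\<mu> * (LINT x|leb Om. c * ?J x + m * ?q x))" by (simp only: integral_mult_right_zero)
  also have "... <= \<epsilon> * (\<mu> * ((c + m * Ch) * ?W))" using Idiv \<mu> \<epsilon> by (intro mult_left_mono) auto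
  finally show "(LINT x|leb Om. \<epsilon> / 2 * \<mu> * (wdiv \<iota> Om u x)^2) <= \<epsilon> * (\<mu> * ((c + m * Ch) * ?W))" .
  let ?T = "%x. \<epsilon> / 2 * (norm (wjac Om u x))^2 + 1 / \<epsilon> * f (norm (u x)) - xi \<phi> \<delta> S W x <.> wgrad Om (psi g u) x"
  have "(LINT x|leb Om. ?T x) <= (LINT x|leb Om. \<epsilon> * (1 / 2 * ?J x + ?V))"
  proof (rule integral_mono_AE')
   show "integrable (leb Om) (%x. \<epsilon> * (1 / 2 * ?J x + ?V))" by (intro integrable_mult_right Bochner_Integration.integrable_add iJ i1)
   show "AE x in leb Om. 0 <= \<epsilon> * (1 / 2 * ?J x + ?V)" using \<epsilon> by (intro AE_I2 mult_nonneg_nonneg add_nonneg_nonneg) auto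
   show "AE x in leb Om. ?T x <= \<epsilon> * (1 / 2 * ?J x + ?V)"
    unfolding AEon using dens U(5)
   proof eventually_elim
    case (elim x)
    show ?case
    proof
     assume x: "x : Om"
     have "grad sd x <.> gs x = slope x"
     proof (rule layer_cases[of x])
      assume "D x <= r"
      hence "x : V" using ab by (simp add: V_def)
      from norm_grad_sd_le[OF this] show ?thesis by (simp add: gs_def norm_eq_1)
     qed (simp add: gs_def)
     hence "xi \<phi> \<delta> S W x <.> wgrad Om (psi g u) x = \<phi> (sd x / \<delta>) * (g (s x) * slope x)" using elim(2) x by (simp add: xi_def)
     moreover have "\<epsilon> * (1 / 2 * ?J x + ?V) = \<epsilon> / 2 * ?J x + \<epsilon> * ?V" by (simp add: distrib_left)
     ultimately show "?T x <= \<epsilon> * (1 / 2 * ?J x + ?V)" using elim(1)[rule_format, OF x] tilt_excess[OF \<delta>, of x] by linarith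
    qed
   qed
  qed
  also have "... = \<epsilon> * (1 / 2 * (LINT x|leb Om. ?J x) + ?V * vol)"
   by (simp only: integral_mult_right_zero Bochner_Integration.integral_add[OF integrable_mult_right[OF iJ] i1] Iconst)
  also have "... <= \<epsilon> * (1 / 2 * ?W + ?V * vol)" using JW \<epsilon> by (intro mult_left_mono add_right_mono) auto
  finally show "(LINT x|leb Om. ?T x) <= \<epsilon> * (1 / 2 * ?W + ?V * vol)" .
 qed
 have B: "B_energy Om g \<delta> S W u <= 2 * \<epsilon> * vol + 0"
  unfolding B_energy_def set_lebesgue_on(2)[OF so]
 proof (rule add_mono)
  let ?T = "%x. (sigma g * chi Om W x - sigma g + 2 * max (- (psi g u x - sigma g)) 0) * eta \<delta> (sd x)"
  have "(LINT x|leb Om. ?T x) <= (LINT x|leb Om. 2 * \<epsilon>)"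
  proof (rule integral_mono_AE'[OF i1])
   show "AE x in leb Om. ?T x <= 2 * \<epsilon>"
    unfolding AEon using U(5) AE_notin_S by eventually_elim (use volume_excess(1)[OF \<delta>(1)] in simp)
  qed (use \<epsilon> in simp)
  thus "(LINT x|leb Om. ?T x) <= 2 * \<epsilon> * vol" by (simp only: Iconst)
  have "(LINT x|leb Om. max (psi g u x - sigma g) 0 * \<bar>eta \<delta> (sd x)\<bar>) <= (LINT x|leb Om. 0)"
  proof (rule integral_mono_AE')
   show "AE x in leb Om. max (psi g u x - sigma g) 0 * \<bar>eta \<delta> (sd x)\<bar> <= 0"
    unfolding AEon using U(5) AE_notin_S by eventually_elim (use volume_excess(2)[OF \<delta>(1)] in simp)
  qed simp_all
  thus "(LINT x|leb Om. max (psi g u x - sigma g) 0 * \<bar>eta \<delta> (sd x)\<bar>) <= 0" by simp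
 qed
 show "E_energy \<iota> Om \<mu> f g \<phi> \<delta> S W \<epsilon> u + B_energy Om g \<delta> S W u <= ((\<mu> * (c + m * Ch) + 1 / 2) * ?W + (?V + 2) * vol) * \<epsilon>"
  using add_mono[OF E B] by (simp add: algebra_simps)
qed

end

lemma trace_approximation:
 assumes "has_trace Om S (w :: real^'d => real^3) T" "e > 0"
 shows "EX v. smooth_on Om v & v : W12 Om & W12_norm Om (%x. v x - w x) < e &
  set_nn_integral (hausdorff_measure (CARD('d) - 1)) S (%y. ennreal ((norm (v y - T y))^2)) <= ennreal e"
proof -
 obtain v where v: "!!k. smooth_on Om (v k) & v k : W12 Om" "(%k. W12_norm Om (%x. v k x - w x)) \<longlonglongrightarrow> 0"
  "(%k. set_nn_integral (hausdorff_measure (CARD('d) - 1)) S (%y. ennreal ((norm (v k y - T y))^2))) \<longlonglongrightarrow> 0"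
  using assms(1) unfolding has_trace_def by blast
 have "\<forall>\<^sub>F k in sequentially. W12_norm Om (%x. v k x - w x) < e" by (rule order_tendstoD(2)[OF v(2) assms(2)])
 moreover have "\<forall>\<^sub>F k in sequentially. set_nn_integral (hausdorff_measure (CARD('d) - 1)) S (%y. ennreal ((norm (v k y - T y))^2)) < ennreal e"
  by (rule order_tendstoD(2)[OF v(3)]) (use assms(2) in simp)
 ultimately have "\<forall>\<^sub>F k in sequentially. W12_norm Om (%x. v k x - w x) < e &
  set_nn_integral (hausdorff_measure (CARD('d) - 1)) S (%y. ennreal ((norm (v k y - T y))^2)) < ennreal e"
  by (rule eventually_conj)
 then obtain k where "W12_norm Om (%x. v k x - w x) < e"
  "set_nn_integral (hausdorff_measure (CARD('d) - 1)) S (%y. ennreal ((norm (v k y - T y))^2)) < ennreal e"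
  using eventually_happens'[OF sequentially_bot] by blast
 thus ?thesis using v(1)[of k] by (intro exI[of _ "v k"]) simp
qed

lemma near_hypersurface_subset:
 fixes S :: "(real^'d) set"
 assumes S: "closed_hypersurface S" "S <= Om" and d: "\<rho> <= setdist S (frontier Om)" and x: "infdist x S < \<rho>"
 shows "x : Om"
proof (rule ccontr)
 assume nx: "x ~: Om"
 have "closed S" "S ~= {}" using S(1) by (auto simp: closed_hypersurface_def compact_imp_closed)
 then obtain y where y: "y : S" "infdist x S = dist x y" using infdist_attains_inf by blast
 have "closed_segment y x \<inter> frontier Om ~= {}"
  using nx y S(2) by (intro connected_Int_frontier connected_segment) auto
 then obtain z where z: "z : closed_segment y x" "z : frontier Om" by blast
 have "setdist S (frontier Om) <= dist y z" by (rule setdist_le_dist[OF y(1) z(2)])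
 also have "... <= dist y x" using dist_in_closed_segment[OF z(1)] by (simp add: dist_commute)
 finally show False using d x y(2) by (simp add: dist_commute)
qed

section \<open>Existence of well prepared initial fields\<close>

theorem proposition1p1:
  fixes \<iota> :: "'d::finite \<Rightarrow> 3"
    and \<Omega> I0 \<Omega>p :: "(real^'d) set"
    and \<mu> \<delta>0 :: real
    and f g \<phi> :: "real \<Rightarrow> real"
  assumes "inj \<iota>" and "range \<iota> = {1, 2} \<or> range \<iota> = UNIV"
    and "open \<Omega>" and "connected \<Omega>" and "bounded \<Omega>" and "\<Omega> \<noteq> {}" and "C3_boundary \<Omega>"
    and "\<mu> > 0"
    and "double_well f g"
    and "cutoff \<phi>"
    and "closed_hypersurface I0" and "I0 \<subseteq> \<Omega>"
    and "encloses I0 \<Omega>p" and "\<Omega>p \<subseteq> \<Omega>"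
    and "0 < \<delta>0" and "\<delta>0 < 1"
    and "smooth_nearest_point_on (tube \<Omega> I0 \<Omega>p (4 * \<delta>0)) I0"
    and "4 * \<delta>0 \<le> setdist I0 (frontier \<Omega>)"
  shows "\<exists>c1 :: real \<Rightarrow> real. (\<forall>K. c1 K > 0) \<and>
    (\<forall>u_in \<in> W12 \<Omega>.
       (AE x in lebesgue. x \<in> \<Omega> \<longrightarrow> norm (u_in x) = 1) \<and> tangential_on \<iota> \<Omega> I0 \<Omega>p u_in \<longrightarrow>
       (\<forall>\<epsilon>. 0 < \<epsilon> \<and> \<epsilon> < 1 \<longrightarrow>
          (\<exists>u \<in> W12_0 \<Omega> \<inter> L_infty \<Omega>.
             (AE x in lebesgue. x \<in> \<Omega>p - tube \<Omega> I0 \<Omega>p (2 * \<delta>0) \<longrightarrow> u x = u_in x) \<and>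
             (AE x in lebesgue. x \<in> (\<Omega> - closure \<Omega>p) - tube \<Omega> I0 \<Omega>p (2 * \<delta>0) \<longrightarrow> u x = 0) \<and>
             A_energy \<iota> \<Omega> \<mu> f \<epsilon> u \<le> c1 (W12_norm \<Omega> u_in) \<and>
             E_energy \<iota> \<Omega> \<mu> f g \<phi> \<delta>0 I0 \<Omega>p \<epsilon> u + B_energy \<Omega> g \<delta>0 I0 \<Omega>p u
               \<le> c1 (W12_norm \<Omega> u_in) * \<epsilon>)))"
proof -
 note A = assms
 have V\<Omega>: "{x. infdist x I0 < 4 * \<delta>0} <= \<Omega>" using near_hypersurface_subset[OF A(11,12,18)] by blast
 have abs_sdist: "\<bar>sdist I0 \<Omega>p x\<bar> = infdist x I0" for x by (simp add: sdist_def infdist_nonneg)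
 have tube: "tube \<Omega> I0 \<Omega>p (4 * \<delta>0) = {x. infdist x I0 < 4 * \<delta>0}" using V\<Omega> by (auto simp: tube_def abs_sdist)
 obtain P where P: "smooth_on {x. infdist x I0 < 4 * \<delta>0} P" "!!x. infdist x I0 < 4 * \<delta>0 ==> P x : I0 & dist x (P x) = infdist x I0"
  using A(17) unfolding tube smooth_nearest_point_on_def by blast
 interpret enclosed_tube I0 "4 * \<delta>0" P \<Omega>p
  by unfold_locales (use A(11,13,15) P in auto)
 have V: "V <= \<Omega>" using V\<Omega> by (simp add: V_def)
 have d2: "CARD('d) >= 2"
 proof -
  have "CARD('d) = card (range \<iota>)" using card_image[OF A(1)] by simp
  thus ?thesis using A(2) by auto
 qed
 obtain Ch where Ch: "Ch > 0" "!!w T \<kappa>. w : W12 \<Omega> ==> 0 < \<kappa> ==>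
   (AE y in hausdorff_measure (CARD('d) - 1). y : I0 --> T y <.> emb \<iota> (grad sd y) = 0) ==>
   (ALL e>0. EX v. smooth_on \<Omega> v & v : W12 \<Omega> & W12_norm \<Omega> (%x. v x - w x) < e &
    set_nn_integral (hausdorff_measure (CARD('d) - 1)) I0 (%y. ennreal ((norm (v y - T y))^2)) <= ennreal e) ==>
   integrable (leb \<Omega>) (%x. indicator core x * ((w x <.> emb \<iota> (N x))^2 / (D x + \<kappa>)^2)) &
   (LINT x|leb \<Omega>. indicator core x * ((w x <.> emb \<iota> (N x))^2 / (D x + \<kappa>)^2)) <= Ch * (W12_norm \<Omega> w)^2"
  using hardy_trace[OF A(10) d2 A(1,3) V] by blast
 obtain Cl where Cl: "Cl > 0" "!!\<kappa>. 0 < \<kappa> ==> integrable lebesgue (%x. indicator core x * (\<kappa> / (D x + \<kappa>)^2)) &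
   (LINT x|lebesgue. indicator core x * (\<kappa> / (D x + \<kappa>)^2)) <= Cl"
  using layer_kernel_bound[OF A(10)] by blast
 obtain M where M: "M > 0" "!!t. 0 <= t ==> t <= 1 ==> g t <= M" using double_well_bounded[OF A(9)] by blast
 define r where "r = \<delta>0 / 2"
 have rp: "0 < r" "2 * r <= 4 * \<delta>0 / 4" "2 * r <= \<delta>0" using A(15) by (auto simp: r_def)
 define m where "m = (1 + M + 1 / r)^2"
 define vol :: real where "vol = (LINT x|leb \<Omega>. 1)"
 define c where "c = \<mu> * ((real CARD('d))^2 + m * Ch) + 1 / 2"
 define c' where "c' = (1 / (2 * r^2) + 4 / \<delta>0^2 + 2) * vol"
 define c1 where "c1 K = 1 + c * K^2 + m * Cl + c'" for K
 have m0: "0 <= m * Cl" using Cl(1) by (simp add: m_def)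
 have c0: "0 <= c" unfolding c_def m_def using A(8) Ch(1) by simp
 have c'0: "0 <= c'" unfolding c'_def vol_def using rp A(15) by (intro mult_nonneg_nonneg add_nonneg_nonneg) auto
 show ?thesis
 proof (rule exI[of _ c1], rule conjI, rule allI, goal_cases)
  case (1 K)
  have "0 <= c * K^2" using c0 by simp
  thus ?case using m0 c'0 by (simp add: c1_def)
 next
  case 2
  show ?case
  proof (intro ballI impI allI)
   fix w :: "real^'d => real^3" and \<epsilon> :: real
   assume w: "w : W12 \<Omega>" and h: "(AE x in lebesgue. x : \<Omega> --> norm (w x) = 1) & tangential_on \<iota> \<Omega> I0 \<Omega>p w" and e: "0 < \<epsilon> & \<epsilon> < 1"
   obtain T where T: "has_trace \<Omega> I0 w T" "AE y in hausdorff_measure (CARD('d) - 1). y : I0 --> T y <.> emb \<iota> (grad sd y) = 0"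
    using h unfolding tangential_on_def by blast
   note app = trace_approximation[OF T(1)]
   obtain p a b where p: "profile g r \<epsilon> p a b" using profile_exists[OF A(9) rp(1), of \<epsilon>] e by blast
   interpret transition_layer I0 \<Omega>p "4 * \<delta>0" P \<Omega> f g \<phi> p r \<epsilon> a b
    by unfold_locales (use A p rp e V in auto)
   have gl: "gradient_limit (C_on (Suc 0) \<Omega>) \<Omega> (%x. w x $ j) (%x. wjac \<Omega> w x $ j)" for j
    by (rule gradient_limit_of_smooth_approximation[OF A(10,3) w]) (use app in blast)
   have e0: "0 < \<epsilon>" using e by blast
   have H: "integrable (leb \<Omega>) (%x. indicator core x * ((w x <.> emb \<iota> (N x))^2 / (D x + \<epsilon>)^2)) &
    (LINT x|leb \<Omega>. indicator core x * ((w x <.> emb \<iota> (N x))^2 / (D x + \<epsilon>)^2)) <= Ch * (W12_norm \<Omega> w)^2"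
    by (rule Ch(2)[OF w e0 T(2)]) (use app in blast)
   note F = layer_field[OF w gl conjunct1[OF h]]
   note EN0 = layer_energy[OF w gl conjunct1[OF h] M(2,1) A(8,15) rp(3) conjunct1[OF H] conjunct2[OF H] conjunct1[OF Cl(2)[OF e0]] conjunct2[OF Cl(2)[OF e0]],
    folded m_def vol_def, folded c_def c'_def]
   have EN: "A_energy \<iota> \<Omega> \<mu> f \<epsilon> (%x. s x *R w x) <= c * (W12_norm \<Omega> w)^2 + m * Cl"
    "E_energy \<iota> \<Omega> \<mu> f g \<phi> \<delta>0 I0 \<Omega>p \<epsilon> (%x. s x *R w x) + B_energy \<Omega> g \<delta>0 I0 \<Omega>p (%x. s x *R w x) <= (c * (W12_norm \<Omega> w)^2 + c') * \<epsilon>"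
    by (rule EN0; assumption)+
   have sW: "s x = 1" if "x : \<Omega>p" "x ~: tube \<Omega> I0 \<Omega>p (2 * \<delta>0)" for x
   proof -
    have "\<not> infdist x I0 < 2 * \<delta>0" using that A(14) by (auto simp: tube_def abs_sdist)
    hence "b <= sd x" using that(1) ab(4) rp(3) A(15) by (simp add: sdist_def r_def)
    thus ?thesis by (rule s_outside(2))
   qed
   have sO: "s x = 0" if "x : \<Omega> - closure \<Omega>p" "x ~: tube \<Omega> I0 \<Omega>p (2 * \<delta>0)" for x
   proof -
    have "\<not> infdist x I0 < 2 * \<delta>0" using that by (auto simp: tube_def abs_sdist)
    moreover have "x ~: \<Omega>p" using that(1) closure_subset by blast
    ultimately have "sd x <= a" using ab(1) rp(3) A(15) by (simp add: sdist_def r_def)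
    thus ?thesis by (rule s_outside(1))
   qed
   show "EX u : W12_0 \<Omega> \<inter> L_infty \<Omega>.
       (AE x in lebesgue. x : \<Omega>p - tube \<Omega> I0 \<Omega>p (2 * \<delta>0) --> u x = w x) &
       (AE x in lebesgue. x : (\<Omega> - closure \<Omega>p) - tube \<Omega> I0 \<Omega>p (2 * \<delta>0) --> u x = 0) &
       A_energy \<iota> \<Omega> \<mu> f \<epsilon> u <= c1 (W12_norm \<Omega> w) &
       E_energy \<iota> \<Omega> \<mu> f g \<phi> \<delta>0 I0 \<Omega>p \<epsilon> u + B_energy \<Omega> g \<delta>0 I0 \<Omega>p u <= c1 (W12_norm \<Omega> w) * \<epsilon>"
   proof (intro bexI[of _ "%x. s x *R w x"] conjI IntI F(1,2))
    show "AE x in lebesgue. x : \<Omega>p - tube \<Omega> I0 \<Omega>p (2 * \<delta>0) --> s x *R w x = w x" using sW by (intro AE_I2) auto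
    show "AE x in lebesgue. x : (\<Omega> - closure \<Omega>p) - tube \<Omega> I0 \<Omega>p (2 * \<delta>0) --> s x *R w x = 0" using sO by (intro AE_I2) auto
    have "c * (W12_norm \<Omega> w)^2 + m * Cl <= c1 (W12_norm \<Omega> w)" using c'0 by (simp add: c1_def)
    thus "A_energy \<iota> \<Omega> \<mu> f \<epsilon> (%x. s x *R w x) <= c1 (W12_norm \<Omega> w)" by (rule order_trans[OF EN(1)])
    have "(c * (W12_norm \<Omega> w)^2 + c') * \<epsilon> <= c1 (W12_norm \<Omega> w) * \<epsilon>" using m0 e0 by (intro mult_right_mono) (auto simp: c1_def)
    thus "E_energy \<iota> \<Omega> \<mu> f g \<phi> \<delta>0 I0 \<Omega>p \<epsilon> (%x. s x *R w x) + B_energy \<Omega> g \<delta>0 I0 \<Omega>p (%x. s x *R w x) <= c1 (W12_norm \<Omega> w) * \<epsilon>"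
     by (rule order_trans[OF EN(2)])
   qed
  qed
 qed
qed

end
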